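(* Let $\mathsf f$ be an a.s. uniformly bounded additive functional on a uniformly elliptic Markov chain $\mathsf X$. Suppose $\mathsf f$ is irreducible, with algebraic range $\mathbb R$. Then $V_N\to\infty$, and for every interval $(a,b)$ and every sequence $z_N\in\mathbb R$ such that $\frac{z_N-\mathbb E(S_N)}{\sqrt{V_N}}$ converges to a finite limit $z$, $$\mathbb P[S_N-z_N\in(a,b)]=[1+o(1)]\,\frac{e^{-z^2/2}}{\sqrt{2\pi V_N}}\,(b-a)\qquad\text{as }N\to\infty.$$
   Context: A Markov chain $\mathsf X=\{X_n\}_{n\ge1}$ (possibly inhomogeneous) has complete separable metric state spaces $\mathfrak S_n\ni X_n$ with Borel $\sigma$-algebras, an arbitrary initial distribution on $\mathfrak S_1$ (possibly a point mass), and transition kernels $\pi_{n,n+1}(x,dy)$, so that $\mathbb P(X_{n+1}\in E\mid X_n,\dots,X_1)=\pi_{n,n+1}(X_n,E)$. It is uniformly elliptic if there are $0<\epsilon_0<1$, Borel probability measures $\mu_n$ on $\mathfrak S_n$ and measurable $p_n:\mathfrak S_n\times\mathfrak S_{n+1}\to[0,\infty)$ such that for all $n\ge1$: (a) $\pi_{n,n+1}(x,dy)=p_n(x,y)\mu_{n+1}(dy)$; (b) $0\le p_n\le1/\epsilon_0$; (c) $\int_{\mathfrak S_{n+1}}p_n(x,y)p_{n+1}(y,z)\mu_{n+1}(dy)>\epsilon_0$ for all $x\in\mathfrak S_n$, $z\in\mathfrak S_{n+2}$. An additive functional is a sequence $\mathsf f=\{f_n\}$ of measurable $f_n:\mathfrak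 S_n\times\mathfrak S_{n+1}\to\mathbb R$; $S_N=\sum_{n=1}^Nf_n(X_n,X_{n+1})$; $V_N=\mathrm{Var}(S_N)$. $\mathsf f$ is a.s. uniformly bounded if $\sup_n\mathrm{ess\,sup}|f_n(X_n,X_{n+1})|<\infty$. $\mathsf f$ is center-tight if there are constants $m_N$ such that for every $\epsilon>0$ there is $M$ with $\mathbb P[|S_N-m_N|>M]<\epsilon$ for all $N$. $G_{alg}(\mathsf X,\mathsf f)$ (algebraic range) is the intersection of all closed subgroups $G\le\mathbb R$ for which there are $c_n\in\mathbb R$ with $\mathbb P[f_n(X_n,X_{n+1})-c_n\in G]=1$ for all $n\ge1$. $G_{ess}(\mathsf X,\mathsf f)=\bigcap\{G_{alg}(\mathsf X,\mathsf g):\mathsf g$ an additive functional on $\mathsf X$ with $\mathsf f-\mathsf g$ center-tight$\}$. $\mathsf f$ is irreducible if $G_{ess}(\mathsf X,\mathsf f)=G_{alg}(\mathsf X,\mathsf f)$. *)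

theory Defs
  imports "HOL-Probability.Probability"
begin

text \<open>All sequences are indexed by \<^typ>\<open>nat\<close>, but only their values at indices \<open>n \<ge> 1\<close> are
  constrained or used. The state spaces may differ with the time; taking them to be carriers of
  metrics on one type \<open>'s\<close> is no restriction, since countably many spaces embed disjointly into
  a common type.\<close>

definition borel_metric :: "'s metric \<Rightarrow> 's measure" where
  "borel_metric m = sigma (mspace m) {U. openin (mtopology_of m) U}"

text \<open>Only the sets of this measure matter: it is the \<open>\<sigma>\<close>-algebra generated by \<open>X\<^sub>1, \<dots>, X\<^sub>n\<close>.\<close>

definition history ::
    "'w measure \<Rightarrow> (nat \<Rightarrow> 's metric) \<Rightarrow> (nat \<Rightarrow> 'w \<Rightarrow> 's) \<Rightarrow> nat \<Rightarrow> 'w measure" where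
  "history M S X n =
     sigma (space M) (\<Union>i\<in>{1..n}. {X i -` A \<inter> space M | A. A \<in> sets (borel_metric (S i))})"

text \<open>Here \<open>\<pi> n\<close> is the transition kernel from time \<open>n\<close> to time \<open>n + 1\<close>. The distribution of
  \<open>X 1\<close> is arbitrary.\<close>

locale markov_chain = prob_space M
  for M :: "'w measure" +
  fixes S :: "nat \<Rightarrow> 's metric"
    and \<pi> :: "nat \<Rightarrow> 's \<Rightarrow> 's measure"
    and X :: "nat \<Rightarrow> 'w \<Rightarrow> 's"
  assumes complete: "\<And>n. n \<ge> 1 \<Longrightarrow> mcomplete_of (S n)"
    and separable: "\<And>n. n \<ge> 1 \<Longrightarrow> separable_space (mtopology_of (S n))"
    and kernel: "\<And>n. n \<ge> 1 \<Longrightarrow>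
      \<pi> n \<in> borel_metric (S n) \<rightarrow>\<^sub>M prob_algebra (borel_metric (S (n + 1)))"
    and random_variable_X: "\<And>n. n \<ge> 1 \<Longrightarrow> X n \<in> M \<rightarrow>\<^sub>M borel_metric (S n)"
    and markov: "\<And>n E. n \<ge> 1 \<Longrightarrow> E \<in> sets (borel_metric (S (n + 1))) \<Longrightarrow>
      AE \<omega> in M. real_cond_exp M (history M S X n) (\<lambda>\<omega>. indicator E (X (n + 1) \<omega>)) \<omega>
        = measure (\<pi> n (X n \<omega>)) E"

definition uniformly_elliptic ::
    "(nat \<Rightarrow> 's metric) \<Rightarrow> (nat \<Rightarrow> 's \<Rightarrow> 's measure) \<Rightarrow> bool" where
  "uniformly_elliptic S \<pi> \<longleftrightarrow>
    (\<exists>\<epsilon>\<^sub>0 (\<mu> :: nat \<Rightarrow> 's measure) (p :: nat \<Rightarrow> 's \<Rightarrow> 's \<Rightarrow> real). 0 < \<epsilon>\<^sub>0 \<and> \<epsilon>\<^sub>0 < 1 \<and>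
      (\<forall>n\<ge>1.
        prob_space (\<mu> n) \<and> sets (\<mu> n) = sets (borel_metric (S n)) \<and>
        case_prod (p n) \<in> borel_measurable (borel_metric (S n) \<Otimes>\<^sub>M borel_metric (S (n + 1))) \<and>
        (\<forall>x\<in>mspace (S n). \<pi> n x = density (\<mu> (n + 1)) (\<lambda>y. ennreal (p n x y))) \<and>
        (\<forall>x\<in>mspace (S n). \<forall>y\<in>mspace (S (n + 1)). 0 \<le> p n x y \<and> p n x y \<le> 1 / \<epsilon>\<^sub>0) \<and>
        (\<forall>x\<in>mspace (S n). \<forall>z\<in>mspace (S (n + 2)).
          (\<integral>y. p n x y * p (n + 1) y z \<partial>\<mu> (n + 1)) > \<epsilon>\<^sub>0)))"

definition additive_functional :: "(nat \<Rightarrow> 's metric) \<Rightarrow> (nat \<Rightarrow> 's \<Rightarrow> 's \<Rightarrow> real) \<Rightarrow> bool" where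
  "additive_functional S f \<longleftrightarrow>
    (\<forall>n\<ge>1. case_prod (f n) \<in> borel_measurable (borel_metric (S n) \<Otimes>\<^sub>M borel_metric (S (n + 1))))"

definition partial_sum ::
    "(nat \<Rightarrow> 'w \<Rightarrow> 's) \<Rightarrow> (nat \<Rightarrow> 's \<Rightarrow> 's \<Rightarrow> real) \<Rightarrow> nat \<Rightarrow> 'w \<Rightarrow> real" where
  "partial_sum X f N \<omega> = (\<Sum>n=1..N. f n (X n \<omega>) (X (n + 1) \<omega>))"

definition as_uniformly_bounded ::
    "'w measure \<Rightarrow> (nat \<Rightarrow> 'w \<Rightarrow> 's) \<Rightarrow> (nat \<Rightarrow> 's \<Rightarrow> 's \<Rightarrow> real) \<Rightarrow> bool" where
  "as_uniformly_bounded M X f \<longleftrightarrow>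
    (SUP n\<in>{1..}. esssup M (\<lambda>\<omega>. ereal \<bar>f n (X n \<omega>) (X (n + 1) \<omega>)\<bar>)) < \<infinity>"

definition center_tight ::
    "'w measure \<Rightarrow> (nat \<Rightarrow> 'w \<Rightarrow> 's) \<Rightarrow> (nat \<Rightarrow> 's \<Rightarrow> 's \<Rightarrow> real) \<Rightarrow> bool" where
  "center_tight M X f \<longleftrightarrow>
    (\<exists>m :: nat \<Rightarrow> real. \<forall>\<epsilon>>0. \<exists>K :: real. \<forall>N\<ge>1.
      \<P>(\<omega> in M. \<bar>partial_sum X f N \<omega> - m N\<bar> > K) < \<epsilon>)"

definition closed_subgroup :: "real set \<Rightarrow> bool" where
  "closed_subgroup G \<longleftrightarrow>
    closed G \<and> 0 \<in> G \<and> (\<forall>x\<in>G. \<forall>y\<in>G. x + y \<in> G) \<and> (\<forall>x\<in>G. - x \<in> G)"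

definition algebraic_range ::
    "'w measure \<Rightarrow> (nat \<Rightarrow> 'w \<Rightarrow> 's) \<Rightarrow> (nat \<Rightarrow> 's \<Rightarrow> 's \<Rightarrow> real) \<Rightarrow> real set" where
  "algebraic_range M X f =
    \<Inter>{G. closed_subgroup G \<and>
        (\<exists>c :: nat \<Rightarrow> real. \<forall>n\<ge>1. \<P>(\<omega> in M. f n (X n \<omega>) (X (n + 1) \<omega>) - c n \<in> G) = 1)}"

definition essential_range ::
    "'w measure \<Rightarrow> (nat \<Rightarrow> 's metric) \<Rightarrow> (nat \<Rightarrow> 'w \<Rightarrow> 's) \<Rightarrow> (nat \<Rightarrow> 's \<Rightarrow> 's \<Rightarrow> real) \<Rightarrow> real set" where
  "essential_range M S X f =
    \<Inter>{algebraic_range M X g | g.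
        additive_functional S g \<and> center_tight M X (\<lambda>n x y. f n x y - g n x y)}"

definition irreducible_functional ::
    "'w measure \<Rightarrow> (nat \<Rightarrow> 's metric) \<Rightarrow> (nat \<Rightarrow> 'w \<Rightarrow> 's) \<Rightarrow> (nat \<Rightarrow> 's \<Rightarrow> 's \<Rightarrow> real) \<Rightarrow> bool" where
  "irreducible_functional M S X f \<longleftrightarrow> essential_range M S X f = algebraic_range M X f"

end

(* The variance and the characteristic function of S_N are controlled by one quantity: the sum over n of the
   hexagon moments d_n(xi)^2, the mean of 1 - cos(xi G), where G is the difference of f along two independent
   three-step paths with common end points. Uniform ellipticity turns it into a contraction,
   |E exp(i xi S_N)| <= exp(-c sum d_n(xi)^2). If the sum stays bounded for some xi <> 0, then comparison with a
   typical trajectory of the chain makes f cohomologous, up to a center-tight error, to a functional with values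
   in translates of (2 pi/xi)Z, which irreducibility with algebraic range R excludes. So the sums diverge for all
   xi <> 0; near xi = 0 they dominate c V_N xi^2, and together with 1 - cos(a - b) <= 2(1 - cos a) + 2(1 - cos b)
   this shows that frequencies away from 0 contribute o(V_N^{-1/2}) to Fourier integrals over compact sets. A
   martingale central limit theorem handles frequencies of order V_N^{-1/2}. Multiplying by a Fejer kernel, whose
   Fourier transform has compact support, and applying Levy's continuity theorem yields the local limit theorem. *)

theory Submission
  imports Defs "HOL-Real_Asymp.Real_Asymp"
begin

section \<open>Uniformly elliptic chains and the Markov property\<close>

text \<open>Ellipticity bounds only the two-step density from below, so each comparison of states
  costs two steps. A hexagon therefore sets a two-step average followed by one step against one step
  followed by a two-step average. If it nearly closes up, the increment of the functional over its
  last step agrees modulo 2 pi with the one over a fixed first step, up to the phases of the two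
  averages; these phases are the coboundary that straightens the functional along a reference
  trajectory. Two further obstacles shape the analysis. The conditional variances of the martingale
  differences are random; instead of a law of large numbers for them, a second Poisson equation, for
  the squared differences, is solved. And the hexagon sums diverge at no known rate, whereas the
  Fourier integrals must be small even after multiplication by \<open>sqrt (V N)\<close>; the
  missing factor comes from the width of a Gaussian bound, not from the size of the sums. Finally
  the Fejer weight has to be removed again: the weighted laws are normalised to probability
  measures, and the weight is divided out on the interval, where a small bandwidth keeps it bounded
  below.\<close>

definition bnd :: "('a \<Rightarrow> 'b::real_normed_vector) \<Rightarrow> bool" where
  "bnd f \<longleftrightarrow> (\<exists>C. \<forall>x. norm (f x) \<le> C)"

lemma bndI: "(\<And>x. norm (f x) \<le> C) \<Longrightarrow> bnd f"
  unfolding bnd_def by auto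

lemma bnd_bound:
  assumes "bnd f"
  obtains C where "C \<ge> 0" "\<And>x. norm (f x) \<le> C"
proof -
  obtain C where C: "\<And>x. norm (f x) \<le> C" using assms unfolding bnd_def by auto
  then have "0 \<le> C" using norm_ge_zero order_trans by blast
  with C show ?thesis using that by blast
qed

lemma bnd_const [intro, simp]: "bnd (\<lambda>_. c)"
  by (rule bndI[of _ "norm c"]) simp

lemma bnd_compose: "bnd f \<Longrightarrow> bnd (\<lambda>x. f (g x))"
  unfolding bnd_def by auto

lemma bnd_compose2: "bnd (\<lambda>(x, y). f x y) \<Longrightarrow> bnd (\<lambda>w. f (g w) (h w))"
  unfolding bnd_def by (metis case_prod_conv)

lemma bnd_add [intro]: "bnd f \<Longrightarrow> bnd g \<Longrightarrow> bnd (\<lambda>x. f x + g x)"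
  unfolding bnd_def by (meson norm_triangle_mono)

lemma bnd_diff [intro]: "bnd f \<Longrightarrow> bnd g \<Longrightarrow> bnd (\<lambda>x. f x - g x)"
  unfolding bnd_def by (meson norm_triangle_le_diff add_mono)

lemma bnd_minus [intro]: "bnd f \<Longrightarrow> bnd (\<lambda>x. - f x)"
  unfolding bnd_def by simp

lemma bnd_mult [intro]:
  fixes f g :: "'a \<Rightarrow> 'b::real_normed_algebra"
  assumes "bnd f" "bnd g" shows "bnd (\<lambda>x. f x * g x)"
proof -
  obtain C where C: "C \<ge> 0" "\<And>x. norm (f x) \<le> C" using assms(1) bnd_bound by blast
  obtain D where D: "D \<ge> 0" "\<And>x. norm (g x) \<le> D" using assms(2) bnd_bound by blast
  show ?thesis
    by (rule bndI[of _ "C * D"]) (meson C D norm_mult_ineq mult_mono norm_ge_zero order_trans)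
qed

lemma bnd_scaleR [intro]:
  assumes "bnd f" "bnd g" shows "bnd (\<lambda>x. f x *\<^sub>R g x)"
proof -
  obtain C where C: "C \<ge> 0" "\<And>x. norm (f x) \<le> C" using assms(1) bnd_bound by blast
  obtain D where D: "D \<ge> 0" "\<And>x. norm (g x) \<le> D" using assms(2) bnd_bound by blast
  show ?thesis
    using C D by (intro bndI[of _ "C * D"]) (auto intro!: mult_mono)
qed

lemma bnd_power [intro]:
  fixes f :: "'a \<Rightarrow> 'b::real_normed_div_algebra"
  shows "bnd f \<Longrightarrow> bnd (\<lambda>x. f x ^ k)"
  by (induction k) (auto intro!: bnd_mult)

lemma bnd_sum [intro]: "(\<And>i. i \<in> I \<Longrightarrow> bnd (f i)) \<Longrightarrow> bnd (\<lambda>x. \<Sum>i\<in>I. f i x)"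
  by (induction I rule: infinite_finite_induct) auto

lemma bnd_of_real [intro]: "bnd f \<Longrightarrow> bnd (\<lambda>x. complex_of_real (f x))"
  unfolding bnd_def by simp

lemma bnd_abs [intro]: "bnd f \<Longrightarrow> bnd (\<lambda>x. \<bar>f x :: real\<bar>)"
  unfolding bnd_def by simp

lemma bnd_norm [intro]: "bnd f \<Longrightarrow> bnd (\<lambda>x. norm (f x))"
  unfolding bnd_def by simp

lemma bnd_Re [intro]: "bnd f \<Longrightarrow> bnd (\<lambda>x. Re (f x))"
  unfolding bnd_def by (auto intro: order_trans[OF abs_Re_le_cmod])

lemma bnd_Im [intro]: "bnd f \<Longrightarrow> bnd (\<lambda>x. Im (f x))"
  unfolding bnd_def by (auto intro: order_trans[OF abs_Im_le_cmod])

lemma bnd_cos [intro, simp]: "bnd (\<lambda>x. cos (f x :: real))"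
  by (rule bndI[of _ 1]) simp

lemma bnd_iexp [intro, simp]: "bnd (\<lambda>x. iexp (f x))"
  by (rule bndI[of _ 1]) simp

lemma bnd_indicator [intro, simp]: "bnd (\<lambda>x. indicator (A x) (f x) :: real)"
  by (rule bndI[of _ 1]) (auto simp: indicator_def)

text \<open>Bounds in the sense of \<open>bnd\<close> hold at every point, also outside the state
  spaces. Integrability of a composite expression thus reduces to structural rules for
  \<open>bnd\<close> and to measurability, without any almost-everywhere reasoning.\<close>

lemma (in finite_measure) integrable_bnd [intro]:
  fixes f :: "'a \<Rightarrow> 'b::{banach, second_countable_topology}"
  assumes "bnd f" "f \<in> borel_measurable M"
  shows "integrable M f"
  using assms bnd_bound[OF assms(1)] by (metis AE_I2 integrable_const_bound)

lemma (in prob_space) norm_integral_le: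
  fixes f :: "'a \<Rightarrow> 'b::{banach, second_countable_topology}"
  assumes "\<And>x. x \<in> space M \<Longrightarrow> norm (f x) \<le> C" "0 \<le> C"
  shows "norm (\<integral>x. f x \<partial>M) \<le> C"
proof (cases "integrable M f")
  case True
  have "norm (\<integral>x. f x \<partial>M) \<le> (\<integral>x. norm (f x) \<partial>M)" by (rule integral_norm_bound)
  also have "\<dots> \<le> (\<integral>x. C \<partial>M)" using True assms by (intro integral_mono) auto
  finally show ?thesis by (simp add: prob_space)
qed (use assms in \<open>simp add: not_integrable_integral_eq\<close>)

lemma (in prob_space) bnd_integral:
  fixes f :: "'c \<Rightarrow> 'a \<Rightarrow> 'b::{banach, second_countable_topology}"
  assumes "bnd (\<lambda>(x, y). f x y)"
  shows "bnd (\<lambda>x. \<integral>y. f x y \<partial>M)"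
proof -
  obtain C where "C \<ge> 0" "\<And>z. norm ((\<lambda>(x, y). f x y) z) \<le> C" using bnd_bound[OF assms] by blast
  then show ?thesis by (intro bndI[of _ C] norm_integral_le) auto
qed

lemma Fubini_bnd:
  fixes f :: "'a \<Rightarrow> 'c \<Rightarrow> 'b::{banach, second_countable_topology}"
  assumes "finite_measure A" "finite_measure B"
    and "bnd (\<lambda>(x, y). f x y)" "(\<lambda>(x, y). f x y) \<in> borel_measurable (A \<Otimes>\<^sub>M B)"
  shows "(\<integral>x. \<integral>y. f x y \<partial>B \<partial>A) = (\<integral>y. \<integral>x. f x y \<partial>A \<partial>B)"
    and "(\<integral>x. \<integral>y. f x y \<partial>B \<partial>A) = (\<integral>z. f (fst z) (snd z) \<partial>(A \<Otimes>\<^sub>M B))"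
proof -
  interpret A: finite_measure A by fact
  interpret B: finite_measure B by fact
  interpret AB: pair_sigma_finite A B ..
  interpret P: finite_measure "A \<Otimes>\<^sub>M B" by (intro finite_measure_pair_measure assms)
  have "integrable (A \<Otimes>\<^sub>M B) (\<lambda>(x, y). f x y)" using assms by auto
  then show "(\<integral>x. \<integral>y. f x y \<partial>B \<partial>A) = (\<integral>y. \<integral>x. f x y \<partial>A \<partial>B)"
    "(\<integral>x. \<integral>y. f x y \<partial>B \<partial>A) = (\<integral>z. f (fst z) (snd z) \<partial>(A \<Otimes>\<^sub>M B))"
    using AB.Fubini_integral[of f] AB.integral_fst'[of "\<lambda>(x, y). f x y"] by (simp_all add: case_prod_unfold)
qed

text \<open>Times are shifted to start at \<open>0\<close>, and \<open>F n\<close> plays the role of the \<open>\<sigma>\<close>-algebra of the history up to time \<open>n\<close>.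
  The bounds on \<open>p\<close> are required also outside the state spaces; truncating \<open>p\<close> achieves this.\<close>

locale elliptic_chain = prob_space M for M :: "'w measure" +
  fixes \<mu> :: "nat \<Rightarrow> 's measure"
    and p :: "nat \<Rightarrow> 's \<Rightarrow> 's \<Rightarrow> real"
    and X :: "nat \<Rightarrow> 'w \<Rightarrow> 's"
    and F :: "nat \<Rightarrow> 'w measure"
    and \<epsilon> :: real
  assumes eps_pos: "0 < \<epsilon>" and eps_less_1: "\<epsilon> < 1"
    and prob_space_mu: "\<And>n. prob_space (\<mu> n)"
    and p_meas: "\<And>n. (\<lambda>(x, y). p n x y) \<in> borel_measurable (\<mu> n \<Otimes>\<^sub>M \<mu> (Suc n))"
    and p_nonneg: "\<And>n x y. 0 \<le> p n x y"
    and p_le: "\<And>n x y. p n x y \<le> 1 / \<epsilon>"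
    and p_integral: "\<And>n x. x \<in> space (\<mu> n) \<Longrightarrow> (\<integral>y. p n x y \<partial>\<mu> (Suc n)) = 1"
    and p2_ge: "\<And>n x z. x \<in> space (\<mu> n) \<Longrightarrow> z \<in> space (\<mu> (Suc (Suc n))) \<Longrightarrow>
      \<epsilon> \<le> (\<integral>y. p n x y * p (Suc n) y z \<partial>\<mu> (Suc n))"
    and subalg: "\<And>n. subalgebra M (F n)"
    and X_meas_F: "\<And>i n. i \<le> n \<Longrightarrow> X i \<in> F n \<rightarrow>\<^sub>M \<mu> i"
    and markov_set: "\<And>n E H C. E \<in> sets (\<mu> (Suc n)) \<Longrightarrow> H \<in> borel_measurable (F n) \<Longrightarrow>
      (\<And>\<omega>. 0 \<le> H \<omega>) \<Longrightarrow> (\<And>\<omega>. H \<omega> \<le> (C :: real)) \<Longrightarrow>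
      (\<integral>\<omega>. H \<omega> * indicator E (X (Suc n) \<omega>) \<partial>M)
        = (\<integral>\<omega>. H \<omega> * (\<integral>y. p n (X n \<omega>) y * indicator E y \<partial>\<mu> (Suc n)) \<partial>M)"
begin

lemma mu_prob [simp, intro]: "prob_space (\<mu> n)" by (rule prob_space_mu)

lemma mu_finite [simp, intro]: "finite_measure (\<mu> n)"
  using prob_space_mu prob_space.finite_measure by blast

sublocale mu: prob_space "\<mu> n" for n by (rule prob_space_mu)

lemma p_measurable [measurable (raw)]:
  "g \<in> N \<rightarrow>\<^sub>M \<mu> n \<Longrightarrow> h \<in> N \<rightarrow>\<^sub>M \<mu> (Suc n) \<Longrightarrow> (\<lambda>w. p n (g w) (h w)) \<in> borel_measurable N"
  using measurable_compose[OF measurable_Pair p_meas] by simp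

lemma bnd_p [intro, simp]: "bnd (\<lambda>w. p n (g w) (h w))"
  using p_nonneg p_le by (intro bndI[of _ "1 / \<epsilon>"]) auto

lemma F_borel: "H \<in> F n \<rightarrow>\<^sub>M N \<Longrightarrow> H \<in> M \<rightarrow>\<^sub>M N"
  using subalg measurable_from_subalg by blast

lemma X_measurable [measurable]: "X n \<in> M \<rightarrow>\<^sub>M \<mu> n"
  using X_meas_F[of n n] F_borel by blast

lemma X_space: "\<omega> \<in> space M \<Longrightarrow> X n \<omega> \<in> space (\<mu> n)"
  using measurable_space[OF X_measurable] by blast

text \<open>The conditional expectation of \<open>G (X n) (X (Suc n))\<close> given
  \<open>X n\<close>. Since \<open>G\<close> sees both end points of the step, one operator serves
  for functionals, for functions of the next state and for functions twisted by a phase.\<close>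

definition T :: "nat \<Rightarrow> ('s \<Rightarrow> 's \<Rightarrow> 'b::{banach, second_countable_topology}) \<Rightarrow> 's \<Rightarrow> 'b" where
  "T n G x = (\<integral>y. p n x y *\<^sub>R G x y \<partial>\<mu> (Suc n))"

lemma T_measurable [measurable]:
  fixes G :: "'s \<Rightarrow> 's \<Rightarrow> 'b::{banach, second_countable_topology}"
  assumes [measurable]: "(\<lambda>(x, y). G x y) \<in> borel_measurable (\<mu> n \<Otimes>\<^sub>M \<mu> (Suc n))"
  shows "T n G \<in> borel_measurable (\<mu> n)"
  unfolding T_def by measurable

lemma bnd_T [intro]:
  fixes G :: "'s \<Rightarrow> 's \<Rightarrow> 'b::{banach, second_countable_topology}"
  assumes "bnd (\<lambda>(x, y). G x y)"
  shows "bnd (T n G)"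
proof -
  have "bnd (\<lambda>(x, y). p n x y *\<^sub>R G x y)"
    using bnd_scaleR[OF bnd_p[of n fst snd] assms] by (simp add: case_prod_unfold)
  then show ?thesis unfolding T_def[abs_def] by (rule mu.bnd_integral)
qed

text \<open>The Markov property is assumed for events only. The weight \<open>H\<close> enters as a
  density, and on a rectangle the identity is \<open>markov_set\<close> with weight
  \<open>H * indicator A (X n)\<close>; rectangles form an intersection-stable generator, so both
  finite measures agree.\<close>

lemma distr_X_pair:
  assumes H: "H \<in> borel_measurable (F n)" "\<And>\<omega>. 0 \<le> H \<omega>" "\<And>\<omega>. H \<omega> \<le> (C :: real)"
  shows "distr (density M H) (\<mu> n \<Otimes>\<^sub>M \<mu> (Suc n)) (\<lambda>\<omega>. (X n \<omega>, X (Suc n) \<omega>))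
    = density (distr (density M H) (\<mu> n) (X n) \<Otimes>\<^sub>M \<mu> (Suc n)) (\<lambda>(x, y). ennreal (p n x y))"
    (is "?A = ?B")
proof -
  have [measurable]: "H \<in> borel_measurable M" using F_borel[OF H(1)] .
  have [measurable]: "(\<lambda>x. indicator A (X n x) :: real) \<in> borel_measurable (F n)" if [measurable]: "A \<in> sets (\<mu> n)" for A
    using measurable_compose[OF X_meas_F[OF order_refl] borel_measurable_indicator[OF that]] .
  define D where "D = distr (density M H) (\<mu> n) (X n)"
  have fin: "finite_measure (density M H)"
  proof (rule finite_measureI)
    have "emeasure (density M H) (space M) = (\<integral>\<^sup>+ x. ennreal (H x) \<partial>M)"
      by (subst emeasure_density) (auto intro!: nn_integral_cong)
    also have "\<dots> \<le> (\<integral>\<^sup>+ x. ennreal C \<partial>M)" by (intro nn_integral_mono ennreal_leI H)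
    also have "\<dots> = ennreal C" by (simp add: emeasure_space_1)
    finally show "emeasure (density M H) (space (density M H)) \<noteq> \<infinity>" by (auto simp: top_unique)
  qed
  then have finD: "finite_measure D"
    unfolding D_def by (intro finite_measure.finite_measure_distr) auto
  have sD [measurable_cong]: "sets D = sets (\<mu> n)" unfolding D_def by simp
  have rect: "emeasure ?A (A \<times> B) = emeasure ?B (A \<times> B)"
    if [measurable]: "A \<in> sets (\<mu> n)" "B \<in> sets (\<mu> (Suc n))" for A B
  proof -
    have "emeasure ?A (A \<times> B)
        = emeasure (density M H) ((\<lambda>\<omega>. (X n \<omega>, X (Suc n) \<omega>)) -` (A \<times> B) \<inter> space M)"
      by (subst emeasure_distr) auto
    also have "\<dots> = (\<integral>\<^sup>+ \<omega>. ennreal (H \<omega> * indicator A (X n \<omega>) * indicator B (X (Suc n) \<omega>)) \<partial>M)"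
      by (subst emeasure_density) (auto intro!: nn_integral_cong simp: indicator_def)
    also have "\<dots> = ennreal (\<integral>\<omega>. H \<omega> * indicator A (X n \<omega>) * indicator B (X (Suc n) \<omega>) \<partial>M)"
    proof (rule nn_integral_eq_integral)
      show "integrable M (\<lambda>\<omega>. H \<omega> * indicator A (X n \<omega>) * indicator B (X (Suc n) \<omega>))"
        using H by (intro integrable_bnd bnd_mult bnd_indicator bndI[of H C]) auto
    qed (use H in auto)
    also have "(\<integral>\<omega>. H \<omega> * indicator A (X n \<omega>) * indicator B (X (Suc n) \<omega>) \<partial>M)
        = (\<integral>\<omega>. (H \<omega> * indicator A (X n \<omega>)) * (\<integral>y. p n (X n \<omega>) y * indicator B y \<partial>\<mu> (Suc n)) \<partial>M)"
    proof (rule markov_set[of _ _ _ C])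
      have "0 \<le> C" using H(2,3) order_trans by blast
      with H(2,3) show "H \<omega> * indicator A (X n \<omega>) \<le> C" for \<omega> by (auto simp: indicator_def)
      show "(\<lambda>\<omega>. H \<omega> * indicator A (X n \<omega>)) \<in> borel_measurable (F n)" using H(1) by measurable
    qed (use H in auto)
    also have "ennreal \<dots> = (\<integral>\<^sup>+ \<omega>. ennreal ((H \<omega> * indicator A (X n \<omega>)) * (\<integral>y. p n (X n \<omega>) y * indicator B y \<partial>\<mu> (Suc n))) \<partial>M)"
    proof (rule nn_integral_eq_integral[symmetric])
      show "integrable M (\<lambda>\<omega>. (H \<omega> * indicator A (X n \<omega>)) * (\<integral>y. p n (X n \<omega>) y * indicator B y \<partial>\<mu> (Suc n)))"
        using H by (intro integrable_bnd bnd_mult bnd_indicator mu.bnd_integral bndI[of H C]) (auto simp: case_prod_unfold)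
      show "AE \<omega> in M. 0 \<le> H \<omega> * indicator A (X n \<omega>) * (\<integral>y. p n (X n \<omega>) y * indicator B y \<partial>\<mu> (Suc n))"
        using H by (auto intro!: integral_nonneg_AE mult_nonneg_nonneg p_nonneg)
    qed
    also have "\<dots> = (\<integral>\<^sup>+ \<omega>. ennreal (H \<omega>) * (indicator A (X n \<omega>) * (\<integral>\<^sup>+y. ennreal (p n (X n \<omega>) y) * indicator B y \<partial>\<mu> (Suc n))) \<partial>M)"
    proof (rule nn_integral_cong)
      fix \<omega> assume "\<omega> \<in> space M"
      have "ennreal (\<integral>y. p n (X n \<omega>) y * indicator B y \<partial>\<mu> (Suc n))
          = (\<integral>\<^sup>+y. ennreal (p n (X n \<omega>) y * indicator B y) \<partial>\<mu> (Suc n))"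
        using \<open>\<omega> \<in> space M\<close> by (intro nn_integral_eq_integral[symmetric] mu.integrable_bnd bnd_mult)
          (auto simp: p_nonneg X_space)
      also have "\<dots> = (\<integral>\<^sup>+y. ennreal (p n (X n \<omega>) y) * indicator B y \<partial>\<mu> (Suc n))"
        by (intro nn_integral_cong) (auto simp: indicator_def)
      finally show "ennreal ((H \<omega> * indicator A (X n \<omega>)) * (\<integral>y. p n (X n \<omega>) y * indicator B y \<partial>\<mu> (Suc n)))
         = ennreal (H \<omega>) * (indicator A (X n \<omega>) * (\<integral>\<^sup>+y. ennreal (p n (X n \<omega>) y) * indicator B y \<partial>\<mu> (Suc n)))"
        using H by (auto simp: indicator_def ennreal_mult' p_nonneg)
    qed
    also have "\<dots> = (\<integral>\<^sup>+ x. indicator A x * (\<integral>\<^sup>+y. ennreal (p n x y) * indicator B y \<partial>\<mu> (Suc n)) \<partial>D)"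
      unfolding D_def by (subst nn_integral_distr; (subst nn_integral_density)?) auto
    also have "\<dots> = (\<integral>\<^sup>+ x. (\<integral>\<^sup>+y. ennreal (p n x y) * indicator (A \<times> B) (x, y) \<partial>\<mu> (Suc n)) \<partial>D)"
      by (intro nn_integral_cong) (auto simp: indicator_def)
    also have "\<dots> = emeasure ?B (A \<times> B)"
      unfolding D_def[symmetric]
      by (subst emeasure_density, measurable, subst mu.nn_integral_fst[symmetric])
        (auto simp: case_prod_unfold)
    finally show ?thesis .
  qed
  let ?E = "{a \<times> b | a b. a \<in> sets (\<mu> n) \<and> b \<in> sets (\<mu> (Suc n))}"
  show ?thesis
  proof (rule measure_eqI_generator_eq[where E = ?E and A = "\<lambda>_. space (\<mu> n) \<times> space (\<mu> (Suc n))"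
        and \<Omega> = "space (\<mu> n) \<times> space (\<mu> (Suc n))"])
    show "Int_stable ?E" by (rule Int_stable_pair_measure_generator)
    show "?E \<subseteq> Pow (space (\<mu> n) \<times> space (\<mu> (Suc n)))"
      using sets.sets_into_space[of _ "\<mu> n"] sets.sets_into_space[of _ "\<mu> (Suc n)"] by blast
    show "sets ?A = sigma_sets (space (\<mu> n) \<times> space (\<mu> (Suc n))) ?E"
      by (simp add: sets_pair_measure)
    show "sets ?B = sigma_sets (space (\<mu> n) \<times> space (\<mu> (Suc n))) ?E"
      unfolding D_def[symmetric] by (simp add: sets_pair_measure sD sets_eq_imp_space_eq[OF sD])
    have "finite_measure ?A" using fin by (intro finite_measure.finite_measure_distr) auto
    then show "emeasure ?A (space (\<mu> n) \<times> space (\<mu> (Suc n))) \<noteq> \<infinity>"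
      using finite_measure.emeasure_finite by auto
  qed (auto simp: rect)
qed

lemma markov_nonneg:
  fixes G :: "'s \<Rightarrow> 's \<Rightarrow> 'b::{banach, second_countable_topology}"
  assumes H: "H \<in> borel_measurable (F n)" "\<And>\<omega>. 0 \<le> H \<omega>" "\<And>\<omega>. H \<omega> \<le> (C :: real)"
    and G [measurable]: "(\<lambda>(x, y). G x y) \<in> borel_measurable (\<mu> n \<Otimes>\<^sub>M \<mu> (Suc n))" and "bnd (\<lambda>(x, y). G x y)"
  shows "(\<integral>\<omega>. H \<omega> *\<^sub>R G (X n \<omega>) (X (Suc n) \<omega>) \<partial>M) = (\<integral>\<omega>. H \<omega> *\<^sub>R T n G (X n \<omega>) \<partial>M)"
proof -
  have [measurable]: "H \<in> borel_measurable M" using F_borel[OF H(1)] .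
  define D where "D = distr (density M H) (\<mu> n) (X n)"
  have sD [measurable_cong]: "sets D = sets (\<mu> n)" unfolding D_def by simp
  have fin: "finite_measure (density M H)"
  proof (rule finite_measureI)
    have "emeasure (density M H) (space M) = (\<integral>\<^sup>+ x. ennreal (H x) \<partial>M)"
      by (subst emeasure_density) (auto intro!: nn_integral_cong)
    also have "\<dots> \<le> (\<integral>\<^sup>+ x. ennreal C \<partial>M)" by (intro nn_integral_mono ennreal_leI H)
    also have "\<dots> = ennreal C" by (simp add: emeasure_space_1)
    finally show "emeasure (density M H) (space (density M H)) \<noteq> \<infinity>" by (auto simp: top_unique)
  qed
  then have finD: "finite_measure D"
    unfolding D_def by (intro finite_measure.finite_measure_distr) auto
  have b: "bnd (\<lambda>(x, y). p n x y *\<^sub>R G x y)"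
    using bnd_scaleR[OF bnd_p[of n fst snd] assms(5)] by (simp add: case_prod_unfold)
  have "(\<integral>\<omega>. H \<omega> *\<^sub>R G (X n \<omega>) (X (Suc n) \<omega>) \<partial>M)
      = (\<integral>z. G (fst z) (snd z) \<partial>distr (density M H) (\<mu> n \<Otimes>\<^sub>M \<mu> (Suc n)) (\<lambda>\<omega>. (X n \<omega>, X (Suc n) \<omega>)))"
    using H by (subst integral_distr) (auto simp: integral_density)
  also have "\<dots> = (\<integral>z. p n (fst z) (snd z) *\<^sub>R G (fst z) (snd z) \<partial>(D \<Otimes>\<^sub>M \<mu> (Suc n)))"
    unfolding distr_X_pair[OF H] D_def[symmetric]
    by (subst integral_density[symmetric]) (auto simp: p_nonneg case_prod_unfold)
  also have "\<dots> = (\<integral>x. \<integral>y. p n x y *\<^sub>R G x y \<partial>\<mu> (Suc n) \<partial>D)"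
    using Fubini_bnd(2)[OF finD mu_finite b] by simp
  also have "\<dots> = (\<integral>x. T n G x \<partial>D)" unfolding T_def ..
  also have "\<dots> = (\<integral>\<omega>. H \<omega> *\<^sub>R T n G (X n \<omega>) \<partial>M)"
  proof -
    have [measurable]: "(\<lambda>\<omega>. T n G (X n \<omega>)) \<in> borel_measurable M"
      by (rule measurable_compose[OF X_measurable T_measurable[OF G]])
    show ?thesis
      unfolding D_def using H by (subst integral_distr) (auto simp: integral_density)
  qed
  finally show ?thesis .
qed

lemma markov_real:
  fixes G :: "'s \<Rightarrow> 's \<Rightarrow> 'b::{banach, second_countable_topology}"
  assumes H: "H \<in> borel_measurable (F n)" "bnd (H :: _ \<Rightarrow> real)"
    and G [measurable]: "(\<lambda>(x, y). G x y) \<in> borel_measurable (\<mu> n \<Otimes>\<^sub>M \<mu> (Suc n))" "bnd (\<lambda>(x, y). G x y)"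
  shows "(\<integral>\<omega>. H \<omega> *\<^sub>R G (X n \<omega>) (X (Suc n) \<omega>) \<partial>M) = (\<integral>\<omega>. H \<omega> *\<^sub>R T n G (X n \<omega>) \<partial>M)"
proof -
  have [measurable]: "H \<in> borel_measurable M" using F_borel[OF H(1)] .
  obtain C where C: "C \<ge> 0" "\<And>x. norm (H x) \<le> C" using bnd_bound[OF H(2)] by blast
  have c: "- C \<le> H x" "H x \<le> C" for x using C(2)[of x] by auto
  have bG: "bnd (\<lambda>\<omega>. G (X n \<omega>) (X (Suc n) \<omega>))" "bnd (\<lambda>\<omega>. T n G (X n \<omega>))"
    using bnd_compose2[OF G(2)] bnd_compose[OF bnd_T[OF G(2)]] by auto
  \<comment> \<open>\<open>markov_nonneg\<close> asks for a nonnegative weight. Both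
    \<open>H + C\<close> and the constant \<open>C\<close> qualify, and subtracting the two
    identities leaves the one for \<open>H\<close>.\<close>
  have 1: "(\<integral>\<omega>. (H \<omega> + C) *\<^sub>R G (X n \<omega>) (X (Suc n) \<omega>) \<partial>M) = (\<integral>\<omega>. (H \<omega> + C) *\<^sub>R T n G (X n \<omega>) \<partial>M)"
    using H(1) c by (intro markov_nonneg[of _ _ "2 * C"] G) (auto simp: algebra_simps, metis add.commute minus_le_iff neg_le_iff_le add_increasing diff_ge_0_iff_ge diff_minus_eq_add)
  have 2: "(\<integral>\<omega>. C *\<^sub>R G (X n \<omega>) (X (Suc n) \<omega>) \<partial>M) = (\<integral>\<omega>. C *\<^sub>R T n G (X n \<omega>) \<partial>M)"
    using C by (intro markov_nonneg[of _ _ C] G) auto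
  have [measurable]: "(\<lambda>\<omega>. T n G (X n \<omega>)) \<in> borel_measurable M"
    by (rule measurable_compose[OF X_measurable T_measurable[OF G(1)]])
  have i: "integrable M (\<lambda>\<omega>. H \<omega> *\<^sub>R G (X n \<omega>) (X (Suc n) \<omega>))"
    "integrable M (\<lambda>\<omega>. C *\<^sub>R G (X n \<omega>) (X (Suc n) \<omega>))"
    "integrable M (\<lambda>\<omega>. H \<omega> *\<^sub>R T n G (X n \<omega>))" "integrable M (\<lambda>\<omega>. C *\<^sub>R T n G (X n \<omega>))"
    using H(2) bG by (auto intro!: integrable_bnd)
  show ?thesis using 1 2 i by (auto simp: scaleR_add_left)
qed

lemma markov_complex:
  fixes G :: "'s \<Rightarrow> 's \<Rightarrow> complex"
  assumes H: "H \<in> borel_measurable (F n)" "bnd (H :: _ \<Rightarrow> complex)"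
    and G [measurable]: "(\<lambda>(x, y). G x y) \<in> borel_measurable (\<mu> n \<Otimes>\<^sub>M \<mu> (Suc n))" "bnd (\<lambda>(x, y). G x y)"
  shows "(\<integral>\<omega>. H \<omega> * G (X n \<omega>) (X (Suc n) \<omega>) \<partial>M) = (\<integral>\<omega>. H \<omega> * T n G (X n \<omega>) \<partial>M)"
proof -
  have [measurable]: "H \<in> borel_measurable M" using F_borel[OF H(1)] .
  have bG: "bnd (\<lambda>\<omega>. G (X n \<omega>) (X (Suc n) \<omega>))" "bnd (\<lambda>\<omega>. T n G (X n \<omega>))"
    using bnd_compose2[OF G(2)] bnd_compose[OF bnd_T[OF G(2)]] by auto
  have *: "(\<integral>\<omega>. H \<omega> * g \<omega> \<partial>M) = (\<integral>\<omega>. Re (H \<omega>) *\<^sub>R g \<omega> \<partial>M) + \<i> * (\<integral>\<omega>. Im (H \<omega>) *\<^sub>R g \<omega> \<partial>M)"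
    if "bnd g" and [measurable]: "g \<in> borel_measurable M" for g :: "'w \<Rightarrow> complex"
  proof -
    have "integrable M (\<lambda>\<omega>. Re (H \<omega>) *\<^sub>R g \<omega>)" "integrable M (\<lambda>\<omega>. Im (H \<omega>) *\<^sub>R g \<omega>)"
      using H(2) that by (auto intro!: integrable_bnd)
    then have "(\<integral>\<omega>. Re (H \<omega>) *\<^sub>R g \<omega> \<partial>M) + \<i> * (\<integral>\<omega>. Im (H \<omega>) *\<^sub>R g \<omega> \<partial>M)
      = (\<integral>\<omega>. Re (H \<omega>) *\<^sub>R g \<omega> + \<i> * (Im (H \<omega>) *\<^sub>R g \<omega>) \<partial>M)"
      by (simp del: mult_scaleR_right)
    also have "\<dots> = (\<integral>\<omega>. H \<omega> * g \<omega> \<partial>M)"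
      by (intro Bochner_Integration.integral_cong refl) (simp add: complex_eq_iff algebra_simps)
    finally show ?thesis by simp
  qed
  have m: "(\<lambda>\<omega>. Re (H \<omega>)) \<in> borel_measurable (F n)" "(\<lambda>\<omega>. Im (H \<omega>)) \<in> borel_measurable (F n)"
    using H(1) by auto
  show ?thesis
    using markov_real[OF m(1) bnd_Re[OF H(2)] G] markov_real[OF m(2) bnd_Im[OF H(2)] G] bG
    by (subst (1 2) *) auto
qed

section \<open>Two-step transitions\<close>

lemma expectation_pair:
  fixes G :: "'s \<Rightarrow> 's \<Rightarrow> 'b::{banach, second_countable_topology}"
  assumes "(\<lambda>(x, y). G x y) \<in> borel_measurable (\<mu> n \<Otimes>\<^sub>M \<mu> (Suc n))" "bnd (\<lambda>(x, y). G x y)"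
  shows "(\<integral>\<omega>. G (X n \<omega>) (X (Suc n) \<omega>) \<partial>M) = (\<integral>\<omega>. T n G (X n \<omega>) \<partial>M)"
  using markov_real[of "\<lambda>_. 1", OF _ _ assms] by simp

lemma T_nonneg: "(\<And>x y. 0 \<le> G x y) \<Longrightarrow> 0 \<le> T n G x" for G :: "'s \<Rightarrow> 's \<Rightarrow> real"
  unfolding T_def by (auto intro!: integral_nonneg_AE mult_nonneg_nonneg p_nonneg)

lemma T_mono:
  fixes G G' :: "'s \<Rightarrow> 's \<Rightarrow> real"
  assumes [measurable]: "(\<lambda>(x, y). G x y) \<in> borel_measurable (\<mu> n \<Otimes>\<^sub>M \<mu> (Suc n))"
    "(\<lambda>(x, y). G' x y) \<in> borel_measurable (\<mu> n \<Otimes>\<^sub>M \<mu> (Suc n))"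
    and b: "bnd (\<lambda>(x, y). G x y)" "bnd (\<lambda>(x, y). G' x y)" and x[measurable]: "x \<in> space (\<mu> n)"
    and le: "\<And>y. y \<in> space (\<mu> (Suc n)) \<Longrightarrow> G x y \<le> G' x y"
  shows "T n G x \<le> T n G' x"
  unfolding T_def
  using bnd_compose2[OF b(1), of "\<lambda>_. x" "\<lambda>y. y"] bnd_compose2[OF b(2), of "\<lambda>_. x" "\<lambda>y. y"]
  by (intro integral_mono mu.integrable_bnd bnd_scaleR bnd_p) (auto intro!: mult_left_mono p_nonneg le)

lemma T_const: "x \<in> space (\<mu> n) \<Longrightarrow> T n (\<lambda>_ _. c) x = c" for c :: real
  unfolding T_def by (simp add: p_integral)

lemma T_add:
  fixes G G' :: "'s \<Rightarrow> 's \<Rightarrow> 'b::{banach, second_countable_topology}"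
  assumes [measurable]: "(\<lambda>(x, y). G x y) \<in> borel_measurable (\<mu> n \<Otimes>\<^sub>M \<mu> (Suc n))"
    "(\<lambda>(x, y). G' x y) \<in> borel_measurable (\<mu> n \<Otimes>\<^sub>M \<mu> (Suc n))"
    and b: "bnd (\<lambda>(x, y). G x y)" "bnd (\<lambda>(x, y). G' x y)" and x[measurable]: "x \<in> space (\<mu> n)"
  shows "T n (\<lambda>x y. G x y + G' x y) x = T n G x + T n G' x"
proof -
  have "integrable (\<mu> (Suc n)) (\<lambda>y. p n x y *\<^sub>R G x y)" "integrable (\<mu> (Suc n)) (\<lambda>y. p n x y *\<^sub>R G' x y)"
    using bnd_compose2[OF b(1), of "\<lambda>_. x" "\<lambda>y. y"] bnd_compose2[OF b(2), of "\<lambda>_. x" "\<lambda>y. y"]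
    by (auto intro!: mu.integrable_bnd bnd_scaleR bnd_p)
  then show ?thesis unfolding T_def by (simp add: scaleR_add_right)
qed

text \<open>The two-step transition density. Ellipticity bounds it, but not the one-step density
  \<open>p\<close>, away from 0; hence the contraction arguments advance by two steps.\<close>

definition q :: "nat \<Rightarrow> 's \<Rightarrow> 's \<Rightarrow> real" where
  "q n x z = (\<integral>y. p n x y * p (Suc n) y z \<partial>\<mu> (Suc n))"

lemma q_meas [measurable]: "(\<lambda>(x, z). q n x z) \<in> borel_measurable (\<mu> n \<Otimes>\<^sub>M \<mu> (Suc (Suc n)))"
  unfolding q_def by measurable

lemma bnd_q [intro, simp]: "bnd (\<lambda>w. q n (g w) (h w))"
  unfolding q_def by (rule mu.bnd_integral) (auto intro!: bnd_mult simp: case_prod_unfold)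

lemma q_ge: "x \<in> space (\<mu> n) \<Longrightarrow> z \<in> space (\<mu> (Suc (Suc n))) \<Longrightarrow> \<epsilon> \<le> q n x z"
  unfolding q_def by (rule p2_ge)

lemma q_le:
  assumes [measurable]: "x \<in> space (\<mu> n)" "z \<in> space (\<mu> (Suc (Suc n)))"
  shows "q n x z \<le> 1 / \<epsilon>"
proof -
  have "q n x z \<le> (\<integral>y. p n x y * (1 / \<epsilon>) \<partial>\<mu> (Suc n))"
    unfolding q_def
    by (intro integral_mono mu.integrable_bnd bnd_mult mult_left_mono p_nonneg p_le) auto
  also have "\<dots> = 1 / \<epsilon>" using assms by (simp add: p_integral)
  finally show ?thesis .
qed

lemma T_T:
  fixes h :: "'s \<Rightarrow> 'b::{banach, second_countable_topology}"
  assumes [measurable]: "h \<in> borel_measurable (\<mu> (Suc (Suc n)))" and b: "bnd h" and [measurable]: "x \<in> space (\<mu> n)"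
  shows "T n (\<lambda>_. T (Suc n) (\<lambda>_. h)) x = (\<integral>z. q n x z *\<^sub>R h z \<partial>\<mu> (Suc (Suc n)))"
proof -
  have "T n (\<lambda>_. T (Suc n) (\<lambda>_. h)) x
      = (\<integral>y. \<integral>z. (p n x y * p (Suc n) y z) *\<^sub>R h z \<partial>\<mu> (Suc (Suc n)) \<partial>\<mu> (Suc n))"
    unfolding T_def by (simp flip: integral_scaleR_right)
  also have "\<dots> = (\<integral>z. \<integral>y. (p n x y * p (Suc n) y z) *\<^sub>R h z \<partial>\<mu> (Suc n) \<partial>\<mu> (Suc (Suc n)))"
    using b by (intro Fubini_bnd(1)) (auto simp: case_prod_unfold intro!: bnd_mult bnd_scaleR bnd_compose[OF b])
  also have "\<dots> = (\<integral>z. q n x z *\<^sub>R h z \<partial>\<mu> (Suc (Suc n)))"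
    unfolding q_def
    by (intro Bochner_Integration.integral_cong refl integral_scaleR_left mu.integrable_bnd bnd_mult) auto
  finally show ?thesis .
qed

lemma q_integral: "x \<in> space (\<mu> n) \<Longrightarrow> (\<integral>z. q n x z \<partial>\<mu> (Suc (Suc n))) = 1"
proof -
  assume x: "x \<in> space (\<mu> n)"
  have "T n (\<lambda>_. T (Suc n) (\<lambda>_ _. 1::real)) x = T n (\<lambda>_ _. 1::real) x"
    unfolding T_def by (intro Bochner_Integration.integral_cong refl) (simp add: p_integral)
  then show ?thesis using T_T[of "\<lambda>_. 1::real" n x] x by (simp add: T_const)
qed

lemma expectation_T2:
  fixes h :: "'s \<Rightarrow> real"
  assumes [measurable]: "h \<in> borel_measurable (\<mu> (Suc (Suc n)))" and b: "bnd h"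
  shows "(\<integral>\<omega>. h (X (Suc (Suc n)) \<omega>) \<partial>M) = (\<integral>\<omega>. (\<integral>z. q n (X n \<omega>) z * h z \<partial>\<mu> (Suc (Suc n))) \<partial>M)"
proof -
  have 1: "(\<integral>\<omega>. h (X (Suc (Suc n)) \<omega>) \<partial>M) = (\<integral>\<omega>. T (Suc n) (\<lambda>_. h) (X (Suc n) \<omega>) \<partial>M)"
    by (rule expectation_pair) (auto simp: case_prod_unfold intro!: bnd_compose[OF b])
  have "bnd (T (Suc n) (\<lambda>_. h))" by (rule bnd_T) (auto simp: case_prod_unfold intro!: bnd_compose[OF b])
  then have "(\<integral>\<omega>. T (Suc n) (\<lambda>_. h) (X (Suc n) \<omega>) \<partial>M) = (\<integral>\<omega>. T n (\<lambda>_. T (Suc n) (\<lambda>_. h)) (X n \<omega>) \<partial>M)"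
    by (intro expectation_pair) (auto simp: case_prod_unfold dest: bnd_compose[where g = snd])
  also have "\<dots> = (\<integral>\<omega>. (\<integral>z. q n (X n \<omega>) z * h z \<partial>\<mu> (Suc (Suc n))) \<partial>M)"
    by (intro Bochner_Integration.integral_cong refl) (simp add: T_T b X_space)
  finally show ?thesis using 1 by simp
qed

text \<open>After one step the law of the chain has a density at most 1/\<epsilon> with respect to
  the reference measure. The time is a successor because the initial law is arbitrary, possibly a
  point mass.\<close>

lemma expectation_le:
  fixes h :: "'s \<Rightarrow> real"
  assumes [measurable]: "h \<in> borel_measurable (\<mu> (Suc n))" and b: "bnd h" and nn: "\<And>x. 0 \<le> h x"
  shows "(\<integral>\<omega>. h (X (Suc n) \<omega>) \<partial>M) \<le> (1 / \<epsilon>) * (\<integral>x. h x \<partial>\<mu> (Suc n))"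
proof -
  have "(\<integral>\<omega>. h (X (Suc n) \<omega>) \<partial>M) = (\<integral>\<omega>. T n (\<lambda>_. h) (X n \<omega>) \<partial>M)"
    by (rule expectation_pair) (auto simp: case_prod_unfold intro!: bnd_compose[OF b])
  also have "\<dots> \<le> (\<integral>\<omega>. (1 / \<epsilon>) * (\<integral>x. h x \<partial>\<mu> (Suc n)) \<partial>M)"
  proof (rule integral_mono)
    show "integrable M (\<lambda>\<omega>. T n (\<lambda>_. h) (X n \<omega>))"
      by (intro integrable_bnd bnd_compose[OF bnd_T]) (auto simp: case_prod_unfold intro!: bnd_compose[OF b])
    fix \<omega> assume "\<omega> \<in> space M"
    note X_space[OF this, measurable]
    have "T n (\<lambda>_. h) (X n \<omega>) \<le> (\<integral>y. (1 / \<epsilon>) * h y \<partial>\<mu> (Suc n))"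
      unfolding T_def real_scaleR_def
      by (intro integral_mono mu.integrable_bnd bnd_mult mult_right_mono p_le nn bnd_p b) auto
    then show "T n (\<lambda>_. h) (X n \<omega>) \<le> (1 / \<epsilon>) * (\<integral>x. h x \<partial>\<mu> (Suc n))" by simp
  qed auto
  also have "\<dots> = (1 / \<epsilon>) * (\<integral>x. h x \<partial>\<mu> (Suc n))" by (simp add: prob_space)
  finally show ?thesis .
qed

lemma expectation_pair_le:
  fixes G :: "'s \<Rightarrow> 's \<Rightarrow> real"
  assumes [measurable]: "(\<lambda>(x, y). G x y) \<in> borel_measurable (\<mu> n \<Otimes>\<^sub>M \<mu> (Suc n))"
    and b: "bnd (\<lambda>(x, y). G x y)" and nn: "\<And>x y. 0 \<le> G x y" and n: "0 < n"
  shows "(\<integral>\<omega>. G (X n \<omega>) (X (Suc n) \<omega>) \<partial>M) \<le> (1 / \<epsilon>) * (\<integral>x. \<integral>y. p n x y * G x y \<partial>\<mu> (Suc n) \<partial>\<mu> n)"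
proof -
  obtain m where [simp]: "n = Suc m" using n not0_implies_Suc by auto
  have "(\<integral>\<omega>. G (X n \<omega>) (X (Suc n) \<omega>) \<partial>M) = (\<integral>\<omega>. T n G (X n \<omega>) \<partial>M)"
    by (rule expectation_pair[OF assms(1) b])
  also have "\<dots> = (\<integral>\<omega>. T n G (X (Suc m) \<omega>) \<partial>M)" by simp
  also have "\<dots> \<le> (1 / \<epsilon>) * (\<integral>x. T n G x \<partial>\<mu> (Suc m))"
    using T_measurable[OF assms(1)] by (intro expectation_le bnd_T b T_nonneg nn) auto
  finally show ?thesis unfolding T_def by simp
qed

text \<open>Doeblin's argument: subtracting the minorant \<open>\<epsilon>\<close> from \<open>q\<close> leaves a kernel of mass \<open>1 - \<epsilon>\<close>.\<close>

lemma q_split: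
  fixes h :: "'s \<Rightarrow> real"
  assumes [measurable]: "h \<in> borel_measurable (\<mu> (Suc (Suc n)))" and b: "bnd h" and x [measurable]: "x \<in> space (\<mu> n)"
  shows "(\<integral>z. q n x z * h z \<partial>\<mu> (Suc (Suc n)))
    = \<epsilon> * (\<integral>z. h z \<partial>\<mu> (Suc (Suc n))) + (\<integral>z. (q n x z - \<epsilon>) * h z \<partial>\<mu> (Suc (Suc n)))"
proof -
  have "integrable (\<mu> (Suc (Suc n))) h" "integrable (\<mu> (Suc (Suc n))) (\<lambda>z. q n x z * h z)"
    using b by (auto intro!: mu.integrable_bnd bnd_mult)
  then show ?thesis by (simp add: left_diff_distrib)
qed

lemma q_minus_integral: "x \<in> space (\<mu> n) \<Longrightarrow> (\<integral>z. q n x z - \<epsilon> \<partial>\<mu> (Suc (Suc n))) = 1 - \<epsilon>"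
  by (subst Bochner_Integration.integral_diff) (auto simp: q_integral mu.prob_space intro!: mu.integrable_bnd)

text \<open>The constant part \<epsilon> of the density contributes the same amount for both
  starting points and cancels. What remains is a nonnegative kernel of mass 1 - \<epsilon>, against
  which \<open>h\<close> lies between \<open>s - R\<close> and its supremum
  \<open>s\<close>.\<close>

lemma q_oscillation:
  fixes h :: "'s \<Rightarrow> real"
  assumes [measurable]: "h \<in> borel_measurable (\<mu> (Suc (Suc n)))" and b: "bnd h"
    and x [measurable]: "x \<in> space (\<mu> n)" and x' [measurable]: "x' \<in> space (\<mu> n)"
    and R: "\<And>z z'. z \<in> space (\<mu> (Suc (Suc n))) \<Longrightarrow> z' \<in> space (\<mu> (Suc (Suc n))) \<Longrightarrow> h z - h z' \<le> R"
  shows "(\<integral>z. q n x z * h z \<partial>\<mu> (Suc (Suc n))) - (\<integral>z. q n x' z * h z \<partial>\<mu> (Suc (Suc n))) \<le> (1 - \<epsilon>) * R"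
proof -
  let ?S = "space (\<mu> (Suc (Suc n)))"
  obtain C where C: "\<And>x. norm (h x) \<le> C" using bnd_bound[OF b] by blast
  have ne: "?S \<noteq> {}" by (rule mu.not_empty)
  define s where "s = (SUP z\<in>?S. h z)"
  have bdd: "bdd_above (h ` ?S)" using C by (intro bdd_aboveI2[of _ _ C]) (auto intro: order_trans[OF abs_ge_self])
  have s1: "h z \<le> s" if "z \<in> ?S" for z unfolding s_def by (rule cSUP_upper[OF that bdd])
  have s2: "s - R \<le> h z" if "z \<in> ?S" for z
  proof -
    have "s \<le> h z + R" unfolding s_def using R[OF _ that] by (intro cSUP_least ne) (auto simp: algebra_simps)
    then show ?thesis by simp
  qed
  have i: "integrable (\<mu> (Suc (Suc n))) (\<lambda>z. (q n w z - \<epsilon>) * h z)" "integrable (\<mu> (Suc (Suc n))) (\<lambda>z. (q n w z - \<epsilon>) * c)"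
    if [measurable]: "w \<in> space (\<mu> n)" for w c
    using b by (auto intro!: mu.integrable_bnd bnd_mult bnd_diff)
  have "(\<integral>z. (q n x z - \<epsilon>) * h z \<partial>\<mu> (Suc (Suc n))) \<le> (\<integral>z. (q n x z - \<epsilon>) * s \<partial>\<mu> (Suc (Suc n)))"
    using q_ge x s1 by (intro integral_mono i x mult_left_mono) auto
  moreover have "(\<integral>z. (q n x' z - \<epsilon>) * (s - R) \<partial>\<mu> (Suc (Suc n))) \<le> (\<integral>z. (q n x' z - \<epsilon>) * h z \<partial>\<mu> (Suc (Suc n)))"
    using q_ge x' s2 by (intro integral_mono i x' mult_left_mono) auto
  ultimately have "(\<integral>z. (q n x z - \<epsilon>) * h z \<partial>\<mu> (Suc (Suc n))) - (\<integral>z. (q n x' z - \<epsilon>) * h z \<partial>\<mu> (Suc (Suc n))) \<le> (1 - \<epsilon>) * s - (1 - \<epsilon>) * (s - R)"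
    by (simp add: q_minus_integral x x')
  then show ?thesis
    unfolding q_split[OF assms(1) b x] q_split[OF assms(1) b x'] by (simp add: algebra_simps)
qed

end

lemma (in prob_space) weighted_Cauchy_Schwarz:
  fixes w h :: "'a \<Rightarrow> real"
  assumes [measurable]: "w \<in> borel_measurable M" "h \<in> borel_measurable M" and b: "bnd w" "bnd h"
    and nn: "\<And>x. x \<in> space M \<Longrightarrow> 0 \<le> w x"
  shows "(\<integral>x. w x * h x \<partial>M)\<^sup>2 \<le> (\<integral>x. w x \<partial>M) * (\<integral>x. w x * (h x)\<^sup>2 \<partial>M)"
proof -
  let ?a = "\<integral>x. w x \<partial>M" let ?b = "\<integral>x. w x * h x \<partial>M" let ?c = "\<integral>x. w x * (h x)\<^sup>2 \<partial>M"
  have i: "integrable M w" "integrable M (\<lambda>x. w x * h x)" "integrable M (\<lambda>x. w x * (h x)\<^sup>2)"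
    using b by (auto intro!: integrable_bnd)
  have *: "0 \<le> ?c - 2 * t * ?b + t\<^sup>2 * ?a" for t
  proof -
    have "0 \<le> (\<integral>x. w x * (h x - t)\<^sup>2 \<partial>M)" using nn by (auto intro!: integral_nonneg_AE)
    also have "\<dots> = (\<integral>x. w x * (h x)\<^sup>2 - 2 * t * (w x * h x) + t\<^sup>2 * w x \<partial>M)"
      by (intro Bochner_Integration.integral_cong refl) (simp add: power2_eq_square algebra_simps)
    also have "\<dots> = ?c - 2 * t * ?b + t\<^sup>2 * ?a" using i by simp
    finally show ?thesis .
  qed
  have "0 \<le> ?a" using nn by (auto intro!: integral_nonneg_AE)
  show ?thesis
  proof (cases "?a = 0")
    case True
    have "?b = 0"
    proof (rule ccontr)
      assume "?b \<noteq> 0"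
      \<comment> \<open>With total weight 0 the polynomial in \<open>t\<close> is affine; at this
        \<open>t\<close> it takes the value -1.\<close>
      then show False using *[of "(?c + 1) / (2 * ?b)"] True by (simp add: field_simps)
    qed
    then show ?thesis using True by simp
  next
    case False
    with \<open>0 \<le> ?a\<close> have "0 < ?a" by simp
    then show ?thesis using *[of "?b / ?a"] by (simp add: field_simps power2_eq_square)
  qed
qed

context elliptic_chain begin

text \<open>By \<open>q_split\<close> the two-step average is a constant \<open>c\<close> plus an
  integral against a kernel of mass 1 - \<epsilon>. A centred variable has the smallest second
  moment among its translates, so \<open>c\<close> may be dropped, and Cauchy-Schwarz for the
  remaining kernel yields the factor 1 - \<epsilon>. The mean is taken under the law of the chain,
  whereas \<open>c\<close> is an integral under the reference measure.\<close>

lemma q_contraction_L2: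
  fixes h :: "'s \<Rightarrow> real"
  assumes [measurable]: "h \<in> borel_measurable (\<mu> (Suc (Suc n)))" and b: "bnd h"
    and mean: "(\<integral>\<omega>. h (X (Suc (Suc n)) \<omega>) \<partial>M) = 0"
  shows "(\<integral>\<omega>. (\<integral>z. q n (X n \<omega>) z * h z \<partial>\<mu> (Suc (Suc n)))\<^sup>2 \<partial>M)
    \<le> (1 - \<epsilon>) * (\<integral>\<omega>. (h (X (Suc (Suc n)) \<omega>))\<^sup>2 \<partial>M)"
proof -
  let ?\<mu> = "\<mu> (Suc (Suc n))"
  let ?Q = "\<lambda>\<omega>. \<integral>z. q n (X n \<omega>) z * h z \<partial>?\<mu>"
  let ?R = "\<lambda>\<omega>. \<integral>z. (q n (X n \<omega>) z - \<epsilon>) * h z \<partial>?\<mu>"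
  define c where "c = \<epsilon> * (\<integral>z. h z \<partial>?\<mu>)"
  have bQ: "bnd ?Q" by (rule mu.bnd_integral) (auto simp: case_prod_unfold intro!: bnd_mult bnd_compose[OF b])
  have bR: "bnd ?R" by (rule mu.bnd_integral) (auto simp: case_prod_unfold intro!: bnd_mult bnd_diff bnd_compose[OF b])
  have bS: "bnd (\<lambda>\<omega>. \<integral>z. q n (X n \<omega>) z * (h z)\<^sup>2 \<partial>?\<mu>)"
    by (rule mu.bnd_integral) (auto simp: case_prod_unfold intro!: bnd_mult bnd_power bnd_compose[OF b])
  have Q: "?Q \<omega> = c + ?R \<omega>" if "\<omega> \<in> space M" for \<omega>
    unfolding c_def by (rule q_split) (auto simp: b X_space that)
  have EQ: "(\<integral>\<omega>. ?Q \<omega> \<partial>M) = 0" using expectation_T2[of h n] b mean by simp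
  have iQ: "integrable M ?Q" "integrable M (\<lambda>\<omega>. (?Q \<omega>)\<^sup>2)" using bQ by (auto intro!: integrable_bnd)
  \<comment> \<open>As \<open>?Q\<close> has mean 0, adding \<open>c\<^sup>2\<close> completes the
    square to the second moment of \<open>?Q - c = ?R\<close>.\<close>
  have "(\<integral>\<omega>. (?Q \<omega>)\<^sup>2 \<partial>M) \<le> (\<integral>\<omega>. (?Q \<omega>)\<^sup>2 \<partial>M) - 2 * c * (\<integral>\<omega>. ?Q \<omega> \<partial>M) + c\<^sup>2" using EQ by simp
  also have "\<dots> = (\<integral>\<omega>. (?Q \<omega>)\<^sup>2 - 2 * c * ?Q \<omega> + c\<^sup>2 \<partial>M)" using iQ by (simp add: prob_space)
  also have "\<dots> = (\<integral>\<omega>. (?R \<omega>)\<^sup>2 \<partial>M)"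
  proof (intro Bochner_Integration.integral_cong refl)
    fix \<omega> assume "\<omega> \<in> space M"
    have "(c + r)\<^sup>2 - 2 * c * (c + r) + c\<^sup>2 = r\<^sup>2" for r by algebra
    then show "(?Q \<omega>)\<^sup>2 - 2 * c * ?Q \<omega> + c\<^sup>2 = (?R \<omega>)\<^sup>2" by (simp only: Q[OF \<open>\<omega> \<in> space M\<close>])
  qed
  also have "\<dots> \<le> (\<integral>\<omega>. (1 - \<epsilon>) * (\<integral>z. q n (X n \<omega>) z * (h z)\<^sup>2 \<partial>?\<mu>) \<partial>M)"
  proof (rule integral_mono)
    fix \<omega> assume w: "\<omega> \<in> space M"
    note [measurable] = X_space[OF w]
    have "(?R \<omega>)\<^sup>2 \<le> (\<integral>z. (q n (X n \<omega>) z - \<epsilon>) \<partial>?\<mu>) * (\<integral>z. (q n (X n \<omega>) z - \<epsilon>) * (h z)\<^sup>2 \<partial>?\<mu>)"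
      using b by (intro mu.weighted_Cauchy_Schwarz) (auto simp: q_ge X_space w)
    also have "\<dots> = (1 - \<epsilon>) * (\<integral>z. (q n (X n \<omega>) z - \<epsilon>) * (h z)\<^sup>2 \<partial>?\<mu>)"
      by (simp add: q_minus_integral X_space w)
    also have "\<dots> \<le> (1 - \<epsilon>) * (\<integral>z. q n (X n \<omega>) z * (h z)\<^sup>2 \<partial>?\<mu>)"
      using eps_less_1 eps_pos b
      by (intro mult_left_mono integral_mono mu.integrable_bnd bnd_mult bnd_diff bnd_power) (auto intro!: mult_right_mono)
    finally show "(?R \<omega>)\<^sup>2 \<le> (1 - \<epsilon>) * (\<integral>z. q n (X n \<omega>) z * (h z)\<^sup>2 \<partial>?\<mu>)" .
  qed (use bR bS in \<open>auto intro!: integrable_bnd\<close>)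
  also have "\<dots> = (1 - \<epsilon>) * (\<integral>\<omega>. (h (X (Suc (Suc n)) \<omega>))\<^sup>2 \<partial>M)"
    by (subst expectation_T2[of "\<lambda>z. (h z)\<^sup>2" n]) (auto intro!: bnd_power b)
  finally show ?thesis .
qed

section \<open>Correctors\<close>

lemma bnd_const_pair [simp, intro]: "bnd (\<lambda>(x, y). c)"
  by (simp add: case_prod_unfold)

lemma F_pair_measurable:
  assumes "(\<lambda>(x, y). G x y) \<in> borel_measurable (\<mu> i \<Otimes>\<^sub>M \<mu> (Suc i))" "Suc i \<le> n"
  shows "(\<lambda>\<omega>. G (X i \<omega>) (X (Suc i) \<omega>)) \<in> borel_measurable (F n)"
  using measurable_compose[OF measurable_Pair[OF X_meas_F[of i n] X_meas_F[of "Suc i" n]] assms(1)] assms(2) by simp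

lemma T_square_le:
  fixes G :: "'s \<Rightarrow> 's \<Rightarrow> real"
  assumes [measurable]: "(\<lambda>(x, y). G x y) \<in> borel_measurable (\<mu> n \<Otimes>\<^sub>M \<mu> (Suc n))"
    and b: "bnd (\<lambda>(x, y). G x y)" and x [measurable]: "x \<in> space (\<mu> n)"
  shows "(T n G x)\<^sup>2 \<le> T n (\<lambda>x y. (G x y)\<^sup>2) x"
proof -
  have "bnd (G x)" using bnd_compose2[OF b, of "\<lambda>_. x" "\<lambda>y. y"] by simp
  then show ?thesis
    unfolding T_def real_scaleR_def using mu.weighted_Cauchy_Schwarz[of "p n x" "Suc n" "G x"] x
    by (simp add: p_nonneg p_integral)
qed

lemma expectation_T_square_le:
  fixes G :: "'s \<Rightarrow> 's \<Rightarrow> real"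
  assumes [measurable]: "(\<lambda>(x, y). G x y) \<in> borel_measurable (\<mu> n \<Otimes>\<^sub>M \<mu> (Suc n))"
    and b: "bnd (\<lambda>(x, y). G x y)"
  shows "(\<integral>\<omega>. (T n G (X n \<omega>))\<^sup>2 \<partial>M) \<le> (\<integral>\<omega>. (G (X n \<omega>) (X (Suc n) \<omega>))\<^sup>2 \<partial>M)"
proof -
  have m: "(\<lambda>(x, y). (G x y)\<^sup>2) \<in> borel_measurable (\<mu> n \<Otimes>\<^sub>M \<mu> (Suc n))" by measurable
  have b2: "bnd (\<lambda>(x, y). (G x y)\<^sup>2)" using bnd_power[OF b, of 2] by (simp add: case_prod_unfold)
  have "(\<integral>\<omega>. (T n G (X n \<omega>))\<^sup>2 \<partial>M) \<le> (\<integral>\<omega>. T n (\<lambda>x y. (G x y)\<^sup>2) (X n \<omega>) \<partial>M)"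
    using bnd_compose[OF bnd_T[OF b]] bnd_compose[OF bnd_T[OF b2]] m
    by (intro integral_mono integrable_bnd bnd_power T_square_le b) (auto simp: X_space)
  then show ?thesis using expectation_pair[OF m b2] by simp
qed

lemma centered_square_le:
  fixes Y :: "'w \<Rightarrow> real"
  assumes "bnd Y" "Y \<in> borel_measurable M" "(\<integral>\<omega>. Y \<omega> \<partial>M) = m"
  shows "(\<integral>\<omega>. (Y \<omega> - m)\<^sup>2 \<partial>M) \<le> (\<integral>\<omega>. (Y \<omega>)\<^sup>2 \<partial>M)"
proof -
  have i: "integrable M Y" "integrable M (\<lambda>\<omega>. (Y \<omega>)\<^sup>2)" using assms by (auto intro!: integrable_bnd)
  have "(\<integral>\<omega>. (Y \<omega> - m)\<^sup>2 \<partial>M) = (\<integral>\<omega>. (Y \<omega>)\<^sup>2 - 2 * m * Y \<omega> + m\<^sup>2 \<partial>M)"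
    by (intro Bochner_Integration.integral_cong refl) (simp add: power2_eq_square algebra_simps)
  also have "\<dots> = (\<integral>\<omega>. (Y \<omega>)\<^sup>2 \<partial>M) - m\<^sup>2" using i assms(3) by (simp add: prob_space power2_eq_square)
  finally show ?thesis by simp
qed

definition mean :: "(nat \<Rightarrow> 's \<Rightarrow> 's \<Rightarrow> real) \<Rightarrow> nat \<Rightarrow> real" where
  "mean \<Phi> n = (\<integral>\<omega>. \<Phi> n (X n \<omega>) (X (Suc n) \<omega>) \<partial>M)"

text \<open>Backward solution of the Poisson equation \<open>T n (\<Phi> n + u (n + 1)) - u n = mean \<Phi> n\<close>, \<open>u N = 0\<close>, with \<open>k\<close> the
  number of steps back from \<open>N\<close>. Adding the coboundary of \<open>u\<close> turns \<open>\<Phi> n - mean \<Phi> n\<close> into martingale differences.\<close>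

primrec backward :: "(nat \<Rightarrow> 's \<Rightarrow> 's \<Rightarrow> real) \<Rightarrow> nat \<Rightarrow> nat \<Rightarrow> 's \<Rightarrow> real" where
  "backward \<Phi> N 0 = (\<lambda>_. 0)"
| "backward \<Phi> N (Suc k) = (\<lambda>x. T (N - Suc k) (\<lambda>x y. \<Phi> (N - Suc k) x y + backward \<Phi> N k y) x - mean \<Phi> (N - Suc k))"

definition corrector :: "(nat \<Rightarrow> 's \<Rightarrow> 's \<Rightarrow> real) \<Rightarrow> nat \<Rightarrow> nat \<Rightarrow> 's \<Rightarrow> real" where
  "corrector \<Phi> N n = backward \<Phi> N (N - n)"

definition functional :: "(nat \<Rightarrow> 's \<Rightarrow> 's \<Rightarrow> real) \<Rightarrow> bool" where
  "functional \<Phi> \<longleftrightarrow> (\<forall>n. (\<lambda>(x, y). \<Phi> n x y) \<in> borel_measurable (\<mu> n \<Otimes>\<^sub>M \<mu> (Suc n)) \<and> bnd (\<lambda>(x, y). \<Phi> n x y))"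

lemma functionalD:
  assumes "functional \<Phi>"
  shows "(\<lambda>(x, y). \<Phi> n x y) \<in> borel_measurable (\<mu> n \<Otimes>\<^sub>M \<mu> (Suc n))" "bnd (\<lambda>(x, y). \<Phi> n x y)"
  using assms unfolding functional_def by auto

lemma functional_measurable:
  assumes "functional \<Phi>" "g \<in> N \<rightarrow>\<^sub>M \<mu> n" "h \<in> N \<rightarrow>\<^sub>M \<mu> (Suc n)"
  shows "(\<lambda>w. \<Phi> n (g w) (h w)) \<in> borel_measurable N"
  using measurable_compose[OF measurable_Pair[OF assms(2,3)] functionalD(1)[OF assms(1)]] by simp

lemma functional_bnd: "functional \<Phi> \<Longrightarrow> bnd (\<lambda>w. \<Phi> n (g w) (h w))"
  using bnd_compose2[OF functionalD(2)] .

definition energy :: "(nat \<Rightarrow> 's \<Rightarrow> 's \<Rightarrow> real) \<Rightarrow> nat \<Rightarrow> real" where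
  "energy \<Phi> n = (\<integral>\<omega>. (\<Phi> n (X n \<omega>) (X (Suc n) \<omega>))\<^sup>2 \<partial>M)"

section \<open>The Poisson equation: oscillation and energy of the corrector\<close>

context
  fixes \<Phi> :: "nat \<Rightarrow> 's \<Rightarrow> 's \<Rightarrow> real" and N :: nat
  assumes fnl: "functional \<Phi>" and zero: "\<And>n x y. N \<le> n \<Longrightarrow> \<Phi> n x y = 0"
begin

private abbreviation "u \<equiv> corrector \<Phi> N"
private abbreviation "m \<equiv> mean \<Phi>"

lemmas Phi_measurable [measurable (raw)] = functional_measurable[OF fnl]
lemmas bnd_Phi = functional_bnd[OF fnl]

lemma corrector_Suc:
  "n < N \<Longrightarrow> u n = (\<lambda>x. T n (\<lambda>x y. \<Phi> n x y + u (Suc n) y) x - m n)"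
proof -
  assume n: "n < N"
  then have "N - n = Suc (N - Suc n)" "N - Suc (N - Suc n) = n" by auto
  then show ?thesis unfolding corrector_def by simp
qed

lemma corrector_0: "N \<le> n \<Longrightarrow> u n x = 0"
  unfolding corrector_def by simp

lemma mean_0: "N \<le> n \<Longrightarrow> m n = 0"
  unfolding mean_def using zero by simp

lemma backward_good: "k \<le> N \<Longrightarrow> backward \<Phi> N k \<in> borel_measurable (\<mu> (N - k)) \<and> bnd (backward \<Phi> N k)"
proof (induction k)
  case (Suc k)
  then have *: "Suc (N - Suc k) = N - k" and IH [measurable]: "backward \<Phi> N k \<in> borel_measurable (\<mu> (N - k))"
    and b: "bnd (backward \<Phi> N k)" by auto
  have [measurable]: "backward \<Phi> N k \<in> borel_measurable (\<mu> (Suc (N - Suc k)))" using * IH by simp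
  have "bnd (\<lambda>(x, y). \<Phi> (N - Suc k) x y + backward \<Phi> N k y)"
    by (auto simp: case_prod_unfold intro!: bnd_add bnd_Phi bnd_compose[OF b])
  then show ?case by (auto intro!: bnd_diff bnd_T)
qed simp

lemma corrector_measurable [measurable]: "u n \<in> borel_measurable (\<mu> n)"
proof (cases "n \<le> N")
  case True
  then show ?thesis using backward_good[of "N - n"] unfolding corrector_def by simp
qed (simp add: corrector_def)

lemmas corrector_measurable_compose [measurable (raw)] = measurable_compose[OF _ corrector_measurable]

lemma bnd_corrector: "bnd (u n)"
  using backward_good[of "N - n"] unfolding corrector_def by simp

lemma bnd_corrector_compose: "bnd (\<lambda>w. u n (g w))"
  by (rule bnd_compose[OF bnd_corrector])

lemma corrector_eq: "T n (\<lambda>x y. \<Phi> n x y + u (Suc n) y) x = u n x + m n"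
proof (cases "n < N")
  case True
  show ?thesis using fun_cong[OF corrector_Suc[OF True], of x] by simp
next
  case False
  then show ?thesis by (simp add: zero corrector_0 mean_0 T_def)
qed

lemma corrector_mean: "(\<integral>\<omega>. u n (X n \<omega>) \<partial>M) = 0"
proof (cases "n \<le> N")
  case True
  then show ?thesis
  proof (induction n rule: inc_induct)
    case (step n)
    have i: "integrable M (\<lambda>\<omega>. \<Phi> n (X n \<omega>) (X (Suc n) \<omega>))" "integrable M (\<lambda>\<omega>. u (Suc n) (X (Suc n) \<omega>))"
      by (auto intro!: integrable_bnd bnd_Phi bnd_corrector_compose)
    have b: "bnd (\<lambda>(x, y). \<Phi> n x y + u (Suc n) y)"
      by (auto simp: case_prod_unfold intro!: bnd_add bnd_Phi bnd_corrector_compose)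
    have "(\<integral>\<omega>. u n (X n \<omega>) \<partial>M) + m n = (\<integral>\<omega>. u n (X n \<omega>) + m n \<partial>M)"
      by (subst Bochner_Integration.integral_add) (auto intro!: integrable_bnd bnd_corrector_compose simp: prob_space)
    also have "\<dots> = (\<integral>\<omega>. T n (\<lambda>x y. \<Phi> n x y + u (Suc n) y) (X n \<omega>) \<partial>M)" by (simp only: corrector_eq)
    also have "\<dots> = (\<integral>\<omega>. \<Phi> n (X n \<omega>) (X (Suc n) \<omega>) + u (Suc n) (X (Suc n) \<omega>) \<partial>M)"
      by (rule expectation_pair[symmetric]) (use b in auto)
    also have "\<dots> = m n" using i step by (simp add: mean_def)
    finally show ?case by simp
  qed (simp add: corrector_0)
qed (simp add: corrector_0)

private definition "g n x = (T n (\<Phi> n) x - m n) + (T n (\<lambda>_. T (Suc n) (\<Phi> (Suc n))) x - m (Suc n))"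

lemma bnd_TPhi: "bnd (\<lambda>w. T n (\<Phi> n) (h w))"
  by (rule bnd_compose[OF bnd_T[OF functionalD(2)[OF fnl]]])

lemma bnd_TTPhi: "bnd (\<lambda>w. T n (\<lambda>_. T (Suc n) (\<Phi> (Suc n))) (h w))"
  by (rule bnd_compose[OF bnd_T]) (auto simp: case_prod_unfold intro!: bnd_TPhi)

text \<open>Two steps of the recursion are taken at once because contraction is known only for the
  two-step kernel \<open>q\<close>; \<open>g\<close> collects the centred source terms of both
  steps.\<close>

lemma corrector_two_step:
  assumes x [measurable]: "x \<in> space (\<mu> n)"
  shows "u n x = g n x + (\<integral>z. q n x z * u (Suc (Suc n)) z \<partial>\<mu> (Suc (Suc n)))"
proof -
  have bu: "bnd (\<lambda>(x, y). u (Suc k) y)" for k by (auto simp: case_prod_unfold intro!: bnd_corrector_compose)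
  have bTu: "bnd (\<lambda>w. T (Suc n) (\<lambda>_. u (Suc (Suc n))) (h w))" for h
    by (rule bnd_compose[OF bnd_T]) (auto simp: case_prod_unfold intro!: bnd_corrector_compose)
  have 1: "T k (\<Phi> k) y + T k (\<lambda>_. u (Suc k)) y = u k y + m k" if [measurable]: "y \<in> space (\<mu> k)" for k y
  proof -
    have "T k (\<lambda>x y. \<Phi> k x y + u (Suc k) y) y = T k (\<Phi> k) y + T k (\<lambda>_. u (Suc k)) y"
      by (rule T_add) (use functionalD[OF fnl] bu that in auto)
    then show ?thesis by (simp add: corrector_eq)
  qed
  have 2: "T n (\<lambda>_. u (Suc n)) x = T n (\<lambda>x y. (T (Suc n) (\<Phi> (Suc n)) y + T (Suc n) (\<lambda>_. u (Suc (Suc n))) y) + (- m (Suc n))) x"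
    unfolding T_def[of n] using 1[of _ "Suc n"] by (intro Bochner_Integration.integral_cong refl) (simp add: algebra_simps)
  also have "\<dots> = T n (\<lambda>x y. T (Suc n) (\<Phi> (Suc n)) y + T (Suc n) (\<lambda>_. u (Suc (Suc n))) y) x + T n (\<lambda>_ _. - m (Suc n)) x"
    by (rule T_add) (auto simp: case_prod_unfold x intro!: bnd_add bnd_TPhi bTu)
  also have "T n (\<lambda>x y. T (Suc n) (\<Phi> (Suc n)) y + T (Suc n) (\<lambda>_. u (Suc (Suc n))) y) x
     = T n (\<lambda>x y. T (Suc n) (\<Phi> (Suc n)) y) x + T n (\<lambda>x y. T (Suc n) (\<lambda>_. u (Suc (Suc n))) y) x"
    by (rule T_add) (auto simp: case_prod_unfold x intro!: bnd_add bnd_TPhi bTu)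
  also have "T n (\<lambda>x y. T (Suc n) (\<lambda>_. u (Suc (Suc n))) y) x = (\<integral>z. q n x z * u (Suc (Suc n)) z \<partial>\<mu> (Suc (Suc n)))"
    using T_T[OF corrector_measurable bnd_corrector x] by simp
  finally show ?thesis
    using 1[OF x] T_const[OF x, of "- m (Suc n)"] unfolding g_def by linarith
qed

lemma abs_TPhi_le:
  assumes K: "\<And>n x y. \<bar>\<Phi> n x y\<bar> \<le> K" and x: "x \<in> space (\<mu> n)"
  shows "\<bar>T n (\<Phi> n) x\<bar> \<le> K"
proof -
  have "\<Phi> n x y \<le> K" "- K \<le> \<Phi> n x y" for x y using K[of n x y] by auto
  then have "T n (\<Phi> n) x \<le> T n (\<lambda>_ _. K) x" "T n (\<lambda>_ _. - K) x \<le> T n (\<Phi> n) x"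
    using functionalD[OF fnl] x by (auto intro!: T_mono)
  then show ?thesis using x by (auto simp: T_const)
qed

lemma abs_TTPhi_le:
  assumes K: "\<And>n x y. \<bar>\<Phi> n x y\<bar> \<le> K" and x: "x \<in> space (\<mu> n)"
  shows "\<bar>T n (\<lambda>_. T (Suc n) (\<Phi> (Suc n))) x\<bar> \<le> K"
proof -
  have *: "T (Suc n) (\<Phi> (Suc n)) y \<le> K" "- K \<le> T (Suc n) (\<Phi> (Suc n)) y" if "y \<in> space (\<mu> (Suc n))" for y
    using abs_TPhi_le[OF K that] by auto
  have "T n (\<lambda>_. T (Suc n) (\<Phi> (Suc n))) x \<le> T n (\<lambda>_ _. K) x" "T n (\<lambda>_ _. - K) x \<le> T n (\<lambda>_. T (Suc n) (\<Phi> (Suc n))) x"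
    by (intro T_mono x *; auto simp: case_prod_unfold intro!: bnd_TPhi)+
  then show ?thesis using x by (auto simp: T_const)
qed

text \<open>The number \<open>4 * K / \<epsilon>\<close> is the fixed point of
  \<open>r \<mapsto> 4 * K + (1 - \<epsilon>) * r\<close>, the recursion for oscillations over two
  steps. The induction jumps from \<open>n\<close> to \<open>n + 2\<close>, hence the strong
  form.\<close>

lemma corrector_oscillation:
  assumes K: "\<And>n x y. \<bar>\<Phi> n x y\<bar> \<le> K"
  shows "x \<in> space (\<mu> n) \<Longrightarrow> x' \<in> space (\<mu> n) \<Longrightarrow> u n x - u n x' \<le> 4 * K / \<epsilon>"
proof (induction "N - n" arbitrary: n x x' rule: less_induct)
  case less
  have K0: "0 \<le> K" using K[of 0 undefined undefined] by linarith
  show ?case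
  proof (cases "n < N")
    case False
    then show ?thesis using K0 eps_pos by (simp add: corrector_0)
  next
    case True
    have IH: "u (Suc (Suc n)) z - u (Suc (Suc n)) z' \<le> 4 * K / \<epsilon>"
      if "z \<in> space (\<mu> (Suc (Suc n)))" "z' \<in> space (\<mu> (Suc (Suc n)))" for z z'
      using less(1)[OF _ that] True by auto
    have "(\<integral>z. q n x z * u (Suc (Suc n)) z \<partial>\<mu> (Suc (Suc n))) - (\<integral>z. q n x' z * u (Suc (Suc n)) z \<partial>\<mu> (Suc (Suc n))) \<le> (1 - \<epsilon>) * (4 * K / \<epsilon>)"
      using less.prems IH bnd_corrector by (intro q_oscillation) auto
    moreover have "g n x - g n x' \<le> 4 * K"
      using abs_TPhi_le[OF K less.prems(1)] abs_TPhi_le[OF K less.prems(2)]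
        abs_TTPhi_le[OF K less.prems(1)] abs_TTPhi_le[OF K less.prems(2)] unfolding g_def by linarith
    ultimately have "u n x - u n x' \<le> 4 * K + (1 - \<epsilon>) * (4 * K / \<epsilon>)"
      by (simp add: corrector_two_step less.prems)
    also have "\<dots> = 4 * K / \<epsilon>" using eps_pos by (simp add: field_simps)
    finally show ?thesis .
  qed
qed

text \<open>The corrector has mean zero along the chain, so \<open>u n x\<close> is the mean of the
  differences \<open>u n x - u n (X n)\<close>, which the oscillation bounds.\<close>

lemma corrector_bound:
  assumes K: "\<And>n x y. \<bar>\<Phi> n x y\<bar> \<le> K" and x: "x \<in> space (\<mu> n)"
  shows "\<bar>u n x\<bar> \<le> 4 * K / \<epsilon>"
proof -
  have i: "integrable M (\<lambda>\<omega>. u n (X n \<omega>))" by (auto intro!: integrable_bnd bnd_corrector_compose)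
  have "u n x = (\<integral>\<omega>. u n x - u n (X n \<omega>) \<partial>M)" using i by (simp add: corrector_mean prob_space)
  also have "\<dots> \<le> (\<integral>\<omega>. 4 * K / \<epsilon> \<partial>M)"
    using i by (intro integral_mono corrector_oscillation[OF K x]) (auto simp: X_space)
  finally have 1: "u n x \<le> 4 * K / \<epsilon>" by (simp add: prob_space)
  have "- u n x = (\<integral>\<omega>. u n (X n \<omega>) - u n x \<partial>M)" using i by (simp add: corrector_mean prob_space)
  also have "\<dots> \<le> (\<integral>\<omega>. 4 * K / \<epsilon> \<partial>M)"
    using i by (intro integral_mono corrector_oscillation[OF K _ x]) (auto simp: X_space)
  finally show ?thesis using 1 by (simp add: prob_space)
qed

lemma energy_g: "(\<integral>\<omega>. (g n (X n \<omega>))\<^sup>2 \<partial>M) \<le> 2 * energy \<Phi> n + 2 * energy \<Phi> (Suc n)"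
proof -
  let ?a = "\<lambda>\<omega>. T n (\<Phi> n) (X n \<omega>) - m n" and ?b = "\<lambda>\<omega>. T n (\<lambda>_. T (Suc n) (\<Phi> (Suc n))) (X n \<omega>) - m (Suc n)"
  have bT: "bnd (\<lambda>(x, y). T (Suc n) (\<Phi> (Suc n)) y)" by (auto simp: case_prod_unfold intro!: bnd_TPhi)
  have mT: "(\<lambda>(x, y). T (Suc n) (\<Phi> (Suc n)) y) \<in> borel_measurable (\<mu> n \<Otimes>\<^sub>M \<mu> (Suc n))" by measurable
  have 1: "(\<integral>\<omega>. (?a \<omega>)\<^sup>2 \<partial>M) \<le> energy \<Phi> n"
  proof -
    have "(\<integral>\<omega>. (?a \<omega>)\<^sup>2 \<partial>M) \<le> (\<integral>\<omega>. (T n (\<Phi> n) (X n \<omega>))\<^sup>2 \<partial>M)"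
      using expectation_pair[OF functionalD[OF fnl], of n]
      by (intro centered_square_le) (auto simp: mean_def intro!: bnd_TPhi)
    also have "\<dots> \<le> energy \<Phi> n" unfolding energy_def by (rule expectation_T_square_le[OF functionalD[OF fnl]])
    finally show ?thesis .
  qed
  have 2: "(\<integral>\<omega>. (?b \<omega>)\<^sup>2 \<partial>M) \<le> energy \<Phi> (Suc n)"
  proof -
    have "(\<integral>\<omega>. (?b \<omega>)\<^sup>2 \<partial>M) \<le> (\<integral>\<omega>. (T n (\<lambda>_. T (Suc n) (\<Phi> (Suc n))) (X n \<omega>))\<^sup>2 \<partial>M)"
      using expectation_pair[OF mT bT] expectation_pair[OF functionalD[OF fnl], of "Suc n"]
      by (intro centered_square_le) (auto simp: mean_def intro!: bnd_TTPhi)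
    also have "\<dots> \<le> (\<integral>\<omega>. (T (Suc n) (\<Phi> (Suc n)) (X (Suc n) \<omega>))\<^sup>2 \<partial>M)"
      by (rule expectation_T_square_le[OF mT bT])
    also have "\<dots> \<le> energy \<Phi> (Suc n)" unfolding energy_def by (rule expectation_T_square_le[OF functionalD[OF fnl]])
    finally show ?thesis .
  qed
  have i: "integrable M (\<lambda>\<omega>. (?a \<omega>)\<^sup>2)" "integrable M (\<lambda>\<omega>. (?b \<omega>)\<^sup>2)" "integrable M (\<lambda>\<omega>. (?a \<omega> + ?b \<omega>)\<^sup>2)"
    by (auto intro!: integrable_bnd bnd_power bnd_diff bnd_add bnd_TPhi bnd_TTPhi)
  have "(\<integral>\<omega>. (g n (X n \<omega>))\<^sup>2 \<partial>M) \<le> (\<integral>\<omega>. 2 * (?a \<omega>)\<^sup>2 + 2 * (?b \<omega>)\<^sup>2 \<partial>M)"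
    unfolding g_def using i
  proof (intro integral_mono)
    show "(?a \<omega> + ?b \<omega>)\<^sup>2 \<le> 2 * (?a \<omega>)\<^sup>2 + 2 * (?b \<omega>)\<^sup>2" for \<omega>
      using sum_squares_bound[of "?a \<omega>" "?b \<omega>"] by (simp only: power2_sum)
  qed auto
  also have "\<dots> \<le> 2 * energy \<Phi> n + 2 * energy \<Phi> (Suc n)" using 1 2 i by simp
  finally show ?thesis .
qed

text \<open>The cross term is split with unequal weights: \<open>(a + b)\<^sup>2\<close> is at most
  \<open>(1 + 2 / \<epsilon>) * a\<^sup>2 + (1 + \<epsilon> / 2) * b\<^sup>2\<close>. The loss 1 +
  \<epsilon>/2 on the transported part is small enough that its product with the contraction factor
  1 - \<epsilon> stays below 1 - \<epsilon>/2.\<close>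

lemma corrector_energy_step:
  "(\<integral>\<omega>. (u n (X n \<omega>))\<^sup>2 \<partial>M) \<le> (1 + 2 / \<epsilon>) * (2 * energy \<Phi> n + 2 * energy \<Phi> (Suc n))
     + (1 - \<epsilon> / 2) * (\<integral>\<omega>. (u (Suc (Suc n)) (X (Suc (Suc n)) \<omega>))\<^sup>2 \<partial>M)"
proof -
  let ?Q = "\<lambda>\<omega>. \<integral>z. q n (X n \<omega>) z * u (Suc (Suc n)) z \<partial>\<mu> (Suc (Suc n))"
  let ?e = "\<integral>\<omega>. (u (Suc (Suc n)) (X (Suc (Suc n)) \<omega>))\<^sup>2 \<partial>M"
  have bQ: "bnd ?Q" by (rule mu.bnd_integral) (auto simp: case_prod_unfold intro!: bnd_mult bnd_corrector_compose)
  have i: "integrable M (\<lambda>\<omega>. (u n (X n \<omega>))\<^sup>2)" "integrable M (\<lambda>\<omega>. (g n (X n \<omega>))\<^sup>2)" "integrable M (\<lambda>\<omega>. (?Q \<omega>)\<^sup>2)"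
    unfolding g_def by (auto intro!: integrable_bnd bnd_power bnd_diff bnd_add bnd_TPhi bnd_TTPhi bnd_corrector_compose bQ)
  have "(\<integral>\<omega>. (u n (X n \<omega>))\<^sup>2 \<partial>M) \<le> (\<integral>\<omega>. (1 + 2 / \<epsilon>) * (g n (X n \<omega>))\<^sup>2 + (1 + \<epsilon> / 2) * (?Q \<omega>)\<^sup>2 \<partial>M)"
  proof (rule integral_mono)
    fix \<omega> assume w: "\<omega> \<in> space M"
    let ?a = "g n (X n \<omega>)" and ?b = "?Q \<omega>"
    have "0 \<le> (2 / \<epsilon>) * (?a - \<epsilon> / 2 * ?b)\<^sup>2" using eps_pos by simp
    also have "\<dots> = (1 + 2 / \<epsilon>) * ?a\<^sup>2 + (1 + \<epsilon> / 2) * ?b\<^sup>2 - (?a + ?b)\<^sup>2"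
    proof -
      have "(2 / \<epsilon>) * (a - \<epsilon> / 2 * b)\<^sup>2 = (1 + 2 / \<epsilon>) * a\<^sup>2 + (1 + \<epsilon> / 2) * b\<^sup>2 - (a + b)\<^sup>2" for a b
        using eps_pos by (simp add: power2_eq_square field_simps)
      then show ?thesis .
    qed
    finally show "(u n (X n \<omega>))\<^sup>2 \<le> (1 + 2 / \<epsilon>) * ?a\<^sup>2 + (1 + \<epsilon> / 2) * ?b\<^sup>2"
      unfolding corrector_two_step[OF X_space[OF w]] by linarith
  qed (use i in auto)
  also have "\<dots> = (1 + 2 / \<epsilon>) * (\<integral>\<omega>. (g n (X n \<omega>))\<^sup>2 \<partial>M) + (1 + \<epsilon> / 2) * (\<integral>\<omega>. (?Q \<omega>)\<^sup>2 \<partial>M)" using i by simp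
  also have "\<dots> \<le> (1 + 2 / \<epsilon>) * (2 * energy \<Phi> n + 2 * energy \<Phi> (Suc n)) + (1 + \<epsilon> / 2) * ((1 - \<epsilon>) * ?e)"
    using eps_pos bnd_corrector by (intro add_mono mult_left_mono energy_g q_contraction_L2) (auto simp: corrector_mean)
  also have "(1 + \<epsilon> / 2) * ((1 - \<epsilon>) * ?e) \<le> (1 - \<epsilon> / 2) * ?e"
  proof -
    have "(1 + \<epsilon> / 2) * (1 - \<epsilon>) \<le> 1 - \<epsilon> / 2" using eps_pos by (simp add: field_simps)
    moreover have "0 \<le> ?e" by simp
    ultimately show ?thesis by (metis mult.assoc mult_right_mono)
  qed
  finally show ?thesis by simp
qed

text \<open>Summed over \<open>n\<close>, the shifted sums on the right are dominated by the
  unshifted ones, since everything vanishes from \<open>N\<close> on. The term with factor 1 -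
  \<epsilon>/2 is then absorbed on the left, at the price 2/\<epsilon>.\<close>

lemma corrector_energy:
  "(\<Sum>n<N. \<integral>\<omega>. (u n (X n \<omega>))\<^sup>2 \<partial>M) \<le> 8 * (1 + 2 / \<epsilon>) / \<epsilon> * (\<Sum>n<N. energy \<Phi> n)"
proof -
  define e where "e n = (\<integral>\<omega>. (u n (X n \<omega>))\<^sup>2 \<partial>M)" for n
  have e0: "0 \<le> e n" for n unfolding e_def by simp
  have eN: "e n = 0" if "N \<le> n" for n unfolding e_def using that by (simp add: corrector_0)
  have f0: "0 \<le> energy \<Phi> n" for n unfolding energy_def by simp
  have fN: "energy \<Phi> n = 0" if "N \<le> n" for n unfolding energy_def using that zero by simp
  have shift: "(\<Sum>n<N. h (Suc n)) \<le> (\<Sum>n<N. h n)" if "\<And>n. 0 \<le> h n" "h N = 0" for h :: "nat \<Rightarrow> real"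
  proof -
    have "(\<Sum>n<N. h (Suc n)) + h 0 = (\<Sum>n<Suc N. h n)" by (subst sum.lessThan_Suc_shift) simp
    then show ?thesis using that(1)[of 0] that(2) by simp
  qed
  have s1: "(\<Sum>n<N. energy \<Phi> (Suc n)) \<le> (\<Sum>n<N. energy \<Phi> n)" by (rule shift) (auto simp: f0 fN)
  have s2: "(\<Sum>n<N. e (Suc (Suc n))) \<le> (\<Sum>n<N. e n)"
    using shift[of e] shift[of "\<lambda>n. e (Suc n)"] e0 eN by fastforce
  have "(\<Sum>n<N. e n) \<le> (\<Sum>n<N. (1 + 2 / \<epsilon>) * (2 * energy \<Phi> n + 2 * energy \<Phi> (Suc n)) + (1 - \<epsilon> / 2) * e (Suc (Suc n)))"
    unfolding e_def by (intro sum_mono corrector_energy_step)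
  also have "\<dots> = (1 + 2 / \<epsilon>) * (2 * (\<Sum>n<N. energy \<Phi> n) + 2 * (\<Sum>n<N. energy \<Phi> (Suc n))) + (1 - \<epsilon> / 2) * (\<Sum>n<N. e (Suc (Suc n)))"
    by (simp add: sum.distrib flip: sum_distrib_left)
  also have "\<dots> \<le> (1 + 2 / \<epsilon>) * (4 * (\<Sum>n<N. energy \<Phi> n)) + (1 - \<epsilon> / 2) * (\<Sum>n<N. e n)"
    using s1 s2 eps_pos eps_less_1 by (intro add_mono mult_left_mono) auto
  finally have "\<epsilon> / 2 * (\<Sum>n<N. e n) \<le> (1 + 2 / \<epsilon>) * (4 * (\<Sum>n<N. energy \<Phi> n))" by (simp add: algebra_simps)
  then have "(\<Sum>n<N. e n) \<le> (2 / \<epsilon>) * ((1 + 2 / \<epsilon>) * (4 * (\<Sum>n<N. energy \<Phi> n)))"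
    using eps_pos by (simp add: pos_le_divide_eq pos_divide_le_eq mult.commute mult.left_commute divide_simps)
  moreover have "(2 / \<epsilon>) * (c * (4 * s)) = 8 * c / \<epsilon> * s" for c s by simp
  ultimately show ?thesis unfolding e_def by metis
qed

end

section \<open>Martingale decomposition and the linear variance bound\<close>

declare Phi_measurable [measurable del (raw)] corrector_measurable [measurable del]
  corrector_measurable_compose [measurable del (raw)]

text \<open>Each difference \<open>D n\<close> integrates to 0 against any bounded function of the
  past, so all cross terms vanish. The term \<open>z (X 0)\<close> acts as an initial increment; it
  will be the corrector at time 0.\<close>

lemma martingale_orthogonal:
  fixes D :: "nat \<Rightarrow> 's \<Rightarrow> 's \<Rightarrow> real" and z :: "'s \<Rightarrow> real"
  assumes D: "functional D" and TD: "\<And>n x. x \<in> space (\<mu> n) \<Longrightarrow> T n (D n) x = 0"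
    and z: "z \<in> borel_measurable (\<mu> 0)" "bnd z"
  shows "(\<integral>\<omega>. (z (X 0 \<omega>) + (\<Sum>n<N. D n (X n \<omega>) (X (Suc n) \<omega>)))\<^sup>2 \<partial>M)
    = (\<integral>\<omega>. (z (X 0 \<omega>))\<^sup>2 \<partial>M) + (\<Sum>n<N. \<integral>\<omega>. (D n (X n \<omega>) (X (Suc n) \<omega>))\<^sup>2 \<partial>M)"
proof (induction N)
  case (Suc N)
  let ?D = "\<lambda>n \<omega>. D n (X n \<omega>) (X (Suc n) \<omega>)"
  let ?H = "\<lambda>\<omega>. z (X 0 \<omega>) + (\<Sum>n<N. ?D n \<omega>)"
  have HF: "?H \<in> borel_measurable (F N)"
    by (intro borel_measurable_add borel_measurable_sum measurable_compose[OF X_meas_F z(1)]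
        F_pair_measurable functionalD[OF D]) auto
  have [measurable]: "?H \<in> borel_measurable M" by (rule F_borel[OF HF])
  have [measurable]: "?D n \<in> borel_measurable M" for n by (rule functional_measurable[OF D]) auto
  have b: "bnd ?H" "bnd (?D N)" by (auto intro!: bnd_add bnd_sum functional_bnd[OF D] bnd_compose[OF z(2)])
  have "(\<integral>\<omega>. ?H \<omega> * ?D N \<omega> \<partial>M) = (\<integral>\<omega>. ?H \<omega> * T N (D N) (X N \<omega>) \<partial>M)"
    using markov_real[OF HF b(1) functionalD[OF D]] by simp
  also have "\<dots> = (\<integral>\<omega>. 0 \<partial>M)"
    by (intro Bochner_Integration.integral_cong refl) (simp add: TD X_space)
  finally have 0: "(\<integral>\<omega>. ?H \<omega> * ?D N \<omega> \<partial>M) = 0" by simp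
  have i: "integrable M (\<lambda>\<omega>. (?H \<omega>)\<^sup>2)" "integrable M (\<lambda>\<omega>. (?D N \<omega>)\<^sup>2)" "integrable M (\<lambda>\<omega>. ?H \<omega> * ?D N \<omega>)"
    using b by (auto intro!: integrable_bnd)
  have sq: "(a + (s + d))\<^sup>2 = (a + s)\<^sup>2 + 2 * ((a + s) * d) + d\<^sup>2" for a s d :: real by algebra
  have "(\<integral>\<omega>. (z (X 0 \<omega>) + (\<Sum>n<Suc N. ?D n \<omega>))\<^sup>2 \<partial>M) = (\<integral>\<omega>. (?H \<omega>)\<^sup>2 + 2 * (?H \<omega> * ?D N \<omega>) + (?D N \<omega>)\<^sup>2 \<partial>M)"
    by (intro Bochner_Integration.integral_cong refl) (simp only: sum.lessThan_Suc sq)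
  also have "\<dots> = (\<integral>\<omega>. (?H \<omega>)\<^sup>2 \<partial>M) + (\<integral>\<omega>. (?D N \<omega>)\<^sup>2 \<partial>M)"
    using i 0 by (simp del: integral_mult_right_zero)
  finally show ?case using Suc by simp
qed simp

definition mdiff :: "(nat \<Rightarrow> 's \<Rightarrow> 's \<Rightarrow> real) \<Rightarrow> nat \<Rightarrow> nat \<Rightarrow> 's \<Rightarrow> 's \<Rightarrow> real" where
  "mdiff \<Phi> N n x y = \<Phi> n x y - mean \<Phi> n + corrector \<Phi> N (Suc n) y - corrector \<Phi> N n x"

context
  fixes \<Phi> :: "nat \<Rightarrow> 's \<Rightarrow> 's \<Rightarrow> real" and N :: nat
  assumes fnl: "functional \<Phi>" and zero: "\<And>n x y. N \<le> n \<Longrightarrow> \<Phi> n x y = 0"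
begin

private abbreviation "v \<equiv> corrector \<Phi> N"

lemmas Phi_measurable' [measurable (raw)] = functional_measurable[OF fnl]
lemmas corrector_measurable' [measurable] = corrector_measurable[OF fnl zero]

lemma functional_mdiff: "functional (mdiff \<Phi> N)"
  unfolding functional_def mdiff_def[abs_def]
  by (auto simp: case_prod_unfold intro!: bnd_add bnd_diff functional_bnd[OF fnl] bnd_corrector_compose[OF fnl zero])

lemma T_mdiff: "x \<in> space (\<mu> n) \<Longrightarrow> T n (mdiff \<Phi> N n) x = 0"
proof -
  assume x [measurable]: "x \<in> space (\<mu> n)"
  have "T n (mdiff \<Phi> N n) x = T n (\<lambda>x' y. (\<Phi> n x' y + v (Suc n) y) + (- mean \<Phi> n - v n x)) x"
    unfolding T_def mdiff_def by (simp add: algebra_simps)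
  also have "\<dots> = T n (\<lambda>x' y. \<Phi> n x' y + v (Suc n) y) x + T n (\<lambda>_ _. - mean \<Phi> n - v n x) x"
    by (rule T_add) (auto simp: case_prod_unfold x intro!: bnd_add functional_bnd[OF fnl] bnd_corrector_compose[OF fnl zero])
  also have "\<dots> = 0" using corrector_eq[OF fnl zero, where n = n and x = x] x by (simp add: T_const)
  finally show ?thesis .
qed

lemma sum_mdiff: "(\<Sum>n<N. \<Phi> n (X n \<omega>) (X (Suc n) \<omega>)) - (\<Sum>n<N. mean \<Phi> n)
    = v 0 (X 0 \<omega>) + (\<Sum>n<N. mdiff \<Phi> N n (X n \<omega>) (X (Suc n) \<omega>))"
proof -
  have "(\<Sum>n<N. mdiff \<Phi> N n (X n \<omega>) (X (Suc n) \<omega>))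
    = (\<Sum>n<N. \<Phi> n (X n \<omega>) (X (Suc n) \<omega>)) - (\<Sum>n<N. mean \<Phi> n) + (\<Sum>n<N. v (Suc n) (X (Suc n) \<omega>) - v n (X n \<omega>))"
    unfolding mdiff_def by (simp add: sum.distrib sum_subtractf algebra_simps)
  also have "(\<Sum>n<N. v (Suc n) (X (Suc n) \<omega>) - v n (X n \<omega>)) = - v 0 (X 0 \<omega>)"
    using sum_lessThan_telescope[of "\<lambda>n. v n (X n \<omega>)" N]
    by (simp add: corrector_def)
  finally show ?thesis by simp
qed

lemma expectation_sum: "(\<integral>\<omega>. (\<Sum>n<N. \<Phi> n (X n \<omega>) (X (Suc n) \<omega>)) \<partial>M) = (\<Sum>n<N. mean \<Phi> n)"
  unfolding mean_def by (intro Bochner_Integration.integral_sum integrable_bnd functional_bnd[OF fnl]) auto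

lemma variance_sum:
  "variance (\<lambda>\<omega>. \<Sum>n<N. \<Phi> n (X n \<omega>) (X (Suc n) \<omega>))
    = (\<integral>\<omega>. (v 0 (X 0 \<omega>))\<^sup>2 \<partial>M) + (\<Sum>n<N. \<integral>\<omega>. (mdiff \<Phi> N n (X n \<omega>) (X (Suc n) \<omega>))\<^sup>2 \<partial>M)"
  unfolding expectation_sum sum_mdiff
  using functional_mdiff T_mdiff corrector_measurable[OF fnl zero] bnd_corrector[OF fnl zero]
  by (rule martingale_orthogonal)

lemma mdiff_energy:
  "(\<integral>\<omega>. (mdiff \<Phi> N n (X n \<omega>) (X (Suc n) \<omega>))\<^sup>2 \<partial>M)
   \<le> 3 * energy \<Phi> n + 3 * (\<integral>\<omega>. (v (Suc n) (X (Suc n) \<omega>))\<^sup>2 \<partial>M) + 3 * (\<integral>\<omega>. (v n (X n \<omega>))\<^sup>2 \<partial>M)"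
proof -
  let ?a = "\<lambda>\<omega>. \<Phi> n (X n \<omega>) (X (Suc n) \<omega>) - mean \<Phi> n" and ?b = "\<lambda>\<omega>. v (Suc n) (X (Suc n) \<omega>)" and ?c = "\<lambda>\<omega>. v n (X n \<omega>)"
  have b: "bnd ?a" "bnd ?b" "bnd ?c"
    by (auto intro!: bnd_diff functional_bnd[OF fnl] bnd_corrector_compose[OF fnl zero])
  have [measurable]: "?a \<in> borel_measurable M" "?b \<in> borel_measurable M" "?c \<in> borel_measurable M" by measurable
  have i: "integrable M (\<lambda>\<omega>. (?a \<omega>)\<^sup>2)" "integrable M (\<lambda>\<omega>. (?b \<omega>)\<^sup>2)" "integrable M (\<lambda>\<omega>. (?c \<omega>)\<^sup>2)"
    "integrable M (\<lambda>\<omega>. (?a \<omega> + ?b \<omega> - ?c \<omega>)\<^sup>2)"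
    by (intro integrable_bnd bnd_power bnd_add bnd_diff b; simp)+
  have "(\<integral>\<omega>. (mdiff \<Phi> N n (X n \<omega>) (X (Suc n) \<omega>))\<^sup>2 \<partial>M) \<le> (\<integral>\<omega>. 3 * (?a \<omega>)\<^sup>2 + 3 * (?b \<omega>)\<^sup>2 + 3 * (?c \<omega>)\<^sup>2 \<partial>M)"
    unfolding mdiff_def
  proof (intro integral_mono)
    have "(a + b - c)\<^sup>2 \<le> 3 * a\<^sup>2 + 3 * b\<^sup>2 + 3 * c\<^sup>2" for a b c :: real
    proof -
      have "0 \<le> (a - b)\<^sup>2 + (a + c)\<^sup>2 + (b + c)\<^sup>2" by simp
      then show ?thesis by (simp add: power2_eq_square algebra_simps)
    qed
    then show "(?a \<omega> + ?b \<omega> - ?c \<omega>)\<^sup>2 \<le> 3 * (?a \<omega>)\<^sup>2 + 3 * (?b \<omega>)\<^sup>2 + 3 * (?c \<omega>)\<^sup>2" for \<omega> .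
  qed (use i in auto)
  also have "\<dots> = 3 * (\<integral>\<omega>. (?a \<omega>)\<^sup>2 \<partial>M) + 3 * (\<integral>\<omega>. (?b \<omega>)\<^sup>2 \<partial>M) + 3 * (\<integral>\<omega>. (?c \<omega>)\<^sup>2 \<partial>M)" using i by simp
  also have "(\<integral>\<omega>. (?a \<omega>)\<^sup>2 \<partial>M) \<le> energy \<Phi> n"
    unfolding energy_def by (intro centered_square_le functional_bnd[OF fnl]) (auto simp: mean_def)
  finally show ?thesis by simp
qed

text \<open>This is where mixing pays off: the variance of the sum is at most a constant times the
  sum of the second moments, with no covariances left. The corrector at time 0 and three times the
  two corrector sums make at most 7 corrector energies, and 56 = 7 * 8 with the 8 of
  \<open>corrector_energy\<close>.\<close>

lemma variance_le:
  "variance (\<lambda>\<omega>. \<Sum>n<N. \<Phi> n (X n \<omega>) (X (Suc n) \<omega>))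
    \<le> (3 + 56 * (1 + 2 / \<epsilon>) / \<epsilon>) * (\<Sum>n<N. energy \<Phi> n)"
proof -
  define e where "e n = (\<integral>\<omega>. (v n (X n \<omega>))\<^sup>2 \<partial>M)" for n
  have e0: "0 \<le> e n" for n unfolding e_def by simp
  have eN: "e N = 0" unfolding e_def by (simp add: corrector_def)
  have sh: "(\<Sum>n<N. e (Suc n)) + e 0 = (\<Sum>n<N. e n)"
  proof -
    have "(\<Sum>n<N. e (Suc n)) + e 0 = (\<Sum>n<Suc N. e n)" by (subst sum.lessThan_Suc_shift) simp
    then show ?thesis using eN by simp
  qed
  have "e 0 \<le> (\<Sum>n<N. e n)" using sh sum_nonneg[of "{..<N}" "\<lambda>n. e (Suc n)"] e0 by simp
  have "variance (\<lambda>\<omega>. \<Sum>n<N. \<Phi> n (X n \<omega>) (X (Suc n) \<omega>))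
      \<le> e 0 + (\<Sum>n<N. 3 * energy \<Phi> n + 3 * e (Suc n) + 3 * e n)"
    unfolding variance_sum e_def by (intro add_mono sum_mono mdiff_energy order_refl)
  also have "\<dots> = e 0 + 3 * (\<Sum>n<N. energy \<Phi> n) + 3 * (\<Sum>n<N. e (Suc n)) + 3 * (\<Sum>n<N. e n)"
    by (simp add: sum.distrib sum_distrib_left)
  also have "\<dots> \<le> 3 * (\<Sum>n<N. energy \<Phi> n) + 7 * (\<Sum>n<N. e n)"
    using sh \<open>e 0 \<le> _\<close> e0[of 0] by linarith
  also have "\<dots> \<le> 3 * (\<Sum>n<N. energy \<Phi> n) + 7 * (8 * (1 + 2 / \<epsilon>) / \<epsilon> * (\<Sum>n<N. energy \<Phi> n))"
    unfolding e_def by (intro add_left_mono mult_left_mono corrector_energy[OF fnl zero]) auto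
  finally show ?thesis by (simp add: algebra_simps)
qed

end

declare Phi_measurable' [measurable del (raw)] corrector_measurable' [measurable del]

end

section \<open>The central limit theorem\<close>

lemma bnd_divide: "bnd f \<Longrightarrow> bnd (\<lambda>x. f x / c)" for c :: "'b::real_normed_field"
  unfolding divide_inverse by (intro bnd_mult bnd_const)

lemmas bnd_intros = bnd_add bnd_diff bnd_minus bnd_mult bnd_scaleR bnd_power bnd_of_real bnd_divide bnd_iexp bnd_cos bnd_const bnd_abs

lemma exp_minus_approx:
  fixes y :: real
  assumes "0 \<le> y"
  shows "\<bar>exp (- y) - 1 + y\<bar> \<le> y\<^sup>2 / 2"
proof -
  have "1 + - y \<le> exp (- y)" by (rule exp_ge_add_one_self)
  moreover have "exp (- y) \<le> 1 - y + y\<^sup>2 / 2"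
  proof -
    have "1 + y + y\<^sup>2 / 2 \<le> exp y" using assms by (rule exp_lower_Taylor_quadratic)
    moreover have pos: "0 < 1 + y + y\<^sup>2 / 2" using assms by (simp add: add_pos_nonneg)
    ultimately have "exp (- y) \<le> 1 / (1 + y + y\<^sup>2 / 2)"
      by (simp add: exp_minus inverse_eq_divide frac_le)
    also have "\<dots> \<le> 1 - y + y\<^sup>2 / 2"
    proof -
      have "(1 - y + y\<^sup>2 / 2) * (1 + y + y\<^sup>2 / 2) = 1 + (y\<^sup>2)\<^sup>2 / 4"
        by (simp add: power2_eq_square algebra_simps)
      then have "1 \<le> (1 - y + y\<^sup>2 / 2) * (1 + y + y\<^sup>2 / 2)" by simp
      then show ?thesis using pos by (simp add: pos_divide_le_eq)
    qed
    finally show ?thesis .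
  qed
  ultimately show ?thesis by simp
qed

lemma iexp_diff_le: "norm (iexp x - iexp y) \<le> \<bar>x - y\<bar>"
proof -
  have "iexp x - iexp y = iexp y * (iexp (x - y) - 1)" by (simp add: algebra_simps flip: exp_add)
  then have "norm (iexp x - iexp y) = norm (iexp (x - y) - 1)" by (simp add: norm_mult)
  also have "\<dots> \<le> \<bar>x - y\<bar>" using iexp_approx1[of "x - y" 0] by simp
  finally show ?thesis .
qed

lemma iexp_approx_quadratic: "norm (iexp x - (1 + \<i> * x - x\<^sup>2 / 2)) \<le> \<bar>x\<bar> ^ 3 / 6"
proof -
  have "(\<Sum>k\<le>2. (\<i> * complex_of_real x) ^ k / fact k) = 1 + \<i> * x - x\<^sup>2 / 2"
    by (simp add: numeral_2_eq_2 complex_eq_iff)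
  then show ?thesis using iexp_approx1[of x 2] by (simp add: eval_nat_numeral)
qed

context elliptic_chain begin

context
  fixes \<Phi> :: "nat \<Rightarrow> 's \<Rightarrow> 's \<Rightarrow> real" and N :: nat and K :: real
  assumes fnl: "functional \<Phi>" and zero: "\<And>n x y. N \<le> n \<Longrightarrow> \<Phi> n x y = 0"
    and K: "\<And>n x y. \<bar>\<Phi> n x y\<bar> \<le> K"
begin

lemma abs_mdiff_le:
  assumes "x \<in> space (\<mu> n)" "y \<in> space (\<mu> (Suc n))"
  shows "\<bar>mdiff \<Phi> N n x y\<bar> \<le> 2 * K + 8 * K / \<epsilon>"
proof -
  have K0: "0 \<le> K" using K[of 0 undefined undefined] by linarith
  have "\<bar>mean \<Phi> n\<bar> \<le> K"
    unfolding mean_def using norm_integral_le[of "\<lambda>\<omega>. \<Phi> n (X n \<omega>) (X (Suc n) \<omega>)" K] K K0 by simp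
  moreover have "\<bar>corrector \<Phi> N n x\<bar> \<le> 4 * K / \<epsilon>" "\<bar>corrector \<Phi> N (Suc n) y\<bar> \<le> 4 * K / \<epsilon>"
    using corrector_bound[OF fnl zero K] assms by auto
  ultimately show ?thesis using K[of n x y] unfolding mdiff_def by linarith
qed

text \<open>The Gaussian factor is exchanged for the characteristic function one time step at a
  time. In a single exchange the linear term vanishes by the martingale property and Taylor
  remainders are harmless, but \<open>D n\<close> squared minus its mean \<open>s n\<close> survives
  at order \<open>lam\<^sup>2\<close>, as conditional variances are not constant. A second corrector
  \<open>U\<close>, for the weighted squares, rewrites this term as \<open>c n - d n\<close>; since
  \<open>d n\<close> is close to \<open>c (Suc n)\<close>, these sum up to one further order of
  \<open>lam\<close>.\<close>

lemma martingale_char_approx: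
  fixes lam :: real
  defines "B \<equiv> 2 * K + 8 * K / \<epsilon>"
  defines "\<sigma> \<equiv> (\<Sum>n<N. \<integral>\<omega>. (mdiff \<Phi> N n (X n \<omega>) (X (Suc n) \<omega>))\<^sup>2 \<partial>M)"
  shows "norm ((\<integral>\<omega>. iexp (lam * (\<Sum>n<N. mdiff \<Phi> N n (X n \<omega>) (X (Suc n) \<omega>))) \<partial>M) - exp (- (lam\<^sup>2 * \<sigma> / 2)))
    \<le> (\<bar>lam\<bar> ^ 3 * (B / 6 + (1 + 8 * (1 + 2 / \<epsilon>) / \<epsilon> * B\<^sup>2) / 4) + lam ^ 4 * B\<^sup>2 / 8) * \<sigma>"
proof -
  have fD: "functional (mdiff \<Phi> N)" by (rule functional_mdiff[OF fnl zero])
  have K0: "0 \<le> K" using K[of 0 undefined undefined] by linarith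
  then have B0: "0 \<le> B" unfolding B_def using eps_pos by simp
  define D where "D n \<omega> = mdiff \<Phi> N n (X n \<omega>) (X (Suc n) \<omega>)" for n \<omega>
  have D_meas [measurable]: "D n \<in> borel_measurable M" for n
    unfolding D_def[abs_def] by (rule functional_measurable[OF fD]) auto
  have bD: "bnd (D n)" for n unfolding D_def[abs_def] by (rule functional_bnd[OF fD])
  have D_le: "\<bar>D n \<omega>\<bar> \<le> B" if "\<omega> \<in> space M" for n \<omega>
    unfolding D_def B_def using that by (intro abs_mdiff_le X_space)
  define s where "s n = (\<integral>\<omega>. (D n \<omega>)\<^sup>2 \<partial>M)" for n
  have iD2: "integrable M (\<lambda>\<omega>. (D n \<omega>)\<^sup>2)" for n by (intro integrable_bnd bnd_power bD) auto
  have s0: "0 \<le> s n" for n unfolding s_def by simp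
  have D2_le: "(D n \<omega>)\<^sup>2 \<le> B\<^sup>2" if "\<omega> \<in> space M" for n \<omega>
    using power_mono[OF D_le[OF that, of n], of 2] by simp
  have sB: "s n \<le> B\<^sup>2" for n
  proof -
    have "s n \<le> (\<integral>\<omega>. B\<^sup>2 \<partial>M)" unfolding s_def by (intro integral_mono iD2 D2_le) auto
    then show ?thesis by (simp add: prob_space)
  qed
  define \<tau> where "\<tau> n = (\<Sum>j\<in>{n..<N}. s j)" for n
  have \<tau>0: "0 \<le> \<tau> n" for n unfolding \<tau>_def by (intro sum_nonneg s0)
  have \<tau>_Suc: "\<tau> n = s n + \<tau> (Suc n)" if "n < N" for n
    unfolding \<tau>_def using that by (simp add: sum.atLeast_Suc_lessThan)
  have \<sigma>: "\<sigma> = \<tau> 0" unfolding \<sigma>_def \<tau>_def s_def D_def by (simp add: atLeast0LessThan)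
  define w where "w n = exp (- (lam\<^sup>2 * \<tau> (Suc n) / 2))" for n
  have w0: "0 < w n" "w n \<le> 1" for n unfolding w_def using \<tau>0 by auto
  define H where "H n \<omega> = iexp (lam * (\<Sum>j<n. D j \<omega>))" for n \<omega>
  have HF: "H n \<in> borel_measurable (F n)" for n
  proof -
    have "(\<lambda>\<omega>. \<Sum>j<n. D j \<omega>) \<in> borel_measurable (F n)"
      unfolding D_def by (intro borel_measurable_sum F_pair_measurable functionalD[OF fD]) auto
    then show ?thesis unfolding H_def[abs_def] by measurable
  qed
  have H_meas [measurable]: "H n \<in> borel_measurable M" for n by (rule F_borel[OF HF])
  have bH: "bnd (H n)" for n unfolding H_def[abs_def] by (rule bnd_iexp)
  have nH: "norm (H n \<omega>) = 1" for n \<omega> unfolding H_def by (rule norm_exp_i_times)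
  have HS: "H (Suc n) \<omega> = H n \<omega> * iexp (lam * D n \<omega>)" for n \<omega>
    unfolding H_def by (simp add: algebra_simps flip: exp_add)

  \<comment> \<open>The Gaussian weight \<open>w n\<close>, belonging to the variance still to come
    after step \<open>n\<close>, is put into the function before the Poisson equation is solved. The
    weighted second-order terms then telescope directly, without summation by parts.\<close>
  define \<Psi> where "\<Psi> n x y = (if n < N then w n * (mdiff \<Phi> N n x y)\<^sup>2 else 0)" for n x y
  have m\<Psi>: "(\<lambda>(x, y). \<Psi> n x y) \<in> borel_measurable (\<mu> n \<Otimes>\<^sub>M \<mu> (Suc n))" for n
    unfolding \<Psi>_def using functionalD(1)[OF fD] by measurable
  have b\<Psi>: "bnd (\<lambda>(x, y). \<Psi> n x y)" for n
    unfolding \<Psi>_def case_prod_unfold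
    by (cases "n < N") (auto intro!: bnd_mult bnd_power functional_bnd[OF fD])
  have f\<Psi>: "functional \<Psi>" unfolding functional_def using m\<Psi> b\<Psi> by auto
  have z\<Psi>: "\<Psi> n x y = 0" if "N \<le> n" for n x y using that unfolding \<Psi>_def by simp
  define U where "U = corrector \<Psi> N"
  have U_meas [measurable]: "U n \<in> borel_measurable (\<mu> n)" for n
    unfolding U_def by (rule corrector_measurable[OF f\<Psi>]) (rule z\<Psi>)
  have bU: "bnd (\<lambda>\<omega>. U n (g \<omega>))" for n and g :: "'c \<Rightarrow> 's"
    unfolding U_def by (rule bnd_corrector_compose[OF f\<Psi>]) (rule z\<Psi>)
  have U_eq: "T n (\<lambda>x y. \<Psi> n x y + U (Suc n) y) x = U n x + mean \<Psi> n" for n x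
    unfolding U_def by (rule corrector_eq[OF f\<Psi>]) (rule z\<Psi>)
  have U_mean: "(\<integral>\<omega>. U n (X n \<omega>) \<partial>M) = 0" for n
    unfolding U_def by (rule corrector_mean[OF f\<Psi>]) (rule z\<Psi>)
  have U_en: "(\<Sum>n<N. \<integral>\<omega>. (U n (X n \<omega>))\<^sup>2 \<partial>M) \<le> 8 * (1 + 2 / \<epsilon>) / \<epsilon> * (\<Sum>n<N. energy \<Psi> n)"
    unfolding U_def by (rule corrector_energy[OF f\<Psi>]) (rule z\<Psi>)
  have mean\<Psi>: "mean \<Psi> n = w n * s n" if "n < N" for n
    unfolding mean_def \<Psi>_def s_def D_def using that by simp
  have U_energy: "(\<Sum>n<N. \<integral>\<omega>. (U n (X n \<omega>))\<^sup>2 \<partial>M) \<le> 8 * (1 + 2 / \<epsilon>) / \<epsilon> * (B\<^sup>2 * \<sigma>)"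
  proof -
    have "energy \<Psi> n \<le> B\<^sup>2 * s n" if "n < N" for n
    proof -
      have "energy \<Psi> n = (\<integral>\<omega>. (w n)\<^sup>2 * ((D n \<omega>)\<^sup>2)\<^sup>2 \<partial>M)"
        unfolding energy_def \<Psi>_def D_def using that by (simp add: power_mult_distrib)
      also have "\<dots> \<le> (\<integral>\<omega>. B\<^sup>2 * (D n \<omega>)\<^sup>2 \<partial>M)"
      proof (rule integral_mono)
        fix \<omega> assume "\<omega> \<in> space M"
        have "(w n)\<^sup>2 * ((D n \<omega>)\<^sup>2)\<^sup>2 \<le> 1 * ((D n \<omega>)\<^sup>2)\<^sup>2"
          using w0[of n] by (intro mult_right_mono) (auto simp: power_le_one)
        also have "\<dots> \<le> B\<^sup>2 * (D n \<omega>)\<^sup>2"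
          using mult_right_mono[OF D2_le[OF \<open>\<omega> \<in> space M\<close>, of n] zero_le_power2[of "D n \<omega>"]]
          by (simp only: power2_eq_square[of "(D n \<omega>)\<^sup>2"] mult_1)
        finally show "(w n)\<^sup>2 * ((D n \<omega>)\<^sup>2)\<^sup>2 \<le> B\<^sup>2 * (D n \<omega>)\<^sup>2" .
      qed (auto intro!: integrable_bnd bnd_mult bnd_power bD)
      also have "\<dots> = B\<^sup>2 * s n" unfolding s_def using iD2 by simp
      finally show ?thesis .
    qed
    then have "(\<Sum>n<N. energy \<Psi> n) \<le> B\<^sup>2 * \<sigma>"
      unfolding \<sigma> \<tau>_def sum_distrib_left atLeast0LessThan by (intro sum_mono) auto
    moreover have "0 \<le> 8 * (1 + 2 / \<epsilon>) / \<epsilon>" using eps_pos by simp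
    ultimately show ?thesis
      using U_en by (meson mult_left_mono order_trans)
  qed

  define c where "c n = (\<integral>\<omega>. H n \<omega> * U n (X n \<omega>) \<partial>M)" for n
  define d where "d n = (\<integral>\<omega>. H n \<omega> * U (Suc n) (X (Suc n) \<omega>) \<partial>M)" for n
  have c0: "c 0 = 0"
  proof -
    have "c 0 = complex_of_real (\<integral>\<omega>. U 0 (X 0 \<omega>) \<partial>M)" unfolding c_def H_def by simp
    then show ?thesis using U_mean[of 0] by simp
  qed
  have cN: "c N = 0" unfolding c_def U_def by (simp add: corrector_def)
  \<comment> \<open>The Markov property at time \<open>n\<close> replaces
    \<open>\<Psi> n + U (Suc n)\<close> by \<open>U n + mean \<Psi> n\<close> under the expectation
    against \<open>H n\<close>.\<close>
  have main: "w n * (\<integral>\<omega>. H n \<omega> * ((D n \<omega>)\<^sup>2 - s n) \<partial>M) = c n - d n" if n: "n < N" for n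
  proof -
    have m: "(\<lambda>(x, y). complex_of_real (\<Psi> n x y + U (Suc n) y)) \<in> borel_measurable (\<mu> n \<Otimes>\<^sub>M \<mu> (Suc n))"
      using m\<Psi> by measurable
    have b: "bnd (\<lambda>(x, y). complex_of_real (\<Psi> n x y + U (Suc n) y))"
      using b\<Psi>[of n] by (auto simp: case_prod_unfold intro!: bnd_of_real bnd_add bU)
    have T: "T n (\<lambda>x y. complex_of_real (\<Psi> n x y + U (Suc n) y)) x = U n x + mean \<Psi> n" for x
    proof -
      have "T n (\<lambda>x y. complex_of_real (\<Psi> n x y + U (Suc n) y)) x = complex_of_real (T n (\<lambda>x y. \<Psi> n x y + U (Suc n) y) x)"
        unfolding T_def by (simp add: scaleR_conv_of_real flip: integral_complex_of_real)
      then show ?thesis using U_eq by simp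
    qed
    have i: "integrable M (\<lambda>\<omega>. H n \<omega> * (w n * (D n \<omega>)\<^sup>2))" "integrable M (\<lambda>\<omega>. H n \<omega> * U (Suc n) (X (Suc n) \<omega>))"
      "integrable M (\<lambda>\<omega>. H n \<omega> * U n (X n \<omega>))" "integrable M (\<lambda>\<omega>. H n \<omega> * mean \<Psi> n)" "integrable M (H n)"
      by (auto intro!: integrable_bnd bnd_mult bH bnd_of_real bU bnd_power bD)
    have "(\<integral>\<omega>. H n \<omega> * (w n * (D n \<omega>)\<^sup>2) \<partial>M) + d n = (\<integral>\<omega>. H n \<omega> * (\<Psi> n (X n \<omega>) (X (Suc n) \<omega>) + U (Suc n) (X (Suc n) \<omega>)) \<partial>M)"
      unfolding d_def using i(1,2) n by (simp add: distrib_left \<Psi>_def D_def)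
    also have "\<dots> = (\<integral>\<omega>. H n \<omega> * (U n (X n \<omega>) + mean \<Psi> n) \<partial>M)"
      unfolding markov_complex[OF HF bH m b] T ..
    also have "\<dots> = c n + (\<integral>\<omega>. H n \<omega> * mean \<Psi> n \<partial>M)"
      unfolding c_def using i(3,4) by (simp add: distrib_left)
    finally have e: "(\<integral>\<omega>. H n \<omega> * (w n * (D n \<omega>)\<^sup>2) \<partial>M) + d n = c n + (\<integral>\<omega>. H n \<omega> * mean \<Psi> n \<partial>M)" .
    have "w n * (\<integral>\<omega>. H n \<omega> * ((D n \<omega>)\<^sup>2 - s n) \<partial>M) = (\<integral>\<omega>. w n * (H n \<omega> * ((D n \<omega>)\<^sup>2 - s n)) \<partial>M)" by simp
    also have "\<dots> = (\<integral>\<omega>. H n \<omega> * (w n * (D n \<omega>)\<^sup>2) - H n \<omega> * mean \<Psi> n \<partial>M)"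
      using n by (intro Bochner_Integration.integral_cong refl) (simp add: mean\<Psi> algebra_simps)
    also have "\<dots> = (\<integral>\<omega>. H n \<omega> * (w n * (D n \<omega>)\<^sup>2) \<partial>M) - (\<integral>\<omega>. H n \<omega> * mean \<Psi> n \<partial>M)"
      using i(1,4) by (rule Bochner_Integration.integral_diff)
    finally have lhs: "w n * (\<integral>\<omega>. H n \<omega> * ((D n \<omega>)\<^sup>2 - s n) \<partial>M) = (\<integral>\<omega>. H n \<omega> * (w n * (D n \<omega>)\<^sup>2) \<partial>M) - (\<integral>\<omega>. H n \<omega> * mean \<Psi> n \<partial>M)" .
    have "A - B = c n - d n" if "A + d n = c n + B" for A B using that by (simp add: algebra_simps)
    from this[OF e] show ?thesis unfolding lhs .
  qed
  have cd: "norm (c (Suc n) - d n) \<le> \<bar>lam\<bar> / 2 * (s n + (\<integral>\<omega>. (U (Suc n) (X (Suc n) \<omega>))\<^sup>2 \<partial>M))" for n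
  proof -
    have i: "integrable M (\<lambda>\<omega>. H (Suc n) \<omega> * U (Suc n) (X (Suc n) \<omega>))" "integrable M (\<lambda>\<omega>. H n \<omega> * U (Suc n) (X (Suc n) \<omega>))"
      "integrable M (\<lambda>\<omega>. (U (Suc n) (X (Suc n) \<omega>))\<^sup>2)"
      by (auto intro!: integrable_bnd bnd_mult bH bnd_of_real bU bnd_power)
    have "norm (c (Suc n) - d n) = norm (\<integral>\<omega>. H (Suc n) \<omega> * U (Suc n) (X (Suc n) \<omega>) - H n \<omega> * U (Suc n) (X (Suc n) \<omega>) \<partial>M)"
      unfolding c_def d_def using i by simp
    also have "\<dots> \<le> (\<integral>\<omega>. norm (H (Suc n) \<omega> * U (Suc n) (X (Suc n) \<omega>) - H n \<omega> * U (Suc n) (X (Suc n) \<omega>)) \<partial>M)"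
      by (rule integral_norm_bound)
    also have "\<dots> \<le> (\<integral>\<omega>. \<bar>lam\<bar> / 2 * ((D n \<omega>)\<^sup>2 + (U (Suc n) (X (Suc n) \<omega>))\<^sup>2) \<partial>M)"
    proof (rule integral_mono)
      fix \<omega>
      let ?u = "U (Suc n) (X (Suc n) \<omega>)"
      have "norm (H (Suc n) \<omega> - H n \<omega>) \<le> \<bar>lam * D n \<omega>\<bar>"
        using iexp_diff_le[of "lam * (\<Sum>j<Suc n. D j \<omega>)" "lam * (\<Sum>j<n. D j \<omega>)"] unfolding H_def
        by (simp add: algebra_simps)
      then have "norm ((H (Suc n) \<omega> - H n \<omega>) * ?u) \<le> \<bar>lam\<bar> * \<bar>D n \<omega>\<bar> * \<bar>?u\<bar>"
        by (simp add: norm_mult abs_mult mult_right_mono)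
      also have "\<dots> \<le> \<bar>lam\<bar> * (((D n \<omega>)\<^sup>2 + ?u\<^sup>2) / 2)"
        using sum_squares_bound[of "\<bar>D n \<omega>\<bar>" "\<bar>?u\<bar>"] by (simp add: mult.assoc mult_left_mono)
      finally show "norm (H (Suc n) \<omega> * ?u - H n \<omega> * ?u) \<le> \<bar>lam\<bar> / 2 * ((D n \<omega>)\<^sup>2 + ?u\<^sup>2)"
        by (simp add: left_diff_distrib)
    qed (use i iD2 in auto)
    also have "\<dots> = \<bar>lam\<bar> / 2 * (s n + (\<integral>\<omega>. (U (Suc n) (X (Suc n) \<omega>))\<^sup>2 \<partial>M))"
      unfolding s_def using i iD2 by simp
    finally show ?thesis .
  qed
  have cd_sum: "norm (\<Sum>n<N. c n - d n) \<le> \<bar>lam\<bar> / 2 * ((1 + 8 * (1 + 2 / \<epsilon>) / \<epsilon> * B\<^sup>2) * \<sigma>)"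
  proof -
    define e where "e n = (\<integral>\<omega>. (U n (X n \<omega>))\<^sup>2 \<partial>M)" for n
    have "e N = 0" unfolding e_def U_def by (simp add: corrector_def)
    moreover have "(\<Sum>n<N. e (Suc n)) + e 0 = (\<Sum>n<Suc N. e n)" by (subst sum.lessThan_Suc_shift) simp
    moreover have "0 \<le> e 0" unfolding e_def by simp
    ultimately have e: "(\<Sum>n<N. e (Suc n)) \<le> (\<Sum>n<N. e n)" by simp
    \<comment> \<open>The telescoping part is \<open>c N - c 0 = 0\<close>: \<open>U\<close>
      vanishes at time \<open>N\<close>, and at time 0 \<open>H\<close> is 1 while \<open>U\<close>
      has mean 0.\<close>
    have "(\<Sum>n<N. c n - d n) = (\<Sum>n<N. c (Suc n) - d n) - (\<Sum>n<N. c (Suc n) - c n)"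
      by (simp flip: sum_subtractf)
    also have "\<dots> = (\<Sum>n<N. c (Suc n) - d n)" using c0 cN by (simp add: sum_lessThan_telescope)
    also have "norm \<dots> \<le> (\<Sum>n<N. \<bar>lam\<bar> / 2 * (s n + e (Suc n)))"
      unfolding e_def by (intro sum_norm_le cd)
    also have "\<dots> = \<bar>lam\<bar> / 2 * (\<sigma> + (\<Sum>n<N. e (Suc n)))"
      unfolding sum_distrib_left[symmetric] sum.distrib \<sigma> \<tau>_def atLeast0LessThan ..
    also have "\<dots> \<le> \<bar>lam\<bar> / 2 * (\<sigma> + 8 * (1 + 2 / \<epsilon>) / \<epsilon> * (B\<^sup>2 * \<sigma>))"
      using e U_energy unfolding e_def by (intro mult_left_mono add_left_mono) auto
    finally show ?thesis by (simp add: algebra_simps)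
  qed

  \<comment> \<open>\<open>a\<close> interpolates: up to time \<open>n\<close> the true
    characteristic function, afterwards the Gaussian factor of the remaining variance
    \<open>\<tau> n\<close>. Thus \<open>a 0\<close> is the Gaussian value and \<open>a N\<close>
    the characteristic function.\<close>
  define a where "a n = (\<integral>\<omega>. H n \<omega> \<partial>M) * exp (- (lam\<^sup>2 * \<tau> n / 2))" for n
  have step: "norm (a (Suc n) - a n + lam\<^sup>2 / 2 * (c n - d n)) \<le> (\<bar>lam\<bar> ^ 3 * B / 6 + lam ^ 4 * B\<^sup>2 / 8) * s n"
    if n: "n < N" for n
  proof -
    define y where "y = lam\<^sup>2 * s n / 2"
    have y0: "0 \<le> y" unfolding y_def using s0 by simp
    have an: "a n = w n * (exp (- y) * (\<integral>\<omega>. H n \<omega> \<partial>M))"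
    proof -
      have "exp (- (lam\<^sup>2 * \<tau> n / 2)) = w n * exp (- y)"
        unfolding w_def y_def \<tau>_Suc[OF n] by (simp add: algebra_simps add_divide_distrib flip: exp_add)
      then show ?thesis unfolding a_def by simp
    qed
    define R where "R \<omega> = iexp (lam * D n \<omega>) - (1 + \<i> * (lam * D n \<omega>) - (lam * D n \<omega>)\<^sup>2 / 2)" for \<omega>
    have R_meas [measurable]: "R \<in> borel_measurable M" unfolding R_def[abs_def] by measurable
    have bR: "bnd R" unfolding R_def[abs_def]
      by (intro bnd_intros bD)
    have i: "integrable M (H n)" "integrable M (\<lambda>\<omega>. H n \<omega> * D n \<omega>)" "integrable M (\<lambda>\<omega>. H n \<omega> * ((D n \<omega>)\<^sup>2 - s n))"
      "integrable M (\<lambda>\<omega>. H n \<omega> * R \<omega>)"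
      by (auto intro!: integrable_bnd bnd_mult bH bnd_of_real bnd_diff bnd_power bD bR)
    have HD: "(\<integral>\<omega>. H n \<omega> * D n \<omega> \<partial>M) = 0"
    proof -
      have m: "(\<lambda>(x, y). complex_of_real (mdiff \<Phi> N n x y)) \<in> borel_measurable (\<mu> n \<Otimes>\<^sub>M \<mu> (Suc n))"
        using functionalD(1)[OF fD] by measurable
      have b: "bnd (\<lambda>(x, y). complex_of_real (mdiff \<Phi> N n x y))"
        by (auto simp: case_prod_unfold intro!: bnd_of_real functional_bnd[OF fD])
      have T: "T n (\<lambda>x y. complex_of_real (mdiff \<Phi> N n x y)) x = 0" if "x \<in> space (\<mu> n)" for x
      proof -
        have "T n (mdiff \<Phi> N n) x = 0" by (rule T_mdiff[OF fnl _ that]) (rule zero)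
        moreover have "p n x y *\<^sub>R complex_of_real r = complex_of_real (p n x y *\<^sub>R r)" for y r
          by (simp add: scaleR_conv_of_real)
        ultimately show ?thesis unfolding T_def by (simp only: integral_complex_of_real of_real_0)
      qed
      have "(\<integral>\<omega>. H n \<omega> * D n \<omega> \<partial>M) = (\<integral>\<omega>. H n \<omega> * T n (\<lambda>x y. complex_of_real (mdiff \<Phi> N n x y)) (X n \<omega>) \<partial>M)"
        unfolding D_def by (rule markov_complex[OF HF bH m b])
      also have "\<dots> = (\<integral>\<omega>. 0 \<partial>M)" by (intro Bochner_Integration.integral_cong refl) (simp add: T X_space)
      finally show ?thesis by simp
    qed
    have "(\<integral>\<omega>. H (Suc n) \<omega> \<partial>M) = (\<integral>\<omega>. H n \<omega> * R \<omega> + \<i> * lam * (H n \<omega> * D n \<omega>) - lam\<^sup>2 / 2 * (H n \<omega> * ((D n \<omega>)\<^sup>2 - s n)) + (1 - y) * H n \<omega> \<partial>M)"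
      unfolding HS R_def y_def by (intro Bochner_Integration.integral_cong refl) (simp add: power_mult_distrib field_simps)
    also have "\<dots> = (\<integral>\<omega>. H n \<omega> * R \<omega> \<partial>M) - lam\<^sup>2 / 2 * (\<integral>\<omega>. H n \<omega> * ((D n \<omega>)\<^sup>2 - s n) \<partial>M) + (1 - y) * (\<integral>\<omega>. H n \<omega> \<partial>M)"
      using i HD by simp
    finally have EH: "(\<integral>\<omega>. H (Suc n) \<omega> \<partial>M) = (\<integral>\<omega>. H n \<omega> * R \<omega> \<partial>M) - lam\<^sup>2 / 2 * (\<integral>\<omega>. H n \<omega> * ((D n \<omega>)\<^sup>2 - s n) \<partial>M) + (1 - y) * (\<integral>\<omega>. H n \<omega> \<partial>M)" .
    have aS: "a (Suc n) = w n * (\<integral>\<omega>. H (Suc n) \<omega> \<partial>M)" unfolding a_def w_def by simp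
    have "a (Suc n) - a n + lam\<^sup>2 / 2 * (c n - d n)
       = w n * (\<integral>\<omega>. H n \<omega> * R \<omega> \<partial>M) - w n * ((exp (- y) - 1 + y) * (\<integral>\<omega>. H n \<omega> \<partial>M))"
      unfolding an aS EH main[OF n, symmetric] by (simp add: algebra_simps)
    also have "norm \<dots> \<le> norm (w n * (\<integral>\<omega>. H n \<omega> * R \<omega> \<partial>M)) + norm (w n * ((exp (- y) - 1 + y) * (\<integral>\<omega>. H n \<omega> \<partial>M)))"
      by (rule norm_triangle_ineq4)
    also have "norm (w n * (\<integral>\<omega>. H n \<omega> * R \<omega> \<partial>M)) \<le> \<bar>lam\<bar> ^ 3 * B / 6 * s n"
    proof -
      have "norm (w n * (\<integral>\<omega>. H n \<omega> * R \<omega> \<partial>M)) = w n * norm (\<integral>\<omega>. H n \<omega> * R \<omega> \<partial>M)"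
        using w0[of n] by (simp add: norm_mult)
      also have "\<dots> \<le> 1 * (\<integral>\<omega>. norm (H n \<omega> * R \<omega>) \<partial>M)"
        using w0[of n] by (intro mult_mono integral_norm_bound) auto
      also have "\<dots> \<le> (\<integral>\<omega>. \<bar>lam\<bar> ^ 3 * B / 6 * (D n \<omega>)\<^sup>2 \<partial>M)"
        unfolding mult_1
      proof (rule integral_mono)
        fix \<omega> assume w: "\<omega> \<in> space M"
        have "norm (H n \<omega> * R \<omega>) \<le> \<bar>lam * D n \<omega>\<bar> ^ 3 / 6"
          using iexp_approx_quadratic[of "lam * D n \<omega>"] by (simp add: norm_mult nH R_def)
        also have "\<dots> = \<bar>lam\<bar> ^ 3 / 6 * (\<bar>D n \<omega>\<bar> * (D n \<omega>)\<^sup>2)"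
          by (simp add: abs_mult power_mult_distrib power3_eq_cube[of "\<bar>D n \<omega>\<bar>"] power2_eq_square mult.assoc)
        also have "\<dots> \<le> \<bar>lam\<bar> ^ 3 / 6 * (B * (D n \<omega>)\<^sup>2)"
          by (intro mult_left_mono mult_right_mono D_le w) auto
        finally show "norm (H n \<omega> * R \<omega>) \<le> \<bar>lam\<bar> ^ 3 * B / 6 * (D n \<omega>)\<^sup>2" by (simp add: mult.assoc)
      qed (use i iD2 in auto)
      also have "\<dots> = \<bar>lam\<bar> ^ 3 * B / 6 * s n" unfolding s_def using iD2 by simp
      finally show ?thesis .
    qed
    also have "norm (w n * ((exp (- y) - 1 + y) * (\<integral>\<omega>. H n \<omega> \<partial>M))) \<le> lam ^ 4 * B\<^sup>2 / 8 * s n"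
    proof -
      have "norm (\<integral>\<omega>. H n \<omega> \<partial>M) \<le> 1" by (rule norm_integral_le) (auto simp: nH)
      then have "norm (w n * ((exp (- y) - 1 + y) * (\<integral>\<omega>. H n \<omega> \<partial>M))) \<le> 1 * (\<bar>exp (- y) - 1 + y\<bar> * 1)"
        using w0[of n] unfolding norm_mult norm_of_real by (intro mult_mono) simp_all
      also have "\<dots> \<le> y\<^sup>2 / 2" using exp_minus_approx[OF y0] by simp
      also have "\<dots> = lam ^ 4 / 8 * (s n * s n)" unfolding y_def by (simp add: power2_eq_square eval_nat_numeral)
      also have "\<dots> \<le> lam ^ 4 / 8 * (B\<^sup>2 * s n)" by (intro mult_left_mono mult_right_mono sB s0) auto
      finally show ?thesis by (simp add: mult.assoc)
    qed
    finally show ?thesis by (simp add: distrib_right)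
  qed
  have "a N - a 0 = (\<Sum>n<N. a (Suc n) - a n)" by (simp add: sum_lessThan_telescope)
  also have "\<dots> = (\<Sum>n<N. a (Suc n) - a n + lam\<^sup>2 / 2 * (c n - d n)) - lam\<^sup>2 / 2 * (\<Sum>n<N. c n - d n)"
    by (simp add: sum.distrib sum_distrib_left)
  also have "norm \<dots> \<le> norm (\<Sum>n<N. a (Suc n) - a n + lam\<^sup>2 / 2 * (c n - d n)) + norm (lam\<^sup>2 / 2 * (\<Sum>n<N. c n - d n))"
    by (rule norm_triangle_ineq4)
  also have "norm (\<Sum>n<N. a (Suc n) - a n + lam\<^sup>2 / 2 * (c n - d n)) \<le> (\<Sum>n<N. (\<bar>lam\<bar> ^ 3 * B / 6 + lam ^ 4 * B\<^sup>2 / 8) * s n)"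
    by (intro sum_norm_le step) auto
  also have "\<dots> = (\<bar>lam\<bar> ^ 3 * B / 6 + lam ^ 4 * B\<^sup>2 / 8) * \<sigma>"
    by (simp add: \<sigma> \<tau>_def atLeast0LessThan flip: sum_distrib_left)
  also have "norm (lam\<^sup>2 / 2 * (\<Sum>n<N. c n - d n)) \<le> lam\<^sup>2 / 2 * (\<bar>lam\<bar> / 2 * ((1 + 8 * (1 + 2 / \<epsilon>) / \<epsilon> * B\<^sup>2) * \<sigma>))"
    using mult_left_mono[OF cd_sum, of "lam\<^sup>2 / 2"] by (simp add: norm_mult norm_divide norm_power)
  also have "\<dots> = \<bar>lam\<bar> ^ 3 * ((1 + 8 * (1 + 2 / \<epsilon>) / \<epsilon> * B\<^sup>2) / 4) * \<sigma>"
  proof -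
    have "\<bar>lam\<bar> ^ 3 = lam\<^sup>2 * \<bar>lam\<bar>" by (simp add: power3_eq_cube power2_eq_square)
    then show ?thesis by simp
  qed
  finally have fin: "norm (a N - a 0) \<le> (\<bar>lam\<bar> ^ 3 * B / 6 + lam ^ 4 * B\<^sup>2 / 8) * \<sigma> + \<bar>lam\<bar> ^ 3 * ((1 + 8 * (1 + 2 / \<epsilon>) / \<epsilon> * B\<^sup>2) / 4) * \<sigma>"
    by simp
  have aN: "a N = (\<integral>\<omega>. iexp (lam * (\<Sum>n<N. mdiff \<Phi> N n (X n \<omega>) (X (Suc n) \<omega>))) \<partial>M)"
    unfolding a_def H_def \<tau>_def D_def by simp
  have a0: "a 0 = exp (- (lam\<^sup>2 * \<sigma> / 2))" unfolding a_def H_def \<sigma> by (simp add: prob_space)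
  show ?thesis using fin unfolding aN a0 by (simp add: algebra_simps)
qed

end

lemma abs_exp_minus_diff_le:
  fixes a b :: real
  assumes "0 \<le> a" "a \<le> b"
  shows "\<bar>exp (- a) - exp (- b)\<bar> \<le> b - a"
proof -
  have "exp (- a) - exp (- b) = exp (- a) * (1 - exp (- (b - a)))" by (simp add: algebra_simps flip: exp_add)
  also have "\<dots> \<le> 1 * (b - a)"
  proof (rule mult_mono)
    show "exp (- a) \<le> 1" "0 \<le> 1 - exp (- (b - a))" using assms by simp_all
    show "1 - exp (- (b - a)) \<le> b - a" using exp_ge_add_one_self[of "- (b - a)"] by linarith
  qed simp
  finally show ?thesis using assms by simp
qed

definition psum :: "(nat \<Rightarrow> 's \<Rightarrow> 's \<Rightarrow> real) \<Rightarrow> nat \<Rightarrow> 'w \<Rightarrow> real" where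
  "psum \<Phi> N \<omega> = (\<Sum>n<N. \<Phi> n (X n \<omega>) (X (Suc n) \<omega>))"

lemma psum_measurable: "functional \<Phi> \<Longrightarrow> psum \<Phi> N \<in> borel_measurable M"
  unfolding psum_def[abs_def] by (intro borel_measurable_sum functional_measurable) auto

lemma bnd_psum: "functional \<Phi> \<Longrightarrow> bnd (psum \<Phi> N)"
  unfolding psum_def[abs_def] by (intro bnd_sum functional_bnd)

text \<open>The centred sum is a martingale plus the corrector \<open>Z\<close> at time 0. Dropping
  \<open>Z\<close>, which is bounded by \<open>R\<close>, costs \<open>\<bar>lam\<bar> * R\<close>
  in the characteristic function; replacing the martingale variance \<sigma> by \<open>V\<close>,
  which exceeds it by the second moment of \<open>Z\<close>, costs
  \<open>lam\<^sup>2 * R\<^sup>2 / 2\<close>.\<close>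

lemma char_psum_approx:
  fixes lam :: real and N :: nat
  assumes fnl: "functional \<Phi>" and K: "\<And>n x y. \<bar>\<Phi> n x y\<bar> \<le> K"
  defines "B \<equiv> 2 * K + 8 * K / \<epsilon>"
  defines "R \<equiv> 4 * K / \<epsilon>"
  defines "V \<equiv> variance (psum \<Phi> N)"
  shows "norm ((\<integral>\<omega>. iexp (lam * (psum \<Phi> N \<omega> - expectation (psum \<Phi> N))) \<partial>M) - exp (- (lam\<^sup>2 * V / 2)))
    \<le> \<bar>lam\<bar> * R + lam\<^sup>2 * R\<^sup>2 / 2 + (\<bar>lam\<bar> ^ 3 * (B / 6 + (1 + 8 * (1 + 2 / \<epsilon>) / \<epsilon> * B\<^sup>2) / 4) + lam ^ 4 * B\<^sup>2 / 8) * V"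
proof -
  define \<Psi> where "\<Psi> n x y = (if n < N then \<Phi> n x y else 0)" for n x y
  have zero: "\<And>n x y. N \<le> n \<Longrightarrow> \<Psi> n x y = 0" unfolding \<Psi>_def by simp
  have K0: "0 \<le> K" using K[of 0 undefined undefined] by linarith
  have K': "\<bar>\<Psi> n x y\<bar> \<le> K" for n x y unfolding \<Psi>_def using K K0 by simp
  have f\<Psi>: "functional \<Psi>"
    unfolding functional_def \<Psi>_def
  proof (intro allI conjI)
    fix n
    show "(\<lambda>(x, y). if n < N then \<Phi> n x y else 0) \<in> borel_measurable (\<mu> n \<Otimes>\<^sub>M \<mu> (Suc n))"
      using functionalD(1)[OF fnl] by (cases "n < N") auto
    show "bnd (\<lambda>(x, y). if n < N then \<Phi> n x y else 0)"
      using functionalD(2)[OF fnl] by (cases "n < N") auto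
  qed
  have S: "psum \<Phi> N \<omega> = (\<Sum>n<N. \<Psi> n (X n \<omega>) (X (Suc n) \<omega>))" for \<omega>
    unfolding psum_def \<Psi>_def by (intro sum.cong) auto
  define Z where "Z \<omega> = corrector \<Psi> N 0 (X 0 \<omega>)" for \<omega>
  define Q where "Q \<omega> = (\<Sum>n<N. mdiff \<Psi> N n (X n \<omega>) (X (Suc n) \<omega>))" for \<omega>
  define \<sigma> where "\<sigma> = (\<Sum>n<N. \<integral>\<omega>. (mdiff \<Psi> N n (X n \<omega>) (X (Suc n) \<omega>))\<^sup>2 \<partial>M)"
  have \<sigma>0: "0 \<le> \<sigma>" unfolding \<sigma>_def by (intro sum_nonneg) simp
  have E: "expectation (psum \<Phi> N) = (\<Sum>n<N. mean \<Psi> n)"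
    unfolding S by (rule expectation_sum[OF f\<Psi>]) (rule zero)
  have dec: "psum \<Phi> N \<omega> - expectation (psum \<Phi> N) = Z \<omega> + Q \<omega>" for \<omega>
    unfolding E S Z_def Q_def by (rule sum_mdiff[OF f\<Psi>]) (rule zero)
  have V: "V = (\<integral>\<omega>. (Z \<omega>)\<^sup>2 \<partial>M) + \<sigma>"
    unfolding V_def S Z_def \<sigma>_def by (rule variance_sum[OF f\<Psi>]) (rule zero)
  have Z_le: "\<bar>Z \<omega>\<bar> \<le> R" if "\<omega> \<in> space M" for \<omega>
    unfolding Z_def R_def by (rule corrector_bound[OF f\<Psi> _ K' X_space[OF that]]) (rule zero)
  have R0: "0 \<le> R" unfolding R_def using K0 eps_pos by simp
  have fm: "functional (mdiff \<Psi> N)" by (rule functional_mdiff[OF f\<Psi>]) (rule zero)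
  have Q_meas [measurable]: "Q \<in> borel_measurable M"
    unfolding Q_def[abs_def] by (intro borel_measurable_sum functional_measurable[OF fm]) auto
  have "corrector \<Psi> N 0 \<in> borel_measurable (\<mu> 0)" by (rule corrector_measurable[OF f\<Psi>]) (rule zero)
  then have Z_meas [measurable]: "Z \<in> borel_measurable M"
    unfolding Z_def[abs_def] by (rule measurable_compose[OF X_measurable])
  have bZ: "bnd Z" unfolding Z_def[abs_def] by (rule bnd_corrector_compose[OF f\<Psi>]) (rule zero)
  have EZ: "(\<integral>\<omega>. (Z \<omega>)\<^sup>2 \<partial>M) \<le> R\<^sup>2"
  proof -
    have "(\<integral>\<omega>. (Z \<omega>)\<^sup>2 \<partial>M) \<le> (\<integral>\<omega>. R\<^sup>2 \<partial>M)"
    proof (rule integral_mono)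
      fix \<omega> assume "\<omega> \<in> space M"
      then show "(Z \<omega>)\<^sup>2 \<le> R\<^sup>2" using power_mono[OF Z_le, of \<omega> 2] by simp
    qed (auto intro!: integrable_bnd bnd_power bZ)
    then show ?thesis by (simp add: prob_space)
  qed
  have EZ0: "0 \<le> (\<integral>\<omega>. (Z \<omega>)\<^sup>2 \<partial>M)" by simp
  let ?E1 = "\<integral>\<omega>. iexp (lam * (Z \<omega> + Q \<omega>)) \<partial>M" and ?E2 = "\<integral>\<omega>. iexp (lam * Q \<omega>) \<partial>M"
  have i: "integrable M (\<lambda>\<omega>. iexp (lam * (Z \<omega> + Q \<omega>)))" "integrable M (\<lambda>\<omega>. iexp (lam * Q \<omega>))"
    by (rule integrable_bnd[OF bnd_iexp]; measurable)+
  have "norm (?E1 - ?E2) \<le> \<bar>lam\<bar> * R"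
  proof -
    have "norm (?E1 - ?E2) = norm (\<integral>\<omega>. iexp (lam * (Z \<omega> + Q \<omega>)) - iexp (lam * Q \<omega>) \<partial>M)"
      by (subst Bochner_Integration.integral_diff[OF i]) (rule refl)
    also have "\<dots> \<le> \<bar>lam\<bar> * R"
    proof (rule norm_integral_le)
      fix \<omega> assume w: "\<omega> \<in> space M"
      have "norm (iexp (lam * (Z \<omega> + Q \<omega>)) - iexp (lam * Q \<omega>)) \<le> \<bar>lam * (Z \<omega> + Q \<omega>) - lam * Q \<omega>\<bar>"
        by (rule iexp_diff_le)
      also have "\<dots> = \<bar>lam\<bar> * \<bar>Z \<omega>\<bar>" by (simp add: distrib_left abs_mult)
      also have "\<dots> \<le> \<bar>lam\<bar> * R" by (intro mult_left_mono Z_le w) auto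
      finally show "norm (iexp (lam * (Z \<omega> + Q \<omega>)) - iexp (lam * Q \<omega>)) \<le> \<bar>lam\<bar> * R" .
    qed (use R0 in auto)
    finally show ?thesis .
  qed
  moreover have "norm (?E2 - exp (- (lam\<^sup>2 * \<sigma> / 2)))
      \<le> (\<bar>lam\<bar> ^ 3 * (B / 6 + (1 + 8 * (1 + 2 / \<epsilon>) / \<epsilon> * B\<^sup>2) / 4) + lam ^ 4 * B\<^sup>2 / 8) * \<sigma>"
    unfolding Q_def \<sigma>_def B_def by (rule martingale_char_approx[OF f\<Psi> _ K']) (rule zero)
  moreover have "\<dots> \<le> (\<bar>lam\<bar> ^ 3 * (B / 6 + (1 + 8 * (1 + 2 / \<epsilon>) / \<epsilon> * B\<^sup>2) / 4) + lam ^ 4 * B\<^sup>2 / 8) * V"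
    using eps_pos K0 V EZ0 unfolding B_def by (intro mult_left_mono) auto
  moreover have "norm (complex_of_real (exp (- (lam\<^sup>2 * \<sigma> / 2))) - exp (- (lam\<^sup>2 * V / 2))) \<le> lam\<^sup>2 * R\<^sup>2 / 2"
  proof -
    have "\<bar>exp (- (lam\<^sup>2 * \<sigma> / 2)) - exp (- (lam\<^sup>2 * V / 2))\<bar> \<le> lam\<^sup>2 * V / 2 - lam\<^sup>2 * \<sigma> / 2"
      using \<sigma>0 V EZ0 by (intro abs_exp_minus_diff_le) (auto intro!: divide_right_mono mult_left_mono)
    also have "\<dots> = lam\<^sup>2 * (\<integral>\<omega>. (Z \<omega>)\<^sup>2 \<partial>M) / 2" unfolding V by (simp add: algebra_simps add_divide_distrib)
    also have "\<dots> \<le> lam\<^sup>2 * R\<^sup>2 / 2" by (intro divide_right_mono mult_left_mono EZ) auto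
    finally show ?thesis by (simp only: norm_of_real flip: of_real_diff)
  qed
  ultimately show ?thesis
    unfolding dec using norm_triangle_ineq[of "?E1 - ?E2" "?E2 - exp (- (lam\<^sup>2 * \<sigma> / 2))"]
      norm_triangle_ineq[of "?E1 - exp (- (lam\<^sup>2 * \<sigma> / 2))" "complex_of_real (exp (- (lam\<^sup>2 * \<sigma> / 2))) - exp (- (lam\<^sup>2 * V / 2))"]
    by simp
qed

text \<open>With \<open>lam = t / sqrt V\<close> the errors of \<open>char_psum_approx\<close> are
  of order \<open>V\<close> to the power -1/2 or -1, the cubic and quartic ones after their factor
  \<open>V\<close> is taken into account.\<close>

theorem CLT:
  assumes fnl: "functional \<Phi>" and K: "\<And>n x y. \<bar>\<Phi> n x y\<bar> \<le> K"
    and V: "filterlim (\<lambda>N. variance (psum \<Phi> N)) at_top sequentially"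
  shows "(\<lambda>N. \<integral>\<omega>. iexp (t * ((psum \<Phi> N \<omega> - expectation (psum \<Phi> N)) / sqrt (variance (psum \<Phi> N)))) \<partial>M)
    \<longlonglongrightarrow> complex_of_real (exp (- t\<^sup>2 / 2))"
proof -
  define v where "v N = variance (psum \<Phi> N)" for N
  define R where "R = 4 * K / \<epsilon>"
  define B where "B = 2 * K + 8 * K / \<epsilon>"
  define C1 where "C1 = B / 6 + (1 + 8 * (1 + 2 / \<epsilon>) / \<epsilon> * B\<^sup>2) / 4"
  have v: "filterlim v at_top sequentially" using V unfolding v_def .
  have lim: "((\<lambda>v. \<bar>t / sqrt v\<bar> * R + (t / sqrt v)\<^sup>2 * R\<^sup>2 / 2 + (\<bar>t / sqrt v\<bar> ^ 3 * C1 + (t / sqrt v) ^ 4 * B\<^sup>2 / 8) * v) \<longlongrightarrow> 0) at_top"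
  proof (rule Lim_transform_eventually)
    have "((\<lambda>v::real. 1 / sqrt v) \<longlongrightarrow> 0) at_top" "((\<lambda>v::real. (1 / sqrt v)\<^sup>2) \<longlongrightarrow> 0) at_top"
      "((\<lambda>v::real. (1 / sqrt v) ^ 3 * v) \<longlongrightarrow> 0) at_top" "((\<lambda>v::real. (1 / sqrt v) ^ 4 * v) \<longlongrightarrow> 0) at_top"
      by real_asymp+
    note l = tendsto_mult_right_zero[OF this(1), of "\<bar>t\<bar> * R"] tendsto_mult_right_zero[OF this(2), of "t\<^sup>2 * R\<^sup>2 / 2"]
      tendsto_mult_right_zero[OF this(3), of "\<bar>t\<bar> ^ 3 * C1"] tendsto_mult_right_zero[OF this(4), of "t ^ 4 * B\<^sup>2 / 8"]
    show "((\<lambda>v. \<bar>t\<bar> * R * (1 / sqrt v) + t\<^sup>2 * R\<^sup>2 / 2 * (1 / sqrt v)\<^sup>2 + \<bar>t\<bar> ^ 3 * C1 * ((1 / sqrt v) ^ 3 * v)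
        + t ^ 4 * B\<^sup>2 / 8 * ((1 / sqrt v) ^ 4 * v)) \<longlongrightarrow> 0) at_top"
      using tendsto_add[OF tendsto_add[OF tendsto_add[OF l(1,2)] l(3)] l(4)] by simp
    show "eventually (\<lambda>v. \<bar>t\<bar> * R * (1 / sqrt v) + t\<^sup>2 * R\<^sup>2 / 2 * (1 / sqrt v)\<^sup>2 + \<bar>t\<bar> ^ 3 * C1 * ((1 / sqrt v) ^ 3 * v)
        + t ^ 4 * B\<^sup>2 / 8 * ((1 / sqrt v) ^ 4 * v) =
      \<bar>t / sqrt v\<bar> * R + (t / sqrt v)\<^sup>2 * R\<^sup>2 / 2 + (\<bar>t / sqrt v\<bar> ^ 3 * C1 + (t / sqrt v) ^ 4 * B\<^sup>2 / 8) * v) at_top"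
      using eventually_gt_at_top[of 0]
      by eventually_elim (simp add: abs_divide power_divide field_simps)
  qed
  have "(\<lambda>N. (\<integral>\<omega>. iexp (t * ((psum \<Phi> N \<omega> - expectation (psum \<Phi> N)) / sqrt (v N))) \<partial>M) - exp (- t\<^sup>2 / 2)) \<longlonglongrightarrow> 0"
  proof (rule Lim_null_comparison)
    show "(\<lambda>N. \<bar>t / sqrt (v N)\<bar> * R + (t / sqrt (v N))\<^sup>2 * R\<^sup>2 / 2 + (\<bar>t / sqrt (v N)\<bar> ^ 3 * C1 + (t / sqrt (v N)) ^ 4 * B\<^sup>2 / 8) * v N) \<longlonglongrightarrow> 0"
      by (rule filterlim_compose[OF lim v])
    have "eventually (\<lambda>N. 0 < v N) sequentially" using v by (simp add: filterlim_at_top_dense)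
    then show "eventually (\<lambda>N. norm ((\<integral>\<omega>. iexp (t * ((psum \<Phi> N \<omega> - expectation (psum \<Phi> N)) / sqrt (v N))) \<partial>M) - exp (- t\<^sup>2 / 2))
      \<le> \<bar>t / sqrt (v N)\<bar> * R + (t / sqrt (v N))\<^sup>2 * R\<^sup>2 / 2 + (\<bar>t / sqrt (v N)\<bar> ^ 3 * C1 + (t / sqrt (v N)) ^ 4 * B\<^sup>2 / 8) * v N) sequentially"
    proof eventually_elim
      case (elim N)
      have "- t\<^sup>2 / 2 = - ((t / sqrt (v N))\<^sup>2 * v N / 2)" using elim by (simp add: power_divide)
      then show ?case
        using char_psum_approx[OF fnl K, of "t / sqrt (v N)" N] unfolding v_def[symmetric] R_def B_def C1_def by simp
    qed
  qed
  then show ?thesis unfolding v_def by (rule LIM_zero_cancel)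
qed

end

section \<open>Hexagons and decay of characteristic functions\<close>

text \<open>Let \<open>?q\<close> be the total weight and \<open>k\<close> the modulus of the
  twisted integral. Expanding the cosine of a difference shows that the double integral equals
  \<open>?q\<^sup>2 - k\<^sup>2 = (?q - k) * (?q + k)\<close>, and \<open>?q + k\<close> is at most
  2/c. So dispersion of phases forces a loss of modulus.\<close>

lemma (in prob_space) norm_integral_iexp_le:
  fixes w \<theta> :: "'a \<Rightarrow> real"
  assumes [measurable]: "w \<in> borel_measurable M" "\<theta> \<in> borel_measurable M" and b: "bnd w"
    and nn: "\<And>x. x \<in> space M \<Longrightarrow> 0 \<le> w x" and le: "(\<integral>x. w x \<partial>M) \<le> 1 / c" and c: "0 < c"
  shows "norm (\<integral>x. w x *\<^sub>R iexp (\<theta> x) \<partial>M)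
    \<le> (\<integral>x. w x \<partial>M) - c / 2 * (\<integral>x. \<integral>y. w x * w y * (1 - cos (\<theta> x - \<theta> y)) \<partial>M \<partial>M)"
proof -
  let ?q = "\<integral>x. w x \<partial>M" and ?C = "\<integral>x. w x * cos (\<theta> x) \<partial>M" and ?S = "\<integral>x. w x * sin (\<theta> x) \<partial>M"
  define k where "k = norm (\<integral>x. w x *\<^sub>R iexp (\<theta> x) \<partial>M)"
  have bs: "bnd (\<lambda>x. sin (\<theta> x))" by (rule bndI[of _ 1]) simp
  have i: "integrable M (\<lambda>x. w x *\<^sub>R iexp (\<theta> x))" "integrable M w" "integrable M (\<lambda>x. w x * cos (\<theta> x))"
    "integrable M (\<lambda>x. w x * sin (\<theta> x))"
    using b bs by (auto intro!: integrable_bnd bnd_intros)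
  have Re: "Re (\<integral>x. w x *\<^sub>R iexp (\<theta> x) \<partial>M) = ?C"
    by (subst integral_Re[symmetric, OF i(1)]) (simp add: Re_exp)
  have Im: "Im (\<integral>x. w x *\<^sub>R iexp (\<theta> x) \<partial>M) = ?S"
    by (subst integral_Im[symmetric, OF i(1)]) (simp add: Im_exp)
  have k2: "k\<^sup>2 = ?C\<^sup>2 + ?S\<^sup>2" unfolding k_def cmod_power2 Re Im ..
  have "(\<integral>y. w x * w y * (1 - cos (\<theta> x - \<theta> y)) \<partial>M) = w x * ?q - (w x * cos (\<theta> x)) * ?C - (w x * sin (\<theta> x)) * ?S" for x
  proof -
    have "(\<integral>y. w x * w y * (1 - cos (\<theta> x - \<theta> y)) \<partial>M)
      = (\<integral>y. w x * w y - (w x * cos (\<theta> x)) * (w y * cos (\<theta> y)) - (w x * sin (\<theta> x)) * (w y * sin (\<theta> y)) \<partial>M)"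
      by (intro Bochner_Integration.integral_cong refl) (simp add: cos_diff algebra_simps)
    then show ?thesis using i by simp
  qed
  then have H: "(\<integral>x. \<integral>y. w x * w y * (1 - cos (\<theta> x - \<theta> y)) \<partial>M \<partial>M) = ?q\<^sup>2 - k\<^sup>2"
    using i unfolding k2 by (simp add: power2_eq_square)
  have "k \<le> (\<integral>x. norm (w x *\<^sub>R iexp (\<theta> x)) \<partial>M)" unfolding k_def by (rule integral_norm_bound)
  also have "\<dots> = ?q" using nn by (intro Bochner_Integration.integral_cong refl) simp
  finally have kq: "k \<le> ?q" .
  have "(?q - k) * (?q + k) \<le> (?q - k) * (2 / c)"
    using kq le by (intro mult_left_mono) auto
  then have "c / 2 * (?q\<^sup>2 - k\<^sup>2) \<le> c / 2 * ((?q - k) * (2 / c))"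
    using c by (intro mult_left_mono) (auto simp: power2_eq_square algebra_simps)
  also have "\<dots> = ?q - k" using c by simp
  finally show ?thesis unfolding H k_def[symmetric] by simp
qed

context elliptic_chain begin

sublocale rho: prob_space "\<mu> (Suc n) \<Otimes>\<^sub>M \<mu> (Suc (Suc n))" for n
  by (intro prob_space_pair prob_space_mu)

abbreviation rho :: "nat \<Rightarrow> ('s \<times> 's) measure" where
  "rho n \<equiv> \<mu> (Suc n) \<Otimes>\<^sub>M \<mu> (Suc (Suc n))"

definition path_weight :: "nat \<Rightarrow> 's \<Rightarrow> 's \<Rightarrow> 's \<Rightarrow> 's \<Rightarrow> real" where
  "path_weight n x u v z = p n x u * p (Suc n) u v * p (Suc (Suc n)) v z"

lemma path_weight_nonneg: "0 \<le> path_weight n x u v z"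
  unfolding path_weight_def by (simp add: p_nonneg)

lemma bnd_path_weight [simp]: "bnd (\<lambda>w. path_weight n (g1 w) (g2 w) (g3 w) (g4 w))"
  unfolding path_weight_def by (intro bnd_mult bnd_p)

lemma path_weight_measurable [measurable (raw)]:
  assumes [measurable]: "g1 \<in> A \<rightarrow>\<^sub>M \<mu> n" "g2 \<in> A \<rightarrow>\<^sub>M \<mu> (Suc n)" "g3 \<in> A \<rightarrow>\<^sub>M \<mu> (Suc (Suc n))" "g4 \<in> A \<rightarrow>\<^sub>M \<mu> (Suc (Suc (Suc n)))"
  shows "(\<lambda>w. path_weight n (g1 w) (g2 w) (g3 w) (g4 w)) \<in> borel_measurable A"
  unfolding path_weight_def by measurable

lemma path_weight_le: "path_weight n x u v z \<le> 1 / \<epsilon> ^ 3"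
proof -
  have "path_weight n x u v z \<le> 1 / \<epsilon> * (1 / \<epsilon>) * (1 / \<epsilon>)"
    unfolding path_weight_def using eps_pos by (intro mult_mono p_le p_nonneg mult_nonneg_nonneg) auto
  then show ?thesis by (simp add: power3_eq_cube)
qed

lemma path_weight_integral:
  assumes [measurable]: "x \<in> space (\<mu> n)" "z \<in> space (\<mu> (Suc (Suc (Suc n))))"
  shows "(\<integral>b. path_weight n x (fst b) (snd b) z \<partial>rho n) \<le> 1 / \<epsilon>"
proof -
  have "(\<integral>b. path_weight n x (fst b) (snd b) z \<partial>rho n) = (\<integral>u. \<integral>v. path_weight n x u v z \<partial>\<mu> (Suc (Suc n)) \<partial>\<mu> (Suc n))"
    by (rule Fubini_bnd(2)[symmetric]) (auto simp: case_prod_unfold)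
  also have "\<dots> = (\<integral>u. p n x u * q (Suc n) u z \<partial>\<mu> (Suc n))"
    unfolding q_def path_weight_def by (intro Bochner_Integration.integral_cong refl) (simp add: mult.assoc)
  also have "\<dots> \<le> (\<integral>u. p n x u * (1 / \<epsilon>) \<partial>\<mu> (Suc n))"
    by (intro integral_mono mu.integrable_bnd bnd_mult mult_left_mono q_le p_nonneg) (auto simp: assms)
  also have "\<dots> = 1 / \<epsilon>" by (simp add: p_integral assms)
  finally show ?thesis .
qed

end

locale bounded_functional = elliptic_chain +
  fixes f :: "nat \<Rightarrow> 'b \<Rightarrow> 'b \<Rightarrow> real" and K :: real
  assumes fnl: "functional f" and K: "\<And>n x y. \<bar>f n x y\<bar> \<le> K"
begin

lemmas f_measurable [measurable (raw)] = functional_measurable[OF fnl]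

definition path_sum :: "nat \<Rightarrow> 'b \<Rightarrow> 'b \<Rightarrow> 'b \<Rightarrow> 'b \<Rightarrow> real" where
  "path_sum n x u v z = f n x u + f (Suc n) u v + f (Suc (Suc n)) v z"

lemma path_sum_measurable [measurable (raw)]:
  assumes [measurable]: "g1 \<in> A \<rightarrow>\<^sub>M \<mu> n" "g2 \<in> A \<rightarrow>\<^sub>M \<mu> (Suc n)" "g3 \<in> A \<rightarrow>\<^sub>M \<mu> (Suc (Suc n))" "g4 \<in> A \<rightarrow>\<^sub>M \<mu> (Suc (Suc (Suc n)))"
  shows "(\<lambda>w. path_sum n (g1 w) (g2 w) (g3 w) (g4 w)) \<in> borel_measurable A"
  unfolding path_sum_def by measurable

text \<open>Two paths of length three with common end points \<open>x\<close> and \<open>z\<close> form a hexagon. The hexagon moment below is the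
  square of the structure constant \<open>d\<^sub>n(\<xi>)\<close> of Dolgopyat and Sarig.\<close>

definition hexagon :: "real \<Rightarrow> nat \<Rightarrow> 'b \<Rightarrow> 'b \<Rightarrow> 'b \<Rightarrow> 'b \<Rightarrow> 'b \<Rightarrow> 'b \<Rightarrow> real" where
  "hexagon \<xi> n x z u v u' v' = path_weight n x u v z * path_weight n x u' v' z * (1 - cos (\<xi> * (path_sum n x u v z - path_sum n x u' v' z)))"

lemma hexagon_nonneg: "0 \<le> hexagon \<xi> n x z u v u' v'"
  unfolding hexagon_def by (simp add: path_weight_nonneg)

lemma bnd_hexagon [simp]: "bnd (\<lambda>w. hexagon \<xi> n (g1 w) (g2 w) (g3 w) (g4 w) (g5 w) (g6 w))"
  unfolding hexagon_def by (intro bnd_mult bnd_diff bnd_path_weight bnd_cos bnd_const)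

lemma hexagon_measurable [measurable (raw)]:
  assumes [measurable]: "g1 \<in> A \<rightarrow>\<^sub>M \<mu> n" "g2 \<in> A \<rightarrow>\<^sub>M \<mu> (Suc (Suc (Suc n)))"
    "g3 \<in> A \<rightarrow>\<^sub>M \<mu> (Suc n)" "g4 \<in> A \<rightarrow>\<^sub>M \<mu> (Suc (Suc n))" "g5 \<in> A \<rightarrow>\<^sub>M \<mu> (Suc n)" "g6 \<in> A \<rightarrow>\<^sub>M \<mu> (Suc (Suc n))"
  shows "(\<lambda>w. hexagon \<xi> n (g1 w) (g2 w) (g3 w) (g4 w) (g5 w) (g6 w)) \<in> borel_measurable A"
  unfolding hexagon_def by measurable

definition hexagon_inner :: "real \<Rightarrow> nat \<Rightarrow> 'b \<Rightarrow> 'b \<Rightarrow> real" where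
  "hexagon_inner \<xi> n x z = (\<integral>b. \<integral>b'. hexagon \<xi> n x z (fst b) (snd b) (fst b') (snd b') \<partial>rho n \<partial>rho n)"

lemma hexagon_inner_nonneg: "0 \<le> hexagon_inner \<xi> n x z"
  unfolding hexagon_inner_def by (simp add: hexagon_nonneg)

lemma bnd_hexagon_inner [simp]: "bnd (\<lambda>w. hexagon_inner \<xi> n (g1 w) (g2 w))"
  unfolding hexagon_inner_def by (intro rho.bnd_integral) (auto simp: case_prod_unfold intro!: rho.bnd_integral)

lemma hexagon_inner_measurable [measurable (raw)]:
  assumes [measurable]: "g1 \<in> A \<rightarrow>\<^sub>M \<mu> n" "g2 \<in> A \<rightarrow>\<^sub>M \<mu> (Suc (Suc (Suc n)))"
  shows "(\<lambda>w. hexagon_inner \<xi> n (g1 w) (g2 w)) \<in> borel_measurable A"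
  unfolding hexagon_inner_def by measurable

definition hexagon_from :: "real \<Rightarrow> nat \<Rightarrow> 'b \<Rightarrow> real" where
  "hexagon_from \<xi> n x = (\<integral>z. hexagon_inner \<xi> n x z \<partial>\<mu> (Suc (Suc (Suc n))))"

lemma hexagon_from_nonneg: "0 \<le> hexagon_from \<xi> n x"
  unfolding hexagon_from_def by (simp add: hexagon_inner_nonneg)

lemma bnd_hexagon_from [simp]: "bnd (\<lambda>w. hexagon_from \<xi> n (g1 w))"
  unfolding hexagon_from_def by (intro mu.bnd_integral) (auto simp: case_prod_unfold)

lemma hexagon_from_measurable [measurable (raw)]:
  assumes [measurable]: "g1 \<in> A \<rightarrow>\<^sub>M \<mu> n"
  shows "(\<lambda>w. hexagon_from \<xi> n (g1 w)) \<in> borel_measurable A"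
  unfolding hexagon_from_def by measurable

text \<open>The start point is integrated under the reference measure and not under the law of the
  chain, and the two path densities enter as they are, without normalisation by the three-step
  density.\<close>

definition hexagon_moment :: "real \<Rightarrow> nat \<Rightarrow> real" where
  "hexagon_moment \<xi> n = (\<integral>x. hexagon_from \<xi> n x \<partial>\<mu> n)"

lemma hexagon_moment_nonneg: "0 \<le> hexagon_moment \<xi> n"
  unfolding hexagon_moment_def by (simp add: hexagon_from_nonneg)

text \<open>The transition operator perturbed by a phase. Products of such operators applied to the
  constant 1 give the characteristic function of the sum, so a bound on their norms bounds the
  characteristic function.\<close>

definition twisted_T :: "real \<Rightarrow> nat \<Rightarrow> ('b \<Rightarrow> complex) \<Rightarrow> 'b \<Rightarrow> complex" where
  "twisted_T \<xi> n g = T n (\<lambda>x y. iexp (\<xi> * f n x y) * g y)"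

definition bounded_measurable :: "nat \<Rightarrow> ('b \<Rightarrow> complex) \<Rightarrow> bool" where
  "bounded_measurable n g \<longleftrightarrow> g \<in> borel_measurable (\<mu> n) \<and> bnd g"

lemma bounded_measurable_twisted_T: "bounded_measurable (Suc n) g \<Longrightarrow> bounded_measurable n (twisted_T \<xi> n g)"
proof -
  assume g: "bounded_measurable (Suc n) g"
  then have [measurable]: "g \<in> borel_measurable (\<mu> (Suc n))" by (simp add: bounded_measurable_def)
  have "bnd (\<lambda>(x, y). iexp (\<xi> * f n x y) * g y)"
    using g unfolding bounded_measurable_def case_prod_unfold by (intro bnd_mult bnd_iexp) (auto dest: bnd_compose[where g = snd])
  then show ?thesis unfolding bounded_measurable_def twisted_T_def by (intro conjI bnd_T T_measurable) measurable
qed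

lemma norm_twisted_T_le:
  assumes g: "bounded_measurable (Suc n) g" and x [measurable]: "x \<in> space (\<mu> n)"
  shows "norm (twisted_T \<xi> n g x) \<le> T n (\<lambda>_ y. norm (g y)) x"
proof -
  have "norm (twisted_T \<xi> n g x) \<le> (\<integral>y. norm (p n x y *\<^sub>R (iexp (\<xi> * f n x y) * g y)) \<partial>\<mu> (Suc n))"
    unfolding twisted_T_def T_def by (rule integral_norm_bound)
  also have "\<dots> = T n (\<lambda>_ y. norm (g y)) x" unfolding T_def
    by (intro Bochner_Integration.integral_cong refl) (simp add: norm_mult p_nonneg)
  finally show ?thesis .
qed

lemma twisted_T_three:
  assumes g: "bounded_measurable (Suc (Suc (Suc n))) g" and x [measurable]: "x \<in> space (\<mu> n)"
  shows "twisted_T \<xi> n (twisted_T \<xi> (Suc n) (twisted_T \<xi> (Suc (Suc n)) g)) x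
    = (\<integral>z. (\<integral>b. path_weight n x (fst b) (snd b) z *\<^sub>R iexp (\<xi> * path_sum n x (fst b) (snd b) z) \<partial>rho n) * g z \<partial>\<mu> (Suc (Suc (Suc n))))"
proof -
  have gm [measurable]: "g \<in> borel_measurable (\<mu> (Suc (Suc (Suc n))))" and gb: "\<And>h. bnd (\<lambda>w. g (h w))"
    using g bnd_compose unfolding bounded_measurable_def by auto
  let ?G = "\<lambda>u v z. path_weight n x u v z *\<^sub>R iexp (\<xi> * path_sum n x u v z) * g z"
  have bG: "bnd (\<lambda>w. ?G (a w) (b w) (c w))" for a b c by (intro bnd_intros bnd_path_weight gb)
  have "twisted_T \<xi> n (twisted_T \<xi> (Suc n) (twisted_T \<xi> (Suc (Suc n)) g)) x
    = (\<integral>u. \<integral>v. \<integral>z. ?G u v z \<partial>\<mu> (Suc (Suc (Suc n))) \<partial>\<mu> (Suc (Suc n)) \<partial>\<mu> (Suc n))"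
    unfolding twisted_T_def T_def path_sum_def path_weight_def
    by (simp add: algebra_simps exp_add flip: integral_mult_right_zero integral_scaleR_right)
  also have "\<dots> = (\<integral>b. \<integral>z. ?G (fst b) (snd b) z \<partial>\<mu> (Suc (Suc (Suc n))) \<partial>rho n)"
  proof (rule Fubini_bnd(2)[OF mu_finite mu_finite])
    show "bnd (\<lambda>(u, v). \<integral>z. ?G u v z \<partial>\<mu> (Suc (Suc (Suc n))))"
      unfolding case_prod_unfold by (rule mu.bnd_integral, unfold case_prod_unfold, rule bG)
  qed measurable
  also have "\<dots> = (\<integral>z. \<integral>b. ?G (fst b) (snd b) z \<partial>rho n \<partial>\<mu> (Suc (Suc (Suc n))))"
  proof (rule Fubini_bnd(1)[OF rho.finite_measure_axioms mu_finite])
    show "bnd (\<lambda>(b, z). ?G (fst b) (snd b) z)" unfolding case_prod_unfold by (rule bG)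
  qed measurable
  also have "\<dots> = (\<integral>z. (\<integral>b. path_weight n x (fst b) (snd b) z *\<^sub>R iexp (\<xi> * path_sum n x (fst b) (snd b) z) \<partial>rho n) * g z \<partial>\<mu> (Suc (Suc (Suc n))))"
    by (simp only: integral_mult_left_zero)
  finally show ?thesis .
qed

lemma path_weight_integral3:
  assumes x [measurable]: "x \<in> space (\<mu> n)"
  shows "(\<integral>z. \<integral>b. path_weight n x (fst b) (snd b) z \<partial>rho n \<partial>\<mu> (Suc (Suc (Suc n)))) = 1"
proof -
  have "(\<integral>z. \<integral>b. path_weight n x (fst b) (snd b) z \<partial>rho n \<partial>\<mu> (Suc (Suc (Suc n))))
     = (\<integral>b. \<integral>z. path_weight n x (fst b) (snd b) z \<partial>\<mu> (Suc (Suc (Suc n))) \<partial>rho n)"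
    by (rule Fubini_bnd(1)) (auto simp: case_prod_unfold intro!: rho.finite_measure_axioms)
  also have "\<dots> = (\<integral>u. \<integral>v. \<integral>z. path_weight n x u v z \<partial>\<mu> (Suc (Suc (Suc n))) \<partial>\<mu> (Suc (Suc n)) \<partial>\<mu> (Suc n))"
    by (rule Fubini_bnd(2)[symmetric]) (auto simp: case_prod_unfold intro!: mu.bnd_integral)
  also have "\<dots> = (\<integral>u. \<integral>v. p n x u * p (Suc n) u v \<partial>\<mu> (Suc (Suc n)) \<partial>\<mu> (Suc n))"
    unfolding path_weight_def by (intro Bochner_Integration.integral_cong refl) (simp add: p_integral)
  also have "\<dots> = (\<integral>u. p n x u \<partial>\<mu> (Suc n))"
    by (intro Bochner_Integration.integral_cong refl) (simp add: p_integral)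
  finally show ?thesis by (simp add: p_integral x)
qed

text \<open>For fixed end points the three-step operator is an oscillatory integral over the two
  interior points, to which \<open>norm_integral_iexp_le\<close> applies; the loss is the hexagon
  integral. The gain still depends on the starting point \<open>x\<close>.\<close>

lemma twisted_T_three_le:
  assumes g: "bounded_measurable (Suc (Suc (Suc n))) g" and x [measurable]: "x \<in> space (\<mu> n)"
    and G: "\<And>z. z \<in> space (\<mu> (Suc (Suc (Suc n)))) \<Longrightarrow> norm (g z) \<le> G" and G0: "0 \<le> G"
  shows "norm (twisted_T \<xi> n (twisted_T \<xi> (Suc n) (twisted_T \<xi> (Suc (Suc n)) g)) x) \<le> G * (1 - \<epsilon> / 2 * hexagon_from \<xi> n x)"
proof -
  let ?K = "\<lambda>z. \<integral>b. path_weight n x (fst b) (snd b) z *\<^sub>R iexp (\<xi> * path_sum n x (fst b) (snd b) z) \<partial>rho n"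
  let ?Q = "\<lambda>z. \<integral>b. path_weight n x (fst b) (snd b) z \<partial>rho n"
  have gm [measurable]: "g \<in> borel_measurable (\<mu> (Suc (Suc (Suc n))))" and gb: "bnd g"
    using g unfolding bounded_measurable_def by auto
  have bK: "bnd ?K" by (rule rho.bnd_integral, unfold case_prod_unfold, intro bnd_intros bnd_path_weight)
  have bQ: "bnd ?Q" by (intro rho.bnd_integral) (auto simp: case_prod_unfold)
  have "norm (twisted_T \<xi> n (twisted_T \<xi> (Suc n) (twisted_T \<xi> (Suc (Suc n)) g)) x) \<le> (\<integral>z. norm (?K z * g z) \<partial>\<mu> (Suc (Suc (Suc n))))"
    unfolding twisted_T_three[OF g x] by (rule integral_norm_bound)
  also have "\<dots> \<le> (\<integral>z. (?Q z - \<epsilon> / 2 * hexagon_inner \<xi> n x z) * G \<partial>\<mu> (Suc (Suc (Suc n))))"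
  proof (rule integral_mono)
    fix z assume z [measurable]: "z \<in> space (\<mu> (Suc (Suc (Suc n))))"
    have *: "norm (?K z) \<le> ?Q z - \<epsilon> / 2 * hexagon_inner \<xi> n x z"
      unfolding hexagon_inner_def hexagon_def right_diff_distrib[of \<xi>]
      by (intro rho.norm_integral_iexp_le) (auto simp: path_weight_nonneg path_weight_integral eps_pos z x)
    show "norm (?K z * g z) \<le> (?Q z - \<epsilon> / 2 * hexagon_inner \<xi> n x z) * G"
      unfolding norm_mult by (intro mult_mono * order_trans[OF norm_ge_zero *] G z norm_ge_zero)
  next
    show "integrable (\<mu> (Suc (Suc (Suc n)))) (\<lambda>z. norm (?K z * g z))"
      by (intro mu.integrable_bnd bnd_norm bnd_mult bK gb) measurable
    show "integrable (\<mu> (Suc (Suc (Suc n)))) (\<lambda>z. (?Q z - \<epsilon> / 2 * hexagon_inner \<xi> n x z) * G)"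
      by (intro mu.integrable_bnd bnd_intros bQ bnd_hexagon_inner) measurable
  qed
  also have "\<dots> = (\<integral>z. ?Q z - \<epsilon> / 2 * hexagon_inner \<xi> n x z \<partial>\<mu> (Suc (Suc (Suc n)))) * G" by simp
  also have "(\<integral>z. ?Q z - \<epsilon> / 2 * hexagon_inner \<xi> n x z \<partial>\<mu> (Suc (Suc (Suc n)))) = 1 - \<epsilon> / 2 * hexagon_from \<xi> n x"
    unfolding hexagon_from_def
  proof -
    have "integrable (\<mu> (Suc (Suc (Suc n)))) ?Q" "integrable (\<mu> (Suc (Suc (Suc n)))) (\<lambda>z. \<epsilon> / 2 * hexagon_inner \<xi> n x z)"
      by (intro mu.integrable_bnd bnd_intros bQ bnd_hexagon_inner; measurable)+
    then show "(\<integral>z. ?Q z - \<epsilon> / 2 * hexagon_inner \<xi> n x z \<partial>\<mu> (Suc (Suc (Suc n)))) = 1 - \<epsilon> / 2 * (\<integral>z. hexagon_inner \<xi> n x z \<partial>\<mu> (Suc (Suc (Suc n))))"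
      by (simp add: path_weight_integral3 x)
  qed
  finally show ?thesis by (simp add: mult.commute)
qed

text \<open>Two more steps in front average the gain of \<open>twisted_T_three_le\<close> over its
  starting point with density at least \<epsilon>. This gives a contraction in supremum norm with a
  rate that no longer depends on the state; the second factor \<epsilon> comes from this
  averaging.\<close>

lemma twisted_T_five_le:
  assumes g: "bounded_measurable (Suc (Suc (Suc (Suc (Suc n))))) g" and x [measurable]: "x \<in> space (\<mu> n)"
    and G: "\<And>z. z \<in> space (\<mu> (Suc (Suc (Suc (Suc (Suc n)))))) \<Longrightarrow> norm (g z) \<le> G" and G0: "0 \<le> G"
  shows "norm (twisted_T \<xi> n (twisted_T \<xi> (Suc n) (twisted_T \<xi> (Suc (Suc n)) (twisted_T \<xi> (Suc (Suc (Suc n))) (twisted_T \<xi> (Suc (Suc (Suc (Suc n)))) g)))) x)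
    \<le> G * (1 - \<epsilon>\<^sup>2 / 2 * hexagon_moment \<xi> (Suc (Suc n)))"
proof -
  define h where "h = twisted_T \<xi> (Suc (Suc n)) (twisted_T \<xi> (Suc (Suc (Suc n))) (twisted_T \<xi> (Suc (Suc (Suc (Suc n)))) g))"
  define e where "e y = G * (1 - \<epsilon> / 2 * hexagon_from \<xi> (Suc (Suc n)) y)" for y
  have gh: "bounded_measurable (Suc (Suc n)) h" unfolding h_def by (intro bounded_measurable_twisted_T g)
  then have [measurable]: "h \<in> borel_measurable (\<mu> (Suc (Suc n)))" and bh: "bnd h" by (auto simp: bounded_measurable_def)
  have gLh: "bounded_measurable (Suc n) (twisted_T \<xi> (Suc n) h)" by (intro bounded_measurable_twisted_T gh)
  have [measurable]: "twisted_T \<xi> (Suc n) h \<in> borel_measurable (\<mu> (Suc n))" and bLh: "bnd (twisted_T \<xi> (Suc n) h)"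
    using gLh by (auto simp: bounded_measurable_def)
  have he: "norm (h y) \<le> e y" if "y \<in> space (\<mu> (Suc (Suc n)))" for y
    unfolding h_def e_def by (rule twisted_T_three_le[OF g that G G0])
  have be: "bnd e" unfolding e_def[abs_def] by (intro bnd_intros bnd_hexagon_from)
  have em [measurable]: "e \<in> borel_measurable (\<mu> (Suc (Suc n)))" unfolding e_def[abs_def] by measurable
  have "norm (twisted_T \<xi> n (twisted_T \<xi> (Suc n) h) x) \<le> T n (\<lambda>_ y. norm (twisted_T \<xi> (Suc n) h y)) x"
    by (rule norm_twisted_T_le[OF gLh x])
  also have "\<dots> \<le> T n (\<lambda>_. T (Suc n) (\<lambda>_. e)) x"
  proof (rule T_mono)
    fix y assume y: "y \<in> space (\<mu> (Suc n))"
    have "norm (twisted_T \<xi> (Suc n) h y) \<le> T (Suc n) (\<lambda>_ y. norm (h y)) y" by (rule norm_twisted_T_le[OF gh y])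
    also have "\<dots> \<le> T (Suc n) (\<lambda>_. e) y"
      by (intro T_mono y he) (auto simp: case_prod_unfold intro!: bnd_norm bnd_compose[OF bh] bnd_compose[OF be])
    finally show "norm (twisted_T \<xi> (Suc n) h y) \<le> T (Suc n) (\<lambda>_. e) y" .
  next
    have "bnd (T (Suc n) (\<lambda>_. e))" by (intro bnd_T) (auto simp: case_prod_unfold intro!: bnd_compose[OF be])
    then show "bnd (\<lambda>(x, y). T (Suc n) (\<lambda>_. e) y)" by (auto simp: case_prod_unfold dest: bnd_compose[where g = snd])
    show "bnd (\<lambda>(x, y). norm (twisted_T \<xi> (Suc n) h y))" by (auto simp: case_prod_unfold intro!: bnd_norm bnd_compose[OF bLh])
  qed (auto simp: x)
  also have "\<dots> = (\<integral>z. q n x z * e z \<partial>\<mu> (Suc (Suc n)))" using T_T[OF em be x] by simp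
  also have "\<dots> = G * (\<integral>z. q n x z \<partial>\<mu> (Suc (Suc n))) - G * \<epsilon> / 2 * (\<integral>z. q n x z * hexagon_from \<xi> (Suc (Suc n)) z \<partial>\<mu> (Suc (Suc n)))"
  proof -
    have i: "integrable (\<mu> (Suc (Suc n))) (\<lambda>z. q n x z)" "integrable (\<mu> (Suc (Suc n))) (\<lambda>z. q n x z * hexagon_from \<xi> (Suc (Suc n)) z)"
      by (auto intro!: mu.integrable_bnd bnd_mult)
    have "(\<integral>z. q n x z * e z \<partial>\<mu> (Suc (Suc n))) = (\<integral>z. G * q n x z - G * \<epsilon> / 2 * (q n x z * hexagon_from \<xi> (Suc (Suc n)) z) \<partial>\<mu> (Suc (Suc n)))"
      unfolding e_def by (intro Bochner_Integration.integral_cong refl) (simp add: algebra_simps)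
    then show ?thesis using i by simp
  qed
  also have "\<dots> \<le> G - G * \<epsilon> / 2 * (\<epsilon> * hexagon_moment \<xi> (Suc (Suc n)))"
  proof -
    have "\<epsilon> * hexagon_moment \<xi> (Suc (Suc n)) = (\<integral>z. \<epsilon> * hexagon_from \<xi> (Suc (Suc n)) z \<partial>\<mu> (Suc (Suc n)))" unfolding hexagon_moment_def by simp
    also have "\<dots> \<le> (\<integral>z. q n x z * hexagon_from \<xi> (Suc (Suc n)) z \<partial>\<mu> (Suc (Suc n)))"
      by (intro integral_mono mu.integrable_bnd bnd_mult mult_right_mono q_ge hexagon_from_nonneg x) auto
    finally have "G * \<epsilon> / 2 * (\<epsilon> * hexagon_moment \<xi> (Suc (Suc n))) \<le> G * \<epsilon> / 2 * (\<integral>z. q n x z * hexagon_from \<xi> (Suc (Suc n)) z \<partial>\<mu> (Suc (Suc n)))"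
      using G0 eps_pos by (intro mult_left_mono) auto
    then show ?thesis using x by (simp add: q_integral)
  qed
  finally show ?thesis unfolding h_def by (simp add: algebra_simps power2_eq_square)
qed

section \<open>The characteristic function as an iterated twisted operator\<close>

primrec char_back :: "real \<Rightarrow> nat \<Rightarrow> nat \<Rightarrow> 'b \<Rightarrow> complex" where
  "char_back \<xi> N 0 = (\<lambda>_. 1)"
| "char_back \<xi> N (Suc k) = twisted_T \<xi> (N - Suc k) (char_back \<xi> N k)"

definition char_from :: "real \<Rightarrow> nat \<Rightarrow> nat \<Rightarrow> 'b \<Rightarrow> complex" where
  "char_from \<xi> N n = char_back \<xi> N (N - n)"

lemma char_from_step: "n < N \<Longrightarrow> char_from \<xi> N n = twisted_T \<xi> n (char_from \<xi> N (Suc n))"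
proof -
  assume n: "n < N"
  then have "N - n = Suc (N - Suc n)" "N - Suc (N - Suc n) = n" by auto
  then show ?thesis unfolding char_from_def by simp
qed

lemma char_from_N: "char_from \<xi> N N = (\<lambda>_. 1)"
  unfolding char_from_def by simp

lemma bounded_measurable_char_from: "n \<le> N \<Longrightarrow> bounded_measurable n (char_from \<xi> N n)"
proof (induction n rule: inc_induct)
  case base
  show ?case by (simp add: char_from_N bounded_measurable_def)
next
  case (step n)
  then show ?case by (simp add: char_from_step bounded_measurable_twisted_T)
qed

lemma char_psum_char_from:
  assumes "n \<le> N"
  shows "(\<integral>\<omega>. iexp (\<xi> * psum f N \<omega>) \<partial>M) = (\<integral>\<omega>. iexp (\<xi> * psum f n \<omega>) * char_from \<xi> N n (X n \<omega>) \<partial>M)"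
  using assms
proof (induction n rule: inc_induct)
  case base
  show ?case by (simp add: char_from_N)
next
  case (step n)
  have gm [measurable]: "char_from \<xi> N (Suc n) \<in> borel_measurable (\<mu> (Suc n))" and gb: "bnd (char_from \<xi> N (Suc n))"
    using bounded_measurable_char_from[of "Suc n" N] step unfolding bounded_measurable_def by auto
  have H: "(\<lambda>\<omega>. iexp (\<xi> * psum f n \<omega>)) \<in> borel_measurable (F n)"
  proof -
    have "(\<lambda>\<omega>. psum f n \<omega>) \<in> borel_measurable (F n)"
      unfolding psum_def by (intro borel_measurable_sum F_pair_measurable functionalD[OF fnl]) auto
    then show ?thesis by measurable
  qed
  have m: "(\<lambda>(x, y). iexp (\<xi> * f n x y) * char_from \<xi> N (Suc n) y) \<in> borel_measurable (\<mu> n \<Otimes>\<^sub>M \<mu> (Suc n))" by measurable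
  have b: "bnd (\<lambda>(x, y). iexp (\<xi> * f n x y) * char_from \<xi> N (Suc n) y)"
    unfolding case_prod_unfold by (intro bnd_mult bnd_iexp bnd_compose[OF gb])
  have "(\<integral>\<omega>. iexp (\<xi> * psum f N \<omega>) \<partial>M)
     = (\<integral>\<omega>. iexp (\<xi> * psum f n \<omega>) * (iexp (\<xi> * f n (X n \<omega>) (X (Suc n) \<omega>)) * char_from \<xi> N (Suc n) (X (Suc n) \<omega>)) \<partial>M)"
    unfolding step.IH by (intro Bochner_Integration.integral_cong refl) (simp add: psum_def algebra_simps exp_add)
  also have "\<dots> = (\<integral>\<omega>. iexp (\<xi> * psum f n \<omega>) * char_from \<xi> N n (X n \<omega>) \<partial>M)"
    unfolding char_from_step[OF step(2)] twisted_T_def by (rule markov_complex[OF H bnd_iexp m b])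
  finally show ?case .
qed

text \<open>The first two steps are lost because the contraction estimate precedes every hexagon, which occupies the three steps
  from \<open>n + 2\<close> on, by a two-step transition.\<close>

definition hexagon_sum :: "real \<Rightarrow> nat \<Rightarrow> real" where
  "hexagon_sum \<xi> N = (\<Sum>n<N - 4. hexagon_moment \<xi> (n + 2))"

text \<open>The supremum norms \<open>B n\<close> gain the factor of one hexagon moment over each
  window of five steps. Disjoint windows would use only every fifth moment; the overlapping windows
  are combined by multiplying five consecutive norms. The final fifth root turns \<epsilon>^2/2 into
  \<epsilon>^2/10.\<close>

lemma char_psum_le: "norm (\<integral>\<omega>. iexp (\<xi> * psum f N \<omega>) \<partial>M) \<le> exp (- (\<epsilon>\<^sup>2 / 10 * hexagon_sum \<xi> N))"
proof -
  define c where "c = \<epsilon>\<^sup>2 / 2"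
  define B where "B n = (SUP x\<in>space (\<mu> n). norm (char_from \<xi> N n x))" for n
  have bdd: "bdd_above ((\<lambda>x. norm (char_from \<xi> N n x)) ` space (\<mu> n))" if n: "n \<le> N" for n
  proof -
    obtain C where "\<And>x. norm (char_from \<xi> N n x) \<le> C"
      using bounded_measurable_char_from[OF n] bnd_bound unfolding bounded_measurable_def by metis
    then show ?thesis by (intro bdd_aboveI2[where M = C]) blast
  qed
  have ne: "space (\<mu> n) \<noteq> {}" for n by (rule mu.not_empty)
  have Bu: "norm (char_from \<xi> N n x) \<le> B n" if "n \<le> N" "x \<in> space (\<mu> n)" for n x
    unfolding B_def by (rule cSUP_upper[OF that(2) bdd[OF that(1)]])
  have B0: "0 \<le> B n" if "n \<le> N" for n
  proof -
    obtain x where "x \<in> space (\<mu> n)" using ne by blast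
    from Bu[OF that this] show ?thesis using norm_ge_zero order_trans by blast
  qed
  have Bmono: "B n \<le> B (Suc n)" if n: "n < N" for n
    unfolding B_def[of n]
  proof (rule cSUP_least[OF ne])
    fix x assume x: "x \<in> space (\<mu> n)"
    have gd: "bounded_measurable (Suc n) (char_from \<xi> N (Suc n))" using n by (intro bounded_measurable_char_from) auto
    have "norm (char_from \<xi> N n x) \<le> T n (\<lambda>_ y. norm (char_from \<xi> N (Suc n) y)) x"
      unfolding char_from_step[OF n] by (rule norm_twisted_T_le[OF gd x])
    also have "\<dots> \<le> T n (\<lambda>_ _. B (Suc n)) x"
      using gd n unfolding bounded_measurable_def
      by (intro T_mono x Bu) (auto simp: case_prod_unfold intro!: bnd_norm dest: bnd_compose[where g = snd])
    also have "\<dots> = B (Suc n)" using x by (rule T_const)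
    finally show "norm (char_from \<xi> N n x) \<le> B (Suc n)" .
  qed
  have Bmono': "B m \<le> B n" if "m \<le> n" "n \<le> N" for m n
    using that by (induction n rule: dec_induct) (use Bmono in \<open>auto intro: order_trans\<close>)
  have BN: "B N = 1" unfolding B_def char_from_N using ne by simp
  have B1: "B n \<le> 1" if "n \<le> N" for n using Bmono'[OF that] BN by simp
  have B5: "B n \<le> exp (- (c * hexagon_moment \<xi> (n + 2))) * B (n + 5)" if n: "n + 5 \<le> N" for n
  proof -
    have s: "n + 5 = Suc (Suc (Suc (Suc (Suc n))))" "n + 2 = Suc (Suc n)" by simp_all
    have "B n \<le> B (n + 5) * (1 - c * hexagon_moment \<xi> (n + 2))"
      unfolding B_def[of n]
    proof (rule cSUP_least[OF ne])
      fix x assume x: "x \<in> space (\<mu> n)"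
      have e: "char_from \<xi> N n = twisted_T \<xi> n (twisted_T \<xi> (Suc n) (twisted_T \<xi> (Suc (Suc n)) (twisted_T \<xi> (Suc (Suc (Suc n))) (twisted_T \<xi> (Suc (Suc (Suc (Suc n)))) (char_from \<xi> N (n + 5))))))"
        using n by (simp add: char_from_step eval_nat_numeral)
      show "norm (char_from \<xi> N n x) \<le> B (n + 5) * (1 - c * hexagon_moment \<xi> (n + 2))"
        unfolding e c_def using bounded_measurable_char_from[OF n] Bu[OF n] B0[OF n] x unfolding s by (intro twisted_T_five_le) auto
    qed
    also have "\<dots> \<le> B (n + 5) * exp (- (c * hexagon_moment \<xi> (n + 2)))"
      using B0[OF n] exp_ge_add_one_self[of "- (c * hexagon_moment \<xi> (n + 2))"] by (intro mult_left_mono) auto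
    finally show ?thesis by (simp add: mult.commute)
  qed
  \<comment> \<open>Passing from \<open>P m\<close> to \<open>P (Suc m)\<close> exchanges only the
    factor \<open>B m\<close> for \<open>B (m + 5)\<close>, so exactly one hexagon moment is gained
    per unit of time.\<close>
  define P where "P n = B n * B (n + 1) * B (n + 2) * B (n + 3) * B (n + 4)" for n
  have P0: "P 0 \<le> exp (- (c * (\<Sum>n<m. hexagon_moment \<xi> (n + 2)))) * P m" if "m + 4 \<le> N" for m
    using that
  proof (induction m)
    case (Suc m)
    then have m: "m + 5 \<le> N" by simp
    let ?r = "B (m + 1) * B (m + 2) * B (m + 3) * B (m + 4)"
    have r: "0 \<le> ?r" using m by (intro mult_nonneg_nonneg B0) auto
    have "P m \<le> exp (- (c * hexagon_moment \<xi> (m + 2))) * P (Suc m)"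
      using mult_right_mono[OF B5[OF m] r] unfolding P_def by (simp add: algebra_simps eval_nat_numeral)
    then have "exp (- (c * (\<Sum>n<m. hexagon_moment \<xi> (n + 2)))) * P m
       \<le> exp (- (c * (\<Sum>n<m. hexagon_moment \<xi> (n + 2)))) * (exp (- (c * hexagon_moment \<xi> (m + 2))) * P (Suc m))"
      by (intro mult_left_mono) auto
    also have "\<dots> = exp (- (c * (\<Sum>n<Suc m. hexagon_moment \<xi> (n + 2)))) * P (Suc m)"
      by (simp add: algebra_simps flip: exp_add)
    finally show ?case using Suc by simp
  qed simp
  have main: "B 0 \<le> exp (- (\<epsilon>\<^sup>2 / 10 * hexagon_sum \<xi> N))"
  proof (cases "4 \<le> N")
    case True
    have "B 0 ^ 5 \<le> P 0"
    proof -
      have "B 0 * B 0 * B 0 * B 0 * B 0 \<le> P 0"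
        unfolding P_def using True by (intro mult_mono Bmono' mult_nonneg_nonneg B0) auto
      then show ?thesis by (simp add: eval_nat_numeral)
    qed
    also have "\<dots> \<le> exp (- (c * hexagon_sum \<xi> N)) * P (N - 4)" unfolding hexagon_sum_def using True by (intro P0) auto
    also have "\<dots> \<le> exp (- (c * hexagon_sum \<xi> N)) * (1 * 1 * 1 * 1 * 1)"
      unfolding P_def using True by (intro mult_left_mono mult_mono B1 B0 mult_nonneg_nonneg) auto
    also have "\<dots> = exp (- (\<epsilon>\<^sup>2 / 10 * hexagon_sum \<xi> N)) ^ 5" unfolding c_def by (simp flip: exp_of_nat_mult)
    finally show ?thesis by (rule power_le_imp_le_base[of _ 4, simplified]) simp
  next
    case False
    then show ?thesis unfolding hexagon_sum_def using B1[of 0] by simp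
  qed
  have "norm (\<integral>\<omega>. iexp (\<xi> * psum f N \<omega>) \<partial>M) = norm (\<integral>\<omega>. char_from \<xi> N 0 (X 0 \<omega>) \<partial>M)"
    using char_psum_char_from[of 0 N] by (simp add: psum_def)
  also have "\<dots> \<le> B 0" using B0[of 0] by (intro norm_integral_le Bu X_space) auto
  finally show ?thesis using main by simp
qed

end

section \<open>Phases and the ladder estimate\<close>

text \<open>\<open>Arg\<close> jumps across the closed negative real axis, but takes only the values
  0 and pi there and is continuous elsewhere; the two pieces are glued.\<close>

lemma Arg_measurable [measurable]: "Arg \<in> borel_measurable borel"
proof -
  have eq: "Arg = (\<lambda>z. if z \<in> \<real>\<^sub>\<le>\<^sub>0 then (if z = 0 then 0 else pi) else Arg z)"
    by (auto simp: fun_eq_iff Arg_zero elim!: nonpos_Reals_cases)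
  have [measurable]: "(\<real>\<^sub>\<le>\<^sub>0 :: complex set) \<in> sets borel"
    by (intro borel_closed closed_nonpos_Reals_complex)
  have "(\<lambda>z. if z \<in> \<real>\<^sub>\<le>\<^sub>0 then (if z = 0 then 0 else pi) else Arg z) \<in> borel_measurable borel"
  proof (subst measurable_If_restrict_space_iff)
    have m1: "Arg \<in> borel_measurable (restrict_space borel {x :: complex. x \<notin> \<real>\<^sub>\<le>\<^sub>0})"
      by (intro borel_measurable_continuous_on_restrict continuous_at_imp_continuous_on) (auto intro!: continuous_at_Arg)
    have m2: "(\<lambda>z :: complex. if z = 0 then 0 else pi) \<in> borel_measurable borel"
      by (intro measurable_If) auto
    show "(\<lambda>z. if z = 0 then 0 else pi) \<in> borel_measurable (restrict_space borel {x :: complex. x \<in> \<real>\<^sub>\<le>\<^sub>0}) \<and>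
      Arg \<in> borel_measurable (restrict_space borel {x :: complex. x \<notin> \<real>\<^sub>\<le>\<^sub>0})"
      by (rule conjI[OF measurable_restrict_space1[OF m2] m1])
  qed simp
  then show ?thesis using eq by simp
qed

lemma one_minus_cos_ge:
  fixes x :: real
  assumes "\<bar>x\<bar> \<le> 1" shows "x\<^sup>2 / 3 \<le> 1 - cos x"
proof -
  have "\<bar>Re (iexp x - (1 + \<i> * x - x\<^sup>2 / 2))\<bar> \<le> \<bar>x\<bar> ^ 3 / 6"
    using order_trans[OF abs_Re_le_cmod iexp_approx_quadratic] .
  moreover have "Re (iexp x - (1 + \<i> * x - x\<^sup>2 / 2)) = cos x - 1 + x\<^sup>2 / 2"
    by (simp add: Re_exp power2_eq_square)
  moreover have "\<bar>x\<bar> ^ 3 \<le> x\<^sup>2"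
  proof -
    have "\<bar>x\<bar> * x\<^sup>2 \<le> 1 * x\<^sup>2" using assms by (intro mult_right_mono) auto
    then show ?thesis by (simp add: power3_eq_cube power2_eq_square mult.assoc)
  qed
  ultimately show ?thesis unfolding abs_le_iff by linarith
qed

text \<open>The constant is 48 = 16 * 3: for \<open>\<bar>x\<bar>\<close> above 1 the cosine defect
  is at least 1/3, and the square is below 16 because pi < 4.\<close>

lemma square_le_one_minus_cos:
  fixes x :: real
  assumes "\<bar>x\<bar> \<le> pi" shows "x\<^sup>2 \<le> 48 * (1 - cos x)"
proof (cases "\<bar>x\<bar> \<le> 1")
  case True
  then show ?thesis using one_minus_cos_ge[OF True] zero_le_power2[of x] unfolding right_diff_distrib by linarith
next
  case False
  have "cos x = cos \<bar>x\<bar>" by simp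
  also have "\<dots> \<le> cos 1" using False assms by (intro cos_monotone_0_pi_le) auto
  finally have "1 / 3 \<le> 1 - cos x" using one_minus_cos_ge[of 1] by simp
  moreover have "x\<^sup>2 \<le> 16"
    using power_mono[of "\<bar>x\<bar>" 4 2] assms pi_less_4 by simp
  ultimately show ?thesis unfolding right_diff_distrib by linarith
qed

lemma one_minus_cos_le: "1 - cos x \<le> x\<^sup>2 / 2" for x :: real
proof -
  have "cos x = 1 - 2 * (sin (x / 2))\<^sup>2" using cos_double_sin[of "x / 2"] by simp
  moreover have "(sin (x / 2))\<^sup>2 \<le> (x / 2)\<^sup>2"
    using abs_sin_x_le_abs_x[of "x / 2"] by (simp only: abs_le_square_iff)
  ultimately show ?thesis by (simp add: power_divide)
qed

text \<open>The representative of \<open>t\<close> modulo 2 pi in the interval from -pi to pi, that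
  is, the signed distance to a nearest multiple of 2 pi.\<close>

definition circ :: "real \<Rightarrow> real" where
  "circ t = t - 2 * pi * round (t / (2 * pi))"

lemma abs_circ_le: "\<bar>circ t\<bar> \<le> pi"
proof -
  have "circ t = - (2 * pi) * (round (t / (2 * pi)) - t / (2 * pi))" unfolding circ_def by (simp add: field_simps)
  then have "\<bar>circ t\<bar> = 2 * pi * \<bar>round (t / (2 * pi)) - t / (2 * pi)\<bar>" by (simp add: abs_mult)
  also have "\<dots> \<le> 2 * pi * (1 / 2)" by (intro mult_left_mono of_int_round_abs_le) auto
  finally show ?thesis by simp
qed

lemma cos_circ: "cos (circ t) = cos t"
  unfolding circ_def by (simp add: cos_diff sin_int_2pin cos_int_2pin)

lemma circ_eq_self: "\<bar>t\<bar> \<le> 1 \<Longrightarrow> circ t = t"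
proof -
  assume "\<bar>t\<bar> \<le> 1"
  then have "\<bar>t / (2 * pi)\<bar> < 1 / 2" using pi_gt3 by (simp add: abs_divide field_simps)
  then have "round (t / (2 * pi)) = 0" by (intro round_unique') simp
  then show ?thesis unfolding circ_def by simp
qed

lemma circ_measurable [measurable]: "circ \<in> borel_measurable borel"
  unfolding circ_def[abs_def] round_def by measurable

lemma circ_square_le: "(circ t)\<^sup>2 \<le> 48 * (1 - cos t)"
  using square_le_one_minus_cos[OF abs_circ_le, of t] by (simp add: cos_circ)

text \<open>The averaged phase defect between two families controls the defect between their mean
  phases. The double integral is \<open>?q1 * ?q2 - r1 * r2 * g\<close>, where \<open>r1\<close>,
  \<open>r2\<close> are the moduli of the averages and \<open>g\<close> is the cosine of the
  difference of mean phases. For \<open>g \<ge> 0\<close> the moduli are replaced by the masses; for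
  \<open>g < 0\<close> the subtracted term only helps, and \<open>1 - g\<close> is at most 2. The
  masses are at least \<open>e\<close>.\<close>

lemma two_phase_bound:
  fixes A :: "'a measure" and B :: "'c measure"
  assumes A: "prob_space A" and B: "prob_space B"
    and w1 [measurable]: "w1 \<in> borel_measurable A" and w2 [measurable]: "w2 \<in> borel_measurable B"
    and s1 [measurable]: "s1 \<in> borel_measurable A" and s2 [measurable]: "s2 \<in> borel_measurable B"
    and b: "bnd w1" "bnd w2" and nn: "\<And>x. 0 \<le> w1 x" "\<And>y. 0 \<le> w2 y"
    and q1: "e \<le> (\<integral>x. w1 x \<partial>A)" and q2: "e \<le> (\<integral>y. w2 y \<partial>B)" and e: "0 \<le> e"
  defines "M1 \<equiv> (\<integral>x. w1 x *\<^sub>R iexp (s1 x) \<partial>A)" and "M2 \<equiv> (\<integral>y. w2 y *\<^sub>R iexp (s2 y) \<partial>B)"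
  shows "e\<^sup>2 * (1 - cos (Arg M1 + t - Arg M2)) \<le> 2 * (\<integral>x. \<integral>y. w1 x * w2 y * (1 - cos (s1 x + t - s2 y)) \<partial>B \<partial>A)"
proof -
  interpret A: prob_space A by fact
  interpret B: prob_space B by fact
  have fB: "finite_measure B" by unfold_locales
  have fA: "finite_measure A" by unfold_locales
  let ?q1 = "\<integral>x. w1 x \<partial>A" and ?q2 = "\<integral>y. w2 y \<partial>B"
  have bs: "bnd (\<lambda>x. sin (g x :: real))" for g :: "'z \<Rightarrow> real" by (rule bndI[of _ 1]) simp
  have iA: "integrable A (\<lambda>x. w1 x *\<^sub>R iexp (s1 x))" "integrable A w1" "integrable A (\<lambda>x. w1 x * cos (s1 x))"
    "integrable A (\<lambda>x. w1 x * sin (s1 x))"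
    by (intro A.integrable_bnd bnd_intros bs b; measurable)+
  have iB: "integrable B (\<lambda>x. w2 x *\<^sub>R iexp (s2 x))" "integrable B w2" "integrable B (\<lambda>x. w2 x * cos (s2 x))"
    "integrable B (\<lambda>x. w2 x * sin (s2 x))"
    by (intro B.integrable_bnd bnd_intros bs b; measurable)+
  define C1 where "C1 = (\<integral>x. w1 x * cos (s1 x) \<partial>A)"
  define S1 where "S1 = (\<integral>x. w1 x * sin (s1 x) \<partial>A)"
  define C2 where "C2 = (\<integral>x. w2 x * cos (s2 x) \<partial>B)"
  define S2 where "S2 = (\<integral>x. w2 x * sin (s2 x) \<partial>B)"
  have M1: "Re M1 = C1" "Im M1 = S1"
    unfolding M1_def C1_def S1_def by (subst integral_Re[symmetric, OF iA(1)] integral_Im[symmetric, OF iA(1)], simp add: Re_exp Im_exp)+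
  have M2: "Re M2 = C2" "Im M2 = S2"
    unfolding M2_def C2_def S2_def by (subst integral_Re[symmetric, OF iB(1)] integral_Im[symmetric, OF iB(1)], simp add: Re_exp Im_exp)+
  have inner: "(\<integral>y. w1 x * w2 y * (1 - cos (s1 x + t - s2 y)) \<partial>B)
    = w1 x * ?q2 - (w1 x * cos (s1 x)) * (cos t * C2 + sin t * S2) - (w1 x * sin (s1 x)) * (cos t * S2 - sin t * C2)" for x
  proof -
    have "(\<integral>y. w1 x * w2 y * (1 - cos (s1 x + t - s2 y)) \<partial>B)
      = (\<integral>y. w1 x * w2 y - (w1 x * cos (s1 x) * cos t) * (w2 y * cos (s2 y)) + (w1 x * sin (s1 x) * sin t) * (w2 y * cos (s2 y))
          - (w1 x * sin (s1 x) * cos t) * (w2 y * sin (s2 y)) - (w1 x * cos (s1 x) * sin t) * (w2 y * sin (s2 y)) \<partial>B)"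
      by (intro Bochner_Integration.integral_cong refl) (simp add: cos_diff cos_add sin_add algebra_simps)
    also have "\<dots> = w1 x * ?q2 - (w1 x * cos (s1 x) * cos t) * C2 + (w1 x * sin (s1 x) * sin t) * C2
        - (w1 x * sin (s1 x) * cos t) * S2 - (w1 x * cos (s1 x) * sin t) * S2"
      using iB unfolding C2_def S2_def by simp
    finally show ?thesis by (simp add: algebra_simps)
  qed
  have I: "(\<integral>x. \<integral>y. w1 x * w2 y * (1 - cos (s1 x + t - s2 y)) \<partial>B \<partial>A)
    = ?q1 * ?q2 - C1 * (cos t * C2 + sin t * S2) - S1 * (cos t * S2 - sin t * C2)"
    unfolding inner using iA unfolding C1_def S1_def by simp
  define r1 where "r1 = cmod M1"
  define r2 where "r2 = cmod M2"
  have p1: "C1 = r1 * cos (Arg M1)" "S1 = r1 * sin (Arg M1)"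
    using rcis_cmod_Arg[of M1] unfolding r1_def M1[symmetric] by (metis Re_rcis Im_rcis)+
  have p2: "C2 = r2 * cos (Arg M2)" "S2 = r2 * sin (Arg M2)"
    using rcis_cmod_Arg[of M2] unfolding r2_def M2[symmetric] by (metis Re_rcis Im_rcis)+
  define g where "g = cos (Arg M1 + t - Arg M2)"
  have I': "(\<integral>x. \<integral>y. w1 x * w2 y * (1 - cos (s1 x + t - s2 y)) \<partial>B \<partial>A) = ?q1 * ?q2 - r1 * r2 * g"
    unfolding I p1 p2 g_def by (simp add: cos_diff cos_add sin_add algebra_simps)
  have "r1 \<le> (\<integral>x. norm (w1 x *\<^sub>R iexp (s1 x)) \<partial>A)" unfolding r1_def M1_def by (rule integral_norm_bound)
  also have "\<dots> = ?q1" using nn by simp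
  finally have r1: "r1 \<le> ?q1" .
  have "r2 \<le> (\<integral>x. norm (w2 x *\<^sub>R iexp (s2 x)) \<partial>B)" unfolding r2_def M2_def by (rule integral_norm_bound)
  also have "\<dots> = ?q2" using nn by simp
  finally have r2: "r2 \<le> ?q2" .
  have r0: "0 \<le> r1" "0 \<le> r2" unfolding r1_def r2_def by auto
  have rq: "r1 * r2 \<le> ?q1 * ?q2" using r1 r2 r0 by (intro mult_mono) auto
  have eq: "e\<^sup>2 \<le> ?q1 * ?q2" unfolding power2_eq_square using q1 q2 e by (intro mult_mono) auto
  have g1: "-1 \<le> g" "g \<le> 1" unfolding g_def by auto
  have "e\<^sup>2 * (1 - g) \<le> 2 * (?q1 * ?q2 - r1 * r2 * g)"
  proof (cases "0 \<le> g")
    case True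
    have "r1 * r2 * g \<le> ?q1 * ?q2 * g" using True rq by (intro mult_right_mono) auto
    moreover have "e\<^sup>2 * (1 - g) \<le> ?q1 * ?q2 * (1 - g)" using g1 eq by (intro mult_right_mono) auto
    moreover have "0 \<le> e\<^sup>2 * (1 - g)" using g1 by simp
    ultimately show ?thesis by (simp add: algebra_simps)
  next
    case False
    have "e\<^sup>2 * (1 - g) \<le> e\<^sup>2 * 2" using g1 by (intro mult_left_mono) auto
    moreover have "r1 * r2 * g \<le> 0" using False r0 by (intro mult_nonneg_nonpos) auto
    moreover have "a \<le> 2 * (q - r)" if "a \<le> s * 2" "r \<le> 0" "s \<le> q" for a q r s :: real using that unfolding right_diff_distrib by linarith
    ultimately show ?thesis using eq by blast
  qed
  then show ?thesis unfolding I' g_def .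
qed

context bounded_functional begin

text \<open>The amplitude of the two-step passage from \<open>x\<close> to \<open>v\<close>,
  averaged over the midpoint. Its argument serves as the phase accumulated on the way; its total
  weight is at least \<epsilon>.\<close>

definition twist :: "real \<Rightarrow> nat \<Rightarrow> 'b \<Rightarrow> 'b \<Rightarrow> complex" where
  "twist \<xi> n x v = (\<integral>u. (p n x u * p (Suc n) u v) *\<^sub>R iexp (\<xi> * (f n x u + f (Suc n) u v)) \<partial>\<mu> (Suc n))"

lemma twist_measurable [measurable (raw)]:
  assumes [measurable]: "g1 \<in> A \<rightarrow>\<^sub>M \<mu> n" "g2 \<in> A \<rightarrow>\<^sub>M \<mu> (Suc (Suc n))"
  shows "(\<lambda>w. twist \<xi> n (g1 w) (g2 w)) \<in> borel_measurable A"
  unfolding twist_def by measurable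

text \<open>The transition density \<open>p n x u'\<close> is split off from the second path of the hexagon, because
  \<open>u'\<close> will be sampled together with \<open>x\<close> along a fixed trajectory of the chain.\<close>

definition half_hexagon :: "real \<Rightarrow> nat \<Rightarrow> 'b \<Rightarrow> 'b \<Rightarrow> 'b \<Rightarrow> 'b \<Rightarrow> 'b \<Rightarrow> 'b \<Rightarrow> real" where
  "half_hexagon \<xi> n x u' v z u v' = path_weight n x u v z * (p (Suc n) u' v' * p (Suc (Suc n)) v' z)
    * (1 - cos (\<xi> * (path_sum n x u v z - path_sum n x u' v' z)))"

lemma half_hexagon_nonneg: "0 \<le> half_hexagon \<xi> n x u' v z u v'"
  unfolding half_hexagon_def by (simp add: path_weight_nonneg p_nonneg)

lemma bnd_half_hexagon [simp]: "bnd (\<lambda>w. half_hexagon \<xi> n (g1 w) (g2 w) (g3 w) (g4 w) (g5 w) (g6 w))"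
  unfolding half_hexagon_def by (intro bnd_intros bnd_path_weight bnd_p)

lemma half_hexagon_measurable [measurable (raw)]:
  assumes [measurable]: "g1 \<in> A \<rightarrow>\<^sub>M \<mu> n" "g2 \<in> A \<rightarrow>\<^sub>M \<mu> (Suc n)"
    "g3 \<in> A \<rightarrow>\<^sub>M \<mu> (Suc (Suc n))" "g4 \<in> A \<rightarrow>\<^sub>M \<mu> (Suc (Suc (Suc n)))" "g5 \<in> A \<rightarrow>\<^sub>M \<mu> (Suc n)" "g6 \<in> A \<rightarrow>\<^sub>M \<mu> (Suc (Suc n))"
  shows "(\<lambda>w. half_hexagon \<xi> n (g1 w) (g2 w) (g3 w) (g4 w) (g5 w) (g6 w)) \<in> borel_measurable A"
  unfolding half_hexagon_def by measurable

lemma hexagon_eq: "hexagon \<xi> n x z u v u' v' = p n x u' * half_hexagon \<xi> n x u' v z u v'"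
  unfolding hexagon_def half_hexagon_def by (simp add: path_weight_def[of n x u'] mult_ac)

text \<open>The hexagon defect conditional on the first edge \<open>(x, u')\<close> of the second
  path. That edge will be read off a trajectory, while the remaining four vertices are integrated
  out.\<close>

definition err :: "real \<Rightarrow> nat \<Rightarrow> 'b \<Rightarrow> 'b \<Rightarrow> real" where
  "err \<xi> n x u' = (\<integral>v. \<integral>z. \<integral>u. \<integral>v'. half_hexagon \<xi> n x u' v z u v'
     \<partial>\<mu> (Suc (Suc n)) \<partial>\<mu> (Suc n) \<partial>\<mu> (Suc (Suc (Suc n))) \<partial>\<mu> (Suc (Suc n)))"

lemma err_nonneg: "0 \<le> err \<xi> n x u'"
  unfolding err_def by (simp add: half_hexagon_nonneg)

lemma bnd_err [simp]: "bnd (\<lambda>w. err \<xi> n (g1 w) (g2 w))"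
  unfolding err_def
  by (intro mu.bnd_integral, unfold case_prod_unfold)+ (rule bnd_half_hexagon)

lemma err_measurable [measurable (raw)]:
  assumes [measurable]: "g1 \<in> A \<rightarrow>\<^sub>M \<mu> n" "g2 \<in> A \<rightarrow>\<^sub>M \<mu> (Suc n)"
  shows "(\<lambda>w. err \<xi> n (g1 w) (g2 w)) \<in> borel_measurable A"
  unfolding err_def by measurable

text \<open>Only the order of the five integrations changes, \<open>u'\<close> being moved outermost
  so that its factor \<open>p n x u'\<close> can be pulled out. This is what makes the expectation
  of \<open>err\<close> along the chain comparable to the hexagon moment.\<close>

lemma hexagon_from_eq_err:
  assumes x [measurable]: "x \<in> space (\<mu> n)"
  shows "hexagon_from \<xi> n x = (\<integral>u'. p n x u' * err \<xi> n x u' \<partial>\<mu> (Suc n))"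
proof -
  let ?h = "hexagon \<xi> n x"
  let ?A = "\<mu> (Suc n)" and ?B = "\<mu> (Suc (Suc n))" and ?C = "\<mu> (Suc (Suc (Suc n)))"
  note bi = mu.bnd_integral[unfolded case_prod_unfold] rho.bnd_integral[unfolded case_prod_unfold]
  note fub = Fubini_bnd(1)[OF mu_finite mu_finite]
  have "hexagon_from \<xi> n x = (\<integral>z. \<integral>b. \<integral>u'. \<integral>v'. ?h z (fst b) (snd b) u' v' \<partial>?B \<partial>?A \<partial>rho n \<partial>?C)"
    unfolding hexagon_from_def hexagon_inner_def
  proof (rule Bochner_Integration.integral_cong[OF refl], rule Bochner_Integration.integral_cong[OF refl])
    fix z b assume z [measurable]: "z \<in> space ?C" and b: "b \<in> space (rho n)"
    have [measurable]: "fst b \<in> space ?A" "snd b \<in> space ?B" using b by (auto simp: space_pair_measure)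
    show "(\<integral>b'. ?h z (fst b) (snd b) (fst b') (snd b') \<partial>rho n) = (\<integral>u'. \<integral>v'. ?h z (fst b) (snd b) u' v' \<partial>?B \<partial>?A)"
      by (rule Fubini_bnd(2)[OF mu_finite mu_finite, symmetric], unfold case_prod_unfold, rule bnd_hexagon) measurable
  qed
  also have "\<dots> = (\<integral>z. \<integral>u'. \<integral>b. \<integral>v'. ?h z (fst b) (snd b) u' v' \<partial>?B \<partial>rho n \<partial>?A \<partial>?C)"
  proof (rule Bochner_Integration.integral_cong[OF refl])
    fix z assume [measurable]: "z \<in> space ?C"
    show "(\<integral>b. \<integral>u'. \<integral>v'. ?h z (fst b) (snd b) u' v' \<partial>?B \<partial>?A \<partial>rho n) = (\<integral>u'. \<integral>b. \<integral>v'. ?h z (fst b) (snd b) u' v' \<partial>?B \<partial>rho n \<partial>?A)"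
      by (rule Fubini_bnd(1)[OF rho.finite_measure_axioms mu_finite], unfold case_prod_unfold, intro bi bnd_hexagon) measurable
  qed
  also have "\<dots> = (\<integral>u'. \<integral>z. \<integral>b. \<integral>v'. ?h z (fst b) (snd b) u' v' \<partial>?B \<partial>rho n \<partial>?C \<partial>?A)"
    by (rule fub, unfold case_prod_unfold, intro bi bnd_hexagon) measurable
  also have "\<dots> = (\<integral>u'. \<integral>z. \<integral>v. \<integral>u. \<integral>v'. ?h z u v u' v' \<partial>?B \<partial>?A \<partial>?B \<partial>?C \<partial>?A)"
  proof (rule Bochner_Integration.integral_cong[OF refl], rule Bochner_Integration.integral_cong[OF refl])
    fix u' z assume [measurable]: "z \<in> space ?C" "u' \<in> space ?A"
    have "(\<integral>b. \<integral>v'. ?h z (fst b) (snd b) u' v' \<partial>?B \<partial>rho n) = (\<integral>u. \<integral>v. \<integral>v'. ?h z u v u' v' \<partial>?B \<partial>?B \<partial>?A)"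
      by (rule Fubini_bnd(2)[OF mu_finite mu_finite, symmetric], unfold case_prod_unfold, intro bi bnd_hexagon) measurable
    also have "\<dots> = (\<integral>v. \<integral>u. \<integral>v'. ?h z u v u' v' \<partial>?B \<partial>?A \<partial>?B)"
      by (rule fub, unfold case_prod_unfold, intro bi bnd_hexagon) measurable
    finally show "(\<integral>b. \<integral>v'. ?h z (fst b) (snd b) u' v' \<partial>?B \<partial>rho n) = (\<integral>v. \<integral>u. \<integral>v'. ?h z u v u' v' \<partial>?B \<partial>?A \<partial>?B)" .
  qed
  also have "\<dots> = (\<integral>u'. \<integral>v. \<integral>z. \<integral>u. \<integral>v'. ?h z u v u' v' \<partial>?B \<partial>?A \<partial>?C \<partial>?B \<partial>?A)"
  proof (rule Bochner_Integration.integral_cong[OF refl])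
    fix u' assume [measurable]: "u' \<in> space ?A"
    show "(\<integral>z. \<integral>v. \<integral>u. \<integral>v'. ?h z u v u' v' \<partial>?B \<partial>?A \<partial>?B \<partial>?C) = (\<integral>v. \<integral>z. \<integral>u. \<integral>v'. ?h z u v u' v' \<partial>?B \<partial>?A \<partial>?C \<partial>?B)"
      by (rule fub, unfold case_prod_unfold, intro bi bnd_hexagon) measurable
  qed
  also have "\<dots> = (\<integral>u'. p n x u' * err \<xi> n x u' \<partial>?A)"
    unfolding err_def hexagon_eq by simp
  finally show ?thesis .
qed

lemma expectation_err:
  assumes "0 < n"
  shows "(\<integral>\<omega>. err \<xi> n (X n \<omega>) (X (Suc n) \<omega>) \<partial>M) \<le> (1 / \<epsilon>) * hexagon_moment \<xi> n"
proof -
  have "(\<integral>\<omega>. err \<xi> n (X n \<omega>) (X (Suc n) \<omega>) \<partial>M) \<le> (1 / \<epsilon>) * (\<integral>x. \<integral>y. p n x y * err \<xi> n x y \<partial>\<mu> (Suc n) \<partial>\<mu> n)"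
    by (rule expectation_pair_le) (auto simp: case_prod_unfold err_nonneg assms)
  also have "(\<integral>x. \<integral>y. p n x y * err \<xi> n x y \<partial>\<mu> (Suc n) \<partial>\<mu> n) = hexagon_moment \<xi> n"
    unfolding hexagon_moment_def by (intro Bochner_Integration.integral_cong refl hexagon_from_eq_err[symmetric])
  finally show ?thesis .
qed

text \<open>For fixed \<open>v\<close> and \<open>z\<close> this is \<open>two_phase_bound\<close>:
  the first family runs over the midpoint \<open>u\<close> between \<open>x\<close> and
  \<open>v\<close>, the second over the midpoint \<open>v'\<close> between \<open>u'\<close> and
  \<open>z\<close>. Two-step averaging gives both families mass at least \<epsilon>. The edges
  \<open>(v, z)\<close> and \<open>(x, u')\<close> complete the hexagon; their phases form the
  offset \<open>t\<close>.\<close>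

lemma ladder_step:
  assumes x [measurable]: "x \<in> space (\<mu> n)" and u' [measurable]: "u' \<in> space (\<mu> (Suc n))"
  shows "(\<integral>v. \<integral>z. p (Suc (Suc n)) v z *
      (1 - cos (\<xi> * f (Suc (Suc n)) v z + Arg (twist \<xi> n x v) - Arg (twist \<xi> (Suc n) u' z) - \<xi> * f n x u'))
      \<partial>\<mu> (Suc (Suc (Suc n))) \<partial>\<mu> (Suc (Suc n))) \<le> 2 / \<epsilon>\<^sup>2 * err \<xi> n x u'"
proof -
  let ?A = "\<mu> (Suc n)" and ?B = "\<mu> (Suc (Suc n))" and ?C = "\<mu> (Suc (Suc (Suc n)))"
  note bi = mu.bnd_integral[unfolded case_prod_unfold]
  let ?l = "\<lambda>v z. p (Suc (Suc n)) v z *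
      (1 - cos (\<xi> * f (Suc (Suc n)) v z + Arg (twist \<xi> n x v) - Arg (twist \<xi> (Suc n) u' z) - \<xi> * f n x u'))"
  let ?r = "\<lambda>v z. 2 / \<epsilon>\<^sup>2 * (\<integral>u. \<integral>v'. half_hexagon \<xi> n x u' v z u v' \<partial>?B \<partial>?A)"
  have "?l v z \<le> ?r v z" if v [measurable]: "v \<in> space ?B" and z [measurable]: "z \<in> space ?C" for v z
  proof -
    define t where "t = \<xi> * f (Suc (Suc n)) v z - \<xi> * f n x u'"
    let ?w1 = "\<lambda>u. p n x u * p (Suc n) u v" and ?w2 = "\<lambda>v'. p (Suc n) u' v' * p (Suc (Suc n)) v' z"
    let ?s1 = "\<lambda>u. \<xi> * (f n x u + f (Suc n) u v)" and ?s2 = "\<lambda>v'. \<xi> * (f (Suc n) u' v' + f (Suc (Suc n)) v' z)"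
    have "\<epsilon>\<^sup>2 * (1 - cos (Arg (twist \<xi> n x v) + t - Arg (twist \<xi> (Suc n) u' z)))
      \<le> 2 * (\<integral>u. \<integral>v'. ?w1 u * ?w2 v' * (1 - cos (?s1 u + t - ?s2 v')) \<partial>?B \<partial>?A)"
      unfolding twist_def using p2_ge[OF x v] p2_ge[OF u' z] eps_pos
      by (intro two_phase_bound) (auto intro!: bnd_mult mult_nonneg_nonneg p_nonneg)
    then have "p (Suc (Suc n)) v z * (\<epsilon>\<^sup>2 * (1 - cos (Arg (twist \<xi> n x v) + t - Arg (twist \<xi> (Suc n) u' z))))
      \<le> p (Suc (Suc n)) v z * (2 * (\<integral>u. \<integral>v'. ?w1 u * ?w2 v' * (1 - cos (?s1 u + t - ?s2 v')) \<partial>?B \<partial>?A))"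
      by (intro mult_left_mono p_nonneg)
    also have "\<dots> = 2 * (\<integral>u. \<integral>v'. p (Suc (Suc n)) v z * (?w1 u * ?w2 v' * (1 - cos (?s1 u + t - ?s2 v'))) \<partial>?B \<partial>?A)"
      by simp
    also have "(\<integral>u. \<integral>v'. p (Suc (Suc n)) v z * (?w1 u * ?w2 v' * (1 - cos (?s1 u + t - ?s2 v'))) \<partial>?B \<partial>?A)
      = (\<integral>u. \<integral>v'. half_hexagon \<xi> n x u' v z u v' \<partial>?B \<partial>?A)"
    proof (intro Bochner_Integration.integral_cong refl)
      fix u v'
      have "?s1 u + t - ?s2 v' = \<xi> * (path_sum n x u v z - path_sum n x u' v' z)" unfolding t_def path_sum_def by (simp add: algebra_simps)
      then show "p (Suc (Suc n)) v z * (?w1 u * ?w2 v' * (1 - cos (?s1 u + t - ?s2 v'))) = half_hexagon \<xi> n x u' v z u v'"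
        unfolding half_hexagon_def path_weight_def by (simp add: mult_ac)
    qed
    finally have "p (Suc (Suc n)) v z * (1 - cos (Arg (twist \<xi> n x v) + t - Arg (twist \<xi> (Suc n) u' z)))
      \<le> 2 / \<epsilon>\<^sup>2 * (\<integral>u. \<integral>v'. half_hexagon \<xi> n x u' v z u v' \<partial>?B \<partial>?A)"
      using eps_pos by (simp add: pos_le_divide_eq mult_ac)
    then show ?thesis unfolding t_def by (simp add: algebra_simps)
  qed
  then have "(\<integral>v. \<integral>z. ?l v z \<partial>?C \<partial>?B) \<le> (\<integral>v. \<integral>z. ?r v z \<partial>?C \<partial>?B)"
    by (intro integral_mono mu.integrable_bnd bi; (intro bnd_intros bnd_p bi bnd_half_hexagon)?; measurable)
  also have "\<dots> = 2 / \<epsilon>\<^sup>2 * err \<xi> n x u'" unfolding err_def by simp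
  finally show ?thesis .
qed

end

section \<open>Second-moment tools for comparing functionals\<close>

context elliptic_chain begin

definition var_const :: real where
  "var_const = 3 + 56 * (1 + 2 / \<epsilon>) / \<epsilon>"

lemma var_const_pos: "0 < var_const"
  unfolding var_const_def using eps_pos by (intro add_pos_nonneg) auto

lemma variance_psum_le:
  assumes fnl: "functional \<Phi>"
  shows "variance (psum \<Phi> N) \<le> var_const * (\<Sum>n<N. energy \<Phi> n)"
proof -
  define \<Psi> where "\<Psi> n x y = (if n < N then \<Phi> n x y else 0)" for n x y
  have zero: "\<And>n x y. N \<le> n \<Longrightarrow> \<Psi> n x y = 0" unfolding \<Psi>_def by simp
  have f\<Psi>: "functional \<Psi>"
    unfolding functional_def \<Psi>_def
  proof (intro allI conjI)
    fix n
    show "(\<lambda>(x, y). if n < N then \<Phi> n x y else 0) \<in> borel_measurable (\<mu> n \<Otimes>\<^sub>M \<mu> (Suc n))"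
      using functionalD(1)[OF fnl] by (cases "n < N") auto
    show "bnd (\<lambda>(x, y). if n < N then \<Phi> n x y else 0)"
      using functionalD(2)[OF fnl] by (cases "n < N") auto
  qed
  have S: "psum \<Phi> N = (\<lambda>\<omega>. \<Sum>n<N. \<Psi> n (X n \<omega>) (X (Suc n) \<omega>))"
    unfolding psum_def \<Psi>_def by (intro ext sum.cong) auto
  have E: "(\<Sum>n<N. energy \<Psi> n) = (\<Sum>n<N. energy \<Phi> n)"
    unfolding energy_def \<Psi>_def by (intro sum.cong) auto
  show ?thesis unfolding S E[symmetric] var_const_def by (rule variance_le[OF f\<Psi>]) (rule zero)
qed

lemma exists_le_expectation:
  fixes Y :: "'w \<Rightarrow> real"
  assumes "bnd Y" "Y \<in> borel_measurable M"
  obtains \<omega> where "\<omega> \<in> space M" "Y \<omega> \<le> expectation Y + 1"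
proof -
  have "\<exists>\<omega>\<in>space M. Y \<omega> \<le> expectation Y + 1"
  proof (rule ccontr)
    assume "\<not> ?thesis"
    then have "(\<integral>\<omega>. expectation Y + 1 \<partial>M) \<le> expectation Y"
      using assms by (intro integral_mono integrable_bnd) auto
    then show False by (simp add: prob_space)
  qed
  then show ?thesis using that by blast
qed

lemma second_moment_shift_le:
  fixes Y Z :: "'w \<Rightarrow> real"
  assumes [measurable]: "Y \<in> borel_measurable M" "Z \<in> borel_measurable M" and b: "bnd Y" "bnd Z"
    and Z: "\<And>\<omega>. \<bar>Z \<omega>\<bar> \<le> c"
  shows "(\<integral>\<omega>. (Y \<omega> + Z \<omega> - expectation Y)\<^sup>2 \<partial>M) \<le> 2 * variance Y + 2 * c\<^sup>2"
proof -
  have i: "integrable M (\<lambda>\<omega>. (Y \<omega> + Z \<omega> - expectation Y)\<^sup>2)" "integrable M (\<lambda>\<omega>. (Y \<omega> - expectation Y)\<^sup>2)"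
    by (intro integrable_bnd bnd_intros b; measurable)+
  have "(\<integral>\<omega>. (Y \<omega> + Z \<omega> - expectation Y)\<^sup>2 \<partial>M) \<le> (\<integral>\<omega>. 2 * (Y \<omega> - expectation Y)\<^sup>2 + 2 * c\<^sup>2 \<partial>M)"
  proof (rule integral_mono)
    fix \<omega>
    have "(a + z - m)\<^sup>2 \<le> 2 * (a - m)\<^sup>2 + 2 * z\<^sup>2" for a z m :: real
    proof -
      have "0 \<le> ((a - m) - z)\<^sup>2" by simp
      then show ?thesis by (simp add: power2_eq_square algebra_simps)
    qed
    moreover have "(Z \<omega>)\<^sup>2 \<le> c\<^sup>2" using power_mono[OF Z, of \<omega> 2] by simp
    ultimately show "(Y \<omega> + Z \<omega> - expectation Y)\<^sup>2 \<le> 2 * (Y \<omega> - expectation Y)\<^sup>2 + 2 * c\<^sup>2"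
      by (meson add_left_mono mult_left_mono order_trans zero_le_numeral)
  qed (use i in auto)
  also have "\<dots> = 2 * variance Y + 2 * c\<^sup>2" using i by (simp add: prob_space)
  finally show ?thesis .
qed

lemma variance_le_shift:
  fixes Y :: "'w \<Rightarrow> real"
  assumes [measurable]: "Y \<in> borel_measurable M" and b: "bnd Y"
  shows "variance Y \<le> (\<integral>\<omega>. (Y \<omega> - a)\<^sup>2 \<partial>M)"
proof -
  have i: "integrable M Y" by (intro integrable_bnd b) measurable
  have "variance Y = (\<integral>\<omega>. ((Y \<omega> - a) - (expectation Y - a))\<^sup>2 \<partial>M)" by simp
  also have "\<dots> \<le> (\<integral>\<omega>. (Y \<omega> - a)\<^sup>2 \<partial>M)"
    using i by (intro centered_square_le bnd_intros b) (auto simp: prob_space)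
  finally show ?thesis .
qed

end

section \<open>The ladder along a reference trajectory\<close>

context bounded_functional begin

text \<open>The ladder: \<open>\<omega>\<close> is a reference trajectory, and \<open>alpha\<close> the phase of the averaged two-step transition from it to \<open>x\<close>.
  If the hexagon moments are summable, then along a suitable \<open>\<omega>\<close> the cohomologous functional \<open>theta\<close> is close to
  \<open>2\<pi>\<int>\<close> in \<open>L\<^sup>2\<close>, summably in \<open>n\<close>. Indices below \<open>4\<close> are irrelevant and avoid truncated subtraction.\<close>

definition alpha :: "real \<Rightarrow> 'a \<Rightarrow> nat \<Rightarrow> 'b \<Rightarrow> real" where
  "alpha \<xi> \<omega> n x = (if n < 4 then 0 else Arg (twist \<xi> (n - 2) (X (n - 2) \<omega>) x))"

definition shift :: "real \<Rightarrow> 'a \<Rightarrow> nat \<Rightarrow> real" where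
  "shift \<xi> \<omega> n = (if n < 4 then 0 else \<xi> * f (n - 2) (X (n - 2) \<omega>) (X (n - 1) \<omega>))"

definition theta :: "real \<Rightarrow> 'a \<Rightarrow> nat \<Rightarrow> 'b \<Rightarrow> 'b \<Rightarrow> real" where
  "theta \<xi> \<omega> n x y = \<xi> * f n x y + alpha \<xi> \<omega> n x - alpha \<xi> \<omega> (Suc n) y - shift \<xi> \<omega> n"

lemma abs_alpha_le: "\<bar>alpha \<xi> \<omega> n x\<bar> \<le> pi"
  unfolding alpha_def using Arg_bounded by (auto simp: abs_le_iff intro: less_imp_le) (metis less_imp_le minus_le_iff)

lemma alpha_measurable:
  assumes "\<omega> \<in> space M" shows "alpha \<xi> \<omega> n \<in> borel_measurable (\<mu> n)"
proof (cases "n < 4")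
  case False
  then have e: "Suc (Suc (n - 2)) = n" by simp
  note [measurable] = X_space[OF assms, of "n - 2"]
  have "(\<lambda>x. Arg (twist \<xi> (n - 2) (X (n - 2) \<omega>) x)) \<in> borel_measurable (\<mu> (Suc (Suc (n - 2))))" by measurable
  then show ?thesis using False unfolding alpha_def[abs_def] e by simp
qed (simp add: alpha_def[abs_def])

lemma alpha_measurable_compose:
  "\<omega> \<in> space M \<Longrightarrow> g \<in> N \<rightarrow>\<^sub>M \<mu> n \<Longrightarrow> (\<lambda>w. alpha \<xi> \<omega> n (g w)) \<in> borel_measurable N"
  using measurable_compose[OF _ alpha_measurable] .

lemma theta_measurable:
  assumes "\<omega> \<in> space M"
  shows "(\<lambda>(x, y). theta \<xi> \<omega> n x y) \<in> borel_measurable (\<mu> n \<Otimes>\<^sub>M \<mu> (Suc n))"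
proof -
  show ?thesis
    unfolding theta_def case_prod_unfold
    by (intro borel_measurable_diff borel_measurable_add borel_measurable_times borel_measurable_const
        f_measurable alpha_measurable_compose assms measurable_fst measurable_snd)
qed

lemma functional_circ_theta:
  assumes "\<omega> \<in> space M" shows "functional (\<lambda>n x y. circ (theta \<xi> \<omega> n x y))"
  unfolding functional_def
proof (intro allI conjI)
  fix n
  note [measurable] = theta_measurable[OF assms, of \<xi> n]
  show "(\<lambda>(x, y). circ (theta \<xi> \<omega> n x y)) \<in> borel_measurable (\<mu> n \<Otimes>\<^sub>M \<mu> (Suc n))" by measurable
  show "bnd (\<lambda>(x, y). circ (theta \<xi> \<omega> n x y))"
    using abs_circ_le by (intro bndI[of _ pi]) (simp add: case_prod_unfold)
qed

abbreviation "trajectory_err \<xi> \<omega> n \<equiv> err \<xi> (Suc (Suc n)) (X (Suc (Suc n)) \<omega>) (X (Suc (Suc (Suc n))) \<omega>)"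

text \<open>The trajectory \<omega> is frozen and the energy is taken over an independent variable
  of integration. Three estimates combine: \<open>circ_square_le\<close> with constant 48, the law
  of two consecutive states having density at most \<open>p\<close> divided by \<epsilon>, and
  \<open>ladder_step\<close> with constant 2/\<epsilon>^2; so 96 = 48 * 2. \<open>theta\<close> at
  time \<open>n + 4\<close> looks back two steps, to the edge of the trajectory at time
  \<open>n + 2\<close>.\<close>

lemma energy_circ_theta:
  assumes w: "\<omega> \<in> space M"
  shows "energy (\<lambda>n x y. circ (theta \<xi> \<omega> n x y)) (n + 4) \<le> 96 / \<epsilon> ^ 3 * trajectory_err \<xi> \<omega> n"
proof -
  define k where "k = Suc (Suc n)"
  define j where "j = Suc (Suc k)"
  have k: "n + 4 = j" "j - 2 = k" "j - 1 = Suc k" "Suc j - 2 = Suc k" "\<not> j < 4" "\<not> Suc j < 4" unfolding k_def j_def by auto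
  let ?c = "\<lambda>x y. 1 - cos (theta \<xi> \<omega> j x y)"
  have path_sum: "theta \<xi> \<omega> j v z = \<xi> * f (Suc (Suc k)) v z + Arg (twist \<xi> k (X k \<omega>) v) - Arg (twist \<xi> (Suc k) (X (Suc k) \<omega>) z) - \<xi> * f k (X k \<omega>) (X (Suc k) \<omega>)" for v z
    unfolding theta_def alpha_def shift_def k(2-4) using k(5,6) by (simp add: j_def)
  note [measurable] = theta_measurable[OF w, of \<xi> j]
  have m: "(\<lambda>(x, y). ?c x y) \<in> borel_measurable (\<mu> j \<Otimes>\<^sub>M \<mu> (Suc j))" by measurable
  have b: "bnd (\<lambda>(x, y). ?c x y)" unfolding case_prod_unfold by (intro bnd_intros)
  have mj: "(\<lambda>\<omega>'. theta \<xi> \<omega> j (X j \<omega>') (X (Suc j) \<omega>')) \<in> borel_measurable M"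
    using measurable_compose[OF measurable_Pair[OF X_measurable X_measurable] theta_measurable[OF w]] by simp
  then have mj' [measurable]: "(\<lambda>\<omega>'. theta \<xi> \<omega> j (X j \<omega>') (X (Suc j) \<omega>')) \<in> borel_measurable M" .
  have "energy (\<lambda>n x y. circ (theta \<xi> \<omega> n x y)) j \<le> (\<integral>\<omega>'. 48 * ?c (X j \<omega>') (X (Suc j) \<omega>') \<partial>M)"
    unfolding energy_def
  proof (rule integral_mono)
    show "integrable M (\<lambda>\<omega>'. (circ (theta \<xi> \<omega> j (X j \<omega>') (X (Suc j) \<omega>')))\<^sup>2)"
      using abs_circ_le by (intro integrable_bnd bnd_power bndI[of _ pi]) auto
    show "integrable M (\<lambda>\<omega>'. 48 * ?c (X j \<omega>') (X (Suc j) \<omega>'))"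
      by (intro integrable_bnd bnd_intros) measurable
  qed (rule circ_square_le)
  also have "\<dots> = 48 * (\<integral>\<omega>'. ?c (X j \<omega>') (X (Suc j) \<omega>') \<partial>M)" by (rule integral_mult_right_zero)
  also have "\<dots> \<le> 48 * ((1 / \<epsilon>) * (\<integral>x. \<integral>y. p j x y * ?c x y \<partial>\<mu> (Suc j) \<partial>\<mu> j))"
    by (intro mult_left_mono expectation_pair_le m b) (auto simp: j_def)
  also have "(\<integral>x. \<integral>y. p j x y * ?c x y \<partial>\<mu> (Suc j) \<partial>\<mu> j) \<le> 2 / \<epsilon>\<^sup>2 * err \<xi> k (X k \<omega>) (X (Suc k) \<omega>)"
    unfolding path_sum unfolding j_def by (rule ladder_step[OF X_space[OF w] X_space[OF w]])
  also have "48 * (1 / \<epsilon> * (2 / \<epsilon>\<^sup>2 * err \<xi> k (X k \<omega>) (X (Suc k) \<omega>))) = 96 / \<epsilon> ^ 3 * trajectory_err \<xi> \<omega> n"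
    unfolding k_def using eps_pos by (simp add: power2_eq_square power3_eq_cube)
  finally show ?thesis using eps_pos k(1) by (simp add: mult_left_mono divide_right_mono)
qed

lemma energy_circ_theta_sum:
  assumes w: "\<omega> \<in> space M"
  shows "(\<Sum>n<N. energy (\<lambda>n x y. circ (theta \<xi> \<omega> n x y)) n)
    \<le> 4 * pi\<^sup>2 + 96 / \<epsilon> ^ 3 * (\<Sum>n<N - 4. trajectory_err \<xi> \<omega> n)"
proof -
  let ?e = "energy (\<lambda>n x y. circ (theta \<xi> \<omega> n x y))"
  have e0: "0 \<le> ?e n" for n unfolding energy_def by simp
  have pi2: "?e n \<le> pi\<^sup>2" for n
  proof -
    have "(circ t)\<^sup>2 \<le> pi\<^sup>2" for t using power_mono[OF abs_circ_le, of t 2] by simp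
    then have "?e n \<le> (\<integral>\<omega>'. pi\<^sup>2 \<partial>M)"
      unfolding energy_def
      by (intro integral_mono integrable_bnd bnd_power functional_bnd[OF functional_circ_theta[OF w]]
          borel_measurable_power functional_measurable[OF functional_circ_theta[OF w]]) auto
    then show ?thesis by (simp add: prob_space)
  qed
  have "(\<Sum>n<N. ?e n) \<le> (\<Sum>n<4 + (N - 4). ?e n)" by (intro sum_mono2) (auto simp: e0)
  also have "\<dots> = (\<Sum>n<4. ?e n) + (\<Sum>n<N - 4. ?e (n + 4))"
  proof -
    have "(\<Sum>n<a + k. h n) = (\<Sum>n<a. h n) + (\<Sum>n<k. h (n + a))" for a k :: nat and h :: "nat \<Rightarrow> real"
      by (induction k) (simp_all add: add.commute)
    then show ?thesis .
  qed
  also have "\<dots> \<le> (\<Sum>n<4::nat. pi\<^sup>2) + (\<Sum>n<N - 4. 96 / \<epsilon> ^ 3 * trajectory_err \<xi> \<omega> n)"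
    by (intro add_mono sum_mono pi2 energy_circ_theta w)
  finally show ?thesis by (simp add: sum_distrib_left)
qed

lemma psum_theta:
  "psum (theta \<xi> \<omega>) N \<omega>' = \<xi> * psum f N \<omega>' - alpha \<xi> \<omega> N (X N \<omega>') - (\<Sum>n<N. shift \<xi> \<omega> n)"
proof (induction N)
  case 0
  then show ?case by (simp add: psum_def alpha_def)
next
  case (Suc N)
  then show ?case by (simp add: psum_def theta_def algebra_simps)
qed

lemma expectation_trajectory_err:
  "(\<integral>\<omega>. (\<Sum>n<m. trajectory_err \<xi> \<omega> n) \<partial>M) \<le> (1 / \<epsilon>) * (\<Sum>n<m. hexagon_moment \<xi> (n + 2))"
proof -
  have "(\<integral>\<omega>. (\<Sum>n<m. trajectory_err \<xi> \<omega> n) \<partial>M) = (\<Sum>n<m. \<integral>\<omega>. trajectory_err \<xi> \<omega> n \<partial>M)"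
    by (intro Bochner_Integration.integral_sum integrable_bnd bnd_err) measurable
  also have "\<dots> \<le> (\<Sum>n<m. (1 / \<epsilon>) * hexagon_moment \<xi> (n + 2))"
    using expectation_err[of "Suc (Suc _)" \<xi>] by (intro sum_mono) simp
  finally show ?thesis by (simp add: sum_distrib_left sum_divide_distrib)
qed

text \<open>For such small frequencies all phases in the two-step average lie within 1/20 of 0, so
  their cosines are at least 1 - (1/20)^2/2 = 799/800, and so is the cosine of the argument of the
  average. Then \<open>square_le_one_minus_cos\<close> gives a squared argument of at most 48/800,
  below (1/4)^2.\<close>

lemma abs_alpha_small:
  assumes small: "2 * K * \<bar>\<xi>\<bar> \<le> 1 / 20" and w: "\<omega> \<in> space M" and x: "x \<in> space (\<mu> n)"
  shows "\<bar>alpha \<xi> \<omega> n x\<bar> \<le> 1 / 4"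
proof (cases "n < 4")
  case False
  define k where "k = n - 2"
  have n: "n = Suc (Suc k)" using False unfolding k_def by simp
  let ?x = "X k \<omega>"
  note [measurable] = X_space[OF w, of k] x[unfolded n]
  let ?w = "\<lambda>u. p k ?x u * p (Suc k) u x" and ?s = "\<lambda>u. \<xi> * (f k ?x u + f (Suc k) u x)"
  define Z where "Z = twist \<xi> k ?x x"
  define Q where "Q = (\<integral>u. ?w u \<partial>\<mu> (Suc k))"
  have Q: "0 < Q" using p2_ge[OF X_space[OF w] x[unfolded n]] eps_pos unfolding Q_def by linarith
  have i: "integrable (\<mu> (Suc k)) (\<lambda>u. ?w u *\<^sub>R iexp (?s u))" "integrable (\<mu> (Suc k)) ?w"
    "integrable (\<mu> (Suc k)) (\<lambda>u. ?w u * cos (?s u))"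
    by (intro mu.integrable_bnd bnd_intros bnd_p; measurable)+
  have s: "\<bar>?s u\<bar> \<le> 1 / 20" for u
  proof -
    have "\<bar>f k ?x u + f (Suc k) u x\<bar> \<le> 2 * K" using K[of k ?x u] K[of "Suc k" u x] by linarith
    then have "\<bar>\<xi>\<bar> * \<bar>f k ?x u + f (Suc k) u x\<bar> \<le> \<bar>\<xi>\<bar> * (2 * K)" by (intro mult_left_mono) auto
    then show ?thesis using small by (simp add: abs_mult mult_ac)
  qed
  have c: "799 / 800 \<le> cos (?s u)" for u
  proof -
    have "(?s u)\<^sup>2 \<le> (1 / 20)\<^sup>2" using power_mono[OF s, of u 2] by simp
    then show ?thesis using one_minus_cos_le[of "?s u"] by (simp add: power2_eq_square)
  qed
  have "799 / 800 * Q = (\<integral>u. ?w u * (799 / 800) \<partial>\<mu> (Suc k))" unfolding Q_def by simp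
  also have "\<dots> \<le> (\<integral>u. ?w u * cos (?s u) \<partial>\<mu> (Suc k))"
    using i by (intro integral_mono mult_left_mono c mult_nonneg_nonneg p_nonneg) auto
  also have "\<dots> = Re Z" unfolding Z_def twist_def by (subst integral_Re[symmetric, OF i(1)]) (simp add: Re_exp)
  also have "\<dots> = cmod Z * cos (Arg Z)" using rcis_cmod_Arg[of Z] by (metis Re_rcis)
  finally have 1: "799 / 800 * Q \<le> cmod Z * cos (Arg Z)" .
  have "cmod Z \<le> (\<integral>u. norm (?w u *\<^sub>R iexp (?s u)) \<partial>\<mu> (Suc k))" unfolding Z_def twist_def by (rule integral_norm_bound)
  also have "\<dots> = Q" unfolding Q_def by (simp add: p_nonneg abs_mult)
  finally have ZQ: "cmod Z \<le> Q" .
  have "0 < cmod Z * cos (Arg Z)" using 1 Q by (meson less_le_trans mult_pos_pos zero_less_divide_iff zero_less_numeral)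
  then have Z0: "0 < cmod Z" by (metis mult_zero_left norm_ge_zero order_less_le)
  have "799 / 800 * cmod Z \<le> cmod Z * cos (Arg Z)" using 1 ZQ by linarith
  then have "799 / 800 \<le> cos (Arg Z)" using Z0 by (simp add: mult.commute)
  moreover have "\<bar>Arg Z\<bar> \<le> pi" using Arg_bounded[of Z] by linarith
  ultimately have "(Arg Z)\<^sup>2 \<le> (1 / 4)\<^sup>2" using square_le_one_minus_cos[of "Arg Z"] by (simp add: power2_eq_square)
  then have "\<bar>Arg Z\<bar> \<le> 1 / 4" by (simp only: abs_le_square_iff[symmetric])
  then show ?thesis using False unfolding alpha_def Z_def k_def by simp
qed (simp add: alpha_def)

text \<open>For small \<xi> every summand of \<open>theta\<close> lies within 1/40 + 1/40 + 1/4 +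
  1/4 < 1 of 0, so reduction modulo 2 pi does nothing. Hence \<xi> times the sum of \<open>f\<close>
  differs from a functional of controlled energy only by constants and a bounded coboundary. The
  trajectory may depend on \<open>N\<close> here; one is chosen whose error exceeds its mean by at
  most 1.\<close>

lemma variance_le_hexagon_sum:
  assumes small: "2 * K * \<bar>\<xi>\<bar> \<le> 1 / 20"
  shows "\<xi>\<^sup>2 * variance (psum f N) \<le> 2 * var_const * (4 * pi\<^sup>2 + 96 / \<epsilon> ^ 3 * (1 / \<epsilon> * hexagon_sum \<xi> N + 1)) + 2 * pi\<^sup>2"
proof -
  have K0: "0 \<le> K" using K[of 0 undefined undefined] by linarith
  have "bnd (\<lambda>\<omega>. \<Sum>n<N - 4. trajectory_err \<xi> \<omega> n)" by (intro bnd_sum bnd_err)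
  moreover have "(\<lambda>\<omega>. \<Sum>n<N - 4. trajectory_err \<xi> \<omega> n) \<in> borel_measurable M" by measurable
  ultimately obtain \<omega> where w: "\<omega> \<in> space M"
    and "(\<Sum>n<N - 4. trajectory_err \<xi> \<omega> n) \<le> expectation (\<lambda>\<omega>. \<Sum>n<N - 4. trajectory_err \<xi> \<omega> n) + 1"
    using exists_le_expectation by blast
  then have err: "(\<Sum>n<N - 4. trajectory_err \<xi> \<omega> n) \<le> 1 / \<epsilon> * hexagon_sum \<xi> N + 1"
    using expectation_trajectory_err[of \<xi> "N - 4"] unfolding hexagon_sum_def by linarith
  have small_theta: "circ (theta \<xi> \<omega> n (X n \<omega>') (X (Suc n) \<omega>')) = theta \<xi> \<omega> n (X n \<omega>') (X (Suc n) \<omega>')"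
    if w': "\<omega>' \<in> space M" for n \<omega>'
  proof (rule circ_eq_self)
    have f1: "\<bar>\<xi> * f n x y\<bar> \<le> 1 / 40" for n x y
    proof -
      have "\<bar>\<xi>\<bar> * \<bar>f n x y\<bar> \<le> \<bar>\<xi>\<bar> * K" by (intro mult_left_mono K) auto
      then show ?thesis using small by (simp add: abs_mult mult_ac)
    qed
    have "\<bar>shift \<xi> \<omega> n\<bar> \<le> 1 / 40" unfolding shift_def using f1 by simp
    then show "\<bar>theta \<xi> \<omega> n (X n \<omega>') (X (Suc n) \<omega>')\<bar> \<le> 1"
      using f1[of n "X n \<omega>'" "X (Suc n) \<omega>'"] abs_alpha_small[OF small w X_space[OF w'], of n]
        abs_alpha_small[OF small w X_space[OF w'], of "Suc n"]
      unfolding theta_def by linarith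
  qed
  let ?\<theta> = "\<lambda>n x y. circ (theta \<xi> \<omega> n x y)"
  have f\<theta>: "functional ?\<theta>" by (rule functional_circ_theta[OF w])
  define Y where "Y = psum ?\<theta> N"
  have Ym [measurable]: "Y \<in> borel_measurable M" and Yb: "bnd Y"
    unfolding Y_def by (rule psum_measurable[OF f\<theta>], rule bnd_psum[OF f\<theta>])
  define Z where "Z \<omega>' = alpha \<xi> \<omega> N (X N \<omega>')" for \<omega>'
  have Zm [measurable]: "Z \<in> borel_measurable M" unfolding Z_def by (rule alpha_measurable_compose[OF w X_measurable])
  have Zle: "\<bar>Z \<omega>'\<bar> \<le> pi" for \<omega>' unfolding Z_def by (rule abs_alpha_le)
  have Zb: "bnd Z" using Zle by (intro bndI[of _ pi]) auto
  have Sm [measurable]: "psum f N \<in> borel_measurable M" by (rule psum_measurable[OF fnl])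
  have dec: "\<xi> * psum f N \<omega>' = Y \<omega>' + Z \<omega>' + (\<Sum>n<N. shift \<xi> \<omega> n)" if "\<omega>' \<in> space M" for \<omega>'
  proof -
    have "Y \<omega>' = psum (theta \<xi> \<omega>) N \<omega>'" unfolding Y_def psum_def using small_theta[OF that] by simp
    then show ?thesis unfolding Z_def using psum_theta[of \<xi> \<omega> N \<omega>'] by simp
  qed
  have "\<xi>\<^sup>2 * variance (psum f N) = (\<integral>\<omega>'. (\<xi> * psum f N \<omega>' - expectation (\<lambda>\<omega>'. \<xi> * psum f N \<omega>'))\<^sup>2 \<partial>M)"
    by (simp flip: integral_mult_right_zero add: power_mult_distrib[symmetric] right_diff_distrib)
  also have "\<dots> \<le> (\<integral>\<omega>'. (\<xi> * psum f N \<omega>' - ((\<Sum>n<N. shift \<xi> \<omega> n) + expectation Y))\<^sup>2 \<partial>M)"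
    by (intro variance_le_shift bnd_mult bnd_const bnd_psum fnl) measurable
  also have "\<dots> = (\<integral>\<omega>'. (Y \<omega>' + Z \<omega>' - expectation Y)\<^sup>2 \<partial>M)"
  proof (rule Bochner_Integration.integral_cong[OF refl])
    fix \<omega>' assume "\<omega>' \<in> space M"
    have "a + s - (s + m) = a - m" for a s m :: real by simp
    then show "(\<xi> * psum f N \<omega>' - ((\<Sum>n<N. shift \<xi> \<omega> n) + expectation Y))\<^sup>2 = (Y \<omega>' + Z \<omega>' - expectation Y)\<^sup>2"
      by (simp only: dec[OF \<open>\<omega>' \<in> space M\<close>])
  qed
  also have "\<dots> \<le> 2 * variance Y + 2 * pi\<^sup>2" by (intro second_moment_shift_le Ym Zm Yb Zb Zle)
  also have "\<dots> \<le> 2 * (var_const * (4 * pi\<^sup>2 + 96 / \<epsilon> ^ 3 * (1 / \<epsilon> * hexagon_sum \<xi> N + 1))) + 2 * pi\<^sup>2"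
  proof (intro add_right_mono mult_left_mono)
    have "variance Y \<le> var_const * (\<Sum>n<N. energy ?\<theta> n)" unfolding Y_def by (rule variance_psum_le[OF f\<theta>])
    also have "\<dots> \<le> var_const * (4 * pi\<^sup>2 + 96 / \<epsilon> ^ 3 * (\<Sum>n<N - 4. trajectory_err \<xi> \<omega> n))"
      using var_const_pos by (intro mult_left_mono energy_circ_theta_sum w) auto
    also have "\<dots> \<le> var_const * (4 * pi\<^sup>2 + 96 / \<epsilon> ^ 3 * (1 / \<epsilon> * hexagon_sum \<xi> N + 1))"
      using var_const_pos eps_pos by (intro mult_left_mono add_left_mono err) auto
    finally show "variance Y \<le> var_const * (4 * pi\<^sup>2 + 96 / \<epsilon> ^ 3 * (1 / \<epsilon> * hexagon_sum \<xi> N + 1))" .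
  qed auto
  finally show ?thesis by (simp only: mult.assoc)
qed

text \<open>In contrast to the choice made for a single \<open>N\<close>, one trajectory must serve
  for all times. By monotone convergence the whole series of errors has finite expectation, so it
  converges along some trajectory.\<close>

lemma exists_summable_trajectory:
  assumes B: "\<And>N. hexagon_sum \<xi> N \<le> B"
  obtains \<omega> R where "\<omega> \<in> space M" "\<And>m. (\<Sum>n<m. trajectory_err \<xi> \<omega> n) \<le> R"
proof -
  have i: "integrable M (\<lambda>\<omega>. trajectory_err \<xi> \<omega> n)" for n
    by (intro integrable_bnd bnd_err) measurable
  have "(\<integral>\<^sup>+\<omega>. (\<Sum>n. ennreal (trajectory_err \<xi> \<omega> n)) \<partial>M) = (\<Sum>n. \<integral>\<^sup>+\<omega>. ennreal (trajectory_err \<xi> \<omega> n) \<partial>M)"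
    by (rule nn_integral_suminf) measurable
  also have "\<dots> = (\<Sum>n. ennreal (\<integral>\<omega>. trajectory_err \<xi> \<omega> n \<partial>M))"
    using i by (simp add: nn_integral_eq_integral err_nonneg)
  also have "\<dots> \<le> ennreal (B / \<epsilon>)"
  proof (rule suminf_le_const[OF summableI])
    fix m
    have "(\<Sum>n<m. ennreal (\<integral>\<omega>. trajectory_err \<xi> \<omega> n \<partial>M)) = ennreal (\<Sum>n<m. \<integral>\<omega>. trajectory_err \<xi> \<omega> n \<partial>M)"
      by (rule sum_ennreal) (simp add: err_nonneg)
    also have "(\<Sum>n<m. \<integral>\<omega>. trajectory_err \<xi> \<omega> n \<partial>M) = (\<integral>\<omega>. (\<Sum>n<m. trajectory_err \<xi> \<omega> n) \<partial>M)"
      using i by simp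
    also have "\<dots> \<le> (1 / \<epsilon>) * hexagon_sum \<xi> (m + 4)" using expectation_trajectory_err[of \<xi> m] unfolding hexagon_sum_def by simp
    also have "\<dots> \<le> (1 / \<epsilon>) * B" using eps_pos by (intro mult_left_mono B) auto
    finally show "(\<Sum>n<m. ennreal (\<integral>\<omega>. trajectory_err \<xi> \<omega> n \<partial>M)) \<le> ennreal (B / \<epsilon>)"
      by (simp add: ennreal_leI)
  qed
  also have "\<dots> < \<infinity>" by simp
  finally have fin: "(\<integral>\<^sup>+\<omega>. (\<Sum>n. ennreal (trajectory_err \<xi> \<omega> n)) \<partial>M) \<noteq> \<infinity>" by simp
  have "AE \<omega> in M. (\<Sum>n. ennreal (trajectory_err \<xi> \<omega> n)) \<noteq> \<infinity>"
    by (rule nn_integral_noteq_infinite[OF _ fin]) measurable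
  have "\<exists>\<omega>\<in>space M. (\<Sum>n. ennreal (trajectory_err \<xi> \<omega> n)) \<noteq> \<infinity>"
  proof (rule ccontr)
    assume "\<not> ?thesis"
    with \<open>AE \<omega> in M. (\<Sum>n. ennreal (trajectory_err \<xi> \<omega> n)) \<noteq> \<infinity>\<close> have "AE \<omega> in M. False"
      by (auto elim!: AE_mp)
    then show False by simp
  qed
  then obtain \<omega> where w: "\<omega> \<in> space M" and f: "(\<Sum>n. ennreal (trajectory_err \<xi> \<omega> n)) \<noteq> \<infinity>" by blast
  obtain R where R: "R \<ge> 0" "(\<Sum>n. ennreal (trajectory_err \<xi> \<omega> n)) = ennreal R"
    using f by (cases "\<Sum>n. ennreal (trajectory_err \<xi> \<omega> n)") auto
  have "(\<Sum>n<m. trajectory_err \<xi> \<omega> n) \<le> R" for m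
  proof -
    have "ennreal (\<Sum>n<m. trajectory_err \<xi> \<omega> n) = (\<Sum>n<m. ennreal (trajectory_err \<xi> \<omega> n))"
      by (rule sum_ennreal[symmetric]) (simp add: err_nonneg)
    also have "\<dots> \<le> ennreal R" unfolding R(2)[symmetric] by (rule sum_le_suminf[OF summableI]) auto
    finally show ?thesis using R(1) by (simp add: ennreal_le_iff)
  qed
  then show ?thesis using that w by blast
qed

text \<open>Rounding \<open>theta\<close> to the nearest multiple of 2 pi splits \<xi> times
  \<open>f\<close> into a lattice-valued part, a remainder \<open>circ theta\<close> of summable
  energy, and a bounded coboundary. The last two have partial sums of uniformly bounded second
  moment after centring, which will give center-tightness.\<close>

lemma reduction:
  assumes xi: "\<xi> \<noteq> 0" and B: "\<And>N. hexagon_sum \<xi> N \<le> B"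
  obtains g c m V0 where
    "\<And>n. (\<lambda>(x, y). g n x y) \<in> borel_measurable (\<mu> n \<Otimes>\<^sub>M \<mu> (Suc n))"
    "\<And>n x y. \<exists>k :: int. g n x y - c n = 2 * pi / \<xi> * k"
    "\<And>N. psum (\<lambda>n x y. f n x y - g n x y) N \<in> borel_measurable M"
    "\<And>N. bnd (psum (\<lambda>n x y. f n x y - g n x y) N)"
    "\<And>N. (\<integral>\<omega>. (psum (\<lambda>n x y. f n x y - g n x y) N \<omega> - m N)\<^sup>2 \<partial>M) \<le> (V0 :: real)"
proof -
  obtain \<omega> R where w: "\<omega> \<in> space M" and R: "\<And>m. (\<Sum>n<m. trajectory_err \<xi> \<omega> n) \<le> R"
    using exists_summable_trajectory[OF B] by blast
  let ?\<theta> = "\<lambda>n x y. circ (theta \<xi> \<omega> n x y)"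
  have f\<theta>: "functional ?\<theta>" by (rule functional_circ_theta[OF w])
  \<comment> \<open>The rounded functional keeps the deterministic shift, which \<open>c\<close>
    removes again; the coboundary is not part of \<open>g\<close> and goes into the difference
    \<open>f - g\<close>.\<close>
  define g where "g n x y = (shift \<xi> \<omega> n + 2 * pi * round (theta \<xi> \<omega> n x y / (2 * pi))) / \<xi>" for n x y
  define c where "c n = shift \<xi> \<omega> n / \<xi>" for n
  have fg: "\<xi> * (f n x y - g n x y) = ?\<theta> n x y - alpha \<xi> \<omega> n x + alpha \<xi> \<omega> (Suc n) y" for n x y
  proof -
    have "\<xi> * g n x y = shift \<xi> \<omega> n + 2 * pi * round (theta \<xi> \<omega> n x y / (2 * pi))"
      unfolding g_def using xi by simp
    then show ?thesis
      unfolding right_diff_distrib circ_def using theta_def[of \<xi> \<omega> n x y] by linarith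
  qed
  let ?P = "psum (\<lambda>n x y. f n x y - g n x y)"
  have P: "?P N \<omega>' = (psum ?\<theta> N \<omega>' + alpha \<xi> \<omega> N (X N \<omega>')) / \<xi>" for N \<omega>'
  proof -
    have "\<xi> * ?P N \<omega>' = psum ?\<theta> N \<omega>' + alpha \<xi> \<omega> N (X N \<omega>')"
    proof (induction N)
      case 0
      then show ?case by (simp add: psum_def alpha_def)
    next
      case (Suc N)
      then show ?case using fg[of N "X N \<omega>'" "X (Suc N) \<omega>'"] by (simp add: psum_def algebra_simps)
    qed
    then show ?thesis using xi by (simp add: field_simps)
  qed
  have Ym [measurable]: "psum ?\<theta> N \<in> borel_measurable M" and Yb: "bnd (psum ?\<theta> N)" for N
    by (rule psum_measurable[OF f\<theta>], rule bnd_psum[OF f\<theta>])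
  have Zm [measurable]: "(\<lambda>\<omega>'. alpha \<xi> \<omega> N (X N \<omega>')) \<in> borel_measurable M" for N
    by (rule alpha_measurable_compose[OF w X_measurable])
  have Zb: "bnd (\<lambda>\<omega>'. alpha \<xi> \<omega> N (X N \<omega>'))" for N using abs_alpha_le by (intro bndI[of _ pi]) auto
  show ?thesis
  proof (rule that[of g c "\<lambda>N. expectation (psum ?\<theta> N) / \<xi>" "(2 * (var_const * (4 * pi\<^sup>2 + 96 / \<epsilon> ^ 3 * R)) + 2 * pi\<^sup>2) / \<xi>\<^sup>2"])
    fix n
    note [measurable] = theta_measurable[OF w, of \<xi> n]
    show "(\<lambda>(x, y). g n x y) \<in> borel_measurable (\<mu> n \<Otimes>\<^sub>M \<mu> (Suc n))"
      unfolding g_def round_def by measurable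
  next
    fix n x y
    show "\<exists>k :: int. g n x y - c n = 2 * pi / \<xi> * k"
      unfolding g_def c_def by (rule exI[of _ "round (theta \<xi> \<omega> n x y / (2 * pi))"]) (simp add: add_divide_distrib)
  next
    fix N
    show "?P N \<in> borel_measurable M" unfolding P[abs_def] by measurable
    show "bnd (?P N)" unfolding P[abs_def] by (intro bnd_intros Yb Zb)
    have "(\<integral>\<omega>'. (?P N \<omega>' - expectation (psum ?\<theta> N) / \<xi>)\<^sup>2 \<partial>M)
      = (\<integral>\<omega>'. (psum ?\<theta> N \<omega>' + alpha \<xi> \<omega> N (X N \<omega>') - expectation (psum ?\<theta> N))\<^sup>2 / \<xi>\<^sup>2 \<partial>M)"
      by (intro Bochner_Integration.integral_cong refl) (simp add: P power_divide flip: diff_divide_distrib)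
    also have "\<dots> = (\<integral>\<omega>'. (psum ?\<theta> N \<omega>' + alpha \<xi> \<omega> N (X N \<omega>') - expectation (psum ?\<theta> N))\<^sup>2 \<partial>M) / \<xi>\<^sup>2" by simp
    also have "\<dots> \<le> (2 * variance (psum ?\<theta> N) + 2 * pi\<^sup>2) / \<xi>\<^sup>2"
      by (intro divide_right_mono second_moment_shift_le Ym Zm Yb Zb abs_alpha_le) auto
    also have "\<dots> \<le> (2 * (var_const * (4 * pi\<^sup>2 + 96 / \<epsilon> ^ 3 * R)) + 2 * pi\<^sup>2) / \<xi>\<^sup>2"
    proof (intro divide_right_mono add_right_mono mult_left_mono)
      have "variance (psum ?\<theta> N) \<le> var_const * (\<Sum>n<N. energy ?\<theta> n)" by (rule variance_psum_le[OF f\<theta>])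
      also have "\<dots> \<le> var_const * (4 * pi\<^sup>2 + 96 / \<epsilon> ^ 3 * (\<Sum>n<N - 4. trajectory_err \<xi> \<omega> n))"
        using var_const_pos by (intro mult_left_mono energy_circ_theta_sum w) auto
      also have "\<dots> \<le> var_const * (4 * pi\<^sup>2 + 96 / \<epsilon> ^ 3 * R)"
        using var_const_pos eps_pos by (intro mult_left_mono add_left_mono R) auto
      finally show "variance (psum ?\<theta> N) \<le> var_const * (4 * pi\<^sup>2 + 96 / \<epsilon> ^ 3 * R)" .
    qed auto
    finally show "(\<integral>\<omega>'. (?P N \<omega>' - expectation (psum ?\<theta> N) / \<xi>)\<^sup>2 \<partial>M)
      \<le> (2 * (var_const * (4 * pi\<^sup>2 + 96 / \<epsilon> ^ 3 * R)) + 2 * pi\<^sup>2) / \<xi>\<^sup>2" .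
  qed
qed

end

section \<open>Frequencies near and away from zero\<close>

text \<open>With half angles \<open>1 - cos t\<close> is twice a squared sine, and the addition
  theorem makes the modulus of the sine subadditive.\<close>

lemma one_minus_cos_diff_le:
  fixes a b :: real
  shows "1 - cos (a - b) \<le> 2 * (1 - cos a) + 2 * (1 - cos b)"
proof -
  have c: "1 - cos t = 2 * (sin (t / 2))\<^sup>2" for t :: real using cos_double_sin[of "t / 2"] by simp
  let ?x = "a / 2" and ?y = "b / 2"
  have "\<bar>sin (?x - ?y)\<bar> \<le> \<bar>sin ?x\<bar> * \<bar>cos ?y\<bar> + \<bar>cos ?x\<bar> * \<bar>sin ?y\<bar>"
    unfolding sin_diff using abs_triangle_ineq4[of "sin ?x * cos ?y" "cos ?x * sin ?y"] by (simp add: abs_mult)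
  also have "\<dots> \<le> \<bar>sin ?x\<bar> * 1 + 1 * \<bar>sin ?y\<bar>" by (intro add_mono mult_mono) auto
  finally have "(sin (?x - ?y))\<^sup>2 \<le> (\<bar>sin ?x\<bar> + \<bar>sin ?y\<bar>)\<^sup>2"
    using power_mono[of "\<bar>sin (?x - ?y)\<bar>" "\<bar>sin ?x\<bar> + \<bar>sin ?y\<bar>" 2] by simp
  also have "\<dots> \<le> 2 * (sin ?x)\<^sup>2 + 2 * (sin ?y)\<^sup>2"
  proof -
    have "(u + v)\<^sup>2 \<le> 2 * u\<^sup>2 + 2 * v\<^sup>2" for u v :: real
    proof -
      have "0 \<le> (u - v)\<^sup>2" by simp
      then show ?thesis by (simp add: power2_eq_square algebra_simps)
    qed
    from this[of "\<bar>sin ?x\<bar>" "\<bar>sin ?y\<bar>"] show ?thesis by simp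
  qed
  finally have "(sin ((a - b) / 2))\<^sup>2 \<le> 2 * (sin ?x)\<^sup>2 + 2 * (sin ?y)\<^sup>2" by (simp add: diff_divide_distrib)
  then show ?thesis unfolding c by linarith
qed

lemma gaussian_integral:
  fixes s m :: real
  assumes "0 < s"
  shows "integrable lborel (\<lambda>x. exp (- (s * (x - m)\<^sup>2)))" "(\<integral>x. exp (- (s * (x - m)\<^sup>2)) \<partial>lborel) = sqrt (pi / s)"
proof -
  define \<sigma> where "\<sigma> = sqrt (1 / (2 * s))"
  have s2: "\<sigma>\<^sup>2 = 1 / (2 * s)" unfolding \<sigma>_def using assms by simp
  have e: "exp (- (s * (x - m)\<^sup>2)) = sqrt (pi / s) * normal_density m \<sigma> x" for x
    unfolding normal_density_def s2 using assms by (simp add: field_simps)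
  have "0 < \<sigma>" unfolding \<sigma>_def using assms by simp
  then show "integrable lborel (\<lambda>x. exp (- (s * (x - m)\<^sup>2)))" "(\<integral>x. exp (- (s * (x - m)\<^sup>2)) \<partial>lborel) = sqrt (pi / s)"
    unfolding e by (auto simp del: real_sqrt_divide)
qed

context bounded_functional begin

lemma K_nonneg: "0 \<le> K"
  using K[of 0 undefined undefined] by linarith

text \<open>A pointwise inequality between cosine defects passes through all integrations because
  the path weights are nonnegative and do not depend on the frequency. Only arguments up to
  \<open>6 * K\<close> occur, a hexagon having two paths of three edges.\<close>

lemma hexagon_moment_combination:
  assumes le: "\<And>G. \<bar>G\<bar> \<le> 6 * K \<Longrightarrow> 1 - cos (\<xi>1 * G) \<le> a * (1 - cos (\<xi>2 * G)) + a' * (1 - cos (\<xi>3 * G))"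
  shows "hexagon_moment \<xi>1 n \<le> a * hexagon_moment \<xi>2 n + a' * hexagon_moment \<xi>3 n"
proof -
  note bi = mu.bnd_integral[unfolded case_prod_unfold] rho.bnd_integral[unfolded case_prod_unfold]
  have h: "hexagon \<xi>1 n x z u v u' v' \<le> a * hexagon \<xi>2 n x z u v u' v' + a' * hexagon \<xi>3 n x z u v u' v'" for x z u v u' v'
  proof -
    let ?G = "path_sum n x u v z - path_sum n x u' v' z"
    have "\<bar>?G\<bar> \<le> 6 * K"
      using K[of n x u] K[of "Suc n" u v] K[of "Suc (Suc n)" v z] K[of n x u'] K[of "Suc n" u' v'] K[of "Suc (Suc n)" v' z]
      unfolding path_sum_def by linarith
    from mult_left_mono[OF le[OF this], of "path_weight n x u v z * path_weight n x u' v' z"] show ?thesis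
      unfolding hexagon_def by (simp add: path_weight_nonneg algebra_simps)
  qed
  have h2: "hexagon_inner \<xi>1 n x z \<le> a * hexagon_inner \<xi>2 n x z + a' * hexagon_inner \<xi>3 n x z"
    if [measurable]: "x \<in> space (\<mu> n)" "z \<in> space (\<mu> (Suc (Suc (Suc n))))" for x z
  proof -
    have i1: "integrable (rho n) (\<lambda>b'. hexagon \<xi> n x z (fst b) (snd b) (fst b') (snd b'))" if b: "b \<in> space (rho n)" for \<xi> b
    proof -
      have [measurable]: "fst b \<in> space (\<mu> (Suc n))" "snd b \<in> space (\<mu> (Suc (Suc n)))" using b by (auto simp: space_pair_measure)
      show ?thesis by (intro rho.integrable_bnd bnd_hexagon) measurable
    qed
    have i2: "integrable (rho n) (\<lambda>b. \<integral>b'. hexagon \<xi> n x z (fst b) (snd b) (fst b') (snd b') \<partial>rho n)" for \<xi>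
      by (intro rho.integrable_bnd bi bnd_hexagon) measurable
    have "hexagon_inner \<xi>1 n x z \<le> (\<integral>b. a * (\<integral>b'. hexagon \<xi>2 n x z (fst b) (snd b) (fst b') (snd b') \<partial>rho n) + a' * (\<integral>b'. hexagon \<xi>3 n x z (fst b) (snd b) (fst b') (snd b') \<partial>rho n) \<partial>rho n)"
      unfolding hexagon_inner_def
    proof (rule integral_mono)
      fix bb assume bb: "bb \<in> space (rho n)"
      have "(\<integral>b'. hexagon \<xi>1 n x z (fst bb) (snd bb) (fst b') (snd b') \<partial>rho n)
        \<le> (\<integral>b'. a * hexagon \<xi>2 n x z (fst bb) (snd bb) (fst b') (snd b') + a' * hexagon \<xi>3 n x z (fst bb) (snd bb) (fst b') (snd b') \<partial>rho n)"
        using i1[OF bb] by (intro integral_mono h) auto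
      then show "(\<integral>b'. hexagon \<xi>1 n x z (fst bb) (snd bb) (fst b') (snd b') \<partial>rho n)
        \<le> a * (\<integral>b'. hexagon \<xi>2 n x z (fst bb) (snd bb) (fst b') (snd b') \<partial>rho n) + a' * (\<integral>b'. hexagon \<xi>3 n x z (fst bb) (snd bb) (fst b') (snd b') \<partial>rho n)"
        using i1[OF bb] by simp
    qed (use i2 in auto)
    then show ?thesis unfolding hexagon_inner_def using i2 by simp
  qed
  have h1: "hexagon_from \<xi>1 n x \<le> a * hexagon_from \<xi>2 n x + a' * hexagon_from \<xi>3 n x" if [measurable]: "x \<in> space (\<mu> n)" for x
  proof -
    have i: "integrable (\<mu> (Suc (Suc (Suc n)))) (\<lambda>z. hexagon_inner \<xi> n x z)" for \<xi>
      by (intro mu.integrable_bnd bnd_hexagon_inner) measurable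
    have "hexagon_from \<xi>1 n x \<le> (\<integral>z. a * hexagon_inner \<xi>2 n x z + a' * hexagon_inner \<xi>3 n x z \<partial>\<mu> (Suc (Suc (Suc n))))"
      unfolding hexagon_from_def using i by (intro integral_mono h2 that) auto
    then show ?thesis unfolding hexagon_from_def using i by simp
  qed
  have i: "integrable (\<mu> n) (\<lambda>x. hexagon_from \<xi> n x)" for \<xi> by (intro mu.integrable_bnd bnd_hexagon_from) measurable
  have "hexagon_moment \<xi>1 n \<le> (\<integral>x. a * hexagon_from \<xi>2 n x + a' * hexagon_from \<xi>3 n x \<partial>\<mu> n)"
    unfolding hexagon_moment_def using i by (intro integral_mono h1) auto
  then show ?thesis unfolding hexagon_moment_def using i by simp
qed

lemma hexagon_sum_combination:
  assumes "\<And>G. \<bar>G\<bar> \<le> 6 * K \<Longrightarrow> 1 - cos (\<xi>1 * G) \<le> a * (1 - cos (\<xi>2 * G)) + a' * (1 - cos (\<xi>3 * G))"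
  shows "hexagon_sum \<xi>1 N \<le> a * hexagon_sum \<xi>2 N + a' * hexagon_sum \<xi>3 N"
proof -
  have "hexagon_sum \<xi>1 N \<le> (\<Sum>n<N - 4. a * hexagon_moment \<xi>2 (n + 2) + a' * hexagon_moment \<xi>3 (n + 2))"
    unfolding hexagon_sum_def by (intro sum_mono hexagon_moment_combination assms)
  then show ?thesis unfolding hexagon_sum_def by (simp add: sum.distrib sum_distrib_left)
qed

lemma hexagon_sum_diff: "hexagon_sum (\<xi>1 - \<xi>2) N \<le> 2 * hexagon_sum \<xi>1 N + 2 * hexagon_sum \<xi>2 N"
  by (intro hexagon_sum_combination) (simp only: left_diff_distrib one_minus_cos_diff_le)

text \<open>Below \<delta> the arguments of the cosine stay in the unit interval, where
  \<open>1 - cos x\<close> lies between a third and a half of the square of \<open>x\<close>; thus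
  hexagon sums scale quadratically up to the factor 3/2. The second coefficient in the combination
  is a dummy 0.\<close>

lemma hexagon_sum_scale:
  assumes d: "0 < \<delta>" "6 * K * \<delta> \<le> 1" and xi: "\<bar>\<xi>\<bar> \<le> \<delta>"
  shows "2 / 3 * (\<xi> / \<delta>)\<^sup>2 * hexagon_sum \<delta> N \<le> hexagon_sum \<xi> N"
proof -
  have "(\<xi> / \<delta>)\<^sup>2 * hexagon_sum \<delta> N \<le> 3 / 2 * hexagon_sum \<xi> N"
  proof (cases "\<xi> = 0")
    case True
    have "0 \<le> hexagon_sum \<xi> N" unfolding hexagon_sum_def by (intro sum_nonneg hexagon_moment_nonneg)
    then show ?thesis using True by simp
  next
    case False
    have "hexagon_sum \<delta> N \<le> (\<delta> / \<xi>)\<^sup>2 * (3 / 2) * hexagon_sum \<xi> N + 0 * hexagon_sum \<xi> N"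
    proof (rule hexagon_sum_combination)
      fix G :: real assume G: "\<bar>G\<bar> \<le> 6 * K"
      have "\<bar>\<xi> * G\<bar> \<le> \<delta> * (6 * K)" unfolding abs_mult using xi G d by (intro mult_mono) auto
      then have "\<bar>\<xi> * G\<bar> \<le> 1" using d by (simp add: mult_ac)
      from one_minus_cos_ge[OF this] have 1: "(\<xi> * G)\<^sup>2 / 2 \<le> 3 / 2 * (1 - cos (\<xi> * G))" by simp
      have "1 - cos (\<delta> * G) \<le> (\<delta> * G)\<^sup>2 / 2" by (rule one_minus_cos_le)
      also have "\<dots> = (\<delta> / \<xi>)\<^sup>2 * ((\<xi> * G)\<^sup>2 / 2)" using False by (simp add: power_mult_distrib power_divide)
      also have "\<dots> \<le> (\<delta> / \<xi>)\<^sup>2 * (3 / 2 * (1 - cos (\<xi> * G)))" by (intro mult_left_mono 1) auto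
      finally show "1 - cos (\<delta> * G) \<le> (\<delta> / \<xi>)\<^sup>2 * (3 / 2) * (1 - cos (\<xi> * G)) + 0 * (1 - cos (\<xi> * G))"
        by (simp add: mult.assoc)
    qed
    then have "(\<xi> / \<delta>)\<^sup>2 * hexagon_sum \<delta> N \<le> (\<xi> / \<delta>)\<^sup>2 * ((\<delta> / \<xi>)\<^sup>2 * (3 / 2) * hexagon_sum \<xi> N)"
      by (intro mult_left_mono) auto
    also have "\<dots> = 3 / 2 * hexagon_sum \<xi> N" using False d by (simp add: power_divide)
    finally show ?thesis .
  qed
  then show ?thesis by simp
qed

lemma hexagon_sum_mono: "N \<le> N' \<Longrightarrow> hexagon_sum \<xi> N \<le> hexagon_sum \<xi> N'"
  unfolding hexagon_sum_def by (intro sum_mono2) (auto simp: hexagon_moment_nonneg)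

lemma hexagon_sum_nonneg: "0 \<le> hexagon_sum \<xi> N"
  unfolding hexagon_sum_def by (intro sum_nonneg hexagon_moment_nonneg)

text \<open>For fixed \<open>N\<close> this makes the hexagon sum of a small frequency difference
  small; it is the continuity input to the compactness argument in
  \<open>hexagon_sum_uniform\<close>.\<close>

lemma hexagon_sum_le: "\<exists>C\<ge>0. \<forall>\<xi>. hexagon_sum \<xi> N \<le> C * \<xi>\<^sup>2"
proof (intro exI conjI allI)
  let ?c = "real (N - 4) * (1 / \<epsilon> ^ 3 * (1 / \<epsilon> ^ 3) * ((6 * K)\<^sup>2 / 2))"
  show "0 \<le> ?c" using eps_pos by simp
  fix \<xi>
  have hexagon_moment_le: "hexagon_moment \<xi> n \<le> 1 / \<epsilon> ^ 3 * (1 / \<epsilon> ^ 3) * ((\<xi> * (6 * K))\<^sup>2 / 2)" (is "_ \<le> ?C") for n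
  proof -
    have C0: "0 \<le> ?C" using eps_pos by simp
    have h: "norm (hexagon \<xi> n x z u v u' v') \<le> ?C" for x z u v u' v'
    proof -
      let ?G = "path_sum n x u v z - path_sum n x u' v' z"
      have "\<bar>?G\<bar> \<le> 6 * K"
        using K[of n x u] K[of "Suc n" u v] K[of "Suc (Suc n)" v z] K[of n x u'] K[of "Suc n" u' v'] K[of "Suc (Suc n)" v' z]
        unfolding path_sum_def by linarith
      then have "\<bar>\<xi> * ?G\<bar> \<le> \<bar>\<xi> * (6 * K)\<bar>" unfolding abs_mult using K_nonneg by (intro mult_left_mono) auto
      then have "(\<xi> * ?G)\<^sup>2 \<le> (\<xi> * (6 * K))\<^sup>2" by (simp only: abs_le_square_iff)
      then have "1 - cos (\<xi> * ?G) \<le> (\<xi> * (6 * K))\<^sup>2 / 2" using one_minus_cos_le[of "\<xi> * ?G"] by linarith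
      then have "hexagon \<xi> n x z u v u' v' \<le> ?C"
        unfolding hexagon_def using eps_pos by (intro mult_mono path_weight_le path_weight_nonneg mult_nonneg_nonneg) auto
      then show ?thesis using hexagon_nonneg[of \<xi> n x z u v u' v'] by simp
    qed
    have h2: "norm (hexagon_inner \<xi> n x z) \<le> ?C" for x z
      unfolding hexagon_inner_def by (intro rho.norm_integral_le h C0)
    have h1: "norm (hexagon_from \<xi> n x) \<le> ?C" for x
      unfolding hexagon_from_def by (intro mu.norm_integral_le h2 C0)
    have "norm (hexagon_moment \<xi> n) \<le> ?C" unfolding hexagon_moment_def by (intro mu.norm_integral_le h1 C0)
    then show ?thesis by simp
  qed
  have "hexagon_sum \<xi> N \<le> (\<Sum>n<N - 4. 1 / \<epsilon> ^ 3 * (1 / \<epsilon> ^ 3) * ((\<xi> * (6 * K))\<^sup>2 / 2))"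
    unfolding hexagon_sum_def by (intro sum_mono hexagon_moment_le)
  then show "hexagon_sum \<xi> N \<le> ?c * \<xi>\<^sup>2" by (simp add: power_mult_distrib mult_ac)
qed

end

section \<open>Divergent hexagon sums: growth of the variance and decay away from zero\<close>

locale nonlattice_functional = bounded_functional +
  assumes nonlattice: "\<And>\<xi> B. \<xi> \<noteq> 0 \<Longrightarrow> \<exists>N. B < hexagon_sum \<xi> N"
begin

lemma hexagon_sum_at_top: "\<xi> \<noteq> 0 \<Longrightarrow> filterlim (hexagon_sum \<xi>) at_top sequentially"
  unfolding filterlim_at_top
proof
  fix Z assume "\<xi> \<noteq> 0"
  then obtain N where "Z < hexagon_sum \<xi> N" using nonlattice by blast
  then have "Z \<le> hexagon_sum \<xi> n" if "N \<le> n" for n using hexagon_sum_mono[OF that, of \<xi>] by linarith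
  then show "eventually (\<lambda>n. Z \<le> hexagon_sum \<xi> n) sequentially" unfolding eventually_sequentially by blast
qed

text \<open>A compactness argument as in Dini's theorem. Were the sums below \<open>B\<close> at
  frequencies \<open>x N\<close> in the interval, a limit point \<open>l\<close> would satisfy
  \<open>hexagon_sum l N \<le> 2 * B\<close> for every \<open>N\<close>: compare \<open>l\<close>
  with \<open>x (r j)\<close> by \<open>hexagon_sum_diff\<close> and let \<open>j\<close> grow with
  \<open>N\<close> fixed. This contradicts divergence at \<open>l\<close>, which is not 0.\<close>

lemma hexagon_sum_uniform:
  assumes "0 < a"
  shows "\<exists>N0. \<forall>N\<ge>N0. \<forall>\<xi>\<in>{a..b}. B \<le> hexagon_sum \<xi> N"
proof (rule ccontr)
  assume neg: "\<not> ?thesis"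
  have ex: "\<exists>\<xi>\<in>{a..b}. hexagon_sum \<xi> N < B" for N
  proof -
    from neg obtain N' \<xi> where "N \<le> N'" "\<xi> \<in> {a..b}" "hexagon_sum \<xi> N' < B" by (metis not_le)
    then show ?thesis using hexagon_sum_mono[of N N' \<xi>] by (intro bexI[of _ \<xi>]) auto
  qed
  obtain x where x: "\<And>N. x N \<in> {a..b}" "\<And>N. hexagon_sum (x N) N < B" using ex by metis
  obtain l r where l: "l \<in> {a..b}" and r: "strict_mono (r :: nat \<Rightarrow> nat)" and lim: "(x \<circ> r) \<longlonglongrightarrow> l"
    using compact_Icc[of a b] x(1) unfolding compact_def by metis
  have "hexagon_sum l N \<le> 2 * B" for N
  proof -
    obtain C where C: "C \<ge> 0" "\<And>\<xi>. hexagon_sum \<xi> N \<le> C * \<xi>\<^sup>2" using hexagon_sum_le by blast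
    have le: "hexagon_sum l N \<le> 2 * B + 2 * (C * (x (r j) - l)\<^sup>2)" if "N \<le> j" for j
    proof -
      have "N \<le> r j" using seq_suble[OF r, of j] that by linarith
      have "hexagon_sum l N = hexagon_sum (x (r j) - (x (r j) - l)) N" by simp
      also have "\<dots> \<le> 2 * hexagon_sum (x (r j)) N + 2 * hexagon_sum (x (r j) - l) N" by (rule hexagon_sum_diff)
      also have "\<dots> \<le> 2 * B + 2 * (C * (x (r j) - l)\<^sup>2)"
        using hexagon_sum_mono[OF \<open>N \<le> r j\<close>, of "x (r j)"] x(2)[of "r j"] C(2)[of "x (r j) - l"]
        by (intro add_mono mult_left_mono) auto
      finally show ?thesis .
    qed
    have "(\<lambda>j. 2 * B + 2 * (C * (x (r j) - l)\<^sup>2)) \<longlonglongrightarrow> 2 * B + 2 * (C * (l - l)\<^sup>2)"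
      using lim by (intro tendsto_intros) (simp add: comp_def)
    then have "hexagon_sum l N \<le> 2 * B + 2 * (C * (l - l)\<^sup>2)"
      by (rule tendsto_lowerbound) (use le in \<open>auto simp: eventually_sequentially\<close>)
    then show ?thesis by simp
  qed
  moreover have "l \<noteq> 0" using l assms by auto
  ultimately show False using nonlattice[of l "2 * B"] by (meson not_le)
qed

definition phi :: "nat \<Rightarrow> real \<Rightarrow> complex" where
  "phi N \<xi> = (\<integral>\<omega>. iexp (\<xi> * psum f N \<omega>) \<partial>M)"

definition V :: "nat \<Rightarrow> real" where
  "V N = variance (psum f N)"

lemma V_nonneg: "0 \<le> V N"
  unfolding V_def by simp

lemma phi_le: "norm (phi N \<xi>) \<le> exp (- (\<epsilon>\<^sup>2 / 10 * hexagon_sum \<xi> N))"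
  unfolding phi_def by (rule char_psum_le)

lemma phi_ge: "1 - \<xi>\<^sup>2 * V N / 2 \<le> norm (phi N \<xi>)"
proof -
  have [measurable]: "psum f N \<in> borel_measurable M" by (rule psum_measurable[OF fnl])
  define m where "m = expectation (psum f N)"
  have i: "integrable M (\<lambda>\<omega>. iexp (\<xi> * (psum f N \<omega> - m)))" "integrable M (\<lambda>\<omega>. (psum f N \<omega> - m)\<^sup>2)"
    "integrable M (\<lambda>\<omega>. cos (\<xi> * (psum f N \<omega> - m)))"
    by (intro integrable_bnd bnd_intros bnd_psum fnl; measurable)+
  have "1 - \<xi>\<^sup>2 * V N / 2 = (\<integral>\<omega>. 1 - \<xi>\<^sup>2 / 2 * (psum f N \<omega> - m)\<^sup>2 \<partial>M)"
    unfolding V_def m_def[symmetric] using i by (simp add: prob_space)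
  also have "\<dots> \<le> (\<integral>\<omega>. cos (\<xi> * (psum f N \<omega> - m)) \<partial>M)"
  proof (rule integral_mono)
    show "1 - \<xi>\<^sup>2 / 2 * (psum f N \<omega> - m)\<^sup>2 \<le> cos (\<xi> * (psum f N \<omega> - m))" for \<omega>
      using one_minus_cos_le[of "\<xi> * (psum f N \<omega> - m)"] by (simp add: power_mult_distrib)
  qed (use i in auto)
  also have "\<dots> = Re (\<integral>\<omega>. iexp (\<xi> * (psum f N \<omega> - m)) \<partial>M)"
    by (subst integral_Re[symmetric, OF i(1)]) (simp add: Re_exp)
  also have "\<dots> \<le> norm (\<integral>\<omega>. iexp (\<xi> * (psum f N \<omega> - m)) \<partial>M)" by (rule complex_Re_le_cmod)
  also have "(\<integral>\<omega>. iexp (\<xi> * (psum f N \<omega> - m)) \<partial>M) = (\<integral>\<omega>. iexp (- \<xi> * m) * iexp (\<xi> * psum f N \<omega>) \<partial>M)"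
    by (intro Bochner_Integration.integral_cong refl) (simp add: algebra_simps flip: exp_add)
  also have "\<dots> = iexp (- \<xi> * m) * phi N \<xi>" unfolding phi_def by (rule integral_mult_right_zero)
  also have "norm \<dots> = norm (phi N \<xi>)" by (simp only: norm_mult norm_exp_i_times mult_1)
  finally show ?thesis .
qed

text \<open>The frequency \<xi> is tied to the level \<open>Z\<close>: a variance below
  \<open>Z\<close> would give \<open>\<xi>\<^sup>2 * V N \<le> 1\<close>, and \<open>phi_ge\<close>
  would keep the characteristic function at \<xi> above 1/2 in modulus, against the divergence of
  the hexagon sum at this fixed \<xi>.\<close>

lemma V_at_top: "filterlim V at_top sequentially"
proof (rule filterlim_at_top_mono[OF _ eventually_mono, where f = V] filterlim_at_top[THEN iffD2], rule allI)
  fix Z :: real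
  define \<xi> where "\<xi> = 1 / sqrt (max Z 0 + 1)"
  have xi: "\<xi> \<noteq> 0" "\<xi>\<^sup>2 = 1 / (max Z 0 + 1)" unfolding \<xi>_def by (auto simp: power_divide)
  have "eventually (\<lambda>N. 10 / \<epsilon>\<^sup>2 * ln 2 < hexagon_sum \<xi> N) sequentially"
    using hexagon_sum_at_top[OF xi(1)] by (simp add: filterlim_at_top_dense)
  then show "eventually (\<lambda>N. Z \<le> V N) sequentially"
  proof eventually_elim
    case (elim N)
    show ?case
    proof (rule ccontr)
      assume "\<not> Z \<le> V N"
      then have VZ: "V N < Z" "0 < Z" using V_nonneg[of N] by linarith+
      then have "\<xi>\<^sup>2 * V N \<le> 1" unfolding xi(2) using V_nonneg[of N] by (simp add: pos_divide_le_eq)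
      then have "1 / 2 \<le> norm (phi N \<xi>)" using phi_ge[of \<xi> N] by linarith
      also have "\<dots> \<le> exp (- (\<epsilon>\<^sup>2 / 10 * hexagon_sum \<xi> N))" by (rule phi_le)
      also have "\<dots> < exp (- ln 2)"
      proof -
        have "\<epsilon>\<^sup>2 / 10 * (10 / \<epsilon>\<^sup>2 * ln 2) < \<epsilon>\<^sup>2 / 10 * hexagon_sum \<xi> N"
          using elim eps_pos by (intro mult_strict_left_mono) auto
        then show ?thesis using eps_pos by simp
      qed
      also have "\<dots> = 1 / 2" by (simp add: exp_minus)
      finally show False by simp
    qed
  qed
qed

text \<open>Small enough both for \<open>abs_alpha_small\<close> and for the quadratic range of the
  cosine in \<open>hexagon_sum_scale\<close>; \<open>K + 1\<close> keeps the denominator positive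
  when \<open>K\<close> is 0.\<close>

definition delta :: real where
  "delta = 1 / (40 * (K + 1))"

lemma delta: "0 < delta" "2 * K * \<bar>delta\<bar> \<le> 1 / 20" "6 * K * delta \<le> 1"
  unfolding delta_def using K_nonneg by (auto simp: field_simps)

lemma hexagon_sum_delta_ge: "\<exists>c>0. \<exists>C. \<forall>N. c * V N - C \<le> hexagon_sum delta N"
proof -
  define A where "A = 2 * var_const * (96 / \<epsilon> ^ 3 * (1 / \<epsilon>))"
  define B where "B = 2 * var_const * (4 * pi\<^sup>2 + 96 / \<epsilon> ^ 3) + 2 * pi\<^sup>2"
  have A: "0 < A" unfolding A_def using var_const_pos eps_pos by simp
  have "delta\<^sup>2 * V N \<le> A * hexagon_sum delta N + B" for N
  proof -
    have "2 * v * (p + q * (u * x + 1)) + r = 2 * v * (q * u) * x + (2 * v * (p + q) + r)" for p q u x r v :: real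
      by (simp add: algebra_simps)
    then show ?thesis using variance_le_hexagon_sum[OF delta(2), of N] unfolding V_def A_def B_def by (simp only:)
  qed
  then have "delta\<^sup>2 / A * V N - B / A \<le> hexagon_sum delta N" for N
    using A by (simp add: field_simps)
  moreover have "0 < delta\<^sup>2 / A" using A delta(1) by simp
  ultimately show ?thesis by blast
qed

text \<open>The variance bound is used at the single frequency \<open>delta\<close> and carried to
  smaller ones by quadratic scaling. Applying it directly at \<xi> would also bound
  \<open>\<xi>\<^sup>2 * V N\<close>, but the scaling argument suffices once the constants at
  \<open>delta\<close> are known.\<close>

lemma hexagon_sum_small_ge: "\<exists>c>0. \<exists>C. \<forall>N \<xi>. \<bar>\<xi>\<bar> \<le> delta \<longrightarrow> c * V N * \<xi>\<^sup>2 - C \<le> hexagon_sum \<xi> N"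
proof -
  obtain c C where c: "0 < c" and C: "\<And>N. c * V N - C \<le> hexagon_sum delta N" using hexagon_sum_delta_ge by blast
  have "2 / 3 * c / delta\<^sup>2 * V N * \<xi>\<^sup>2 - 2 / 3 * \<bar>C\<bar> \<le> hexagon_sum \<xi> N" if xi: "\<bar>\<xi>\<bar> \<le> delta" for N \<xi>
  proof -
    have r: "(\<xi> / delta)\<^sup>2 \<le> 1"
    proof -
      have "\<bar>\<xi> / delta\<bar> \<le> \<bar>1\<bar>" using xi delta(1) by (simp add: abs_divide)
      then have "(\<xi> / delta)\<^sup>2 \<le> 1\<^sup>2" by (simp only: abs_le_square_iff)
      then show ?thesis by simp
    qed
    have "2 / 3 * c / delta\<^sup>2 * V N * \<xi>\<^sup>2 - 2 / 3 * \<bar>C\<bar> \<le> 2 / 3 * (\<xi> / delta)\<^sup>2 * (c * V N - C)"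
    proof -
      have "(\<xi> / delta)\<^sup>2 * C \<le> (\<xi> / delta)\<^sup>2 * \<bar>C\<bar>" by (intro mult_left_mono) auto
      also have "\<dots> \<le> 1 * \<bar>C\<bar>" using r by (intro mult_right_mono) auto
      finally have "(\<xi> / delta)\<^sup>2 * C \<le> \<bar>C\<bar>" by simp
      moreover have "2 / 3 * (\<xi> / delta)\<^sup>2 * (c * V N - C) = 2 / 3 * c / delta\<^sup>2 * V N * \<xi>\<^sup>2 - 2 / 3 * ((\<xi> / delta)\<^sup>2 * C)"
      proof -
        have "2 / 3 * (x / d) * (c * v - k) = 2 / 3 * c / d * v * x - 2 / 3 * ((x / d) * k)" if "d \<noteq> 0" for x d v k :: real
          using that by (simp add: field_simps)
        from this[of "delta\<^sup>2" "\<xi>\<^sup>2"] show ?thesis using delta(1) by (simp only: power_divide) simp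
      qed
      ultimately show ?thesis by linarith
    qed
    also have "\<dots> \<le> 2 / 3 * (\<xi> / delta)\<^sup>2 * hexagon_sum delta N" by (intro mult_left_mono C) auto
    also have "\<dots> \<le> hexagon_sum \<xi> N" by (rule hexagon_sum_scale[OF delta(1,3) xi])
    finally show ?thesis .
  qed
  moreover have "0 < 2 / 3 * c / delta\<^sup>2" using c delta(1) by simp
  ultimately show ?thesis by blast
qed

lemma phi_near_0: "\<exists>c>0. \<exists>C. \<forall>N \<xi>. \<bar>\<xi>\<bar> \<le> delta \<longrightarrow> norm (phi N \<xi>) \<le> C * exp (- (c * V N * \<xi>\<^sup>2))"
proof -
  obtain c C where c: "0 < c" and C: "\<And>N \<xi>. \<bar>\<xi>\<bar> \<le> delta \<Longrightarrow> c * V N * \<xi>\<^sup>2 - C \<le> hexagon_sum \<xi> N" using hexagon_sum_small_ge by blast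
  have "norm (phi N \<xi>) \<le> exp (\<epsilon>\<^sup>2 / 10 * C) * exp (- (\<epsilon>\<^sup>2 / 10 * c * V N * \<xi>\<^sup>2))" if xi: "\<bar>\<xi>\<bar> \<le> delta" for N \<xi>
  proof -
    have "norm (phi N \<xi>) \<le> exp (- (\<epsilon>\<^sup>2 / 10 * hexagon_sum \<xi> N))" by (rule phi_le)
    also have "\<dots> \<le> exp (- (\<epsilon>\<^sup>2 / 10 * (c * V N * \<xi>\<^sup>2 - C)))"
      using C[OF xi] by (simp add: mult_left_mono)
    also have "\<dots> = exp (\<epsilon>\<^sup>2 / 10 * C) * exp (- (\<epsilon>\<^sup>2 / 10 * c * V N * \<xi>\<^sup>2))"
      by (simp add: algebra_simps flip: exp_add)
    finally show ?thesis .
  qed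
  moreover have "0 < \<epsilon>\<^sup>2 / 10 * c" using c eps_pos by simp
  ultimately show ?thesis by blast
qed

lemma phi_measurable [measurable]: "phi N \<in> borel_measurable borel"
proof -
  have [measurable]: "psum f N \<in> borel_measurable M" by (rule psum_measurable[OF fnl])
  show ?thesis unfolding phi_def[abs_def] by measurable
qed

lemma phi_norm_le_1: "norm (phi N \<xi>) \<le> 1"
  unfolding phi_def by (rule norm_integral_le) auto

text \<open>If \<open>\<xi>\<^sub>0\<close> nearly minimises the hexagon sum on the interval, then \<open>hexagon_sum_diff\<close> bounds the hexagon sum at \<open>\<xi>\<close> from
  below by a multiple of \<open>V N * (\<xi> - \<xi>\<^sub>0)\<^sup>2\<close> plus a term tending to infinity. So the characteristic function is
  dominated by a Gaussian of width \<open>1 / sqrt (V N)\<close> around \<open>\<xi>\<^sub>0\<close> with a vanishing factor.\<close>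

lemma phi_tail_interval:
  assumes a: "0 < a"
  shows "(\<lambda>N. sqrt (V N) * (\<integral>\<xi>. indicator {a..a + delta} \<xi> * norm (phi N \<xi>) \<partial>lborel)) \<longlonglongrightarrow> 0"
proof -
  let ?J = "{a..a + delta}"
  obtain c C where c: "0 < c" and C: "\<And>N \<xi>. \<bar>\<xi>\<bar> \<le> delta \<Longrightarrow> c * V N * \<xi>\<^sup>2 - C \<le> hexagon_sum \<xi> N" using hexagon_sum_small_ge by blast
  define e where "e = \<epsilon>\<^sup>2 / 10"
  have e: "0 < e" unfolding e_def using eps_pos by simp
  define s where "s = e * c / 6"
  have s: "0 < s" unfolding s_def using e c by simp
  define A where "A = exp (e * (2 / 3 + C / 6)) * sqrt (pi / s)"
  have A: "0 < A" unfolding A_def using s by simp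
  have bound: "sqrt (V N) * (\<integral>\<xi>. indicator ?J \<xi> * norm (phi N \<xi>) \<partial>lborel) \<le> A * exp (- (e * B / 3))"
    if B: "\<forall>\<xi>\<in>?J. B \<le> hexagon_sum \<xi> N" and V: "0 < V N" for N B
  proof -
    define I where "I = (INF \<xi>\<in>?J. hexagon_sum \<xi> N)"
    have bdd: "bdd_below ((\<lambda>\<xi>. hexagon_sum \<xi> N) ` ?J)" by (rule bdd_belowI2[of _ 0]) (rule hexagon_sum_nonneg)
    \<comment> \<open>A frequency within 1 of the infimum is enough, so attainment of the infimum is
      never discussed.\<close>
    have "\<exists>\<xi>\<in>?J. hexagon_sum \<xi> N < I + 1"
    proof -
      have "(INF \<xi>\<in>?J. hexagon_sum \<xi> N) < I + 1" unfolding I_def by simp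
      then show ?thesis using delta(1) by (subst (asm) cINF_less_iff[OF _ bdd]) auto
    qed
    then obtain \<xi>0 where x0: "\<xi>0 \<in> ?J" "hexagon_sum \<xi>0 N < I + 1" by blast
    have I: "I \<le> hexagon_sum \<xi> N" if "\<xi> \<in> ?J" for \<xi> unfolding I_def by (rule cINF_lower[OF bdd that])
    have p: "norm (phi N \<xi>) \<le> exp (e * (2 / 3 + C / 6)) * exp (- (e * B / 3)) * exp (- (s * V N * (\<xi> - \<xi>0)\<^sup>2))" if xi: "\<xi> \<in> ?J" for \<xi>
    proof -
      \<comment> \<open>The interval has length \<open>delta\<close>, so the difference of two of
        its frequencies lies in the range where the quadratic lower bound holds.\<close>
      have "c * V N * (\<xi> - \<xi>0)\<^sup>2 - C \<le> hexagon_sum (\<xi> - \<xi>0) N" using xi x0 by (intro C) (auto simp: abs_le_iff)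
      also have "\<dots> \<le> 2 * hexagon_sum \<xi> N + 2 * hexagon_sum \<xi>0 N" by (rule hexagon_sum_diff)
      finally have 1: "c * V N * (\<xi> - \<xi>0)\<^sup>2 - C \<le> 2 * hexagon_sum \<xi> N + 2 * hexagon_sum \<xi>0 N" .
      \<comment> \<open>Near-minimality bounds the sum at \<xi>0 by the sum at \<xi> plus 1. The
        weights 1/3 and 1/6 are such that 2/3 of the sum at \<xi>0 and 1/3 of the sum at \<xi>
        appear, which together are at most the sum at \<xi> plus 2/3.\<close>
      have "hexagon_sum \<xi>0 N / 3 + (c * V N * (\<xi> - \<xi>0)\<^sup>2 - C) / 6 - 2 / 3 \<le> hexagon_sum \<xi> N"
      proof -
        have "d0 / 3 + x / 6 - 2 / 3 \<le> d" if "x \<le> 2 * d + 2 * d0" "i \<le> d" "d0 < i + 1" for d0 x d i :: real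
          using that by linarith
        from this[OF 1 I[OF xi] x0(2)] show ?thesis .
      qed
      then have "B / 3 + (c * V N * (\<xi> - \<xi>0)\<^sup>2 - C) / 6 - 2 / 3 \<le> hexagon_sum \<xi> N"
        using bspec[OF B x0(1)] by linarith
      then have "e * (B / 3 + (c * V N * (\<xi> - \<xi>0)\<^sup>2 - C) / 6 - 2 / 3) \<le> e * hexagon_sum \<xi> N"
        using e by (intro mult_left_mono) auto
      then have "norm (phi N \<xi>) \<le> exp (- (e * (B / 3 + (c * V N * (\<xi> - \<xi>0)\<^sup>2 - C) / 6 - 2 / 3)))"
        using phi_le[of N \<xi>] unfolding e_def[symmetric] by (meson exp_le_cancel_iff neg_le_iff_le order_trans)
      also have "\<dots> = exp (e * (2 / 3 + C / 6)) * exp (- (e * B / 3)) * exp (- (s * V N * (\<xi> - \<xi>0)\<^sup>2))"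
        unfolding s_def by (simp add: field_simps flip: exp_add)
      finally show ?thesis .
    qed
    have sV: "0 < s * V N" using s V by simp
    have "(\<integral>\<xi>. indicator ?J \<xi> * norm (phi N \<xi>) \<partial>lborel)
      \<le> (\<integral>\<xi>. exp (e * (2 / 3 + C / 6)) * exp (- (e * B / 3)) * exp (- (s * V N * (\<xi> - \<xi>0)\<^sup>2)) \<partial>lborel)"
    proof (rule integral_mono_AE')
      show "integrable lborel (\<lambda>\<xi>. exp (e * (2 / 3 + C / 6)) * exp (- (e * B / 3)) * exp (- (s * V N * (\<xi> - \<xi>0)\<^sup>2)))"
        by (intro integrable_mult_right gaussian_integral(1) sV)
      show "AE \<xi> in lborel. indicator ?J \<xi> * norm (phi N \<xi>) \<le> exp (e * (2 / 3 + C / 6)) * exp (- (e * B / 3)) * exp (- (s * V N * (\<xi> - \<xi>0)\<^sup>2))"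
        using p by (intro AE_I2) (auto simp: indicator_def)
    qed auto
    also have "\<dots> = exp (e * (2 / 3 + C / 6)) * exp (- (e * B / 3)) * sqrt (pi / (s * V N))"
      by (subst integral_mult_right_zero, subst gaussian_integral(2)[OF sV]) simp
    finally have "sqrt (V N) * (\<integral>\<xi>. indicator ?J \<xi> * norm (phi N \<xi>) \<partial>lborel)
      \<le> sqrt (V N) * (exp (e * (2 / 3 + C / 6)) * exp (- (e * B / 3)) * sqrt (pi / (s * V N)))"
      using V by (intro mult_left_mono) auto
    also have "\<dots> = A * exp (- (e * B / 3))"
    proof -
      have "sqrt (pi / (s * V N)) = sqrt (pi / s) / sqrt (V N)" by (simp add: real_sqrt_divide real_sqrt_mult)
      then show ?thesis unfolding A_def using V by simp
    qed
    finally show ?thesis .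
  qed
  show ?thesis
  proof (rule tendstoI)
    fix r :: real assume r: "0 < r"
    \<comment> \<open>Chosen so that the bound becomes \<open>r * exp (- 1)\<close>.\<close>
    define B where "B = 3 / e * (ln (A / r) + 1)"
    have AB: "A * exp (- (e * B / 3)) < r"
    proof -
      have "- (e * B / 3) = - ln (A / r) + - 1"
      proof -
        have "- (e * (3 / e * (l + 1)) / 3) = - l + - 1" for l using e by (simp add: field_simps)
        then show ?thesis unfolding B_def .
      qed
      then have "A * exp (- (e * B / 3)) = A * (exp (- ln (A / r)) * exp (- 1))" by (simp only: exp_add)
      also have "\<dots> = r * exp (- 1)" using A r by (simp add: exp_minus)
      also have "\<dots> < r" using r by simp
      finally show ?thesis .
    qed
    obtain N0 where N0: "\<forall>N\<ge>N0. \<forall>\<xi>\<in>?J. B \<le> hexagon_sum \<xi> N" using hexagon_sum_uniform[OF a] by blast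
    have "eventually (\<lambda>N. 0 < V N) sequentially" using V_at_top by (simp add: filterlim_at_top_dense)
    then show "eventually (\<lambda>N. dist (sqrt (V N) * (\<integral>\<xi>. indicator ?J \<xi> * norm (phi N \<xi>) \<partial>lborel)) 0 < r) sequentially"
      using eventually_ge_at_top[of N0]
    proof eventually_elim
      case (elim N)
      have "0 \<le> sqrt (V N) * (\<integral>\<xi>. indicator ?J \<xi> * norm (phi N \<xi>) \<partial>lborel)" using V_nonneg by simp
      then show ?case using bound[of B N] N0 elim AB by (auto simp: dist_real_def)
    qed
  qed
qed

end

section \<open>The Fejer kernel\<close>

definition tri :: "real \<Rightarrow> real \<Rightarrow> real" where
  "tri L \<xi> = max 0 (1 - \<bar>\<xi>\<bar> / L)"

text \<open>The Fourier transform of the triangle function \<open>tri L\<close>; the value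
  \<open>L\<close> at 0 is its continuous extension.\<close>

definition fejer :: "real \<Rightarrow> real \<Rightarrow> real" where
  "fejer L x = (if x = 0 then L else 2 * (1 - cos (L * x)) / (L * x\<^sup>2))"

lemma tri_measurable [measurable]: "tri L \<in> borel_measurable borel"
  unfolding tri_def[abs_def] by measurable

lemma fejer_measurable [measurable]: "fejer L \<in> borel_measurable borel"
  unfolding fejer_def[abs_def] by (intro measurable_If) auto

lemma tri_nonneg: "0 \<le> tri L \<xi>"
  unfolding tri_def by simp

lemma tri_minus [simp]: "tri L (- \<xi>) = tri L \<xi>"
  unfolding tri_def by simp

context
  fixes L :: real
  assumes L: "0 < L"
begin

lemma isCont_tri: "isCont (tri L) x"
  unfolding tri_def[abs_def] using L by (intro continuous_intros) auto

lemma integrable_Icc: "integrable lborel (\<lambda>\<xi>. indicator {a..b :: real} \<xi> :: real)"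
  by (rule integrable_real_indicator) (auto simp: emeasure_lborel_Icc_eq)

lemma tri_le_1: "tri L \<xi> \<le> 1"
  unfolding tri_def using L by simp

lemma tri_eq_0: "L \<le> \<bar>\<xi>\<bar> \<Longrightarrow> tri L \<xi> = 0"
  unfolding tri_def using L by simp

lemma tri_0: "tri L 0 = 1"
  unfolding tri_def by simp

lemma tri_integrable: "integrable lborel (\<lambda>\<xi>. tri L (\<xi> - t))"
proof (rule Bochner_Integration.integrable_bound)
  show "integrable lborel (\<lambda>\<xi>. indicator {t - L..t + L} \<xi> :: real)" by (rule integrable_Icc)
  show "AE \<xi> in lborel. norm (tri L (\<xi> - t)) \<le> norm (indicator {t - L..t + L} \<xi> :: real)"
    using tri_le_1 tri_eq_0 tri_nonneg[of L] by (intro AE_I2) (auto simp: indicator_def)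
qed measurable

lemma tri_cos_half: "(\<integral>\<xi>. ((1 - \<xi> / L) * cos (\<xi> * x)) * indicator {0..L} \<xi> \<partial>lborel) = fejer L x / 2"
proof (cases "x = 0")
  case True
  have "(\<integral>\<xi>. (1 - \<xi> / L) * indicator {0..L} \<xi> \<partial>lborel) = (L - L\<^sup>2 / (2 * L)) - (0 - 0\<^sup>2 / (2 * L))"
    using L by (intro integral_FTC_Icc_real) (auto intro!: derivative_eq_intros continuous_intros simp: field_simps)
  then show ?thesis using True L by (simp add: fejer_def power2_eq_square)
next
  case False
  let ?F = "\<lambda>\<xi>. (1 - \<xi> / L) * sin (\<xi> * x) / x - cos (\<xi> * x) / (L * x\<^sup>2)"
  have "(\<integral>\<xi>. ((1 - \<xi> / L) * cos (\<xi> * x)) * indicator {0..L} \<xi> \<partial>lborel) = ?F L - ?F 0"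
    using L False
    by (intro integral_FTC_Icc_real) (auto intro!: derivative_eq_intros continuous_intros simp: field_simps power2_eq_square)
  then show ?thesis using False L by (simp add: fejer_def diff_divide_distrib)
qed

lemma tri_cos: "(\<integral>\<xi>. tri L \<xi> * cos (\<xi> * x) \<partial>lborel) = fejer L x"
proof -
  let ?f = "\<lambda>\<xi>. ((1 - \<xi> / L) * cos (\<xi> * x)) * indicator {0..L} \<xi>"
  have i: "integrable lborel ?f"
  proof (rule Bochner_Integration.integrable_bound)
    show "integrable lborel (\<lambda>\<xi>. indicator {0..L} \<xi> :: real)" by (rule integrable_Icc)
    show "AE \<xi> in lborel. norm (?f \<xi>) \<le> norm (indicator {0..L} \<xi> :: real)"
    proof (rule AE_I2)
      fix \<xi>
      have "\<bar>1 - \<xi> / L\<bar> * \<bar>cos (\<xi> * x)\<bar> \<le> 1 * 1" if "0 \<le> \<xi>" "\<xi> \<le> L"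
        using that L by (intro mult_mono) (auto simp: abs_le_iff field_simps)
      then show "norm (?f \<xi>) \<le> norm (indicator {0..L} \<xi> :: real)" by (auto simp: indicator_def abs_mult)
    qed
  qed measurable
  have i': "integrable lborel (\<lambda>\<xi>. ?f (- \<xi>))"
    using lborel_integrable_real_affine[OF i, of "-1" 0] by simp
  have "(\<integral>\<xi>. tri L \<xi> * cos (\<xi> * x) \<partial>lborel) = (\<integral>\<xi>. ?f \<xi> + ?f (- \<xi>) \<partial>lborel)"
  proof (rule integral_cong_AE)
    show "AE \<xi> in lborel. tri L \<xi> * cos (\<xi> * x) = ?f \<xi> + ?f (- \<xi>)"
      using AE_lborel_singleton[of "0::real"]
      by eventually_elim (use L in \<open>auto simp: tri_def indicator_def max_def abs_if field_simps\<close>)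
  qed measurable
  also have "\<dots> = (\<integral>\<xi>. ?f \<xi> \<partial>lborel) + (\<integral>\<xi>. ?f (- \<xi>) \<partial>lborel)" using i i' by (rule Bochner_Integration.integral_add)
  also have "(\<integral>\<xi>. ?f (- \<xi>) \<partial>lborel) = (\<integral>\<xi>. ?f \<xi> \<partial>lborel)"
    using lborel_integral_real_affine[of "-1" ?f 0] by simp
  finally show ?thesis unfolding tri_cos_half by simp
qed

lemma tri_iexp_integrable: "integrable lborel (\<lambda>\<xi>. tri L (\<xi> - t) *\<^sub>R g \<xi>)"
  if [measurable]: "g \<in> borel_measurable borel" and "\<And>\<xi>. norm (g \<xi> :: complex) \<le> 1"
proof (rule Bochner_Integration.integrable_bound[OF tri_integrable[of t]])
  show "AE \<xi> in lborel. norm (tri L (\<xi> - t) *\<^sub>R g \<xi>) \<le> norm (tri L (\<xi> - t))"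
    using that(2) mult_left_mono[OF that(2) tri_nonneg[of L]] by (intro AE_I2) (simp add: tri_nonneg)
qed measurable

lemma fourier_tri: "(\<integral>\<xi>. tri L \<xi> *\<^sub>R iexp (\<xi> * x) \<partial>lborel) = fejer L x"
proof -
  have i: "integrable lborel (\<lambda>\<xi>. tri L \<xi> *\<^sub>R iexp (\<xi> * x))"
    using tri_iexp_integrable[of "\<lambda>\<xi>. iexp (\<xi> * x)" 0] by simp
  have "Re (\<integral>\<xi>. tri L \<xi> *\<^sub>R iexp (\<xi> * x) \<partial>lborel) = fejer L x"
    by (subst integral_Re[symmetric, OF i]) (simp add: Re_exp tri_cos)
  moreover have "Im (\<integral>\<xi>. tri L \<xi> *\<^sub>R iexp (\<xi> * x) \<partial>lborel) = 0"
  proof -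
    have "(\<integral>\<xi>. tri L \<xi> * sin (\<xi> * x) \<partial>lborel) = - (\<integral>\<xi>. tri L \<xi> * sin (\<xi> * x) \<partial>lborel)"
      using lborel_integral_real_affine[of "-1" "\<lambda>\<xi>. tri L \<xi> * sin (\<xi> * x)" 0] by simp
    then show ?thesis by (subst integral_Im[symmetric, OF i]) (simp add: Im_exp)
  qed
  ultimately show ?thesis by (simp add: complex_eq_iff)
qed

lemma fejer_nonneg: "0 \<le> fejer L x"
  unfolding fejer_def using L by simp

lemma fejer_le: "fejer L x \<le> L"
proof (cases "x = 0")
  case False
  have "2 * (1 - cos (L * x)) \<le> (L * x)\<^sup>2" using one_minus_cos_le[of "L * x"] by simp
  then have "2 * (1 - cos (L * x)) \<le> L * (L * x\<^sup>2)" by (simp add: power2_eq_square mult_ac)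
  moreover have "0 < L * x\<^sup>2" using False L by simp
  ultimately have "2 * (1 - cos (L * x)) / (L * x\<^sup>2) \<le> L" by (simp only: pos_divide_le_eq)
  then show ?thesis using False by (simp add: fejer_def)
qed (simp add: fejer_def)

text \<open>The constant is 2/48, from \<open>square_le_one_minus_cos\<close> applied to
  \<open>L * x\<close>. The bound permits division by the kernel on a bounded window once
  \<open>L\<close> is small.\<close>

lemma fejer_ge: "L * \<bar>x\<bar> \<le> pi \<Longrightarrow> L / 24 \<le> fejer L x"
proof (cases "x = 0")
  case False
  assume "L * \<bar>x\<bar> \<le> pi"
  then have "(L * x)\<^sup>2 \<le> 48 * (1 - cos (L * x))" using L by (intro square_le_one_minus_cos) (simp add: abs_mult)
  then have "L / 24 * (L * x\<^sup>2) \<le> 2 * (1 - cos (L * x))" by (simp add: power2_eq_square mult_ac)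
  moreover have "0 < L * x\<^sup>2" using False L by simp
  ultimately have "L / 24 \<le> 2 * (1 - cos (L * x)) / (L * x\<^sup>2)" by (simp only: pos_le_divide_eq)
  then show ?thesis using False by (simp add: fejer_def)
qed (use L in \<open>simp add: fejer_def\<close>)

lemma bnd_fejer: "bnd (\<lambda>w. fejer L (g w))"
  using fejer_nonneg fejer_le by (intro bndI[of _ L]) auto

lemma fejer_integrable: "integrable lborel (fejer L)"
proof (rule Bochner_Integration.integrable_bound)
  have "integrable lborel (\<lambda>x :: real. inverse (1 + x\<^sup>2))"
    using integrable_inverse_1_plus_square by (simp add: set_integrable_def einterval_def)
  then show "integrable lborel (\<lambda>x. (L + 4 / L) * inverse (1 + x\<^sup>2))" by (rule integrable_mult_right)
  show "AE x in lborel. norm (fejer L x) \<le> norm ((L + 4 / L) * inverse (1 + x\<^sup>2))"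
  proof (rule AE_I2)
    fix x :: real
    have "fejer L x * x\<^sup>2 \<le> 4 / L"
    proof (cases "x = 0")
      case False
      have "fejer L x * x\<^sup>2 = 2 * (1 - cos (L * x)) / L" using False L by (simp add: fejer_def)
      also have "\<dots> \<le> 4 / L"
      proof (rule divide_right_mono)
        show "2 * (1 - cos (L * x)) \<le> 4"
          using cos_ge_minus_one[of "L * x"] unfolding right_diff_distrib by linarith
      qed (use L in simp)
      finally show ?thesis .
    qed (use L in simp)
    then have "fejer L x * (1 + x\<^sup>2) \<le> L + 4 / L" using fejer_le[of x] by (simp add: distrib_left)
    moreover have "0 < 1 + x\<^sup>2" by (simp add: add_pos_nonneg)
    ultimately have "fejer L x \<le> (L + 4 / L) * inverse (1 + x\<^sup>2)" by (simp add: pos_le_divide_eq flip: divide_inverse)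
    then show "norm (fejer L x) \<le> norm ((L + 4 / L) * inverse (1 + x\<^sup>2))"
      using fejer_nonneg[of x] by simp
  qed
qed measurable

text \<open>The kernel is the transform of the finite measure with density \<open>tri L\<close>, so
  the expectation becomes a Fourier integral by Fubini. The factor \<open>iexp (t * Y)\<close>
  merely translates the triangle, and the support stays compact.\<close>

lemma fejer_expectation:
  fixes M :: "'w measure" and Y :: "'w \<Rightarrow> real"
  assumes "prob_space M" and [measurable]: "Y \<in> borel_measurable M"
  shows "(\<integral>\<omega>. fejer L (Y \<omega>) *\<^sub>R iexp (t * Y \<omega>) \<partial>M) = (\<integral>\<xi>. tri L (\<xi> - t) *\<^sub>R (\<integral>\<omega>. iexp (\<xi> * Y \<omega>) \<partial>M) \<partial>lborel)"
proof -
  interpret prob_space M by fact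
  define \<tau> where "\<tau> = density lborel (\<lambda>\<xi>. ennreal (tri L \<xi>))"
  have s\<tau> [measurable_cong]: "sets \<tau> = sets borel" unfolding \<tau>_def by simp
  have fin: "finite_measure \<tau>"
  proof (rule finite_measureI)
    have "emeasure \<tau> (space \<tau>) = (\<integral>\<^sup>+\<xi>. ennreal (tri L \<xi>) \<partial>lborel)"
      unfolding \<tau>_def by (subst emeasure_density) auto
    also have "\<dots> = ennreal (\<integral>\<xi>. tri L \<xi> \<partial>lborel)"
      using tri_integrable[of 0] by (intro nn_integral_eq_integral) (auto simp: tri_nonneg)
    finally show "emeasure \<tau> (space \<tau>) \<noteq> \<infinity>" by simp
  qed
  have \<tau>: "(\<integral>\<xi>. g \<xi> \<partial>\<tau>) = (\<integral>\<xi>. tri L \<xi> *\<^sub>R g \<xi> \<partial>lborel)"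
    if "g \<in> borel_measurable borel" for g :: "real \<Rightarrow> complex"
    unfolding \<tau>_def using that by (intro integral_density) (auto simp: tri_nonneg)
  have "(\<integral>\<omega>. fejer L (Y \<omega>) *\<^sub>R iexp (t * Y \<omega>) \<partial>M) = (\<integral>\<omega>. \<integral>\<xi>. iexp ((\<xi> + t) * Y \<omega>) \<partial>\<tau> \<partial>M)"
  proof (intro Bochner_Integration.integral_cong refl)
    fix \<omega>
    have "fejer L (Y \<omega>) *\<^sub>R iexp (t * Y \<omega>) = (\<integral>\<xi>. tri L \<xi> *\<^sub>R iexp (\<xi> * Y \<omega>) \<partial>lborel) * iexp (t * Y \<omega>)"
      unfolding fourier_tri by (simp add: scaleR_conv_of_real)
    also have "\<dots> = (\<integral>\<xi>. tri L \<xi> *\<^sub>R iexp (\<xi> * Y \<omega>) * iexp (t * Y \<omega>) \<partial>lborel)" by (simp only: integral_mult_left_zero)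
    also have "\<dots> = (\<integral>\<xi>. iexp ((\<xi> + t) * Y \<omega>) \<partial>\<tau>)"
      by (subst \<tau>) (auto intro!: Bochner_Integration.integral_cong simp: algebra_simps exp_add)
    finally show "fejer L (Y \<omega>) *\<^sub>R iexp (t * Y \<omega>) = (\<integral>\<xi>. iexp ((\<xi> + t) * Y \<omega>) \<partial>\<tau>)" .
  qed
  also have "\<dots> = (\<integral>\<xi>. \<integral>\<omega>. iexp ((\<xi> + t) * Y \<omega>) \<partial>M \<partial>\<tau>)"
    by (rule Fubini_bnd(1)[OF finite_measure_axioms fin], unfold case_prod_unfold, rule bnd_iexp) measurable
  also have "\<dots> = (\<integral>\<xi>. tri L \<xi> *\<^sub>R (\<integral>\<omega>. iexp ((\<xi> + t) * Y \<omega>) \<partial>M) \<partial>lborel)"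
    by (rule \<tau>) measurable
  also have "\<dots> = (\<integral>\<xi>. tri L (\<xi> - t) *\<^sub>R (\<integral>\<omega>. iexp (\<xi> * Y \<omega>) \<partial>M) \<partial>lborel)"
    using lborel_integral_real_affine[of 1 "\<lambda>\<xi>. tri L (\<xi> - t) *\<^sub>R (\<integral>\<omega>. iexp (\<xi> * Y \<omega>) \<partial>M)" t] by (simp add: add.commute)
  finally show ?thesis .
qed

lemma integral_gaussian_iexp:
  "(\<integral>u. exp (- u\<^sup>2 / 2) *\<^sub>R iexp (- u * z) \<partial>lborel) = complex_of_real (sqrt (2 * pi) * exp (- z\<^sup>2 / 2))"
proof -
  have "char std_normal_distribution (- z) = (\<integral>u. std_normal_density u *\<^sub>R iexp (- z * u) \<partial>lborel)"
    unfolding char_def by (subst integral_density) auto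
  also have "\<dots> = (\<integral>u. (1 / sqrt (2 * pi)) *\<^sub>R (exp (- u\<^sup>2 / 2) *\<^sub>R iexp (- u * z)) \<partial>lborel)"
    by (intro Bochner_Integration.integral_cong refl) (simp add: std_normal_density_def mult.commute)
  also have "\<dots> = (1 / sqrt (2 * pi)) *\<^sub>R (\<integral>u. exp (- u\<^sup>2 / 2) *\<^sub>R iexp (- u * z) \<partial>lborel)"
    by (rule integral_scaleR_right)
  finally have "complex_of_real (exp (- z\<^sup>2 / 2)) = (1 / sqrt (2 * pi)) *\<^sub>R (\<integral>u. exp (- u\<^sup>2 / 2) *\<^sub>R iexp (- u * z) \<partial>lborel)"
    unfolding char_std_normal_distribution by simp
  then have "sqrt (2 * pi) *\<^sub>R complex_of_real (exp (- z\<^sup>2 / 2)) = (\<integral>u. exp (- u\<^sup>2 / 2) *\<^sub>R iexp (- u * z) \<partial>lborel)"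
    by (simp add: scaleR_scaleR)
  then show ?thesis by (simp add: scaleR_conv_of_real)
qed

text \<open>Near 0 the substitution \<open>\<xi> = u / sqrt (V N)\<close> absorbs the prefactor, the
  triangle freezes at \<open>- t\<close>, and the Gaussian bound dominates. Farther out the support
  of the triangle ends at \<open>L + \<bar>t\<bar>\<close>, so the tail assumption finishes the
  estimate. The statement is kept abstract because it is applied both to the chain and to pure
  Gaussians, for inversion of \<open>tri\<close>.\<close>

lemma scaled_fourier_limit:
  fixes \<psi> :: "nat \<Rightarrow> real \<Rightarrow> complex" and V :: "nat \<Rightarrow> real"
  assumes V: "filterlim V at_top sequentially"
    and [measurable]: "\<And>N. \<psi> N \<in> borel_measurable borel" and le1: "\<And>N \<xi>. norm (\<psi> N \<xi>) \<le> 1"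
    and c: "0 < c" and \<delta>: "0 < \<delta>"
    and near: "\<And>N \<xi>. \<bar>\<xi>\<bar> \<le> \<delta> \<Longrightarrow> norm (\<psi> N \<xi>) \<le> C * exp (- (c * V N * \<xi>\<^sup>2))"
    and tail: "\<And>R. (\<lambda>N. sqrt (V N) * (\<integral>\<xi>. indicator {\<xi>. \<delta> < \<bar>\<xi>\<bar> \<and> \<bar>\<xi>\<bar> \<le> R} \<xi> * norm (\<psi> N \<xi>) \<partial>lborel)) \<longlonglongrightarrow> 0"
    and lim: "\<And>u. (\<lambda>N. \<psi> N (u / sqrt (V N))) \<longlonglongrightarrow> exp (- u\<^sup>2 / 2) *\<^sub>R iexp (- u * z)"
  shows "(\<lambda>N. sqrt (V N) *\<^sub>R (\<integral>\<xi>. tri L (\<xi> - t) *\<^sub>R \<psi> N \<xi> \<partial>lborel)) \<longlonglongrightarrow> tri L t * (sqrt (2 * pi) * exp (- z\<^sup>2 / 2))"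
proof -
  let ?near = "\<lambda>N \<xi>. indicator {-\<delta>..\<delta>} \<xi> *\<^sub>R (tri L (\<xi> - t) *\<^sub>R \<psi> N \<xi>)"
  let ?far = "\<lambda>N \<xi>. indicator {\<xi>. \<delta> < \<bar>\<xi>\<bar>} \<xi> *\<^sub>R (tri L (\<xi> - t) *\<^sub>R \<psi> N \<xi>)"
  have V0: "eventually (\<lambda>N. 0 < V N) sequentially" using V by (simp add: filterlim_at_top_dense)
  have i: "integrable lborel (\<lambda>\<xi>. tri L (\<xi> - t) *\<^sub>R \<psi> N \<xi>)" for N
    by (rule tri_iexp_integrable) (auto simp: le1)
  have in1: "integrable lborel (?near N)" for N by (rule integrable_mult_indicator[OF _ i]) simp
  have in2: "integrable lborel (?far N)" for N by (rule integrable_mult_indicator[OF _ i]) measurable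
  have split: "(\<integral>\<xi>. tri L (\<xi> - t) *\<^sub>R \<psi> N \<xi> \<partial>lborel) = (\<integral>\<xi>. ?near N \<xi> \<partial>lborel) + (\<integral>\<xi>. ?far N \<xi> \<partial>lborel)" for N
  proof -
    have "(\<integral>\<xi>. tri L (\<xi> - t) *\<^sub>R \<psi> N \<xi> \<partial>lborel) = (\<integral>\<xi>. ?near N \<xi> + ?far N \<xi> \<partial>lborel)"
      by (intro Bochner_Integration.integral_cong refl) (auto simp: indicator_def)
    then show ?thesis using Bochner_Integration.integral_add[OF in1 in2] by simp
  qed
  have far: "(\<lambda>N. sqrt (V N) *\<^sub>R (\<integral>\<xi>. ?far N \<xi> \<partial>lborel)) \<longlonglongrightarrow> 0"
  proof (rule Lim_null_comparison[OF _ tail[of "L + \<bar>t\<bar>"]])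
    show "eventually (\<lambda>N. norm (sqrt (V N) *\<^sub>R (\<integral>\<xi>. ?far N \<xi> \<partial>lborel))
      \<le> sqrt (V N) * (\<integral>\<xi>. indicator {\<xi>. \<delta> < \<bar>\<xi>\<bar> \<and> \<bar>\<xi>\<bar> \<le> L + \<bar>t\<bar>} \<xi> * norm (\<psi> N \<xi>) \<partial>lborel)) sequentially"
      using V0
    proof eventually_elim
      case (elim N)
      have "norm (\<integral>\<xi>. ?far N \<xi> \<partial>lborel) \<le> (\<integral>\<xi>. norm (?far N \<xi>) \<partial>lborel)" by (rule integral_norm_bound)
      also have "\<dots> \<le> (\<integral>\<xi>. indicator {\<xi>. \<delta> < \<bar>\<xi>\<bar> \<and> \<bar>\<xi>\<bar> \<le> L + \<bar>t\<bar>} \<xi> * norm (\<psi> N \<xi>) \<partial>lborel)"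
      proof (rule integral_mono)
        show "integrable lborel (\<lambda>\<xi>. norm (?far N \<xi>))" by (rule integrable_norm[OF in2])
        show "integrable lborel (\<lambda>\<xi>. indicator {\<xi>. \<delta> < \<bar>\<xi>\<bar> \<and> \<bar>\<xi>\<bar> \<le> L + \<bar>t\<bar>} \<xi> * norm (\<psi> N \<xi>))"
        proof (rule Bochner_Integration.integrable_bound)
          show "integrable lborel (\<lambda>\<xi>. indicator {-(L + \<bar>t\<bar>)..L + \<bar>t\<bar>} \<xi> :: real)" by (rule integrable_Icc)
          show "AE \<xi> in lborel. norm (indicator {\<xi>. \<delta> < \<bar>\<xi>\<bar> \<and> \<bar>\<xi>\<bar> \<le> L + \<bar>t\<bar>} \<xi> * norm (\<psi> N \<xi>)) \<le> norm (indicator {-(L + \<bar>t\<bar>)..L + \<bar>t\<bar>} \<xi> :: real)"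
            using le1 by (intro AE_I2) (auto simp: indicator_def)
        qed measurable
        fix \<xi>
        show "norm (?far N \<xi>) \<le> indicator {\<xi>. \<delta> < \<bar>\<xi>\<bar> \<and> \<bar>\<xi>\<bar> \<le> L + \<bar>t\<bar>} \<xi> * norm (\<psi> N \<xi>)"
        proof (cases "\<bar>\<xi>\<bar> \<le> L + \<bar>t\<bar>")
          case True
          then show ?thesis
            using mult_right_mono[OF tri_le_1[of "\<xi> - t"] norm_ge_zero[of "\<psi> N \<xi>"]] by (auto simp: indicator_def tri_nonneg)
        next
          case False
          then have "L \<le> \<bar>\<xi> - t\<bar>" by linarith
          then have "tri L (\<xi> - t) = 0" by (rule tri_eq_0)
          then show ?thesis by simp
        qed
      qed
      finally show ?case using elim by (simp add: mult_left_mono)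
    qed
  qed
  \<comment> \<open>The value 0 for nonpositive \<open>V N\<close> makes the domination hold for
    every \<open>N\<close>, not only eventually.\<close>
  define s where "s N u = (if 0 < V N then ?near N (u / sqrt (V N)) else 0)" for N u
  have s_eq: "s N u = tri L (u / sqrt (V N) - t) *\<^sub>R \<psi> N (u / sqrt (V N))"
    if "0 < V N" "\<bar>u / sqrt (V N)\<bar> \<le> \<delta>" for N u
  proof -
    have "u / sqrt (V N) \<in> {-\<delta>..\<delta>}" using that(2) unfolding atLeastAtMost_iff abs_le_iff by linarith
    then show ?thesis unfolding s_def using that(1) by simp
  qed
  have "(\<lambda>N. \<integral>u. s N u \<partial>lborel) \<longlonglongrightarrow> (\<integral>u. tri L (- t) *\<^sub>R (exp (- u\<^sup>2 / 2) *\<^sub>R iexp (- u * z)) \<partial>lborel)"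
  proof (rule integral_dominated_convergence[where w = "\<lambda>u. \<bar>C\<bar> * exp (- (c * (u - 0)\<^sup>2))"])
    show "integrable lborel (\<lambda>u. \<bar>C\<bar> * exp (- (c * (u - 0)\<^sup>2)))"
      by (intro integrable_mult_right gaussian_integral(1) c)
    show "AE u in lborel. (\<lambda>N. s N u) \<longlonglongrightarrow> tri L (- t) *\<^sub>R (exp (- u\<^sup>2 / 2) *\<^sub>R iexp (- u * z))"
    proof (rule AE_I2)
      fix u :: real
      have sq: "filterlim (\<lambda>N. sqrt (V N)) at_top sequentially" by (rule filterlim_compose[OF sqrt_at_top V])
      have 0: "(\<lambda>N. u / sqrt (V N)) \<longlonglongrightarrow> 0"
        by (rule tendsto_divide_0[OF tendsto_const filterlim_at_top_imp_at_infinity[OF sq]])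
      have "(\<lambda>N. u / sqrt (V N) - t) \<longlonglongrightarrow> 0 - t" by (intro tendsto_diff 0 tendsto_const)
      from isCont_tendsto_compose[OF isCont_tri this]
      have 1: "(\<lambda>N. tri L (u / sqrt (V N) - t)) \<longlonglongrightarrow> tri L (- t)" by simp
      have 2: "eventually (\<lambda>N. \<bar>u / sqrt (V N)\<bar> < \<delta>) sequentially"
        using tendstoD[OF 0 \<delta>] by (simp add: dist_real_def)
      show "(\<lambda>N. s N u) \<longlonglongrightarrow> tri L (- t) *\<^sub>R (exp (- u\<^sup>2 / 2) *\<^sub>R iexp (- u * z))"
      proof (rule Lim_transform_eventually)
        show "(\<lambda>N. tri L (u / sqrt (V N) - t) *\<^sub>R \<psi> N (u / sqrt (V N))) \<longlonglongrightarrow> tri L (- t) *\<^sub>R (exp (- u\<^sup>2 / 2) *\<^sub>R iexp (- u * z))"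
          by (intro tendsto_scaleR 1 lim)
        show "eventually (\<lambda>N. tri L (u / sqrt (V N) - t) *\<^sub>R \<psi> N (u / sqrt (V N)) = s N u) sequentially"
          using 2 V0 by eventually_elim (rule s_eq[symmetric], simp_all del: abs_divide)
      qed
    qed
    fix N
    show "AE u in lborel. norm (s N u) \<le> \<bar>C\<bar> * exp (- (c * (u - 0)\<^sup>2))"
    proof (rule AE_I2)
      fix u
      show "norm (s N u) \<le> \<bar>C\<bar> * exp (- (c * (u - 0)\<^sup>2))"
      proof (cases "0 < V N \<and> \<bar>u / sqrt (V N)\<bar> \<le> \<delta>")
        case True
        have "s N u = tri L (u / sqrt (V N) - t) *\<^sub>R \<psi> N (u / sqrt (V N))" using True by (intro s_eq) blast+
        then have "norm (s N u) = tri L (u / sqrt (V N) - t) * norm (\<psi> N (u / sqrt (V N)))" by (simp add: tri_nonneg)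
        also have "\<dots> \<le> 1 * norm (\<psi> N (u / sqrt (V N)))" by (intro mult_right_mono tri_le_1) auto
        also have "\<dots> \<le> C * exp (- (c * V N * (u / sqrt (V N))\<^sup>2))"
          unfolding mult_1 using True by (intro near) blast
        also have "\<dots> \<le> \<bar>C\<bar> * exp (- (c * V N * (u / sqrt (V N))\<^sup>2))" by (intro mult_right_mono) auto
        also have "\<dots> = \<bar>C\<bar> * exp (- (c * (u - 0)\<^sup>2))" using True by (simp add: power_divide)
        finally show ?thesis .
      next
        case False
        then have "s N u = 0" unfolding s_def by (auto simp: indicator_def abs_le_iff)
        then show ?thesis by simp
      qed
    qed
  qed (unfold s_def, measurable)
  also have "(\<integral>u. tri L (- t) *\<^sub>R (exp (- u\<^sup>2 / 2) *\<^sub>R iexp (- u * z)) \<partial>lborel) = tri L t * (sqrt (2 * pi) * exp (- z\<^sup>2 / 2))"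
    by (subst integral_scaleR_right, subst integral_gaussian_iexp) (simp add: scaleR_conv_of_real)
  finally have lim_s: "(\<lambda>N. \<integral>u. s N u \<partial>lborel) \<longlonglongrightarrow> complex_of_real (tri L t * (sqrt (2 * pi) * exp (- z\<^sup>2 / 2)))" .
  have near': "(\<lambda>N. sqrt (V N) *\<^sub>R (\<integral>\<xi>. ?near N \<xi> \<partial>lborel)) \<longlonglongrightarrow> tri L t * (sqrt (2 * pi) * exp (- z\<^sup>2 / 2))"
  proof (rule Lim_transform_eventually[OF lim_s])
    show "eventually (\<lambda>N. (\<integral>u. s N u \<partial>lborel) = sqrt (V N) *\<^sub>R (\<integral>\<xi>. ?near N \<xi> \<partial>lborel)) sequentially"
      using V0
    proof eventually_elim
      case (elim N)
      have "(\<integral>\<xi>. ?near N \<xi> \<partial>lborel) = (1 / sqrt (V N)) *\<^sub>R (\<integral>u. ?near N (u / sqrt (V N)) \<partial>lborel)"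
        using lborel_integral_real_affine[of "1 / sqrt (V N)" "?near N" 0] elim by simp
      then show ?case using elim by (simp add: s_def)
    qed
  qed
  show ?thesis
    unfolding split scaleR_add_right using tendsto_add[OF near' far] by simp
qed

text \<open>Fourier inversion for the triangle by Gaussian regularisation. Applied to a normal
  variable of standard deviation \<open>Suc n\<close>, \<open>fejer_expectation\<close> gives two
  forms of the same quantity: on the frequency side \<open>scaled_fourier_limit\<close> with
  \<open>V\<close> the square of \<open>Suc n\<close> and \<open>z = 0\<close> yields the limit, on
  the space side the Gaussian factor tends to 1 under the integrable kernel.\<close>

lemma fourier_fejer: "(\<integral>x. fejer L x *\<^sub>R iexp (t * x) \<partial>lborel) = complex_of_real (2 * pi * tri L t)"
proof -
  interpret N: real_distribution std_normal_distribution by (rule real_dist_normal_dist)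
  let ?V = "\<lambda>n. (real (Suc n))\<^sup>2"
  let ?\<psi> = "\<lambda>n \<xi>. complex_of_real (exp (- ((real (Suc n) * \<xi>)\<^sup>2) / 2))"
  have V: "filterlim ?V at_top sequentially" by real_asymp
  have cf: "(\<integral>x. iexp (\<xi> * (real (Suc n) * x)) \<partial>std_normal_distribution) = ?\<psi> n \<xi>" for n \<xi>
    using fun_cong[OF char_std_normal_distribution, of "\<xi> * real (Suc n)"] unfolding char_def by (simp add: mult_ac)
  have "(\<lambda>n. sqrt (?V n) *\<^sub>R (\<integral>\<xi>. tri L (\<xi> - t) *\<^sub>R ?\<psi> n \<xi> \<partial>lborel)) \<longlonglongrightarrow> tri L t * (sqrt (2 * pi) * exp (- 0\<^sup>2 / 2))"
  proof (rule scaled_fourier_limit[OF V, where c = "1 / 2" and \<delta> = 1 and C = 1])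
    show "norm (?\<psi> n \<xi>) \<le> 1 * exp (- (1 / 2 * ?V n * \<xi>\<^sup>2))" for n \<xi> by (simp add: power_mult_distrib)
    show "(\<lambda>n. sqrt (?V n) * (\<integral>\<xi>. indicator {\<xi>. 1 < \<bar>\<xi>\<bar> \<and> \<bar>\<xi>\<bar> \<le> R} \<xi> * norm (?\<psi> n \<xi>) \<partial>lborel)) \<longlonglongrightarrow> 0" for R
    proof (rule tendsto_sandwich[OF _ _ tendsto_const])
      show "eventually (\<lambda>n. 0 \<le> sqrt (?V n) * (\<integral>\<xi>. indicator {\<xi>. 1 < \<bar>\<xi>\<bar> \<and> \<bar>\<xi>\<bar> \<le> R} \<xi> * norm (?\<psi> n \<xi>) \<partial>lborel)) sequentially"
        by simp
      show "(\<lambda>n. real (Suc n) * (2 * \<bar>R\<bar> * exp (- (real (Suc n))\<^sup>2 / 2))) \<longlonglongrightarrow> 0" by real_asymp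
      show "eventually (\<lambda>n. sqrt (?V n) * (\<integral>\<xi>. indicator {\<xi>. 1 < \<bar>\<xi>\<bar> \<and> \<bar>\<xi>\<bar> \<le> R} \<xi> * norm (?\<psi> n \<xi>) \<partial>lborel)
         \<le> real (Suc n) * (2 * \<bar>R\<bar> * exp (- (real (Suc n))\<^sup>2 / 2))) sequentially"
      proof (rule always_eventually, rule allI)
        fix n
        have "(\<integral>\<xi>. indicator {\<xi>. 1 < \<bar>\<xi>\<bar> \<and> \<bar>\<xi>\<bar> \<le> R} \<xi> * norm (?\<psi> n \<xi>) \<partial>lborel)
          \<le> (\<integral>\<xi>. indicator {-\<bar>R\<bar>..\<bar>R\<bar>} \<xi> * exp (- (real (Suc n))\<^sup>2 / 2) \<partial>lborel)"
        proof (rule integral_mono_AE')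
          show "AE \<xi> in lborel. indicator {\<xi>. 1 < \<bar>\<xi>\<bar> \<and> \<bar>\<xi>\<bar> \<le> R} \<xi> * norm (?\<psi> n \<xi>) \<le> indicator {-\<bar>R\<bar>..\<bar>R\<bar>} \<xi> * exp (- (real (Suc n))\<^sup>2 / 2)"
          proof (rule AE_I2)
            fix \<xi> :: real
            have "(real (Suc n))\<^sup>2 * 1 \<le> (real (Suc n))\<^sup>2 * \<xi>\<^sup>2" if "1 < \<bar>\<xi>\<bar>"
              using that abs_le_square_iff[of 1 \<xi>] by (intro mult_left_mono) auto
            then show "indicator {\<xi>. 1 < \<bar>\<xi>\<bar> \<and> \<bar>\<xi>\<bar> \<le> R} \<xi> * norm (?\<psi> n \<xi>) \<le> indicator {-\<bar>R\<bar>..\<bar>R\<bar>} \<xi> * exp (- (real (Suc n))\<^sup>2 / 2)"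
              by (auto simp: indicator_def power_mult_distrib simp del: of_nat_Suc)
          qed
        qed auto
        also have "\<dots> = 2 * \<bar>R\<bar> * exp (- (real (Suc n))\<^sup>2 / 2)" by (simp del: of_nat_Suc)
        finally show "sqrt (?V n) * (\<integral>\<xi>. indicator {\<xi>. 1 < \<bar>\<xi>\<bar> \<and> \<bar>\<xi>\<bar> \<le> R} \<xi> * norm (?\<psi> n \<xi>) \<partial>lborel)
         \<le> real (Suc n) * (2 * \<bar>R\<bar> * exp (- (real (Suc n))\<^sup>2 / 2))"
          by (simp add: mult_left_mono del: of_nat_Suc)
      qed
    qed
    show "(\<lambda>n. ?\<psi> n (u / sqrt (?V n))) \<longlonglongrightarrow> exp (- u\<^sup>2 / 2) *\<^sub>R iexp (- u * 0)" for u
      by (simp add: scaleR_conv_of_real del: of_nat_Suc)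
  qed (auto simp: power_mult_distrib)
  then have lim1: "(\<lambda>n. sqrt (?V n) *\<^sub>R (\<integral>\<xi>. tri L (\<xi> - t) *\<^sub>R ?\<psi> n \<xi> \<partial>lborel)) \<longlonglongrightarrow> complex_of_real (tri L t * sqrt (2 * pi))" by simp
  have eq: "(\<integral>x. exp (- (x / real (Suc n))\<^sup>2 / 2) *\<^sub>R (fejer L x *\<^sub>R iexp (t * x)) \<partial>lborel)
     = sqrt (2 * pi) *\<^sub>R (sqrt (?V n) *\<^sub>R (\<integral>\<xi>. tri L (\<xi> - t) *\<^sub>R ?\<psi> n \<xi> \<partial>lborel))" for n
  proof -
    let ?k = "real (Suc n)"
    let ?g = "\<lambda>x. exp (- (x / ?k)\<^sup>2 / 2) *\<^sub>R (fejer L x *\<^sub>R iexp (t * x))"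
    have "(\<integral>\<xi>. tri L (\<xi> - t) *\<^sub>R ?\<psi> n \<xi> \<partial>lborel) = (\<integral>\<xi>. tri L (\<xi> - t) *\<^sub>R (\<integral>x. iexp (\<xi> * (?k * x)) \<partial>std_normal_distribution) \<partial>lborel)"
      unfolding cf ..
    also have "\<dots> = (\<integral>x. fejer L (?k * x) *\<^sub>R iexp (t * (?k * x)) \<partial>std_normal_distribution)"
      by (rule fejer_expectation[symmetric]) (auto intro: N.prob_space_axioms)
    also have "\<dots> = (\<integral>x. std_normal_density x *\<^sub>R (fejer L (?k * x) *\<^sub>R iexp (t * (?k * x))) \<partial>lborel)"
      by (rule integral_density) auto
    also have "\<dots> = (\<integral>x. (1 / sqrt (2 * pi)) *\<^sub>R ?g (0 + ?k * x) \<partial>lborel)"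
      by (intro Bochner_Integration.integral_cong refl) (simp add: std_normal_density_def del: of_nat_Suc)
    also have "\<dots> = (1 / sqrt (2 * pi)) *\<^sub>R (\<integral>x. ?g (0 + ?k * x) \<partial>lborel)" by (rule integral_scaleR_right)
    also have "(\<integral>x. ?g (0 + ?k * x) \<partial>lborel) = (1 / ?k) *\<^sub>R (\<integral>x. ?g x \<partial>lborel)"
      using lborel_integral_real_affine[of ?k ?g 0] by (simp del: of_nat_Suc)
    finally show ?thesis by (simp del: of_nat_Suc)
  qed
  have lim2: "(\<lambda>n. \<integral>x. exp (- (x / real (Suc n))\<^sup>2 / 2) *\<^sub>R (fejer L x *\<^sub>R iexp (t * x)) \<partial>lborel) \<longlonglongrightarrow> (\<integral>x. fejer L x *\<^sub>R iexp (t * x) \<partial>lborel)"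
  proof (rule integral_dominated_convergence[where w = "fejer L"])
    show "AE x in lborel. (\<lambda>n. exp (- (x / real (Suc n))\<^sup>2 / 2) *\<^sub>R (fejer L x *\<^sub>R iexp (t * x))) \<longlonglongrightarrow> fejer L x *\<^sub>R iexp (t * x)"
    proof (rule AE_I2)
      fix x :: real
      have "(\<lambda>n. x / real (Suc n)) \<longlonglongrightarrow> 0" by (rule LIMSEQ_Suc[OF lim_const_over_n])
      then have "(\<lambda>n. exp (- (x / real (Suc n))\<^sup>2 / 2)) \<longlonglongrightarrow> exp (- 0\<^sup>2 / 2)" by (intro tendsto_intros) auto
      then have "(\<lambda>n. exp (- (x / real (Suc n))\<^sup>2 / 2)) \<longlonglongrightarrow> 1" by simp
      from tendsto_scaleR[OF this tendsto_const[of "fejer L x *\<^sub>R iexp (t * x)"]]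
      show "(\<lambda>n. exp (- (x / real (Suc n))\<^sup>2 / 2) *\<^sub>R (fejer L x *\<^sub>R iexp (t * x))) \<longlonglongrightarrow> fejer L x *\<^sub>R iexp (t * x)" by simp
    qed
    show "AE x in lborel. norm (exp (- (x / real (Suc n))\<^sup>2 / 2) *\<^sub>R (fejer L x *\<^sub>R iexp (t * x))) \<le> fejer L x" for n
    proof (rule AE_I2)
      fix x
      have "exp (- (x / real (Suc n))\<^sup>2 / 2) * fejer L x \<le> 1 * fejer L x" using fejer_nonneg by (intro mult_right_mono) auto
      then show "norm (exp (- (x / real (Suc n))\<^sup>2 / 2) *\<^sub>R (fejer L x *\<^sub>R iexp (t * x))) \<le> fejer L x"
        using fejer_nonneg[of x] by (simp del: of_nat_Suc)
    qed
  qed (auto intro: fejer_integrable)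
  have "(\<lambda>n. sqrt (2 * pi) *\<^sub>R (sqrt (?V n) *\<^sub>R (\<integral>\<xi>. tri L (\<xi> - t) *\<^sub>R ?\<psi> n \<xi> \<partial>lborel))) \<longlonglongrightarrow> sqrt (2 * pi) *\<^sub>R complex_of_real (tri L t * sqrt (2 * pi))"
    by (intro tendsto_scaleR tendsto_const lim1)
  from LIMSEQ_unique[OF lim2[unfolded eq] this] show ?thesis
    by (simp add: scaleR_conv_of_real mult_ac flip: of_real_mult)
qed

end

section \<open>The local limit theorem\<close>

lemma isCont_fejer:
  assumes "0 < L" "x \<noteq> 0" shows "isCont (fejer L) x"
proof -
  have "eventually (\<lambda>y. fejer L y = 2 * (1 - cos (L * y)) / (L * y\<^sup>2)) (nhds x)"
    using t1_space_nhds[OF assms(2)] by eventually_elim (simp add: fejer_def)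
  moreover have "isCont (\<lambda>y. 2 * (1 - cos (L * y)) / (L * y\<^sup>2)) x"
    using assms by (intro continuous_intros) auto
  ultimately show ?thesis by (simp add: isCont_cong)
qed

context nonlattice_functional begin

lemma phi_minus: "phi N (- \<xi>) = cnj (phi N \<xi>)"
proof -
  have "phi N (- \<xi>) = (\<integral>\<omega>. cnj (iexp (\<xi> * psum f N \<omega>)) \<partial>M)"
    unfolding phi_def by (rule Bochner_Integration.integral_cong[OF refl]) (simp add: exp_cnj)
  also have "\<dots> = cnj (phi N \<xi>)" unfolding phi_def by (rule Bochner_Integration.integral_cnj)
  finally show ?thesis .
qed

lemma phi_interval_integrable: "integrable lborel (\<lambda>\<xi>. indicator {a..b} \<xi> * norm (phi N \<xi>))"
proof (rule Bochner_Integration.integrable_bound)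
  show "integrable lborel (\<lambda>\<xi>. indicator {a..b} \<xi> :: real)"
    by (rule integrable_real_indicator) (auto simp: emeasure_lborel_Icc_eq)
  show "AE \<xi> in lborel. norm (indicator {a..b} \<xi> * norm (phi N \<xi>)) \<le> norm (indicator {a..b} \<xi> :: real)"
    using phi_norm_le_1 by (intro AE_I2) (auto simp: indicator_def)
qed measurable

text \<open>The region is covered by finitely many intervals of length \<open>delta\<close> starting
  at positive multiples of \<open>delta\<close>, together with their reflections; conjugate symmetry
  of \<open>phi\<close> makes both halves contribute equally.\<close>

lemma phi_tail:
  "(\<lambda>N. sqrt (V N) * (\<integral>\<xi>. indicator {\<xi>. delta < \<bar>\<xi>\<bar> \<and> \<bar>\<xi>\<bar> \<le> R} \<xi> * norm (phi N \<xi>) \<partial>lborel)) \<longlonglongrightarrow> 0"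
proof -
  define J where "J = nat \<lceil>R / delta\<rceil> + 1"
  define l where "l j = real (Suc j) * delta" for j
  let ?I = "\<lambda>j. {l j..l j + delta}"
  let ?h = "\<lambda>N j \<xi>. indicator (?I j) \<xi> * norm (phi N \<xi>)"
  have cover: "indicator {\<xi>. delta < \<bar>\<xi>\<bar> \<and> \<bar>\<xi>\<bar> \<le> R} \<xi> * norm (phi N \<xi>) \<le> (\<Sum>j<J. ?h N j \<xi> + ?h N j (- \<xi>))" for N \<xi>
  proof (cases "delta < \<bar>\<xi>\<bar> \<and> \<bar>\<xi>\<bar> \<le> R")
    case True
    define k where "k = nat \<lfloor>\<bar>\<xi>\<bar> / delta\<rfloor>"
    have "1 \<le> \<bar>\<xi>\<bar> / delta" using True delta(1) by simp
    then have k1: "1 \<le> k" unfolding k_def by (simp add: le_nat_iff le_floor_iff)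
    have kl: "real k \<le> \<bar>\<xi>\<bar> / delta" "\<bar>\<xi>\<bar> / delta < real k + 1"
      unfolding k_def using delta(1) by (simp_all add: of_nat_nat)
    then have kd: "real k * delta \<le> \<bar>\<xi>\<bar>" "\<bar>\<xi>\<bar> \<le> real k * delta + delta"
      using delta(1) by (simp_all add: pos_le_divide_eq pos_divide_less_eq distrib_right)
    define j where "j = k - 1"
    have kj: "k = Suc j" unfolding j_def using k1 by simp
    have "\<bar>\<xi>\<bar> / delta \<le> R / delta" using True delta(1) by (intro divide_right_mono) auto
    then have "real k \<le> R / delta" using kl by linarith
    then have "int k \<le> \<lceil>R / delta\<rceil>" by (metis ceiling_mono ceiling_of_nat)
    then have jJ: "j < J" unfolding J_def kj by linarith
    have "\<bar>\<xi>\<bar> \<in> ?I j" using kd unfolding l_def kj by auto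
    then have "norm (phi N \<xi>) \<le> ?h N j \<xi> + ?h N j (- \<xi>)"
      by (cases "0 \<le> \<xi>") (auto simp: indicator_def phi_minus)
    also have "\<dots> \<le> (\<Sum>j<J. ?h N j \<xi> + ?h N j (- \<xi>))"
      using jJ by (intro member_le_sum[of j "{..<J}" "\<lambda>j. ?h N j \<xi> + ?h N j (- \<xi>)"]) auto
    finally show ?thesis using True by simp
  qed (auto intro!: sum_nonneg)
  have i: "integrable lborel (?h N j)" for N j by (rule phi_interval_integrable)
  have i': "integrable lborel (\<lambda>\<xi>. ?h N j (- \<xi>))" for N j
    using lborel_integrable_real_affine[OF i[of j N], of "-1" 0] by simp
  have r: "(\<integral>\<xi>. ?h N j (- \<xi>) \<partial>lborel) = (\<integral>\<xi>. ?h N j \<xi> \<partial>lborel)" for N j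
    using lborel_integral_real_affine[of "-1" "?h N j" 0] by simp
  have bound: "sqrt (V N) * (\<integral>\<xi>. indicator {\<xi>. delta < \<bar>\<xi>\<bar> \<and> \<bar>\<xi>\<bar> \<le> R} \<xi> * norm (phi N \<xi>) \<partial>lborel)
    \<le> (\<Sum>j<J. 2 * (sqrt (V N) * (\<integral>\<xi>. ?h N j \<xi> \<partial>lborel)))" for N
  proof -
    have "(\<integral>\<xi>. indicator {\<xi>. delta < \<bar>\<xi>\<bar> \<and> \<bar>\<xi>\<bar> \<le> R} \<xi> * norm (phi N \<xi>) \<partial>lborel) \<le> (\<integral>\<xi>. (\<Sum>j<J. ?h N j \<xi> + ?h N j (- \<xi>)) \<partial>lborel)"
    proof (rule integral_mono_AE')
      show "integrable lborel (\<lambda>\<xi>. \<Sum>j<J. ?h N j \<xi> + ?h N j (- \<xi>))"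
        by (intro Bochner_Integration.integrable_sum Bochner_Integration.integrable_add i i')
    qed (use cover in \<open>auto intro!: AE_I2 sum_nonneg\<close>)
    also have "\<dots> = (\<Sum>j<J. 2 * (\<integral>\<xi>. ?h N j \<xi> \<partial>lborel))" using i i' r by simp
    finally show ?thesis
      using mult_left_mono[of _ _ "sqrt (V N)"] V_nonneg[of N] by (fastforce simp: sum_distrib_left mult_ac)
  qed
  have "(\<lambda>N. \<Sum>j<J. 2 * (sqrt (V N) * (\<integral>\<xi>. ?h N j \<xi> \<partial>lborel))) \<longlonglongrightarrow> (\<Sum>j<J. 2 * 0)"
    using delta(1) unfolding l_def by (intro tendsto_sum tendsto_mult tendsto_const phi_tail_interval) auto
  then have lim: "(\<lambda>N. \<Sum>j<J. 2 * (sqrt (V N) * (\<integral>\<xi>. ?h N j \<xi> \<partial>lborel))) \<longlonglongrightarrow> 0" by simp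
  show ?thesis
  proof (rule tendsto_sandwich[OF _ _ tendsto_const lim])
    show "eventually (\<lambda>N. 0 \<le> sqrt (V N) * (\<integral>\<xi>. indicator {\<xi>. delta < \<bar>\<xi>\<bar> \<and> \<bar>\<xi>\<bar> \<le> R} \<xi> * norm (phi N \<xi>) \<partial>lborel)) sequentially"
      using V_nonneg by (intro always_eventually) simp
  qed (use bound in auto)
qed

text \<open>Weighted by the Fejer kernel and normalised, the laws of \<open>Y N\<close> become
  probability measures whose characteristic functions converge to \<open>tri L\<close>, the
  characteristic function of the normalised Fejer density. Weak convergence is then tested against
  the indicator of the interval divided by the kernel, which undoes the weight on both
  sides.\<close>

theorem local_limit:
  fixes a b z :: real and zs :: "nat \<Rightarrow> real"
  assumes ab: "a < b" and z: "(\<lambda>N. (zs N - expectation (psum f N)) / sqrt (V N)) \<longlonglongrightarrow> z"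
  shows "(\<lambda>N. sqrt (2 * pi * V N) * prob {\<omega> \<in> space M. psum f N \<omega> - zs N \<in> {a<..<b}}) \<longlonglongrightarrow> exp (- z\<^sup>2 / 2) * (b - a)"
proof -
  \<comment> \<open>With this bandwidth \<open>L * \<bar>x\<bar>\<close> is at most 1 on the
    interval, so \<open>fejer_ge\<close> applies there.\<close>
  define L where "L = 1 / (1 + \<bar>a\<bar> + \<bar>b\<bar>)"
  have L: "0 < L" unfolding L_def by (simp add: add_pos_nonneg)
  define Y where "Y N \<omega> = psum f N \<omega> - zs N" for N \<omega>
  have [measurable]: "psum f N \<in> borel_measurable M" for N by (rule psum_measurable[OF fnl])
  have Ym [measurable]: "Y N \<in> borel_measurable M" for N unfolding Y_def[abs_def] by measurable
  define \<psi> where "\<psi> N \<xi> = (\<integral>\<omega>. iexp (\<xi> * Y N \<omega>) \<partial>M)" for N \<xi>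
  have \<psi>m [measurable]: "\<psi> N \<in> borel_measurable borel" for N unfolding \<psi>_def[abs_def] by measurable
  have \<psi>: "\<psi> N \<xi> = iexp (- \<xi> * zs N) * phi N \<xi>" for N \<xi>
  proof -
    have "\<psi> N \<xi> = (\<integral>\<omega>. iexp (- \<xi> * zs N) * iexp (\<xi> * psum f N \<omega>) \<partial>M)"
      unfolding \<psi>_def Y_def by (intro Bochner_Integration.integral_cong refl) (simp add: algebra_simps flip: exp_add)
    then show ?thesis unfolding phi_def by (simp only: integral_mult_right_zero)
  qed
  have n\<psi>: "norm (\<psi> N \<xi>) = norm (phi N \<xi>)" for N \<xi> unfolding \<psi> by (simp only: norm_mult norm_exp_i_times mult_1)
  obtain c C where c: "0 < c" and near: "\<And>N \<xi>. \<bar>\<xi>\<bar> \<le> delta \<Longrightarrow> norm (phi N \<xi>) \<le> C * exp (- (c * V N * \<xi>\<^sup>2))"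
    using phi_near_0 by blast
  have V0: "eventually (\<lambda>N. 0 < V N) sequentially" using V_at_top by (simp add: filterlim_at_top_dense)
  define E where "E N = expectation (psum f N)" for N
  have lim: "(\<lambda>N. \<psi> N (u / sqrt (V N))) \<longlonglongrightarrow> exp (- u\<^sup>2 / 2) *\<^sub>R iexp (- u * z)" for u
  proof -
    have e: "\<psi> N (u / sqrt (V N)) = (\<integral>\<omega>. iexp (u * ((psum f N \<omega> - E N) / sqrt (V N))) \<partial>M) * iexp (- u * ((zs N - E N) / sqrt (V N)))" for N
    proof -
      have "\<psi> N (u / sqrt (V N)) = (\<integral>\<omega>. iexp (u * ((psum f N \<omega> - E N) / sqrt (V N))) * iexp (- u * ((zs N - E N) / sqrt (V N))) \<partial>M)"
        unfolding \<psi>_def Y_def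
      proof (intro Bochner_Integration.integral_cong refl)
        fix \<omega>
        have "u / sqrt (V N) * (psum f N \<omega> - zs N) = u * ((psum f N \<omega> - E N) / sqrt (V N)) + - u * ((zs N - E N) / sqrt (V N))"
          by (simp add: diff_divide_distrib algebra_simps)
        then show "iexp (u / sqrt (V N) * (psum f N \<omega> - zs N)) = iexp (u * ((psum f N \<omega> - E N) / sqrt (V N))) * iexp (- u * ((zs N - E N) / sqrt (V N)))"
          by (simp only: of_real_add distrib_left exp_add)
      qed
      then show ?thesis by (simp only: integral_mult_left_zero)
    qed
    have "(\<lambda>N. \<integral>\<omega>. iexp (u * ((psum f N \<omega> - E N) / sqrt (V N))) \<partial>M) \<longlonglongrightarrow> complex_of_real (exp (- u\<^sup>2 / 2))"
      unfolding E_def V_def using CLT[OF fnl K V_at_top[unfolded V_def[abs_def]]] .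
    moreover have "(\<lambda>N. iexp (- u * ((zs N - E N) / sqrt (V N)))) \<longlonglongrightarrow> iexp (- u * z)"
      by (intro isCont_tendsto_compose[OF isCont_iexp] tendsto_mult tendsto_const z[folded E_def])
    ultimately show ?thesis unfolding e scaleR_conv_of_real by (rule tendsto_mult)
  qed
  define \<kappa> where "\<kappa> = sqrt (2 * pi) * exp (- z\<^sup>2 / 2)"
  have \<kappa>: "0 < \<kappa>" unfolding \<kappa>_def by simp
  have main: "(\<lambda>N. sqrt (V N) *\<^sub>R (\<integral>\<omega>. fejer L (Y N \<omega>) *\<^sub>R iexp (t * Y N \<omega>) \<partial>M)) \<longlonglongrightarrow> complex_of_real (tri L t * \<kappa>)" for t
    unfolding fejer_expectation[OF L prob_space_axioms Ym] \<psi>_def[symmetric] \<kappa>_def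
  proof (rule scaled_fourier_limit[OF L V_at_top \<psi>m _ c delta(1)])
    show "norm (\<psi> N \<xi>) \<le> 1" for N \<xi> unfolding n\<psi> by (rule phi_norm_le_1)
    show "norm (\<psi> N \<xi>) \<le> C * exp (- (c * V N * \<xi>\<^sup>2))" if "\<bar>\<xi>\<bar> \<le> delta" for N \<xi> unfolding n\<psi> using that by (rule near)
    show "(\<lambda>N. sqrt (V N) * (\<integral>\<xi>. indicator {\<xi>. delta < \<bar>\<xi>\<bar> \<and> \<bar>\<xi>\<bar> \<le> R} \<xi> * norm (\<psi> N \<xi>) \<partial>lborel)) \<longlonglongrightarrow> 0" for R
      unfolding n\<psi> by (rule phi_tail)
  qed (rule lim)
  \<comment> \<open>The normalising constant, which is itself of order
    \<open>1 / sqrt (V N)\<close>; its asymptotics are the case \<open>t = 0\<close> of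
    \<open>main\<close>.\<close>
  define e where "e N = (\<integral>\<omega>. fejer L (Y N \<omega>) \<partial>M)" for N
  have e_lim: "(\<lambda>N. sqrt (V N) * e N) \<longlonglongrightarrow> \<kappa>"
  proof -
    have "(\<lambda>N. complex_of_real (sqrt (V N) * e N)) \<longlonglongrightarrow> complex_of_real \<kappa>"
      using main[of 0] tri_0[OF L] unfolding e_def by (simp add: scaleR_conv_of_real)
    then show ?thesis by (simp only: tendsto_of_real_iff)
  qed
  have e_pos: "eventually (\<lambda>N. 0 < e N) sequentially"
    using order_tendstoD(1)[OF e_lim \<kappa>] V0 by eventually_elim (simp add: zero_less_mult_iff)
  \<comment> \<open>The law of \<open>Y N\<close> reweighted by the Fejer kernel; the junk value \<open>P'\<close> only matters for finitely many \<open>N\<close>.\<close>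
  define P' where "P' = density lborel (\<lambda>x. ennreal (fejer L x / (2 * pi)))"
  define P where "P N = (if 0 < e N then density (distr M borel (Y N)) (\<lambda>x. ennreal (fejer L x / e N)) else P')" for N
  have fint: "(\<integral>x. fejer L x \<partial>lborel) = 2 * pi"
  proof -
    have "complex_of_real (\<integral>x. fejer L x \<partial>lborel) = complex_of_real (2 * pi)"
      using fourier_fejer[OF L, of 0] tri_0[OF L] by (simp add: scaleR_conv_of_real)
    then show ?thesis by (simp only: of_real_eq_iff)
  qed
  have P'_int: "(\<integral>x. g x \<partial>P') = (\<integral>x. (fejer L x / (2 * pi)) *\<^sub>R g x \<partial>lborel)"
    if "g \<in> borel_measurable borel" for g :: "real \<Rightarrow> 'z::{banach, second_countable_topology}"
    unfolding P'_def using that fejer_nonneg[OF L] by (intro integral_density) auto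
  have P_int: "(\<integral>x. g x \<partial>P N) = (\<integral>\<omega>. (fejer L (Y N \<omega>) / e N) *\<^sub>R g (Y N \<omega>) \<partial>M)"
    if e: "0 < e N" and [measurable]: "g \<in> borel_measurable borel" for N and g :: "real \<Rightarrow> 'z::{banach, second_countable_topology}"
  proof -
    have "(\<integral>x. g x \<partial>P N) = (\<integral>x. (fejer L x / e N) *\<^sub>R g x \<partial>distr M borel (Y N))"
      unfolding P_def using e fejer_nonneg[OF L] by (simp, intro integral_density) auto
    also have "\<dots> = (\<integral>\<omega>. (fejer L (Y N \<omega>) / e N) *\<^sub>R g (Y N \<omega>) \<partial>M)" by (rule integral_distr) measurable
    finally show ?thesis .
  qed
  have distP': "real_distribution P'"
  proof -
    have "emeasure P' (space P') = (\<integral>\<^sup>+x. ennreal (fejer L x / (2 * pi)) \<partial>lborel)"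
      unfolding P'_def by (subst emeasure_density) auto
    also have "\<dots> = ennreal (\<integral>x. fejer L x / (2 * pi) \<partial>lborel)"
      using fejer_integrable[OF L] fejer_nonneg[OF L] by (intro nn_integral_eq_integral) auto
    also have "(\<integral>x. fejer L x / (2 * pi) \<partial>lborel) = 1" using fint by simp
    finally have "prob_space P'" by (intro prob_spaceI) simp
    then show ?thesis unfolding real_distribution_def real_distribution_axioms_def by (simp add: P'_def)
  qed
  have distP: "real_distribution (P N)" for N
  proof (cases "0 < e N")
    case True
    have i: "integrable M (\<lambda>\<omega>. fejer L (Y N \<omega>))" by (intro integrable_bnd bnd_fejer L) measurable
    have "emeasure (P N) (space (P N)) = (\<integral>\<^sup>+x. ennreal (fejer L x / e N) \<partial>distr M borel (Y N))"
      unfolding P_def using True by (simp, subst emeasure_density) (auto intro!: nn_integral_cong)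
    also have "\<dots> = (\<integral>\<^sup>+\<omega>. ennreal (fejer L (Y N \<omega>) / e N) \<partial>M)" by (rule nn_integral_distr) measurable
    also have "\<dots> = ennreal (\<integral>\<omega>. fejer L (Y N \<omega>) / e N \<partial>M)"
      using i fejer_nonneg[OF L] True by (intro nn_integral_eq_integral) auto
    also have "(\<integral>\<omega>. fejer L (Y N \<omega>) / e N \<partial>M) = 1" using True by (simp add: e_def)
    finally have "prob_space (P N)" by (intro prob_spaceI) simp
    then show ?thesis unfolding real_distribution_def real_distribution_axioms_def using True by (simp add: P_def)
  next
    case False
    then show ?thesis using distP' unfolding P_def by simp
  qed
  have weak: "weak_conv_m P P'"
  proof (rule levy_continuity[OF distP distP'])
    fix t
    have im: "(\<lambda>x. iexp (t * x)) \<in> borel_measurable borel" by measurable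
    have c': "char P' t = complex_of_real (tri L t)"
    proof -
      have "char P' t = (\<integral>x. (1 / (2 * pi)) *\<^sub>R (fejer L x *\<^sub>R iexp (t * x)) \<partial>lborel)"
        unfolding char_def P'_int[OF im] by (rule Bochner_Integration.integral_cong[OF refl]) (simp add: scaleR_conv_of_real)
      also have "\<dots> = (1 / (2 * pi)) *\<^sub>R complex_of_real (2 * pi * tri L t)"
        unfolding fourier_fejer[OF L, symmetric] by (rule integral_scaleR_right)
      finally show ?thesis by (simp add: scaleR_conv_of_real)
    qed
    have "(\<lambda>N. (sqrt (V N) *\<^sub>R (\<integral>\<omega>. fejer L (Y N \<omega>) *\<^sub>R iexp (t * Y N \<omega>) \<partial>M)) / complex_of_real (sqrt (V N) * e N)) \<longlonglongrightarrow> complex_of_real (tri L t * \<kappa>) / complex_of_real \<kappa>"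
      using \<kappa> by (intro tendsto_divide main tendsto_of_real e_lim) simp
    then have l: "(\<lambda>N. (sqrt (V N) *\<^sub>R (\<integral>\<omega>. fejer L (Y N \<omega>) *\<^sub>R iexp (t * Y N \<omega>) \<partial>M)) / complex_of_real (sqrt (V N) * e N)) \<longlonglongrightarrow> complex_of_real (tri L t)"
      using \<kappa> by simp
    show "(\<lambda>N. char (P N) t) \<longlonglongrightarrow> char P' t"
      unfolding c'
    proof (rule Lim_transform_eventually[OF l])
      show "eventually (\<lambda>N. (sqrt (V N) *\<^sub>R (\<integral>\<omega>. fejer L (Y N \<omega>) *\<^sub>R iexp (t * Y N \<omega>) \<partial>M)) / complex_of_real (sqrt (V N) * e N) = char (P N) t) sequentially"
        using e_pos V0
      proof eventually_elim
        case (elim N)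
        have "char (P N) t = (\<integral>\<omega>. (1 / e N) *\<^sub>R (fejer L (Y N \<omega>) *\<^sub>R iexp (t * Y N \<omega>)) \<partial>M)"
          unfolding char_def P_int[OF elim(1) im] by (rule Bochner_Integration.integral_cong[OF refl]) (simp add: scaleR_conv_of_real)
        also have "\<dots> = (1 / e N) *\<^sub>R (\<integral>\<omega>. fejer L (Y N \<omega>) *\<^sub>R iexp (t * Y N \<omega>) \<partial>M)" by (rule integral_scaleR_right)
        finally have ch: "char (P N) t = (1 / e N) *\<^sub>R (\<integral>\<omega>. fejer L (Y N \<omega>) *\<^sub>R iexp (t * Y N \<omega>) \<partial>M)" .
        have "(sqrt (V N) *\<^sub>R w) / complex_of_real (sqrt (V N) * e N) = (1 / e N) *\<^sub>R w" for w
          using elim by (simp add: scaleR_conv_of_real)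
        then show ?case unfolding ch .
      qed
    qed
  qed
  \<comment> \<open>On the interval the maximum equals the kernel, so \<open>G\<close> inverts the
    weight exactly; elsewhere it only keeps the denominator away from 0. Outside \<open>a\<close>,
    \<open>b\<close> and 0 the function is continuous, 0 being set aside because of the case
    distinction in \<open>fejer\<close>.\<close>
  define G where "G x = indicator {a<..<b} x / max (L / 24) (fejer L x)" for x
  have Gm [measurable]: "G \<in> borel_measurable borel" unfolding G_def[abs_def] by measurable
  have G_bound: "norm (G x) \<le> 24 / L" for x
  proof -
    have "0 < max (L / 24) (fejer L x)" using L by (simp add: less_max_iff_disj)
    moreover have "1 / max (L / 24) (fejer L x) \<le> 1 / (L / 24)" using L by (intro divide_left_mono) auto
    ultimately show ?thesis using L unfolding G_def by (auto simp: indicator_def)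
  qed
  have G_cont: "isCont G x" if "x \<notin> {a, b, 0}" for x
  proof -
    have "isCont (\<lambda>x. indicator {a<..<b} x :: real) x"
      using that ab unfolding isCont_indicator by (auto simp: frontier_def)
    moreover have "isCont (\<lambda>x. max (L / 24) (fejer L x)) x"
      using that by (intro continuous_max continuous_const isCont_fejer L) auto
    moreover have "max (L / 24) (fejer L x) \<noteq> 0" using L by (auto simp: max_def)
    ultimately show ?thesis unfolding G_def[abs_def] by (rule isCont_divide)
  qed
  have fG: "fejer L x * G x = indicator {a<..<b} x" for x
  proof (cases "x \<in> {a<..<b}")
    case True
    then have "\<bar>x\<bar> \<le> 1 + \<bar>a\<bar> + \<bar>b\<bar>" by auto
    then have "L * \<bar>x\<bar> \<le> 1" unfolding L_def by simp
    then have "L / 24 \<le> fejer L x" using pi_ge_two by (intro fejer_ge[OF L]) (rule order_trans, assumption, linarith)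
    then show ?thesis using True L unfolding G_def by (simp add: max_def)
  qed (simp add: G_def)
  have "emeasure P' {x. \<not> isCont G x} = 0"
  proof -
    have "{a, b, 0} \<in> null_sets lborel" by (intro finite_imp_null_set_lborel) simp
    then have "{a, b, 0} \<in> null_sets P'"
      using absolutely_continuousI_density[of "\<lambda>x. ennreal (fejer L x / (2 * pi))" lborel]
      unfolding P'_def absolutely_continuous_def by auto
    then have "emeasure P' {a, b, 0} = 0" by auto
    moreover have "emeasure P' {x. \<not> isCont G x} \<le> emeasure P' {a, b, 0}"
      using G_cont by (intro emeasure_mono) (auto simp: P'_def)
    ultimately show ?thesis by simp
  qed
  from weak_conv_imp_bdd_ae_continuous_conv[OF distP distP' weak this G_bound Gm]
  have GP: "(\<lambda>N. \<integral>x. G x \<partial>P N) \<longlonglongrightarrow> (\<integral>x. G x \<partial>P')" .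
  have GP': "(\<integral>x. G x \<partial>P') = (b - a) / (2 * pi)"
  proof -
    have "(\<integral>x. G x \<partial>P') = (\<integral>x. (1 / (2 * pi)) * indicator {a<..<b} x \<partial>lborel)"
      by (subst P'_int[OF Gm]) (auto intro!: Bochner_Integration.integral_cong simp: fG[symmetric])
    then show ?thesis using ab by simp
  qed
  have "(\<lambda>N. sqrt (2 * pi) * ((sqrt (V N) * e N) * (\<integral>x. G x \<partial>P N))) \<longlonglongrightarrow> sqrt (2 * pi) * (\<kappa> * ((b - a) / (2 * pi)))"
    using GP unfolding GP' by (intro tendsto_mult tendsto_const e_lim)
  also have "sqrt (2 * pi) * (\<kappa> * ((b - a) / (2 * pi))) = exp (- z\<^sup>2 / 2) * (b - a)"
  proof -
    have e: "r * (r * u * (v / w)) = (r * r / w) * (u * v)" for r u v w :: real by simp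
    show ?thesis unfolding \<kappa>_def e by simp
  qed
  finally have l: "(\<lambda>N. sqrt (2 * pi) * ((sqrt (V N) * e N) * (\<integral>x. G x \<partial>P N))) \<longlonglongrightarrow> exp (- z\<^sup>2 / 2) * (b - a)" .
  show ?thesis
  proof (rule Lim_transform_eventually[OF l])
    show "eventually (\<lambda>N. sqrt (2 * pi) * ((sqrt (V N) * e N) * (\<integral>x. G x \<partial>P N)) = sqrt (2 * pi * V N) * prob {\<omega> \<in> space M. psum f N \<omega> - zs N \<in> {a<..<b}}) sequentially"
      using e_pos
    proof eventually_elim
      case (elim N)
      have "(\<integral>x. G x \<partial>P N) = (\<integral>\<omega>. (1 / e N) * indicator {\<omega> \<in> space M. Y N \<omega> \<in> {a<..<b}} \<omega> \<partial>M)"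
      proof (subst P_int[OF elim Gm], rule Bochner_Integration.integral_cong[OF refl])
        fix \<omega> assume "\<omega> \<in> space M"
        have "(fejer L (Y N \<omega>) / e N) *\<^sub>R G (Y N \<omega>) = (1 / e N) * (fejer L (Y N \<omega>) * G (Y N \<omega>))" by simp
        also have "\<dots> = (1 / e N) * indicator {\<omega> \<in> space M. Y N \<omega> \<in> {a<..<b}} \<omega>"
          unfolding fG using \<open>\<omega> \<in> space M\<close> by (simp add: indicator_def)
        finally show "(fejer L (Y N \<omega>) / e N) *\<^sub>R G (Y N \<omega>) = (1 / e N) * indicator {\<omega> \<in> space M. Y N \<omega> \<in> {a<..<b}} \<omega>" .
      qed
      also have "\<dots> = (1 / e N) * prob {\<omega> \<in> space M. Y N \<omega> \<in> {a<..<b}}"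
        by (subst integral_mult_right_zero) (simp add: Int_def conj_commute)
      finally have "(\<integral>x. G x \<partial>P N) = (1 / e N) * prob {\<omega> \<in> space M. Y N \<omega> \<in> {a<..<b}}" .
      then show ?case using elim unfolding Y_def by (simp add: real_sqrt_mult)
    qed
  qed
qed

end

section \<open>From the given Markov chain to a bounded functional on an elliptic chain\<close>

lemma space_borel_metric [simp]: "space (borel_metric m) = mspace m"
  unfolding borel_metric_def by (rule space_measure_of_conv)

context markov_chain begin

lemma X_in_mspace: "1 \<le> n \<Longrightarrow> \<omega> \<in> space M \<Longrightarrow> X n \<omega> \<in> mspace (S n)"
  using measurable_space[OF random_variable_X] by simp

lemma sets_history:
  "sets (history M S X n) = sigma_sets (space M) (\<Union>i\<in>{1..n}. {X i -` A \<inter> space M | A. A \<in> sets (borel_metric (S i))})"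
  unfolding history_def by (rule sets_measure_of) auto

lemma space_history: "space (history M S X n) = space M"
  unfolding history_def by (rule space_measure_of_conv)

lemma subalgebra_history: "subalgebra M (history M S X n)"
  unfolding subalgebra_def space_history sets_history
  using random_variable_X by (intro conjI refl sets.sigma_sets_subset) (auto intro!: measurable_sets)

lemma X_measurable_history:
  assumes "1 \<le> i" "i \<le> n" shows "X i \<in> history M S X n \<rightarrow>\<^sub>M borel_metric (S i)"
proof (rule measurableI)
  show "X i \<omega> \<in> space (borel_metric (S i))" if "\<omega> \<in> space (history M S X n)" for \<omega>
    using that X_in_mspace assms unfolding space_history by simp
  show "X i -` A \<inter> space (history M S X n) \<in> sets (history M S X n)" if "A \<in> sets (borel_metric (S i))" for A
    unfolding space_history sets_history using that assms by (intro sigma_sets.Basic UN_I[of i]) auto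
qed

text \<open>The conditional probability in the Markov property is turned into an identity between
  integrals, by testing it against bounded weights measurable for the history.\<close>

lemma markov_history:
  assumes n: "1 \<le> n" and E: "E \<in> sets (borel_metric (S (n + 1)))" and H: "H \<in> borel_measurable (history M S X n)"
    and H_nonneg: "\<And>\<omega>. 0 \<le> H \<omega>" and H_le: "\<And>\<omega>. H \<omega> \<le> (C :: real)"
  shows "(\<integral>\<omega>. H \<omega> * indicator E (X (n + 1) \<omega>) \<partial>M) = (\<integral>\<omega>. H \<omega> * measure (\<pi> n (X n \<omega>)) E \<partial>M)"
proof -
  interpret finite_measure_subalgebra M "history M S X n"
    by unfold_locales (rule subalgebra_history)
  note E [measurable]
  note [measurable] = random_variable_X[of n] random_variable_X[of "n + 1"]
  have Hm [measurable]: "H \<in> borel_measurable M" using measurable_from_subalg[OF subalgebra_history H] .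
  have im: "(\<lambda>\<omega>. indicator E (X (n + 1) \<omega>) :: real) \<in> borel_measurable M" using n by measurable
  have mm: "(\<lambda>\<omega>. measure (\<pi> n (X n \<omega>)) E) \<in> borel_measurable M"
    using measurable_compose[OF measurable_compose[OF random_variable_X[OF n] measurable_prob_algebraD[OF kernel[OF n]]]
        measurable_measure_subprob_algebra[OF E]] .
  have i: "integrable M (\<lambda>\<omega>. H \<omega> * indicator E (X (n + 1) \<omega>))"
  proof (rule integrable_const_bound)
    show "AE \<omega> in M. norm (H \<omega> * indicator E (X (n + 1) \<omega>)) \<le> C"
      using H_nonneg H_le order_trans[OF H_nonneg H_le] by (intro AE_I2) (auto simp: indicator_def)
  qed (use im in measurable)
  have "(\<integral>\<omega>. H \<omega> * indicator E (X (n + 1) \<omega>) \<partial>M)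
    = (\<integral>\<omega>. H \<omega> * real_cond_exp M (history M S X n) (\<lambda>\<omega>. indicator E (X (n + 1) \<omega>)) \<omega> \<partial>M)"
    by (rule real_cond_exp_intg(2)[OF i H im, symmetric])
  also have "\<dots> = (\<integral>\<omega>. H \<omega> * measure (\<pi> n (X n \<omega>)) E \<partial>M)"
    using markov[OF n E] mm by (intro integral_cong_AE) auto
  finally show ?thesis .
qed

text \<open>Times are shifted by one, and \<open>p\<close> is clipped to the interval from 0 to
  1/\<epsilon>. On the state spaces clipping changes nothing, so the kernels and the two-step
  integrals are the original ones.\<close>

lemma elliptic_chainI:
  fixes \<mu> :: "nat \<Rightarrow> 's measure" and p :: "nat \<Rightarrow> 's \<Rightarrow> 's \<Rightarrow> real" and \<epsilon> :: real
  assumes eps: "0 < \<epsilon>" "\<epsilon> < 1"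
    and prob: "\<And>n. 1 \<le> n \<Longrightarrow> prob_space (\<mu> n)"
    and sets: "\<And>n. 1 \<le> n \<Longrightarrow> sets (\<mu> n) = sets (borel_metric (S n))"
    and p: "\<And>n. 1 \<le> n \<Longrightarrow> case_prod (p n) \<in> borel_measurable (borel_metric (S n) \<Otimes>\<^sub>M borel_metric (S (n + 1)))"
    and density: "\<And>n x. 1 \<le> n \<Longrightarrow> x \<in> mspace (S n) \<Longrightarrow> \<pi> n x = density (\<mu> (n + 1)) (\<lambda>y. ennreal (p n x y))"
    and p_bounds: "\<And>n x y. 1 \<le> n \<Longrightarrow> x \<in> mspace (S n) \<Longrightarrow> y \<in> mspace (S (n + 1)) \<Longrightarrow> 0 \<le> p n x y \<and> p n x y \<le> 1 / \<epsilon>"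
    and p2: "\<And>n x z. 1 \<le> n \<Longrightarrow> x \<in> mspace (S n) \<Longrightarrow> z \<in> mspace (S (n + 2)) \<Longrightarrow>
      \<epsilon> < (\<integral>y. p n x y * p (n + 1) y z \<partial>\<mu> (n + 1))"
  shows "elliptic_chain M (\<lambda>n. \<mu> (Suc n)) (\<lambda>n x y. max 0 (min (1 / \<epsilon>) (p (Suc n) x y))) (\<lambda>n. X (Suc n))
    (\<lambda>n. history M S X (Suc n)) \<epsilon>"
proof -
  let ?p = "\<lambda>n x y. max 0 (min (1 / \<epsilon>) (p n x y))"
  have space: "space (\<mu> n) = mspace (S n)" if "1 \<le> n" for n using sets_eq_imp_space_eq[OF sets[OF that]] by simp
  have p_eq: "?p n x y = p n x y" if "1 \<le> n" "x \<in> mspace (S n)" "y \<in> mspace (S (n + 1))" for n x y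
    using p_bounds[OF that] by simp
  have pm: "(\<lambda>(x, y). ?p n x y) \<in> borel_measurable (\<mu> n \<Otimes>\<^sub>M \<mu> (n + 1))" if "1 \<le> n" for n
  proof -
    have [measurable]: "(\<lambda>w. p n (fst w) (snd w)) \<in> borel_measurable (\<mu> n \<Otimes>\<^sub>M \<mu> (n + 1))"
      using p[OF that] that sets unfolding case_prod_beta' by (subst measurable_cong_sets[OF sets_pair_measure_cong refl]) auto
    show ?thesis unfolding case_prod_beta' by measurable
  qed
  have measure_pi: "measure (\<pi> n x) E = (\<integral>y. ?p n x y * indicator E y \<partial>\<mu> (n + 1))"
    if n: "1 \<le> n" and x: "x \<in> mspace (S n)" and E: "E \<in> sets (\<mu> (n + 1))" for n x E
  proof -
    interpret \<mu>: prob_space "\<mu> (n + 1)" using prob by simp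
    have p': "(\<lambda>y. ?p n x y) \<in> borel_measurable (\<mu> (n + 1))"
      using measurable_Pair2[OF pm[OF n], of x] x space[OF n] by simp
    have "\<pi> n x = density (\<mu> (n + 1)) (\<lambda>y. ennreal (?p n x y))"
    proof -
      have "density (\<mu> (n + 1)) (\<lambda>y. ennreal (p n x y)) = density (\<mu> (n + 1)) (\<lambda>y. ennreal (?p n x y))"
      proof (rule density_cong)
        show "AE y in \<mu> (n + 1). ennreal (p n x y) = ennreal (?p n x y)"
          using p_eq[OF n x] space[of "n + 1"] by (intro AE_I2) (simp del: max.bounded_iff)
        have "(\<lambda>y. p n x y) \<in> borel_measurable (\<mu> (n + 1)) \<longleftrightarrow> (\<lambda>y. ?p n x y) \<in> borel_measurable (\<mu> (n + 1))"
          using p_eq[OF n x] space[of "n + 1"] by (intro measurable_cong) simp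
        then show "(\<lambda>y. ennreal (p n x y)) \<in> borel_measurable (\<mu> (n + 1))" using p' by simp
      qed (use p' in measurable)
      then show ?thesis using density[OF n x] by simp
    qed
    then have "emeasure (\<pi> n x) E = (\<integral>\<^sup>+y. ennreal (?p n x y * indicator E y) \<partial>\<mu> (n + 1))"
      using emeasure_density[OF measurable_compose[OF p' measurable_ennreal] E]
      by (auto intro!: nn_integral_cong simp: indicator_def simp del: max.bounded_iff)
    also have "\<dots> = ennreal (\<integral>y. ?p n x y * indicator E y \<partial>\<mu> (n + 1))"
    proof (rule nn_integral_eq_integral)
      show "integrable (\<mu> (n + 1)) (\<lambda>y. ?p n x y * indicator E y)"
        using p' E eps by (intro \<mu>.integrable_const_bound[of _ "1 / \<epsilon>"]) (auto simp: indicator_def)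
    qed (auto intro!: AE_I2)
    finally show ?thesis unfolding measure_def by (simp add: integral_nonneg_AE)
  qed
  show ?thesis
  proof (intro elliptic_chain.intro elliptic_chain_axioms.intro prob_space_axioms)
    fix n
    show "0 < \<epsilon>" "\<epsilon> < 1" by (fact eps)+
    show "prob_space (\<mu> (Suc n))" using prob by simp
    show "(\<lambda>(x, y). ?p (Suc n) x y) \<in> borel_measurable (\<mu> (Suc n) \<Otimes>\<^sub>M \<mu> (Suc (Suc n)))" using pm[of "Suc n"] by simp
    show "0 \<le> ?p (Suc n) x y" "?p (Suc n) x y \<le> 1 / \<epsilon>" for x y using eps by auto
    \<comment> \<open>Mass 1 comes from the kernel taking values in probability measures.\<close>
    show "(\<integral>y. ?p (Suc n) x y \<partial>\<mu> (Suc (Suc n))) = 1" if "x \<in> space (\<mu> (Suc n))" for x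
    proof -
      have x: "x \<in> mspace (S (Suc n))" using that space by simp
      then have "\<pi> (Suc n) x \<in> space (prob_algebra (borel_metric (S (Suc n + 1))))"
        using measurable_space[OF kernel[of "Suc n"]] by simp
      then have P: "prob_space (\<pi> (Suc n) x)" "sets (\<pi> (Suc n) x) = sets (\<mu> (Suc n + 1))"
        using sets[of "Suc n + 1"] by (auto simp: space_prob_algebra)
      have "measure (\<pi> (Suc n) x) (space (\<mu> (Suc n + 1))) = 1"
        using prob_space.prob_space[OF P(1)] sets_eq_imp_space_eq[OF P(2)] by simp
      then have "(\<integral>y. ?p (Suc n) x y * indicator (space (\<mu> (Suc n + 1))) y \<partial>\<mu> (Suc n + 1)) = 1"
        using measure_pi[OF _ x] by simp
      also have "(\<integral>y. ?p (Suc n) x y * indicator (space (\<mu> (Suc n + 1))) y \<partial>\<mu> (Suc n + 1)) = (\<integral>y. ?p (Suc n) x y \<partial>\<mu> (Suc n + 1))"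
        by (rule Bochner_Integration.integral_cong[OF refl]) simp
      finally show ?thesis by simp
    qed
    show "\<epsilon> \<le> (\<integral>y. ?p (Suc n) x y * ?p (Suc (Suc n)) y z \<partial>\<mu> (Suc (Suc n)))"
      if "x \<in> space (\<mu> (Suc n))" "z \<in> space (\<mu> (Suc (Suc (Suc n))))" for x z
    proof -
      have xz: "x \<in> mspace (S (Suc n))" "z \<in> mspace (S (Suc n + 2))" using that space by simp_all
      have "(\<integral>y. ?p (Suc n) x y * ?p (Suc (Suc n)) y z \<partial>\<mu> (Suc (Suc n))) = (\<integral>y. p (Suc n) x y * p (Suc n + 1) y z \<partial>\<mu> (Suc n + 1))"
        using p_eq[of "Suc n" x] p_eq[of "Suc n + 1" _ z] xz space[of "Suc n + 1"]
        by (intro Bochner_Integration.integral_cong) auto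
      then show ?thesis using p2[OF _ xz] by simp
    qed
    show "subalgebra M (history M S X (Suc n))" by (rule subalgebra_history)
    show "X (Suc i) \<in> history M S X (Suc n) \<rightarrow>\<^sub>M \<mu> (Suc i)" if "i \<le> n" for i
      using X_measurable_history[of "Suc i" "Suc n"] that sets[of "Suc i"]
      by (subst measurable_cong_sets[OF refl, of _ "borel_metric (S (Suc i))"]) auto
    show "(\<integral>\<omega>. H \<omega> * indicator E (X (Suc (Suc n)) \<omega>) \<partial>M)
        = (\<integral>\<omega>. H \<omega> * (\<integral>y. ?p (Suc n) (X (Suc n) \<omega>) y * indicator E y \<partial>\<mu> (Suc (Suc n))) \<partial>M)"
      if E: "E \<in> sets (\<mu> (Suc (Suc n)))" and H: "H \<in> borel_measurable (history M S X (Suc n))"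
        "\<And>\<omega>. 0 \<le> H \<omega>" "\<And>\<omega>. H \<omega> \<le> C" for E H and C :: real
    proof -
      have "(\<integral>\<omega>. H \<omega> * indicator E (X (Suc (Suc n)) \<omega>) \<partial>M) = (\<integral>\<omega>. H \<omega> * measure (\<pi> (Suc n) (X (Suc n) \<omega>)) E \<partial>M)"
        using markov_history[of "Suc n" E H C] E H sets[of "Suc n + 1"] by simp
      also have "\<dots> = (\<integral>\<omega>. H \<omega> * (\<integral>y. ?p (Suc n) (X (Suc n) \<omega>) y * indicator E y \<partial>\<mu> (Suc (Suc n))) \<partial>M)"
        using measure_pi[of "Suc n" _ E] X_in_mspace[of "Suc n"] E by (intro Bochner_Integration.integral_cong) auto
      finally show ?thesis .
    qed
  qed
qed

end

lemma closed_subgroup_multiples: "closed_subgroup (range (\<lambda>k :: int. d * real_of_int k))"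
proof -
  have e: "range (\<lambda>k :: int. d * real_of_int k) = (*\<^sub>R) d ` \<int>" by (auto simp: Ints_def)
  have c: "closed (range (\<lambda>k :: int. d * real_of_int k))" unfolding e by (intro closed_scaling closed_Ints)
  show ?thesis
    unfolding closed_subgroup_def
  proof (intro conjI ballI c)
    show "0 \<in> range (\<lambda>k :: int. d * real_of_int k)" by (rule range_eqI[of _ _ 0]) simp
    fix x y assume "x \<in> range (\<lambda>k :: int. d * real_of_int k)"
    then obtain j :: int where j: "x = d * real_of_int j" by blast
    show "- x \<in> range (\<lambda>k :: int. d * real_of_int k)" by (rule range_eqI[of _ _ "- j"]) (simp add: j)
    assume "y \<in> range (\<lambda>k :: int. d * real_of_int k)"
    then obtain k :: int where k: "y = d * real_of_int k" by blast
    show "x + y \<in> range (\<lambda>k :: int. d * real_of_int k)"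
      by (rule range_eqI[of _ _ "j + k"]) (simp add: j k distrib_left)
  qed
qed

lemma (in prob_space) algebraic_range_subset_multiples:
  fixes d :: real
  assumes "\<And>n x y. 1 \<le> n \<Longrightarrow> \<exists>k :: int. g n x y - c n = d * k"
  shows "algebraic_range M X g \<subseteq> range (\<lambda>k :: int. d * real_of_int k)"
proof -
  have "prob {\<omega> \<in> space M. g n (X n \<omega>) (X (n + 1) \<omega>) - c n \<in> range (\<lambda>k :: int. d * real_of_int k)} = 1" if "1 \<le> n" for n
  proof -
    have "{\<omega> \<in> space M. g n (X n \<omega>) (X (n + 1) \<omega>) - c n \<in> range (\<lambda>k :: int. d * real_of_int k)} = space M"
      using assms[OF that] by fastforce
    then show ?thesis by (simp add: prob_space)
  qed
  then show ?thesis
    unfolding algebraic_range_def using closed_subgroup_multiples by (intro Inter_lower) blast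
qed

lemma multiples_neq_UNIV: "d \<noteq> 0 \<Longrightarrow> range (\<lambda>k :: int. d * real_of_int k) \<noteq> UNIV"
proof
  assume d: "d \<noteq> 0" and "range (\<lambda>k :: int. d * real_of_int k) = UNIV"
  then obtain k :: int where "d / 2 = d * real_of_int k" by blast
  then have "2 * real_of_int k = 1" using d by (simp add: field_simps)
  then have "real_of_int (2 * k) = real_of_int 1" by simp
  then have "2 * k = 1" by (simp only: of_int_eq_iff)
  then show False by presburger
qed

text \<open>Chebyshev's inequality: a uniform bound on the centred second moments gives one
  threshold for all \<open>N\<close>. The variables \<open>Z\<close> need to agree with the partial
  sums only almost surely, which accommodates the truncated functional.\<close>

lemma (in prob_space) center_tightI:
  assumes [measurable]: "\<And>N. Z N \<in> borel_measurable M"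
    and sq: "\<And>N. integrable M (\<lambda>\<omega>. (Z N \<omega> - m N)\<^sup>2)" "\<And>N. (\<integral>\<omega>. (Z N \<omega> - m N)\<^sup>2 \<partial>M) \<le> V0"
    and [measurable]: "\<And>N. partial_sum X h N \<in> borel_measurable M"
    and eq: "\<And>N. AE \<omega> in M. partial_sum X h N \<omega> = Z N \<omega>"
  shows "center_tight M X h"
  unfolding center_tight_def
proof (intro exI[of _ m] allI impI)
  fix e :: real assume e: "0 < e"
  define K where "K = sqrt ((\<bar>V0\<bar> + 1) / e)"
  have K: "0 < K" "K\<^sup>2 = (\<bar>V0\<bar> + 1) / e" unfolding K_def using e by (auto simp: add_nonneg_pos)
  have "\<P>(\<omega> in M. \<bar>partial_sum X h N \<omega> - m N\<bar> > K) < e" for N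
  proof -
    have "\<P>(\<omega> in M. \<bar>partial_sum X h N \<omega> - m N\<bar> > K) \<le> \<P>(\<omega> in M. \<bar>Z N \<omega> - m N\<bar> \<ge> K)"
    proof (rule finite_measure_mono_AE)
      show "AE \<omega> in M. \<omega> \<in> {\<omega> \<in> space M. \<bar>partial_sum X h N \<omega> - m N\<bar> > K} \<longrightarrow> \<omega> \<in> {\<omega> \<in> space M. \<bar>Z N \<omega> - m N\<bar> \<ge> K}"
        using eq[of N] by eventually_elim auto
    qed measurable
    also have "\<dots> \<le> (\<integral>\<omega>. (Z N \<omega> - m N)\<^sup>2 \<partial>M) / K\<^sup>2"
      using K sq(1) by (intro second_moment_method) auto
    also have "\<dots> \<le> \<bar>V0\<bar> / K\<^sup>2" using sq(2)[of N] by (intro divide_right_mono) auto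
    also have "\<dots> < e" unfolding K(2) using e by (simp add: field_simps)
    finally show ?thesis .
  qed
  then show "\<exists>K. \<forall>N\<ge>1. \<P>(\<omega> in M. \<bar>partial_sum X h N \<omega> - m N\<bar> > K) < e" by blast
qed

lemma (in prob_space) as_uniformly_boundedD:
  assumes "as_uniformly_bounded M X f"
  obtains K where "0 \<le> K" "\<And>n. 1 \<le> n \<Longrightarrow> AE \<omega> in M. \<bar>f n (X n \<omega>) (X (n + 1) \<omega>)\<bar> \<le> K"
proof -
  let ?s = "\<lambda>n. esssup M (\<lambda>\<omega>. ereal \<bar>f n (X n \<omega>) (X (n + 1) \<omega>)\<bar>)"
  obtain K where K: "(SUP n\<in>{1..}. ?s n) \<le> ereal K"
    using assms unfolding as_uniformly_bounded_def by (cases "SUP n\<in>{1..}. ?s n") auto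
  show thesis
  proof (rule that[of "max 0 K"])
    fix n :: nat assume "1 \<le> n"
    then have n: "?s n \<le> ereal K" using K by (meson SUP_upper atLeast_iff order_trans)
    show "AE \<omega> in M. \<bar>f n (X n \<omega>) (X (n + 1) \<omega>)\<bar> \<le> max 0 K"
      using esssup_AE[of "\<lambda>\<omega>. ereal \<bar>f n (X n \<omega>) (X (n + 1) \<omega>)\<bar>" M]
    proof eventually_elim
      case (elim \<omega>)
      from elim n have "ereal \<bar>f n (X n \<omega>) (X (n + 1) \<omega>)\<bar> \<le> ereal K" by (rule order_trans)
      then show ?case by simp
    qed
  qed simp
qed

lemma partial_sum_shift: "partial_sum X f N \<omega> = (\<Sum>n<N. f (Suc n) (X (Suc n) \<omega>) (X (Suc (Suc n)) \<omega>))"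
  unfolding partial_sum_def by (simp add: sum.atLeast1_atMost_eq)

theorem theorem4p1:
  fixes M :: "'w measure"
    and S :: "nat \<Rightarrow> 's metric"
    and \<pi> :: "nat \<Rightarrow> 's \<Rightarrow> 's measure"
    and X :: "nat \<Rightarrow> 'w \<Rightarrow> 's"
    and f :: "nat \<Rightarrow> 's \<Rightarrow> 's \<Rightarrow> real"
    and V :: "nat \<Rightarrow> real"
  defines "V \<equiv> (\<lambda>N. prob_space.variance M (partial_sum X f N))"
  assumes "markov_chain M S \<pi> X"
    and "uniformly_elliptic S \<pi>"
    and "additive_functional S f"
    and "as_uniformly_bounded M X f"
    and "irreducible_functional M S X f"
    and "algebraic_range M X f = UNIV"
  shows "filterlim V at_top sequentially \<and>
    (\<forall>(a::real) (b::real) (zs :: nat \<Rightarrow> real) (z::real). a < b \<longrightarrow>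
      (\<lambda>N. (zs N - prob_space.expectation M (partial_sum X f N)) / sqrt (V N))
        \<longlonglongrightarrow> z \<longrightarrow>
      (\<exists>r :: nat \<Rightarrow> real. r \<in> o(\<lambda>_. 1) \<and>
        (\<forall>\<^sub>F N in sequentially.
          \<P>(\<omega> in M. partial_sum X f N \<omega> - zs N \<in> {a<..<b})
            = (1 + r N) * (exp (- z\<^sup>2 / 2) / sqrt (2 * pi * V N)) * (b - a))))"
proof -
  interpret markov_chain M S \<pi> X by fact
  obtain \<epsilon> \<mu> p where eps: "0 < \<epsilon>" "\<epsilon> < 1"
    and mu: "\<And>n. 1 \<le> n \<Longrightarrow> prob_space (\<mu> n)" "\<And>n. 1 \<le> n \<Longrightarrow> sets (\<mu> n) = sets (borel_metric (S n))"
    and p: "\<And>n. 1 \<le> n \<Longrightarrow> case_prod (p n) \<in> borel_measurable (borel_metric (S n) \<Otimes>\<^sub>M borel_metric (S (n + 1)))"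
      "\<And>n x. 1 \<le> n \<Longrightarrow> x \<in> mspace (S n) \<Longrightarrow> \<pi> n x = density (\<mu> (n + 1)) (\<lambda>y. ennreal (p n x y))"
      "\<And>n x y. 1 \<le> n \<Longrightarrow> x \<in> mspace (S n) \<Longrightarrow> y \<in> mspace (S (n + 1)) \<Longrightarrow> 0 \<le> p n x y \<and> p n x y \<le> 1 / \<epsilon>"
      "\<And>n x z. 1 \<le> n \<Longrightarrow> x \<in> mspace (S n) \<Longrightarrow> z \<in> mspace (S (n + 2)) \<Longrightarrow>
        \<epsilon> < (\<integral>y. p n x y * p (n + 1) y z \<partial>\<mu> (n + 1))"
    using \<open>uniformly_elliptic S \<pi>\<close> unfolding uniformly_elliptic_def by (elim exE conjE) (rule that, auto)
  define \<mu>' where "\<mu>' n = \<mu> (Suc n)" for n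
  define p' where "p' n x y = max 0 (min (1 / \<epsilon>) (p (Suc n) x y))" for n x y
  define X' where "X' n = X (Suc n)" for n
  define F where "F n = history M S X (Suc n)" for n
  interpret E: elliptic_chain M \<mu>' p' X' F \<epsilon>
    using elliptic_chainI[OF eps mu p] unfolding \<mu>'_def p'_def X'_def F_def .
  obtain K where K: "0 \<le> K" "\<And>n. 1 \<le> n \<Longrightarrow> AE \<omega> in M. \<bar>f n (X n \<omega>) (X (n + 1) \<omega>)\<bar> \<le> K"
    using as_uniformly_boundedD[OF \<open>as_uniformly_bounded M X f\<close>] by blast
  \<comment> \<open>Truncation changes the summands only on null events, by the essential bound, and
    yields a bound at every point of the plane of states. All quantities of the theorem are
    transferred back along \<open>S_eq\<close>.\<close>
  define f' where "f' n x y = (if \<bar>f (Suc n) x y\<bar> \<le> K then f (Suc n) x y else 0)" for n x y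
  have sets_pair: "sets (\<mu>' n \<Otimes>\<^sub>M \<mu>' (Suc n)) = sets (borel_metric (S (Suc n)) \<Otimes>\<^sub>M borel_metric (S (Suc n + 1)))" for n
    unfolding \<mu>'_def using mu(2) by (intro sets_pair_measure_cong) auto
  have f_meas: "(\<lambda>w. f (Suc n) (fst w) (snd w)) \<in> borel_measurable (\<mu>' n \<Otimes>\<^sub>M \<mu>' (Suc n))" for n
    using \<open>additive_functional S f\<close> unfolding additive_functional_def measurable_cong_sets[OF sets_pair refl] case_prod_beta'
    by simp
  have "bounded_functional M \<mu>' p' X' F \<epsilon> f' K"
  proof
    show "E.functional f'"
      unfolding E.functional_def
    proof (intro allI conjI)
      fix n
      note [measurable] = f_meas[of n]
      show "(\<lambda>(x, y). f' n x y) \<in> borel_measurable (\<mu>' n \<Otimes>\<^sub>M \<mu>' (Suc n))"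
        unfolding f'_def case_prod_beta' by measurable
      show "bnd (\<lambda>(x, y). f' n x y)" using K(1) by (intro bndI[of _ K]) (auto simp: f'_def)
    qed
    show "\<bar>f' n x y\<bar> \<le> K" for n x y using K(1) by (simp add: f'_def)
  qed
  then interpret B: bounded_functional M \<mu>' p' X' F \<epsilon> f' K .
  have f'_eq: "AE \<omega> in M. \<forall>n. f (Suc n) (X (Suc n) \<omega>) (X (Suc (Suc n)) \<omega>) = f' n (X' n \<omega>) (X' (Suc n) \<omega>)"
    unfolding AE_all_countable
  proof
    fix n show "AE \<omega> in M. f (Suc n) (X (Suc n) \<omega>) (X (Suc (Suc n)) \<omega>) = f' n (X' n \<omega>) (X' (Suc n) \<omega>)"
      using K(2)[of "Suc n"] unfolding f'_def X'_def by auto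
  qed
  have f_comp: "(\<lambda>\<omega>. f (Suc n) (X (Suc n) \<omega>) (X (Suc (Suc n)) \<omega>)) \<in> borel_measurable M" for n
    using measurable_compose[OF measurable_Pair[OF E.X_measurable[of n] E.X_measurable[of "Suc n"]] f_meas]
    unfolding X'_def by simp
  have S_eq: "AE \<omega> in M. partial_sum X f N \<omega> = E.psum f' N \<omega>" for N
    using f'_eq unfolding partial_sum_shift E.psum_def by eventually_elim simp
  have S_meas [measurable]: "partial_sum X f N \<in> borel_measurable M" for N
    unfolding partial_sum_shift[abs_def] using f_comp by measurable
  have "nonlattice_functional M \<mu>' p' X' F \<epsilon> f' K"
  proof
    fix \<xi> B :: real assume xi: "\<xi> \<noteq> 0"
    show "\<exists>N. B < B.hexagon_sum \<xi> N"
    proof (rule ccontr)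
      assume "\<nexists>N. B < B.hexagon_sum \<xi> N"
      then have "\<And>N. B.hexagon_sum \<xi> N \<le> B" by (meson not_less)
      from B.reduction[OF xi this] obtain g c m V0 where
        g: "\<And>n. (\<lambda>(x, y). g n x y) \<in> borel_measurable (\<mu>' n \<Otimes>\<^sub>M \<mu>' (Suc n))"
          "\<And>n x y. \<exists>k :: int. g n x y - c n = 2 * pi / \<xi> * k"
        and fg: "\<And>N. E.psum (\<lambda>n x y. f' n x y - g n x y) N \<in> borel_measurable M"
          "\<And>N. bnd (E.psum (\<lambda>n x y. f' n x y - g n x y) N)"
          "\<And>N. (\<integral>\<omega>. (E.psum (\<lambda>n x y. f' n x y - g n x y) N \<omega> - m N)\<^sup>2 \<partial>M) \<le> V0"
        by blast
      \<comment> \<open>Undoes the time shift; only indices from 1 on matter.\<close>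
      define G where "G n = g (n - 1)" for n
      have "additive_functional S G"
        unfolding additive_functional_def
      proof (intro allI impI)
        fix n :: nat assume "1 \<le> n"
        then obtain k where k: "n = Suc k" by (cases n) auto
        show "case_prod (G n) \<in> borel_measurable (borel_metric (S n) \<Otimes>\<^sub>M borel_metric (S (n + 1)))"
          using g(1)[of k] unfolding k G_def measurable_cong_sets[OF sets_pair refl] by simp
      qed
      moreover have "center_tight M X (\<lambda>n x y. f n x y - G n x y)"
      proof (rule center_tightI[OF fg(1) _ fg(3)])
        show "integrable M (\<lambda>\<omega>. (E.psum (\<lambda>n x y. f' n x y - g n x y) N \<omega> - m N)\<^sup>2)" for N
          using fg(1,2) by (intro integrable_bnd bnd_intros) auto
        have gm: "(\<lambda>\<omega>. g n (X (Suc n) \<omega>) (X (Suc (Suc n)) \<omega>)) \<in> borel_measurable M" for n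
          using measurable_compose[OF measurable_Pair[OF E.X_measurable[of n] E.X_measurable[of "Suc n"]] g(1)]
          unfolding X'_def by simp
        show "partial_sum X (\<lambda>n x y. f n x y - G n x y) N \<in> borel_measurable M" for N
          unfolding partial_sum_shift[abs_def] G_def using f_comp gm by (auto intro!: borel_measurable_sum)
        show "AE \<omega> in M. partial_sum X (\<lambda>n x y. f n x y - G n x y) N \<omega> = E.psum (\<lambda>n x y. f' n x y - g n x y) N \<omega>" for N
          using f'_eq unfolding partial_sum_shift E.psum_def G_def by eventually_elim (simp add: X'_def)
      qed
      \<comment> \<open>\<open>G\<close> is admissible in the intersection defining the essential
        range, and its values lie in translates of the multiples of \<open>2 * pi / \<xi>\<close>.
        Irreducibility would force this discrete group to be the whole line.\<close>
      ultimately have "essential_range M S X f \<subseteq> algebraic_range M X G"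
        unfolding essential_range_def by blast
      also have "\<dots> \<subseteq> range (\<lambda>k :: int. 2 * pi / \<xi> * real_of_int k)"
        by (rule algebraic_range_subset_multiples[of G "\<lambda>n. c (n - 1)"]) (unfold G_def, rule g(2))
      finally have "range (\<lambda>k :: int. 2 * pi / \<xi> * real_of_int k) = UNIV"
        using \<open>irreducible_functional M S X f\<close> \<open>algebraic_range M X f = UNIV\<close>
        unfolding irreducible_functional_def by blast
      then show False using multiples_neq_UNIV[of "2 * pi / \<xi>"] xi by simp
    qed
  qed
  then interpret C: nonlattice_functional M \<mu>' p' X' F \<epsilon> f' K .
  have psum_meas [measurable]: "E.psum f' N \<in> borel_measurable M" for N by (rule E.psum_measurable[OF B.fnl])
  have exp_eq: "expectation (partial_sum X f N) = expectation (E.psum f' N)" for N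
    using S_eq by (intro integral_cong_AE) auto
  have V_eq: "V = C.V"
  proof
    fix N
    show "V N = C.V N" unfolding V_def C.V_def exp_eq
      using S_eq[of N] by (intro integral_cong_AE) auto
  qed
  have prob_eq: "\<P>(\<omega> in M. partial_sum X f N \<omega> - t \<in> {a<..<b}) = prob {\<omega> \<in> space M. E.psum f' N \<omega> - t \<in> {a<..<b}}" for N t a b
    using S_eq[of N] by (intro measure_eq_AE) auto
  have V_pos: "\<forall>\<^sub>F N in sequentially. 0 < V N"
    using C.V_at_top unfolding V_eq by (simp add: filterlim_at_top_dense)
  show ?thesis
  proof (intro conjI allI impI)
    show "filterlim V at_top sequentially" unfolding V_eq by (rule C.V_at_top)
    fix a b :: real and zs :: "nat \<Rightarrow> real" and z :: real
    assume ab: "a < b" and "(\<lambda>N. (zs N - expectation (partial_sum X f N)) / sqrt (V N)) \<longlonglongrightarrow> z"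
    from C.local_limit[OF this[unfolded exp_eq V_eq]]
    have lim: "(\<lambda>N. sqrt (2 * pi * V N) * \<P>(\<omega> in M. partial_sum X f N \<omega> - zs N \<in> {a<..<b})) \<longlonglongrightarrow> exp (- z\<^sup>2 / 2) * (b - a)"
      unfolding V_eq prob_eq .
    \<comment> \<open>The limit of the rescaled probabilities. It is nonzero since
      \<open>a < b\<close>, so their ratio to \<open>w\<close> tends to 1, and \<open>r\<close> is
      this ratio minus 1.\<close>
    define w where "w = exp (- z\<^sup>2 / 2) * (b - a)"
    have w: "w \<noteq> 0" unfolding w_def using ab by simp
    define r where "r N = sqrt (2 * pi * V N) * \<P>(\<omega> in M. partial_sum X f N \<omega> - zs N \<in> {a<..<b}) / w - 1" for N
    have "r \<longlonglongrightarrow> 0"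
    proof -
      have "r \<longlonglongrightarrow> w / w - 1"
        unfolding r_def[abs_def] using w lim[folded w_def]
        by (intro tendsto_diff tendsto_divide tendsto_const) auto
      then show ?thesis using w by simp
    qed
    then have "r \<in> o(\<lambda>_. 1)" by (intro smalloI_tendsto) auto
    moreover have "\<forall>\<^sub>F N in sequentially. \<P>(\<omega> in M. partial_sum X f N \<omega> - zs N \<in> {a<..<b})
        = (1 + r N) * (exp (- z\<^sup>2 / 2) / sqrt (2 * pi * V N)) * (b - a)"
      using V_pos
    proof eventually_elim
      case (elim N)
      have "(1 + r N) * (exp (- z\<^sup>2 / 2) / sqrt (2 * pi * V N)) * (b - a) = (1 + r N) * w / sqrt (2 * pi * V N)"
        unfolding w_def by simp
      then show ?case unfolding r_def using w elim by simp
    qed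
    ultimately show "\<exists>r :: nat \<Rightarrow> real. r \<in> o(\<lambda>_. 1) \<and> (\<forall>\<^sub>F N in sequentially.
        \<P>(\<omega> in M. partial_sum X f N \<omega> - zs N \<in> {a<..<b}) = (1 + r N) * (exp (- z\<^sup>2 / 2) / sqrt (2 * pi * V N)) * (b - a))"
      by blast
  qed
qed

end
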